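(* Consider the micropolar fluid system on $\mathbb{R}^3$: $$ \begin{cases} \partial_t u-\Delta u+u\cdot\nabla u+\nabla\pi-\nabla\times\omega=0,\\ \partial_t\omega-\Delta\omega+u\cdot\nabla\omega+2\omega-\nabla\operatorname{div}\omega-\nabla\times u=0,\\ \operatorname{div}u=0,\\ (u,\omega)|_{t=0}=(u_0,\omega_0). \end{cases} $$ For $r\in(2,\infty]$ this system is ill-posed in $\dot{FB}^{-1}_{1,r}(\mathbb{R}^3)$ in the sense that the solution map is discontinuous at the origin. More precisely, there exist a sequence of initial data $\{f^N\}_{N=1}^\infty\subset\dot{FB}^{-1}_{1,2}(\mathbb{R}^3)$ and a sequence of times $\{t^N\}_{N=1}^\infty$ with $$\|f^N\|_{\dot{FB}^{-1}_{1,r}(\mathbb{R}^3)}\to0\quad\text{and}\quad t^N\to0\quad\text{as }N\to\infty,$$ such that the corresponding sequence of solutions $(u,\omega)=(u[f^N],\omega[f^N])\in C([0,\infty);\dot{FB}^{-1}_{1,2}(\mathbb{R}^3))$ to the initial value problem for this system with $(u[f^N],\omega[f^N])(0)=f^N$ satisfies $$\|u[f^N](t^N)\|_{\dot{FB}^{-1}_{1,r}(\mathbb{R}^3)}\ge c_0\quad\text{and}\quad\|\omega[f^N](t^N)\|_{\dot{FB}^{-1}_{1,r}(\mathbb{R}^3)}\ge c_0,$$ with a positive constant $c_0$ independent of $N$.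
   Context: Unknowns: $u=u(x,t)$ and $\omega=\omega(x,t)$ are vector fields with three components and $\pi=\pi(x,t)$ is a scalar, for $x\in\mathbb{R}^3$, $t>0$. Initial data are pairs $f=(u_0,\omega_0)$ with $\operatorname{div}u_0=0$ (as required by the system); $(u[f],\omega[f])$ denotes the solution with initial data $f$. Fourier transform: $\hat f(\xi)=\mathcal F[f](\xi)=\int_{\mathbb{R}^3}e^{-ix\cdot\xi}f(x)\,dx$. Littlewood-Paley blocks: $\psi\in\mathcal S(\mathbb{R}^3)$ is a fixed nonnegative function supported in $\{3/4\le|\xi|\le 8/3\}$ with $\sum_{j\in\mathbb{Z}}\psi(2^{-j}\xi)=1$ for all $\xi\neq0$; $\Delta_jf=\mathcal F^{-1}(\psi(2^{-j}\xi)\hat f(\xi))$, $j\in\mathbb{Z}$. $\mathcal S'_h(\mathbb{R}^3)=\mathcal S'(\mathbb{R}^3)/\mathcal P(\mathbb{R}^3)$, where $\mathcal P$ is the set of polynomials. Fourier-Besov spaces: for $s\in\mathbb{R}$, $1\le p,r\le\infty$, $\dot{FB}^s_{p,r}(\mathbb{R}^3)$ is the set of $f\in\mathcal S'_h(\mathbb{R}^3)$ with $\hat f\in L^1_{loc}(\mathbb{R}^3)$ and $\|f\|_{\dot{FB}^s_{p,r}}:=\big(\sum_{j\in\mathbb{Z}}2^{jsr}\|\widehat{\Delta_jf}\|_{L^p}^r\big)^{1/r}<\infty$ (supremum over $j$ of $2^{js}\|\widehat{\Delta_jf}\|_{L^p}$ if $r=\infty$). Vector-valued functions belong to these spaces componentwise.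 Linear semigroup: $\widehat{G(t)f}(\xi)=e^{-t\mathcal A(\xi)}\hat f(\xi)$ for six-component $f=(f_1,f_2)^T$ (each $f_i$ with three components), where $$\mathcal A(\xi)=\begin{bmatrix}|\xi|^2I&\mathcal B(\xi)\\ \mathcal B(\xi)&(|\xi|^2+2)I+\mathcal C(\xi)\end{bmatrix},\quad \mathcal B(\xi)=i\begin{bmatrix}0&\xi_3&-\xi_2\\-\xi_3&0&\xi_1\\ \xi_2&-\xi_1&0\end{bmatrix},\quad \mathcal C(\xi)=(\xi_k\xi_l)_{k,l=1}^3.$$ Solutions are understood as mild solutions: let $\mathbf P=I+\nabla(-\Delta)^{-1}\operatorname{div}$ be the Leray projection (Fourier symbol $(\delta_{kl}-\xi_k\xi_l/|\xi|^2)_{k,l=1}^3$). With $U=(u,\omega)^T$, $U_0=(u_0,\omega_0)^T$, set $\tilde{\mathbf P}\nabla\cdot(U\tilde\otimes U)=(\mathbf P\nabla\cdot(u\otimes u),\ \nabla\cdot(u\otimes\omega))^T$, where $(\nabla\cdot(u\otimes v))_l=\sum_k\partial_k(u_kv_l)$. A mild solution is a solution of the integral equation $$U(t)=G(t)U_0-\int_0^tG(t-\tau)\tilde{\mathbf P}\nabla\cdot(U\tilde\otimes U)(\tau)\,d\tau .$$ *)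

theory Defs
  imports "HOL-Analysis.Analysis" "HOL-Probability.Essential_Supremum"
begin

section \<open>Schwartz functions, test functions and tempered distributions\<close>

definition pd :: "3 \<Rightarrow> (real^3 \<Rightarrow> complex) \<Rightarrow> real^3 \<Rightarrow> complex" where
  "pd k f x = frechet_derivative f (at x) (axis k 1)"

abbreviation iter_pd :: "3 list \<Rightarrow> (real^3 \<Rightarrow> complex) \<Rightarrow> real^3 \<Rightarrow> complex" where
  "iter_pd ks f \<equiv> foldr pd ks f"

definition smooth :: "(real^3 \<Rightarrow> complex) \<Rightarrow> bool" where
  "smooth f \<longleftrightarrow> (\<forall>ks x. iter_pd ks f differentiable (at x))"

definition schwartz :: "(real^3 \<Rightarrow> complex) \<Rightarrow> bool" where
  "schwartz f \<longleftrightarrow> smooth f \<and>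
     (\<forall>m ks. \<exists>C. \<forall>x. (1 + norm x) ^ m * norm (iter_pd ks f x) \<le> C)"

definition schwartz_seminorm :: "nat \<Rightarrow> (real^3 \<Rightarrow> complex) \<Rightarrow> real" where
  "schwartz_seminorm N f =
     (SUP x. (1 + norm x) ^ N * (\<Sum>ks | length ks \<le> N. norm (iter_pd ks f x)))"

definition test_function :: "(real^3 \<Rightarrow> complex) \<Rightarrow> bool" where
  "test_function f \<longleftrightarrow> smooth f \<and> (\<exists>K. compact K \<and> (\<forall>x. x \<notin> K \<longrightarrow> f x = 0))"

text \<open>A tempered distribution is a functional on all functions of which only the values on
  Schwartz functions matter.\<close>

type_synonym functional = "(real^3 \<Rightarrow> complex) \<Rightarrow> complex"

definition tempered :: "functional \<Rightarrow> bool" where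
  "tempered T \<longleftrightarrow>
     (\<forall>f g a b. schwartz f \<longrightarrow> schwartz g \<longrightarrow> T (\<lambda>x. a * f x + b * g x) = a * T f + b * T g) \<and>
     (\<exists>C N. \<forall>f. schwartz f \<longrightarrow> norm (T f) \<le> C * schwartz_seminorm N f)"

definition is_function :: "functional \<Rightarrow> (real^3 \<Rightarrow> complex) \<Rightarrow> bool" where
  "is_function T a \<longleftrightarrow> tempered T \<and>
     (\<forall>f. schwartz f \<longrightarrow> has_bochner_integral lborel (\<lambda>x. a x * f x) (T f))"


section \<open>Tempered distributions modulo polynomials\<close>

definition eq_mod_poly :: "functional \<Rightarrow> functional \<Rightarrow> bool" where
  "eq_mod_poly T S \<longleftrightarrow> tempered T \<and> tempered S \<and>
     (\<exists>p. polynomial_function p \<and> is_function (\<lambda>f. T f - S f) p)"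

lemma schwartz_seminorm_bdd:
  assumes "schwartz f"
  shows "bdd_above (range (\<lambda>x. (1 + norm x) ^ N * (\<Sum>ks | length ks \<le> N. norm (iter_pd ks f x))))"
proof -
  have "\<forall>ks. \<exists>C. \<forall>x. (1 + norm x) ^ N * norm (iter_pd ks f x) \<le> C"
    using assms unfolding schwartz_def by blast
  then obtain C where C: "\<And>ks x. (1 + norm x) ^ N * norm (iter_pd ks f x) \<le> C ks"
    by metis
  show ?thesis
  proof (rule bdd_aboveI2)
    fix x
    show "(1 + norm x) ^ N * (\<Sum>ks | length ks \<le> N. norm (iter_pd ks f x))
        \<le> (\<Sum>ks | length ks \<le> N. C ks)"
      unfolding sum_distrib_left by (rule sum_mono) (rule C)
  qed
qed

lemma finite_short_lists: "finite {ks :: 3 list. length ks \<le> N}"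
  using finite_lists_length_le[of "UNIV :: 3 set" N] by simp

lemma schwartz_seminorm_mono:
  assumes "schwartz f" "M \<le> N"
  shows "schwartz_seminorm M f \<le> schwartz_seminorm N f"
  unfolding schwartz_seminorm_def
proof (rule cSUP_mono)
  fix x :: "real^3"
  have "(1 + norm x) ^ M * (\<Sum>ks | length ks \<le> M. norm (iter_pd ks f x))
      \<le> (1 + norm x) ^ N * (\<Sum>ks | length ks \<le> N. norm (iter_pd ks f x))"
    using assms(2)
    by (intro mult_mono power_increasing sum_mono2 finite_short_lists sum_nonneg) auto
  then show "\<exists>y\<in>UNIV. (1 + norm x) ^ M * (\<Sum>ks | length ks \<le> M. norm (iter_pd ks f x))
      \<le> (1 + norm y) ^ N * (\<Sum>ks | length ks \<le> N. norm (iter_pd ks f y))"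
    by blast
qed (use schwartz_seminorm_bdd[OF assms(1)] in auto)

lemma schwartz_seminorm_nonneg:
  assumes "schwartz f" shows "0 \<le> schwartz_seminorm N f"
proof -
  have "0 \<le> (1 + norm (0::real^3)) ^ N * (\<Sum>ks | length ks \<le> N. norm (iter_pd ks f 0))"
    by (simp add: sum_nonneg)
  also have "\<dots> \<le> schwartz_seminorm N f"
    unfolding schwartz_seminorm_def
    by (rule cSUP_upper[OF _ schwartz_seminorm_bdd[OF assms]]) simp
  finally show ?thesis .
qed

lemma tempered_lincomb:
  assumes "tempered T" "tempered S"
  shows "tempered (\<lambda>f. c * T f + d * S f)"
proof -
  obtain C N where T: "\<And>f. schwartz f \<Longrightarrow> norm (T f) \<le> C * schwartz_seminorm N f"
    using assms(1) unfolding tempered_def by blast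
  obtain D M where S: "\<And>f. schwartz f \<Longrightarrow> norm (S f) \<le> D * schwartz_seminorm M f"
    using assms(2) unfolding tempered_def by blast
  have "norm (c * T f + d * S f)
      \<le> (norm c * \<bar>C\<bar> + norm d * \<bar>D\<bar>) * schwartz_seminorm (max N M) f" if f: "schwartz f" for f
  proof -
    have mono: "A * schwartz_seminorm k f \<le> \<bar>A\<bar> * schwartz_seminorm (max N M) f"
      if "k \<le> max N M" for A k
      using schwartz_seminorm_mono[OF f that] schwartz_seminorm_nonneg[OF f]
      by (intro mult_mono) auto
    have 1: "norm (T f) \<le> \<bar>C\<bar> * schwartz_seminorm (max N M) f"
      using T[OF f] mono[of N C] by simp
    have 2: "norm (S f) \<le> \<bar>D\<bar> * schwartz_seminorm (max N M) f"
      using S[OF f] mono[of M D] by simp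
    have "norm (c * T f + d * S f) \<le> norm c * norm (T f) + norm d * norm (S f)"
      by (metis norm_mult norm_triangle_ineq)
    also have "\<dots> \<le> norm c * (\<bar>C\<bar> * schwartz_seminorm (max N M) f)
        + norm d * (\<bar>D\<bar> * schwartz_seminorm (max N M) f)"
      by (intro add_mono mult_left_mono 1 2) auto
    finally show ?thesis by (simp add: algebra_simps)
  qed
  moreover have "c * T (\<lambda>x. a * f x + b * g x) + d * S (\<lambda>x. a * f x + b * g x)
      = a * (c * T f + d * S f) + b * (c * T g + d * S g)"
    if "schwartz f" "schwartz g" for f g a b
    using assms that unfolding tempered_def by (simp add: algebra_simps)
  ultimately show ?thesis unfolding tempered_def by blast
qed

lemma is_function_lincomb:
  assumes "is_function T p" "is_function S q"
  shows "is_function (\<lambda>f. c * T f + d * S f) (\<lambda>x. c * p x + d * q x)"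
  using assms tempered_lincomb unfolding is_function_def
  by (auto simp: algebra_simps
      intro!: has_bochner_integral_add has_bochner_integral_mult_right)

lemma polynomial_function_complex_lincomb:
  fixes p q :: "'a::real_normed_vector \<Rightarrow> complex"
  assumes "polynomial_function p" "polynomial_function q"
  shows "polynomial_function (\<lambda>x. c * p x + d * q x)"
  using assms unfolding polynomial_function_def o_def
proof (intro allI impI)
  fix h :: "complex \<Rightarrow> real"
  assume h: "bounded_linear h"
    and p: "\<forall>f. bounded_linear f \<longrightarrow> real_polynomial_function (\<lambda>x. f (p x))"
    and q: "\<forall>f. bounded_linear f \<longrightarrow> real_polynomial_function (\<lambda>x. f (q x))"
  have "real_polynomial_function (\<lambda>x. h (c * p x))"
    using p[rule_format, OF bounded_linear_compose[OF h bounded_linear_mult_right[of c]]] .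
  moreover have "real_polynomial_function (\<lambda>x. h (d * q x))"
    using q[rule_format, OF bounded_linear_compose[OF h bounded_linear_mult_right[of d]]] .
  ultimately show "real_polynomial_function (\<lambda>x. h (c * p x + d * q x))"
    by (simp add: linear_add[OF bounded_linear.linear[OF h]] real_polynomial_function.intros(3))
qed

lemma eq_mod_polyI_lincomb:
  assumes "is_function (\<lambda>f. T f - S f) p" "polynomial_function p"
    and "is_function (\<lambda>f. T' f - S' f) q" "polynomial_function q"
    and "tempered R" "tempered R'"
    and "\<And>f. R f - R' f = c * (T f - S f) + d * (T' f - S' f)"
  shows "eq_mod_poly R R'"
  using is_function_lincomb[OF assms(1,3), of c d]
    polynomial_function_complex_lincomb[OF assms(2,4), of c d] assms(5-7)
  unfolding eq_mod_poly_def by auto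

lemma tempered_zero: "tempered (\<lambda>f. 0)"
  unfolding tempered_def by (auto intro!: exI[of _ "0::real"])

lemma eq_mod_poly_refl: "tempered T \<Longrightarrow> eq_mod_poly T T"
  unfolding eq_mod_poly_def is_function_def
  by (auto intro!: exI[of _ "\<lambda>x. 0"] tempered_zero has_bochner_integral_zero)

text \<open>The space of tempered distributions modulo polynomials.\<close>

quotient_type sh = "functional" / partial: eq_mod_poly
proof (rule part_equivpI)
  show "\<exists>T. eq_mod_poly T T"
    using eq_mod_poly_refl[OF tempered_zero] by blast
  show "symp eq_mod_poly"
  proof (rule sympI)
    fix T S assume "eq_mod_poly T S"
    then show "eq_mod_poly S T"
      unfolding eq_mod_poly_def[of T S]
      by (auto intro: eq_mod_polyI_lincomb[where c = "-1" and d = 0])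
  qed
  show "transp eq_mod_poly"
  proof (rule transpI)
    fix T S R assume "eq_mod_poly T S" "eq_mod_poly S R"
    then show "eq_mod_poly T R"
      unfolding eq_mod_poly_def[of T S] eq_mod_poly_def[of S R]
      by (auto intro: eq_mod_polyI_lincomb[where c = 1 and d = 1])
  qed
qed

instantiation sh :: minus
begin

lift_definition minus_sh :: "sh \<Rightarrow> sh \<Rightarrow> sh" is "\<lambda>T S f. T f - S f"
proof -
  fix T T' S S' assume a: "eq_mod_poly T T'" "eq_mod_poly S S'"
  then have "tempered (\<lambda>f. T f - S f)" "tempered (\<lambda>f. T' f - S' f)"
    using tempered_lincomb[of T S 1 "-1"] tempered_lincomb[of T' S' 1 "-1"]
    unfolding eq_mod_poly_def by auto
  with a show "eq_mod_poly (\<lambda>f. T f - S f) (\<lambda>f. T' f - S' f)"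
    unfolding eq_mod_poly_def[of T T'] eq_mod_poly_def[of S S']
    by (auto intro: eq_mod_polyI_lincomb[where c = 1 and d = "-1"])
qed

instance ..

end

definition represents :: "functional \<Rightarrow> sh \<Rightarrow> bool" where
  "represents T f \<longleftrightarrow> tempered T \<and> abs_sh T = f"


section \<open>Fourier transform and Fourier-Besov spaces\<close>

definition fourier :: "(real^3 \<Rightarrow> complex) \<Rightarrow> real^3 \<Rightarrow> complex" where
  "fourier f \<xi> = (LINT x|lborel. exp (- \<i> * of_real (x \<bullet> \<xi>)) * f x)"

definition locally_integrable :: "(real^3 \<Rightarrow> complex) \<Rightarrow> bool" where
  "locally_integrable g \<longleftrightarrow> (\<forall>K. compact K \<longrightarrow> set_integrable lborel K g)"

text \<open>The Fourier transform of \<open>T\<close> (the functional mapping \<open>f\<close> to \<open>T (fourier f)\<close>) is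
  the locally integrable function \<open>g\<close>.\<close>

definition has_fourier :: "functional \<Rightarrow> (real^3 \<Rightarrow> complex) \<Rightarrow> bool" where
  "has_fourier T g \<longleftrightarrow> tempered T \<and> locally_integrable g \<and>
     (\<forall>f. test_function f \<longrightarrow> T (fourier f) = (LINT \<xi>|lborel. g \<xi> * f \<xi>))"

text \<open>A class modulo polynomials has at most one representative whose Fourier transform is
  a locally integrable function, since the transform of a polynomial is supported at the origin.\<close>

definition sh_has_fourier :: "sh \<Rightarrow> (real^3 \<Rightarrow> complex) \<Rightarrow> bool" where
  "sh_has_fourier f g \<longleftrightarrow> (\<exists>T. represents T f \<and> has_fourier T g)"

definition fhat :: "sh \<Rightarrow> real^3 \<Rightarrow> complex" where
  "fhat f = (SOME g. sh_has_fourier f g)"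

definition littlewood_paley :: "(real^3 \<Rightarrow> real) \<Rightarrow> bool" where
  "littlewood_paley \<psi> \<longleftrightarrow>
     schwartz (\<lambda>\<xi>. complex_of_real (\<psi> \<xi>)) \<and>
     (\<forall>\<xi>. 0 \<le> \<psi> \<xi>) \<and>
     (\<forall>\<xi>. \<psi> \<xi> \<noteq> 0 \<longrightarrow> 3/4 \<le> norm \<xi> \<and> norm \<xi> \<le> 8/3) \<and>
     (\<forall>\<xi>. \<xi> \<noteq> 0 \<longrightarrow> ((\<lambda>j::int. \<psi> ((2 powi (- j)) *\<^sub>R \<xi>)) has_sum 1) UNIV)"

text \<open>The Fourier transform of the Littlewood-Paley block \<open>\<Delta>\<^sub>j f\<close>.\<close>

definition block_hat :: "(real^3 \<Rightarrow> real) \<Rightarrow> int \<Rightarrow> sh \<Rightarrow> real^3 \<Rightarrow> complex" where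
  "block_hat \<psi> j f \<xi> = of_real (\<psi> ((2 powi (- j)) *\<^sub>R \<xi>)) * fhat f \<xi>"

text \<open>Power with exponent \<open>a > 0\<close>.\<close>

definition epowr :: "ennreal \<Rightarrow> real \<Rightarrow> ennreal" where
  "epowr x a = (if x = \<infinity> then \<infinity> else ennreal (enn2real x powr a))"

definition Lp_norm :: "ennreal \<Rightarrow> (real^3 \<Rightarrow> complex) \<Rightarrow> ennreal" where
  "Lp_norm p g =
     (if p = \<infinity> then esssup lborel (\<lambda>x. ennreal (norm (g x)))
      else epowr (\<integral>\<^sup>+x. epowr (ennreal (norm (g x))) (enn2real p) \<partial>lborel) (1 / enn2real p))"

definition FB_norm :: "(real^3 \<Rightarrow> real) \<Rightarrow> real \<Rightarrow> ennreal \<Rightarrow> ennreal \<Rightarrow> sh \<Rightarrow> ennreal" where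
  "FB_norm \<psi> s p r f =
     (if r = \<infinity> then (SUP j::int. ennreal (2 powr (real_of_int j * s)) * Lp_norm p (block_hat \<psi> j f))
      else epowr (\<Sum>\<^sub>\<infinity>j::int. ennreal (2 powr (real_of_int j * s * enn2real r))
                    * epowr (Lp_norm p (block_hat \<psi> j f)) (enn2real r)) (1 / enn2real r))"

definition FB :: "(real^3 \<Rightarrow> real) \<Rightarrow> real \<Rightarrow> ennreal \<Rightarrow> ennreal \<Rightarrow> sh set" where
  "FB \<psi> s p r = {f. (\<exists>g. sh_has_fourier f g) \<and> FB_norm \<psi> s p r f < \<infinity>}"

definition FBv :: "(real^3 \<Rightarrow> real) \<Rightarrow> real \<Rightarrow> ennreal \<Rightarrow> ennreal \<Rightarrow> (sh^'n) set" where
  "FBv \<psi> s p r = {f. \<forall>i. f $ i \<in> FB \<psi> s p r}"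

definition FBv_norm :: "(real^3 \<Rightarrow> real) \<Rightarrow> real \<Rightarrow> ennreal \<Rightarrow> ennreal \<Rightarrow> sh^'n \<Rightarrow> ennreal" where
  "FBv_norm \<psi> s p r f = (\<Sum>i\<in>UNIV. FB_norm \<psi> s p r (f $ i))"

definition FBv_continuous ::
  "(real^3 \<Rightarrow> real) \<Rightarrow> real \<Rightarrow> ennreal \<Rightarrow> ennreal \<Rightarrow> (real \<Rightarrow> sh^'n) \<Rightarrow> bool" where
  "FBv_continuous \<psi> s p r U \<longleftrightarrow>
     (\<forall>t\<ge>0. U t \<in> FBv \<psi> s p r \<and>
        ((\<lambda>t'. FBv_norm \<psi> s p r (U t' - U t)) \<longlongrightarrow> 0) (at t within {0..}))"


section \<open>Fields\<close>

text \<open>Six-component fields \<open>(u, \<omega>)\<close> are indexed by \<open>3 + 3\<close>: \<open>u\<close> carries the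
  indices \<open>Inl k\<close> and \<open>\<omega>\<close> the indices \<open>Inr k\<close>.\<close>

definition u_part :: "'a^(3 + 3) \<Rightarrow> 'a^3" where
  "u_part U = (\<chi> k. U $ Inl k)"

definition w_part :: "'a^(3 + 3) \<Rightarrow> 'a^3" where
  "w_part U = (\<chi> k. U $ Inr k)"

text \<open>Every polynomial is the divergence of a polynomial field, so the divergence vanishes modulo
  polynomials iff it vanishes for suitable representatives.\<close>

definition div_free :: "sh^3 \<Rightarrow> bool" where
  "div_free u \<longleftrightarrow> (\<exists>T. (\<forall>k. represents (T k) (u $ k)) \<and>
     (\<forall>f. schwartz f \<longrightarrow> (\<Sum>k\<in>UNIV. - T k (pd k f)) = 0))"

definition real_valued :: "sh \<Rightarrow> bool" where
  "real_valued f \<longleftrightarrow> (\<exists>T. represents T f \<and>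
     (\<forall>g. schwartz g \<longrightarrow> range g \<subseteq> \<real> \<longrightarrow> T g \<in> \<real>))"


section \<open>The linear semigroup\<close>

definition mat_exp :: "complex^'n^'n \<Rightarrow> complex^'n^'n" where
  "mat_exp M = (\<Sum>n. (1 / fact n) *\<^sub>R (((**) M ^^ n) (mat 1)))"

definition B_symbol :: "real^3 \<Rightarrow> complex^3^3" where
  "B_symbol \<xi> = vector
     [vector [0, \<i> * of_real (\<xi> $ 3), - \<i> * of_real (\<xi> $ 2)],
      vector [- \<i> * of_real (\<xi> $ 3), 0, \<i> * of_real (\<xi> $ 1)],
      vector [\<i> * of_real (\<xi> $ 2), - \<i> * of_real (\<xi> $ 1), 0]]"

definition A_symbol :: "real^3 \<Rightarrow> complex^(3 + 3)^(3 + 3)" where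
  "A_symbol \<xi> = (\<chi> i j. case (i, j) of
       (Inl k, Inl l) \<Rightarrow> (if k = l then of_real ((norm \<xi>)\<^sup>2) else 0)
     | (Inl k, Inr l) \<Rightarrow> B_symbol \<xi> $ k $ l
     | (Inr k, Inl l) \<Rightarrow> B_symbol \<xi> $ k $ l
     | (Inr k, Inr l) \<Rightarrow> (if k = l then of_real ((norm \<xi>)\<^sup>2 + 2) else 0) + of_real (\<xi> $ k * \<xi> $ l))"

text \<open>The Fourier transform of \<open>G(t) f\<close> in terms of the Fourier transform \<open>h\<close> of \<open>f\<close>.\<close>

definition G_hat :: "real \<Rightarrow> (real^3 \<Rightarrow> complex^(3 + 3)) \<Rightarrow> real^3 \<Rightarrow> complex^(3 + 3)" where
  "G_hat t h \<xi> = mat_exp (- (t *\<^sub>R A_symbol \<xi>)) *v h \<xi>"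


section \<open>The nonlinearity\<close>

text \<open>The function \<open>a\<close> is the canonical representative (the one with locally integrable
  Fourier transform) of \<open>f\<close>; it is needed because products are not defined modulo polynomials.\<close>

definition sh_is_function :: "sh \<Rightarrow> (real^3 \<Rightarrow> complex) \<Rightarrow> bool" where
  "sh_is_function f a \<longleftrightarrow> (\<exists>T g. represents T f \<and> has_fourier T g \<and> is_function T a)"

text \<open>\<open>is_div_tensor a D\<close>: with \<open>a = (u, \<omega>)\<close> the products \<open>u\<^sub>k a\<^sub>i\<close> are tempered
  distributions and \<open>D\<^sub>i\<close> is the distribution
  \<open>\<Sum>\<^sub>k \<partial>\<^sub>k (u\<^sub>k a\<^sub>i)\<close>.\<close>

definition is_div_tensor ::
  "(real^3 \<Rightarrow> complex^(3 + 3)) \<Rightarrow> (3 + 3 \<Rightarrow> functional) \<Rightarrow> bool" where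
  "is_div_tensor a D \<longleftrightarrow> (\<exists>R.
     (\<forall>k i. is_function (R k i) (\<lambda>x. a x $ Inl k * a x $ i)) \<and>
     (\<forall>i f. schwartz f \<longrightarrow> D i f = (\<Sum>k\<in>UNIV. - R k i (pd k f))))"

definition leray_hat :: "(real^3 \<Rightarrow> complex^(3 + 3)) \<Rightarrow> real^3 \<Rightarrow> complex^(3 + 3)" where
  "leray_hat h \<xi> = (\<chi> i. case i of
       Inl k \<Rightarrow> (\<Sum>l\<in>UNIV. of_real ((if k = l then 1 else 0) - \<xi> $ k * \<xi> $ l / (norm \<xi>)\<^sup>2)
                        * h \<xi> $ Inl l)
     | Inr k \<Rightarrow> h \<xi> $ Inr k)"

text \<open>The function \<open>h\<close> is the Fourier transform of the nonlinear term
  \<open>(P div (u \<otimes> u), div (u \<otimes> \<omega>))\<close> at \<open>U = (u, \<omega>)\<close>.\<close>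

definition nonlinearity_hat :: "sh^(3 + 3) \<Rightarrow> (real^3 \<Rightarrow> complex^(3 + 3)) \<Rightarrow> bool" where
  "nonlinearity_hat U h \<longleftrightarrow> (\<exists>a D g.
     (\<forall>i. sh_is_function (U $ i) (\<lambda>x. a x $ i)) \<and>
     is_div_tensor a D \<and>
     (\<forall>i. has_fourier (D i) (\<lambda>\<xi>. g \<xi> $ i)) \<and>
     h = leray_hat g)"


section \<open>Mild solutions\<close>

text \<open>The representatives \<open>V\<close> and \<open>F \<tau>\<close> stand for \<open>G(t) U\<^sub>0\<close> and for the integrand
  \<open>G(t - \<tau>) P div (U \<otimes> U)(\<tau>)\<close> (given for almost every \<open>\<tau>\<close>), which is integrated
  in the weak sense of tempered distributions.\<close>

definition mild_solution :: "sh^(3 + 3) \<Rightarrow> (real \<Rightarrow> sh^(3 + 3)) \<Rightarrow> bool" where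
  "mild_solution U\<^sub>0 U \<longleftrightarrow> (\<forall>t\<ge>0. \<exists>V F.
     (\<forall>i. has_fourier (V i) (\<lambda>\<xi>. G_hat t (\<lambda>\<xi>. \<chi> j. fhat (U\<^sub>0 $ j) \<xi>) \<xi> $ i)) \<and>
     (AE \<tau> in lborel. 0 < \<tau> \<and> \<tau> < t \<longrightarrow>
        (\<exists>h. nonlinearity_hat (U \<tau>) h \<and>
             (\<forall>i. has_fourier (F \<tau> i) (\<lambda>\<xi>. G_hat (t - \<tau>) h \<xi> $ i)))) \<and>
     (\<forall>i f. schwartz f \<longrightarrow> set_integrable lborel {0..t} (\<lambda>\<tau>. F \<tau> i f)) \<and>
     (\<forall>i. represents (\<lambda>f. V i f - (LINT \<tau>:{0..t}|lborel. F \<tau> i f)) (U t $ i)))"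

end

theory Submission
  imports Defs "HOL-Probability.Characteristic_Functions"
begin

text \<open>The instability is caused by interactions of high frequencies that feed a single low frequency.
  The Fourier transform of \<open>pulses n \<delta>\<close> lives on unit balls around \<open>\<plusminus> 2 ^ (n + k) e\<^sub>1\<close> for \<open>k < n\<close>
  and has size \<open>\<delta> \<bar>\<xi>\<bar> / sqrt n\<close> there. Every dyadic annulus meets a bounded number of these balls
  and carries a mass of order \<open>\<delta> / sqrt n\<close>, so the norm with summation index \<open>r\<close> is of
  order \<open>\<delta> n powr (1/r - 1/2)\<close>: it tends to zero exactly if \<open>r > 2\<close>, while for \<open>r = 2\<close> it stays of order
  \<open>\<delta>\<close> (\<open>FB_norm_pulses_tendsto_0\<close>). In the second Picard iterate each ball interacts with the opposite
  one and produces an output at frequencies near \<open>(1, 1, 0)\<close>. The output of the pair with frequency \<open>R\<close> is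
  \<open>\<delta>\<^sup>2 / n\<close> times \<open>R\<^sup>2\<close> times the life time \<open>1 / R\<^sup>2\<close> of the pulse, hence of order
  \<open>\<delta>\<^sup>2 / n\<close>, and all outputs have the same sign (\<open>resonant_sign\<close>). The \<open>n\<close> pairs together give
  \<open>\<delta>\<^sup>2\<close>, independently of \<open>n\<close> (\<open>duhamel_pulses_ge\<close>). The life times are at most
  \<open>4 ^ (- n)\<close>, so all this has happened by the time \<open>2 ^ (- n)\<close>. The coupling of velocity and
  angular velocity is of lower order and negligible on this time scale (\<open>kernel_pulses_error\<close>). As the
  pulses have the same amplitude in both fields, both fields inflate.

  All higher iterates together contribute \<open>O(\<delta>\<^sup>3)\<close>, uniformly in \<open>n\<close>
  (\<open>solution_remainder_le\<close>). This comes from the construction of the solution, which is carried out on the Fourier side.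
  The symbol of the linear part satisfies \<open>Re \<langle>A w, w\<rangle> \<ge> \<bar>\<xi>\<bar>\<^sup>2 \<bar>w\<bar>\<^sup>2 / 2\<close>
  (\<open>A_symbol_coercive\<close>), so the propagator is dominated by a heat kernel, and the Picard iterates are
  dominated pointwise by those of a scalar equation \<open>M = m + B (M, M)\<close> with nonnegative terms, which
  has a solution with values in the extended half line by monotone convergence. The quantity that closes is the energy
  \<open>\<integral> (\<integral> M (t, \<xi>) d\<xi>)\<^sup>2 dt\<close>; for the scalar product it is controlled by Cauchy-Schwarz
  (\<open>energy_majorant_product_le\<close>), because the time integral of \<open>\<bar>\<xi>\<bar>\<^sup>2 e^(- t \<bar>\<xi>\<bar>\<^sup>2)\<close> does not
  depend on \<open>\<xi>\<close>. For the pulses the energy is of order \<open>\<delta>\<^sup>2\<close> since their frequencies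
  are lacunary (\<open>energy_pulses_le\<close>). The same estimate bounds the integral of \<open>\<bar>U\<bar> / \<bar>\<xi>\<bar>\<close> at every time,
  which is stronger than the norm with summation index 2 and gives global continuity.

  The remaining part translates between functions of \<open>\<xi>\<close> and distributions modulo polynomials. A
  class has at most one locally integrable Fourier transform, because the transform of a polynomial
  lives at the origin (\<open>sh_has_fourier_unique\<close>); therefore the norms of \<open>sh_of g\<close> can be computed from
  \<open>g\<close>. Fourier inversion on Schwartz functions and the product rule \<open>Finv_convolution\<close> identify the
  Fourier side equation with the mild formulation (\<open>mild_evolution\<close>).\<close>

section \<open>Affine changes of variables\<close>

lemma nn_integral_affine:
  fixes f :: "'a::euclidean_space \<Rightarrow> ennreal"
  assumes [measurable]: "f \<in> borel_measurable borel" and c: "c \<noteq> 0"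
  shows "(\<integral>\<^sup>+x. f x \<partial>lborel) = ennreal (\<bar>c\<bar> ^ DIM('a)) * (\<integral>\<^sup>+x. f (t + c *\<^sub>R x) \<partial>lborel)"
  by (subst lborel_affine[OF c, of t])
     (simp add: nn_integral_density nn_integral_distr nn_integral_cmult)

lemma integrable_affine:
  fixes f :: "'a::euclidean_space \<Rightarrow> 'b::{banach, second_countable_topology}"
  assumes "integrable lborel f" "c \<noteq> 0"
  shows "integrable lborel (\<lambda>x. f (t + c *\<^sub>R x))"
proof -
  have [measurable]: "f \<in> borel_measurable borel"
    using assms(1) by (simp add: integrable_iff_bounded)
  have "(\<integral>\<^sup>+x. ennreal (norm (f x)) \<partial>lborel)
      = ennreal (\<bar>c\<bar> ^ DIM('a)) * (\<integral>\<^sup>+x. ennreal (norm (f (t + c *\<^sub>R x))) \<partial>lborel)"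
    by (rule nn_integral_affine[OF _ assms(2)]) simp
  moreover have "(\<integral>\<^sup>+x. ennreal (norm (f x)) \<partial>lborel) < \<infinity>"
    using assms(1) by (simp add: integrable_iff_bounded)
  ultimately show ?thesis
    using assms(2) by (auto simp: integrable_iff_bounded ennreal_mult_less_top)
qed

lemma integral_affine:
  fixes f :: "'a::euclidean_space \<Rightarrow> 'b::{banach, second_countable_topology}"
  assumes [measurable]: "f \<in> borel_measurable borel" and c: "c \<noteq> 0"
  shows "(LINT x|lborel. f x) = \<bar>c\<bar> ^ DIM('a) *\<^sub>R (LINT x|lborel. f (t + c *\<^sub>R x))"
  by (subst lborel_affine[OF c, of t]) (simp add: integral_density integral_distr)

lemma integral_translate:
  fixes f :: "'a::euclidean_space \<Rightarrow> 'b::{banach, second_countable_topology}"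
  assumes "f \<in> borel_measurable borel"
  shows "(LINT x|lborel. f (x + a)) = (LINT x|lborel. f x)"
  using integral_affine[OF assms, of 1 a] by (simp add: add.commute)

lemma integral_reflect:
  fixes f :: "'a::euclidean_space \<Rightarrow> 'b::{banach, second_countable_topology}"
  assumes "f \<in> borel_measurable borel"
  shows "(LINT x|lborel. f (a - x)) = (LINT x|lborel. f x)"
  using integral_affine[OF assms, of "-1" a] by simp

lemma nn_integral_translate:
  fixes f :: "'a::euclidean_space \<Rightarrow> ennreal"
  assumes "f \<in> borel_measurable borel"
  shows "(\<integral>\<^sup>+x. f (x - a) \<partial>lborel) = (\<integral>\<^sup>+x. f x \<partial>lborel)"
  using nn_integral_affine[OF assms, of "1" "-a"] by simp

lemma distr_lborel_reflect:
  "distr lborel borel (\<lambda>x. a - x) = (lborel :: 'a::euclidean_space measure)"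
  by (subst (2) lborel_affine[of "-1" a]) (auto simp: density_1)

lemma AE_lborel_reflect:
  fixes P :: "'a::euclidean_space \<Rightarrow> bool"
  assumes "AE x in lborel. P x"
  shows "AE x in lborel. P (a - x)"
proof -
  obtain N where N: "{x. \<not> P x} \<subseteq> N" "N \<in> null_sets lborel"
    using assms by (auto elim!: AE_E simp: null_setsI)
  have "AE x in distr lborel borel (\<lambda>x. a - x). x \<notin> N"
    using N(2) unfolding distr_lborel_reflect by (rule AE_not_in)
  then have "AE x in lborel. a - x \<notin> N"
    using N(2) by (subst (asm) AE_distr_iff) auto
  then show ?thesis using N(1) by (auto elim!: eventually_mono)
qed

text \<open>The integral of a function that is not integrable is zero by convention, so this case is
  covered as well.\<close>

lemma ennreal_norm_integral_le:
  fixes f :: "'a \<Rightarrow> 'b::{banach, second_countable_topology}"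
  shows "ennreal (norm (integral\<^sup>L M f)) \<le> (\<integral>\<^sup>+x. ennreal (norm (f x)) \<partial>M)"
proof (cases "integrable M f")
  case True then show ?thesis by (rule integral_norm_bound_ennreal)
next
  case False then show ?thesis by (simp add: not_integrable_integral_eq)
qed

section \<open>Schwartz functions\<close>

lemma one_plus_norm_pos: "0 < 1 + norm x"
  by (smt (verit) norm_ge_zero)

lemma smooth_differentiable: "smooth f \<Longrightarrow> iter_pd ks f differentiable (at x)"
  by (simp add: smooth_def)

lemma smooth_iter_pd: "smooth f \<Longrightarrow> smooth (iter_pd ks f)"
  unfolding smooth_def by (metis foldr_append comp_apply)

lemma smooth_continuous_on: "smooth f \<Longrightarrow> continuous_on UNIV (iter_pd ks f)"
  using smooth_differentiable differentiable_imp_continuous_within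
  by (metis continuous_at_imp_continuous_on)

lemma pd_eq: "(f has_derivative f') (at x) \<Longrightarrow> pd k f x = f' (axis k 1)"
  unfolding pd_def by (metis frechet_derivative_at)

lemma pd_lincomb:
  assumes "f differentiable (at x)" "g differentiable (at x)"
  shows "pd k (\<lambda>x. a * f x + b * g x) x = a * pd k f x + b * pd k g x"
proof -
  have "((\<lambda>x. a * f x + b * g x) has_derivative
     (\<lambda>h. a * frechet_derivative f (at x) h + b * frechet_derivative g (at x) h)) (at x)"
    using assms unfolding frechet_derivative_works by (auto intro!: derivative_eq_intros)
  from pd_eq[OF this] show ?thesis by (simp add: pd_def)
qed

lemma iter_pd_lincomb:
  assumes "smooth f" "smooth g"
  shows "iter_pd ks (\<lambda>x. a * f x + b * g x) = (\<lambda>x. a * iter_pd ks f x + b * iter_pd ks g x)"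
proof (induction ks)
  case (Cons k ks)
  then show ?case
    using pd_lincomb[OF smooth_differentiable[OF assms(1)] smooth_differentiable[OF assms(2)]]
    by auto
qed simp

lemma smooth_lincomb:
  assumes "smooth f" "smooth g"
  shows "smooth (\<lambda>x. a * f x + b * g x)"
  using assms unfolding smooth_def iter_pd_lincomb[OF assms] by (auto intro!: derivative_intros)

lemma schwartz_smooth: "schwartz f \<Longrightarrow> smooth f"
  by (simp add: schwartz_def)

lemma schwartz_lincomb:
  assumes "schwartz f" "schwartz g"
  shows "schwartz (\<lambda>x. a * f x + b * g x)"
  unfolding schwartz_def
proof (intro conjI allI)
  show "smooth (\<lambda>x. a * f x + b * g x)"
    using assms schwartz_smooth smooth_lincomb by blast
  fix m ks
  obtain C D where C: "\<And>x. (1 + norm x) ^ m * norm (iter_pd ks f x) \<le> C"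
    and D: "\<And>x. (1 + norm x) ^ m * norm (iter_pd ks g x) \<le> D"
    using assms unfolding schwartz_def by meson
  show "\<exists>C. \<forall>x. (1 + norm x) ^ m * norm (iter_pd ks (\<lambda>x. a * f x + b * g x) x) \<le> C"
  proof (intro exI allI)
    fix x
    have "norm (a * iter_pd ks f x + b * iter_pd ks g x)
        \<le> norm a * norm (iter_pd ks f x) + norm b * norm (iter_pd ks g x)"
      by (metis norm_mult norm_triangle_ineq)
    then have "(1 + norm x) ^ m * norm (a * iter_pd ks f x + b * iter_pd ks g x)
      \<le> (1 + norm x) ^ m * (norm a * norm (iter_pd ks f x) + norm b * norm (iter_pd ks g x))"
      by (intro mult_left_mono) auto
    also have "\<dots> = norm a * ((1 + norm x) ^ m * norm (iter_pd ks f x))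
        + norm b * ((1 + norm x) ^ m * norm (iter_pd ks g x))"
      by (simp add: algebra_simps)
    also have "\<dots> \<le> norm a * C + norm b * D"
      by (intro add_mono mult_left_mono C D) auto
    finally show "(1 + norm x) ^ m * norm (iter_pd ks (\<lambda>x. a * f x + b * g x) x)
        \<le> norm a * C + norm b * D"
      using iter_pd_lincomb[OF schwartz_smooth[OF assms(1)] schwartz_smooth[OF assms(2)]]
      by simp
  qed
qed

lemma schwartz_scale: "schwartz f \<Longrightarrow> schwartz (\<lambda>x. a * f x)"
  using schwartz_lincomb[of f f a 0] by simp

lemma schwartz_iter_pd: "schwartz f \<Longrightarrow> schwartz (iter_pd ks f)"
  using smooth_iter_pd unfolding schwartz_def by (metis foldr_append comp_apply)

lemma schwartz_pd: "schwartz f \<Longrightarrow> schwartz (pd k f)"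
  using schwartz_iter_pd[of f "[k]"] by simp

lemma schwartz_continuous_on: "schwartz f \<Longrightarrow> continuous_on UNIV f"
  using smooth_continuous_on[of f "[]"] schwartz_smooth by simp

lemma schwartz_measurable: "schwartz f \<Longrightarrow> f \<in> borel_measurable borel"
  using schwartz_continuous_on borel_measurable_continuous_onI by blast

lemma schwartz_decay:
  assumes "schwartz f"
  obtains C where "C \<ge> 0" "\<And>x. norm (f x) \<le> C / (1 + norm x) ^ m"
proof -
  obtain C where C: "\<And>x. (1 + norm x) ^ m * norm (iter_pd [] f x) \<le> C"
    using assms unfolding schwartz_def by meson
  have "0 \<le> C" using C[of 0] by (smt (verit) norm_ge_zero mult_nonneg_nonneg zero_le_power)
  moreover have "norm (f x) \<le> C / (1 + norm x) ^ m" for x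
  proof -
    have "0 < (1 + norm x) ^ m" by (smt (verit) norm_ge_zero zero_less_power)
    then show ?thesis using C[of x] by (simp add: pos_le_divide_eq mult.commute)
  qed
  ultimately show ?thesis using that by blast
qed

lemma schwartz_seminorm_upper:
  assumes "schwartz f" "length ks \<le> N"
  shows "(1 + norm x) ^ N * norm (iter_pd ks f x) \<le> schwartz_seminorm N f"
proof -
  have "(1 + norm x) ^ N * norm (iter_pd ks f x)
      \<le> (1 + norm x) ^ N * (\<Sum>ks | length ks \<le> N. norm (iter_pd ks f x))"
    using assms(2) by (intro mult_left_mono member_le_sum[where f="\<lambda>ks. norm (iter_pd ks f x)"]
      finite_short_lists) auto
  also have "\<dots> \<le> schwartz_seminorm N f"
    unfolding schwartz_seminorm_def
    by (rule cSUP_upper[OF _ schwartz_seminorm_bdd[OF assms(1)]]) simp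
  finally show ?thesis .
qed

text \<open>Comparing with balls of integer radius: the weight is at most the sum over \<open>n\<close> of
  \<open>(1 + n) ^ - 5\<close> on the ball of radius \<open>n + 1\<close>, whose volume grows like the cube.\<close>

lemma integrable_weight:
  assumes "5 \<le> m"
  shows "integrable lborel (\<lambda>x::real^3. 1 / (1 + norm x) ^ m)"
proof -
  let ?v = "unit_ball_vol (real CARD(3))"
  let ?g = "\<lambda>n (x::real^3). ennreal (1 / (1 + real n) ^ 5) * indicator (ball 0 (real n + 1)) x"
  have le: "ennreal (1 / (1 + norm x) ^ m) \<le> (\<Sum>n. ?g n x)" for x :: "real^3"
  proof -
    define n where "n = nat \<lfloor>norm x\<rfloor>"
    have n: "real n \<le> norm x" "norm x < real n + 1"
      unfolding n_def by (auto simp: of_nat_nat)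
    have "1 / (1 + norm x) ^ m \<le> 1 / (1 + norm x) ^ 5"
      using assms one_plus_norm_pos[of x]
      by (intro divide_left_mono power_increasing mult_pos_pos zero_less_power) auto
    also have "\<dots> \<le> 1 / (1 + real n) ^ 5"
      using n one_plus_norm_pos[of x] by (intro divide_left_mono power_mono mult_pos_pos zero_less_power) auto
    finally have "ennreal (1 / (1 + norm x) ^ m) \<le> ?g n x"
      using n by (simp add: ennreal_leI)
    also have "\<dots> \<le> (\<Sum>n. ?g n x)"
      using sum_le_suminf[of "\<lambda>n. ?g n x" "{n}"] by (simp del: sum_mult_indicator)
    finally show ?thesis .
  qed
  have "(\<integral>\<^sup>+x. ennreal (1 / (1 + norm (x::real^3)) ^ m) \<partial>lborel) \<le> (\<integral>\<^sup>+x. (\<Sum>n. ?g n x) \<partial>lborel)"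
    by (intro nn_integral_mono le)
  also have "\<dots> = (\<Sum>n. \<integral>\<^sup>+x. ?g n x \<partial>lborel)"
    by (rule nn_integral_suminf) (intro borel_measurable_times_ennreal borel_measurable_indicator; simp)
  also have "\<dots> = (\<Sum>n. ennreal (?v * (1 / (1 + real n) ^ 2)))"
  proof (intro suminf_cong)
    fix n
    have "(\<integral>\<^sup>+x. ?g n x \<partial>lborel) = ennreal (1 / (1 + real n) ^ 5) * emeasure lborel (ball (0::real^3) (real n + 1))"
      by (rule nn_integral_cmult_indicator) simp
    also have "\<dots> = ennreal (1 / (1 + real n) ^ 5 * (?v * (real n + 1) ^ 3))"
      by (simp add: emeasure_ball flip: ennreal_mult)
    also have "1 / (1 + real n) ^ 5 * (?v * (real n + 1) ^ 3) = ?v * (1 / (1 + real n) ^ 2)"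
      by (simp add: field_simps)
    finally show "(\<integral>\<^sup>+x. ?g n x \<partial>lborel) = ennreal (?v * (1 / (1 + real n) ^ 2))" .
  qed
  also have "\<dots> < \<infinity>"
  proof -
    have "summable (\<lambda>n. 1 / (1 + real n) ^ 2)"
      using inverse_power_summable[of 2, where 'a=real] summable_Suc_iff[of "\<lambda>n. inverse (real n ^ 2)"]
      by (simp add: inverse_eq_divide add.commute)
    then have "summable (\<lambda>n. ?v * (1 / (1 + real n) ^ 2))" by (rule summable_mult)
    then show ?thesis
      by (subst suminf_ennreal2) auto
  qed
  finally show ?thesis
    by (intro integrableI_bounded) auto
qed

lemma schwartz_mult_power_integrable:
  assumes "schwartz f"
  shows "integrable lborel (\<lambda>x. norm x ^ m *\<^sub>R f x)"
proof -
  obtain C where C: "C \<ge> 0" "\<And>x. norm (f x) \<le> C / (1 + norm x) ^ (m + 6)"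
    using schwartz_decay[OF assms] by blast
  note [measurable] = schwartz_measurable[OF assms]
  show ?thesis
  proof (rule Bochner_Integration.integrable_bound)
    show "integrable lborel (\<lambda>x::real^3. C * (1 / (1 + norm x) ^ 6))"
      by (intro integrable_mult_right integrable_weight) auto
    show "AE x in lborel. norm (norm x ^ m *\<^sub>R f x) \<le> norm (C * (1 / (1 + norm x) ^ 6))"
    proof (rule AE_I2)
      fix x :: "real^3"
      have "norm (norm x ^ m *\<^sub>R f x) = norm x ^ m * norm (f x)" by simp
      also have "\<dots> \<le> (1 + norm x) ^ m * (C / (1 + norm x) ^ (m + 6))"
        by (intro mult_mono power_mono C) auto
      also have "\<dots> = C * (1 / (1 + norm x) ^ 6)"
      proof -
        have "1 + norm x \<noteq> 0" by (smt (verit) norm_ge_zero)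
        then show ?thesis by (simp add: power_add)
      qed
      finally show "norm (norm x ^ m *\<^sub>R f x) \<le> norm (C * (1 / (1 + norm x) ^ 6))"
        using C(1) by simp
    qed
  qed measurable
qed

lemma schwartz_integrable: "schwartz f \<Longrightarrow> integrable lborel f"
  using schwartz_mult_power_integrable[of f 0] by simp

definition weight_mass :: real where
  "weight_mass = (LINT x|lborel. 1 / (1 + norm (x::real^3)) ^ 6)"

lemma weight_mass_nonneg: "0 \<le> weight_mass"
  unfolding weight_mass_def by (intro integral_nonneg_AE) auto

text \<open>With this bound every pairing with a bounded function is continuous on Schwartz space.\<close>

lemma schwartz_L1_bound:
  assumes "schwartz f" "length ks \<le> 6"
  shows "(LINT x|lborel. norm (iter_pd ks f x)) \<le> weight_mass * schwartz_seminorm 6 f"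
proof -
  have "(LINT x|lborel. norm (iter_pd ks f x))
      \<le> (LINT x|lborel. (1 / (1 + norm (x::real^3)) ^ 6) * schwartz_seminorm 6 f)"
  proof (rule integral_mono)
    show "integrable lborel (\<lambda>x. norm (iter_pd ks f x))"
      using schwartz_integrable[OF schwartz_iter_pd[OF assms(1)]] by (rule integrable_norm)
    show "integrable lborel (\<lambda>x::real^3. (1 / (1 + norm x) ^ 6) * schwartz_seminorm 6 f)"
      by (intro integrable_mult_left integrable_weight) auto
    fix x :: "real^3"
    have "0 < (1 + norm x) ^ 6" by (smt (verit) norm_ge_zero zero_less_power)
    then show "norm (iter_pd ks f x) \<le> (1 / (1 + norm x) ^ 6) * schwartz_seminorm 6 f"
      using schwartz_seminorm_upper[OF assms, of x] by (simp add: pos_le_divide_eq mult.commute)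
  qed
  then show ?thesis by (simp only: weight_mass_def integral_mult_left_zero)
qed

section \<open>The Fourier transform on Schwartz functions\<close>

lemma integrable_char_mult:
  fixes f :: "real^3 \<Rightarrow> complex"
  assumes "integrable lborel f"
  shows "integrable lborel (\<lambda>x. exp (- \<i> * of_real (x \<bullet> \<xi>)) * f x)"
proof (rule Bochner_Integration.integrable_bound[OF integrable_norm[OF assms]])
  have [measurable]: "f \<in> borel_measurable borel"
    using assms by (simp add: integrable_iff_bounded)
  show "(\<lambda>x. exp (- \<i> * of_real (x \<bullet> \<xi>)) * f x) \<in> borel_measurable lborel" by measurable
qed (simp add: norm_mult)

lemma norm_fourier_le:
  assumes "integrable lborel f"
  shows "norm (fourier f \<xi>) \<le> (LINT x|lborel. norm (f x))"
proof -
  have "norm (fourier f \<xi>) \<le> (LINT x|lborel. norm (exp (- \<i> * of_real (x \<bullet> \<xi>)) * f x))"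
    unfolding fourier_def by (rule integral_norm_bound)
  then show ?thesis by (simp add: norm_mult)
qed

lemma fourier_lincomb:
  assumes "integrable lborel f" "integrable lborel g"
  shows "fourier (\<lambda>x. a * f x + b * g x) \<xi> = a * fourier f \<xi> + b * fourier g \<xi>"
proof -
  have "fourier (\<lambda>x. a * f x + b * g x) \<xi> = (LINT x|lborel. a * (exp (- \<i> * of_real (x \<bullet> \<xi>)) * f x)
      + b * (exp (- \<i> * of_real (x \<bullet> \<xi>)) * g x))"
    unfolding fourier_def by (rule Bochner_Integration.integral_cong) (auto simp: algebra_simps)
  then show ?thesis
    unfolding fourier_def using assms[THEN integrable_char_mult, of \<xi>] by simp
qed

lemma fourier_scale: "fourier (\<lambda>x. a * f x) \<xi> = a * fourier f \<xi>"
  unfolding fourier_def by (simp add: mult.left_commute[of _ a])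

lemma has_derivative_line:
  fixes f :: "real^3 \<Rightarrow> complex"
  assumes "f differentiable (at (x + s *\<^sub>R axis k 1))"
  shows "((\<lambda>s. f (x + s *\<^sub>R axis k 1)) has_derivative (\<lambda>d. d *\<^sub>R pd k f (x + s *\<^sub>R axis k 1))) (at s)"
proof -
  let ?y = "x + s *\<^sub>R axis k 1"
  have f: "(f has_derivative frechet_derivative f (at ?y)) (at ?y)"
    using assms frechet_derivative_works by blast
  have "((\<lambda>s. f (x + s *\<^sub>R axis k 1)) has_derivative
      (\<lambda>d. frechet_derivative f (at ?y) (d *\<^sub>R axis k 1))) (at s)"
    by (rule has_derivative_compose[where g=f, of "\<lambda>s. x + s *\<^sub>R axis k 1" "\<lambda>d. d *\<^sub>R axis k 1", OF _ f])
      (auto intro!: derivative_eq_intros)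
  moreover have "(\<lambda>d. frechet_derivative f (at ?y) (d *\<^sub>R axis k 1)) = (\<lambda>d. d *\<^sub>R pd k f ?y)"
    unfolding pd_def using has_derivative_linear[OF f] by (simp add: linear_scale)
  ultimately show ?thesis by simp
qed

lemma vector_derivative_quotient:
  fixes g :: "real \<Rightarrow> 'a::real_normed_vector"
  assumes "(g has_vector_derivative d) (at a)"
  shows "((\<lambda>h. (g (a + h) - g a) /\<^sub>R h) \<longlongrightarrow> d) (at 0)"
proof -
  have "((\<lambda>h. norm (g (a + h) - g a - h *\<^sub>R d) / norm h) \<longlongrightarrow> 0) (at 0)"
    using assms by (simp add: has_vector_derivative_def has_derivative_at)
  moreover have "norm (g (a + h) - g a - h *\<^sub>R d) / norm h = norm ((g (a + h) - g a) /\<^sub>R h - d)"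
    if "h \<noteq> 0" for h
  proof -
    have "(g (a + h) - g a) /\<^sub>R h - d = (g (a + h) - g a - h *\<^sub>R d) /\<^sub>R h"
      using that by (simp add: algebra_simps)
    then show ?thesis by (simp add: divide_inverse)
  qed
  ultimately have "((\<lambda>h. norm ((g (a + h) - g a) /\<^sub>R h - d)) \<longlongrightarrow> 0) (at 0)"
    by (simp cong: Lim_cong_within)
  then show ?thesis by (simp add: tendsto_norm_zero_iff LIM_zero_iff)
qed

lemma filterlim_inverse_Suc: "filterlim (\<lambda>n. 1 / real (Suc n)) (at 0) sequentially"
  by (intro filterlim_atI LIMSEQ_Suc[OF lim_1_over_n]) auto

text \<open>Integration by parts without boundary terms: by translation invariance the difference
  quotients of \<open>f\<close> in direction \<open>k\<close> have the Fourier transform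
  \<open>(e^(i h \<xi>\<^sub>k) - 1) / h\<close> times that of \<open>f\<close>, and they converge dominatedly to the derivative.\<close>

lemma fourier_pd:
  assumes f: "schwartz f"
  shows "fourier (pd k f) \<xi> = \<i> * of_real (\<xi> $ k) * fourier f \<xi>"
proof -
  let ?e = "axis k 1 :: real^3"
  let ?h = "\<lambda>n. 1 / real (Suc n)"
  let ?E = "\<lambda>x. exp (- \<i> * complex_of_real (x \<bullet> \<xi>))"
  let ?q = "\<lambda>n x. (f (x + ?h n *\<^sub>R ?e) - f x) /\<^sub>R ?h n"
  note [measurable] = schwartz_measurable[OF f] schwartz_measurable[OF schwartz_pd[OF f, of k]]
  have e: "norm ?e = 1" by simp
  have diff: "f differentiable (at x)" for x
    using smooth_differentiable[OF schwartz_smooth[OF f], of "[]"] by simp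
  obtain C where C: "C \<ge> 0" "\<And>x. norm (pd k f x) \<le> C / (1 + norm x) ^ 6"
    using schwartz_decay[OF schwartz_pd[OF f]] by blast
  have bound: "norm (?q n x) \<le> C * 2 ^ 6 * (1 / (1 + norm x) ^ 6)" for n x
  proof -
    have h: "0 < ?h n" "?h n \<le> 1" by (auto simp: field_simps)
    have "continuous_on {0..?h n} (\<lambda>s. f (x + s *\<^sub>R ?e))"
      by (intro continuous_on_compose2[OF schwartz_continuous_on[OF f]] continuous_intros) auto
    from mvt_general[OF h(1) this has_derivative_line[OF diff]]
    obtain s where s: "s \<in> {0<..<?h n}"
      "norm (f (x + ?h n *\<^sub>R ?e) - f x) \<le> norm ((?h n - 0) *\<^sub>R pd k f (x + s *\<^sub>R ?e))"
      by auto
    have "norm (?q n x) = norm (f (x + ?h n *\<^sub>R ?e) - f x) / ?h n"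
      by (simp add: divide_inverse)
    also have "\<dots> \<le> norm (pd k f (x + s *\<^sub>R ?e))"
      using s(2) h by (simp add: divide_simps)
    also have "\<dots> \<le> C / (1 + norm (x + s *\<^sub>R ?e)) ^ 6" by (rule C)
    also have "\<dots> \<le> C / ((1 + norm x) / 2) ^ 6"
    proof (intro divide_left_mono power_mono C(1) mult_pos_pos zero_less_power)
      have "norm x \<le> norm (x + s *\<^sub>R ?e) + norm (s *\<^sub>R ?e)"
        by (metis add_diff_cancel_right' norm_triangle_ineq4)
      moreover have "norm (s *\<^sub>R ?e) \<le> 1"
      proof -
        have "norm (s *\<^sub>R ?e) = s" using s(1) by simp
        then show ?thesis using s(1) h(2) unfolding greaterThanLessThan_iff by linarith
      qed
      ultimately have "norm x \<le> norm (x + s *\<^sub>R ?e) + 1" by linarith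
      then show "(1 + norm x) / 2 \<le> 1 + norm (x + s *\<^sub>R ?e)"
        using norm_ge_zero[of "x + s *\<^sub>R ?e"] by argo
      show "0 < (1 + norm x) / 2" using one_plus_norm_pos[of x] by simp
      show "0 < 1 + norm (x + s *\<^sub>R ?e)" by (rule one_plus_norm_pos)
    qed (use one_plus_norm_pos[of x] in auto)
    also have "\<dots> = C * 2 ^ 6 * (1 / (1 + norm x) ^ 6)" by (simp add: power_divide)
    finally show ?thesis .
  qed
  have lim: "(\<lambda>n. ?q n x) \<longlonglongrightarrow> pd k f x" for x
  proof -
    have "((\<lambda>s. f (x + s *\<^sub>R ?e)) has_vector_derivative pd k f x) (at 0)"
      using has_derivative_line[of f x 0 k] diff by (simp add: has_vector_derivative_def)
    from vector_derivative_quotient[OF this] show ?thesis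
      using filterlim_compose[OF _ filterlim_inverse_Suc] by fastforce
  qed
  have int_q: "integrable lborel (?q n)" for n
    using integrable_affine[OF schwartz_integrable[OF f], of 1 "?h n *\<^sub>R ?e"]
    by (intro integrable_scaleR_right Bochner_Integration.integrable_diff schwartz_integrable[OF f]) (simp add: add.commute)
  have "(\<lambda>n. fourier (?q n) \<xi>) \<longlonglongrightarrow> fourier (pd k f) \<xi>"
    unfolding fourier_def
  proof (rule integral_dominated_convergence[where w="\<lambda>x. C * 2 ^ 6 * (1 / (1 + norm x) ^ 6)"])
    show "integrable lborel (\<lambda>x::real^3. C * 2 ^ 6 * (1 / (1 + norm x) ^ 6))"
      by (intro integrable_mult_right integrable_weight) auto
    show "AE x in lborel. (\<lambda>n. ?E x * ?q n x) \<longlonglongrightarrow> ?E x * pd k f x"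
      by (intro AE_I2 tendsto_intros lim)
    show "AE x in lborel. norm (?E x * ?q n x) \<le> C * 2 ^ 6 * (1 / (1 + norm x) ^ 6)" for n
      using bound[of n] by (intro AE_I2) (simp add: norm_mult)
  qed measurable
  moreover have "fourier (?q n) \<xi> = ((exp (\<i> * of_real (?h n * \<xi> $ k)) - 1) /\<^sub>R ?h n) * fourier f \<xi>" for n
  proof -
    have eq: "?E x * ?q n x = (exp (\<i> * of_real (?h n * \<xi> $ k)) * (?E (x + ?h n *\<^sub>R ?e) * f (x + ?h n *\<^sub>R ?e))
        - ?E x * f x) /\<^sub>R ?h n" for x
    proof -
      have "?E x = exp (\<i> * of_real (?h n * \<xi> $ k)) * ?E (x + ?h n *\<^sub>R ?e)"
        unfolding exp_add[symmetric]
        by (rule arg_cong[where f=exp]) (simp add: inner_add_left inner_axis' algebra_simps)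
      then show ?thesis by (simp add: algebra_simps)
    qed
    have i1: "integrable lborel (\<lambda>x. ?E x * f x)"
      by (rule integrable_char_mult[OF schwartz_integrable[OF f]])
    have i2: "integrable lborel (\<lambda>x. ?E (x + ?h n *\<^sub>R ?e) * f (x + ?h n *\<^sub>R ?e))"
      using integrable_affine[OF i1, of 1 "?h n *\<^sub>R ?e"] by (simp add: add.commute)
    have i3: "(LINT x|lborel. ?E (x + ?h n *\<^sub>R ?e) * f (x + ?h n *\<^sub>R ?e)) = fourier f \<xi>"
      unfolding fourier_def by (rule integral_translate[where f="\<lambda>x. ?E x * f x"]) measurable
    show ?thesis
      unfolding fourier_def[of "?q n"] eq
      using i1 i2 i3 by (simp add: fourier_def[of f] algebra_simps)
  qed
  moreover have "(\<lambda>n. ((exp (\<i> * of_real (?h n * \<xi> $ k)) - 1) /\<^sub>R ?h n) * fourier f \<xi>)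
      \<longlonglongrightarrow> \<i> * of_real (\<xi> $ k) * fourier f \<xi>"
  proof -
    let ?g = "\<lambda>s::real. exp (\<i> * of_real (s * \<xi> $ k))"
    have "(?g has_vector_derivative \<i> * of_real (\<xi> $ k)) (at 0)"
    proof -
      have "((\<lambda>z. exp (\<i> * (z * of_real (\<xi> $ k)))) has_field_derivative \<i> * of_real (\<xi> $ k)) (at (of_real 0))"
        by (auto intro!: derivative_eq_intros)
      from has_vector_derivative_real_field[OF this] show ?thesis by simp
    qed
    from vector_derivative_quotient[OF this] have "((\<lambda>y. (?g y - 1) /\<^sub>R y) \<longlongrightarrow> \<i> * of_real (\<xi> $ k)) (at 0)"
      by simp
    from filterlim_compose[OF this filterlim_inverse_Suc] show ?thesis
      by (intro tendsto_mult_right)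
  qed
  ultimately show ?thesis by - (rule LIMSEQ_unique[of "\<lambda>n. fourier (?q n) \<xi>"], assumption, simp only:)
qed

text \<open>Multiplication by a coordinate changes every derivative by another Schwartz function.\<close>

lemma iter_pd_mult_coordinate:
  assumes f: "schwartz f"
  shows "\<exists>h. schwartz h \<and>
    iter_pd ks (\<lambda>x. of_real (x $ k) * f x) = (\<lambda>x. of_real (x $ k) * iter_pd ks f x + h x)"
proof (induction ks)
  case Nil
  show ?case using schwartz_scale[OF f, of 0] by (intro exI[of _ "\<lambda>x. 0"]) auto
next
  case (Cons j ks)
  then obtain h where h: "schwartz h"
    "iter_pd ks (\<lambda>x. of_real (x $ k) * f x) = (\<lambda>x. of_real (x $ k) * iter_pd ks f x + h x)" by auto
  let ?G = "iter_pd ks f"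
  have G: "schwartz ?G" by (rule schwartz_iter_pd[OF f])
  have "pd j (\<lambda>x. of_real (x $ k) * ?G x + h x) x
      = of_real (x $ k) * pd j ?G x + ((if j = k then 1 else 0) * ?G x + 1 * pd j h x)" for x
  proof -
    have 1: "(?G has_derivative frechet_derivative ?G (at x)) (at x)"
      "(h has_derivative frechet_derivative h (at x)) (at x)"
      using smooth_differentiable[OF schwartz_smooth[OF G], of "[]"]
        smooth_differentiable[OF schwartz_smooth[OF h(1)], of "[]"] frechet_derivative_works by auto
    have 2: "((\<lambda>x::real^3. complex_of_real (x $ k)) has_derivative (\<lambda>d. of_real (d $ k))) (at x)"
      by (intro bounded_linear_imp_has_derivative bounded_linear_compose[OF bounded_linear_of_real bounded_linear_vec_nth])
    have "((\<lambda>x. of_real (x $ k) * ?G x + h x) has_derivative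
        (\<lambda>d. (of_real (x $ k) * frechet_derivative ?G (at x) d + of_real (d $ k) * ?G x)
          + frechet_derivative h (at x) d)) (at x)"
      by (intro has_derivative_add has_derivative_mult 1 2)
    from pd_eq[OF this, of j] show ?thesis by (simp add: pd_def axis_def)
  qed
  moreover have "schwartz (\<lambda>x. (if j = k then 1 else 0) * ?G x + 1 * pd j h x)"
    by (intro schwartz_lincomb G schwartz_pd h)
  ultimately show ?case using h(2) by auto
qed

lemma schwartz_mult_coordinate:
  assumes f: "schwartz f"
  shows "schwartz (\<lambda>x. of_real (x $ k) * f x)"
  unfolding schwartz_def smooth_def
proof (intro conjI allI)
  fix ks and x :: "real^3"
  obtain h where h: "schwartz h"
    "iter_pd ks (\<lambda>x. of_real (x $ k) * f x) = (\<lambda>x. of_real (x $ k) * iter_pd ks f x + h x)"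
    using iter_pd_mult_coordinate[OF f] by blast
  have "(\<lambda>x::real^3. complex_of_real (x $ k)) differentiable (at x)"
    by (intro bounded_linear_imp_differentiable bounded_linear_compose[OF bounded_linear_of_real bounded_linear_vec_nth])
  then show "iter_pd ks (\<lambda>x. of_real (x $ k) * f x) differentiable (at x)"
    unfolding h(2) using smooth_differentiable[OF schwartz_smooth[OF f]]
      smooth_differentiable[OF schwartz_smooth[OF h(1)], of "[]"]
    by (auto intro!: differentiable_add differentiable_mult)
  fix m
  obtain C D where C: "\<And>x. (1 + norm x) ^ Suc m * norm (iter_pd ks f x) \<le> C"
    and D: "\<And>x. (1 + norm x) ^ m * norm (iter_pd [] h x) \<le> D"
    using f h(1) unfolding schwartz_def by meson
  show "\<exists>C. \<forall>x. (1 + norm x) ^ m * norm (iter_pd ks (\<lambda>x. of_real (x $ k) * f x) x) \<le> C"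
  proof (intro exI allI)
    fix x :: "real^3"
    have "norm (of_real (x $ k) * iter_pd ks f x + h x)
        \<le> (1 + norm x) * norm (iter_pd ks f x) + norm (h x)"
      using component_le_norm_cart[of x k]
      by (intro order_trans[OF norm_triangle_ineq] add_mono) (auto simp: norm_mult intro!: mult_right_mono)
    then have "(1 + norm x) ^ m * norm (of_real (x $ k) * iter_pd ks f x + h x)
        \<le> (1 + norm x) ^ m * ((1 + norm x) * norm (iter_pd ks f x) + norm (h x))"
      by (intro mult_left_mono) auto
    also have "\<dots> = (1 + norm x) ^ Suc m * norm (iter_pd ks f x) + (1 + norm x) ^ m * norm (iter_pd [] h x)"
      by (simp add: algebra_simps)
    also have "\<dots> \<le> C + D" by (intro add_mono C D)
    finally show "(1 + norm x) ^ m * norm (iter_pd ks (\<lambda>x. of_real (x $ k) * f x) x) \<le> C + D"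
      unfolding h(2) .
  qed
qed

text \<open>Differentiation under the integral sign: the remainder is bounded by
  \<open>\<bar>x \<bullet> h\<bar>\<^sup>2 \<bar>f x\<bar>\<close> pointwise, which is integrable in \<open>x\<close>.\<close>

lemma has_derivative_fourier:
  assumes f: "schwartz f"
  shows "(fourier f has_derivative
    (\<lambda>h. \<Sum>k\<in>UNIV. of_real (h $ k) * fourier (\<lambda>x. - \<i> * (of_real (x $ k) * f x)) \<xi>)) (at \<xi>)"
proof (rule has_derivativeI_sandwich[where e=1])
  let ?L = "\<lambda>h::real^3. \<Sum>k\<in>UNIV. of_real (h $ k) * fourier (\<lambda>x. - \<i> * (of_real (x $ k) * f x)) \<xi>"
  let ?E = "\<lambda>\<xi> x. exp (- \<i> * complex_of_real (x \<bullet> \<xi>))"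
  note [measurable] = schwartz_measurable[OF f]
  show "bounded_linear ?L"
    by (intro bounded_linear_sum bounded_linear_mult_const
      bounded_linear_compose[OF bounded_linear_of_real bounded_linear_vec_nth])
  define C where "C = (LINT x|lborel. norm (norm x ^ 2 *\<^sub>R f x))"
  fix \<eta> :: "real^3" assume ne: "\<eta> \<noteq> \<xi>"
  define h where "h = \<eta> - \<xi>"
  have ik: "integrable lborel (\<lambda>x. ?E \<xi> x * (- \<i> * (of_real (x $ k) * f x)))" for k
    by (intro integrable_char_mult schwartz_integrable schwartz_scale schwartz_mult_coordinate f)
  have L: "?L h = (LINT x|lborel. ?E \<xi> x * (- \<i> * of_real (x \<bullet> h) * f x))"
  proof -
    have "?L h = (LINT x|lborel. (\<Sum>k\<in>UNIV. of_real (h $ k) * (?E \<xi> x * (- \<i> * (of_real (x $ k) * f x)))))"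
      unfolding fourier_def using ik by (simp add: Bochner_Integration.integral_sum)
    also have "\<dots> = (LINT x|lborel. ?E \<xi> x * (- \<i> * of_real (x \<bullet> h) * f x))"
      by (intro Bochner_Integration.integral_cong refl)
        (simp add: inner_vec_def sum_distrib_left sum_distrib_right mult_ac)
    finally show ?thesis .
  qed
  have iL: "integrable lborel (\<lambda>x. ?E \<xi> x * (- \<i> * of_real (x \<bullet> h) * f x))"
  proof -
    have "integrable lborel (\<lambda>x. (\<Sum>k\<in>UNIV. of_real (h $ k) * (?E \<xi> x * (- \<i> * (of_real (x $ k) * f x)))))"
      using ik by (intro Bochner_Integration.integrable_sum integrable_mult_right)
    then show ?thesis
      by (rule Bochner_Integration.integrable_cong[THEN iffD1, rotated 2])
        (auto simp: inner_vec_def sum_distrib_left sum_distrib_right mult_ac)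
  qed
  have i0: "integrable lborel (\<lambda>x. ?E \<zeta> x * f x)" for \<zeta>
    by (rule integrable_char_mult[OF schwartz_integrable[OF f]])
  have pt: "norm (?E \<eta> x * f x - ?E \<xi> x * f x - ?E \<xi> x * (- \<i> * of_real (x \<bullet> h) * f x))
      \<le> norm h ^ 2 * norm (norm x ^ 2 *\<^sub>R f x)" for x
  proof -
    let ?t = "- (x \<bullet> h)"
    have "?E \<eta> x = ?E \<xi> x * iexp ?t"
      unfolding exp_add[symmetric] h_def
      by (rule arg_cong[where f=exp]) (simp add: inner_diff_right algebra_simps)
    then have "?E \<eta> x * f x - ?E \<xi> x * f x - ?E \<xi> x * (- \<i> * of_real (x \<bullet> h) * f x)
        = ?E \<xi> x * (iexp ?t - (1 + \<i> * of_real ?t)) * f x"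
      by (simp add: algebra_simps)
    moreover have "norm (iexp ?t - (1 + \<i> * of_real ?t)) \<le> \<bar>?t\<bar> ^ 2 / 2"
      using iexp_approx1[of ?t 1] by (simp add: numeral_2_eq_2)
    moreover have "\<bar>?t\<bar> ^ 2 / 2 \<le> (norm x * norm h) ^ 2"
    proof -
      have "\<bar>?t\<bar> ^ 2 \<le> (norm x * norm h) ^ 2"
        using Cauchy_Schwarz_ineq2[of x h] by (intro power_mono) auto
      then show ?thesis by (smt (verit) zero_le_power2 field_sum_of_halves)
    qed
    ultimately have "norm (?E \<eta> x * f x - ?E \<xi> x * f x - ?E \<xi> x * (- \<i> * of_real (x \<bullet> h) * f x))
        \<le> (norm x * norm h) ^ 2 * norm (f x)"
      by (simp add: norm_mult mult_right_mono)
    then show ?thesis by (simp add: power_mult_distrib mult_ac)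
  qed
  have "norm (fourier f \<eta> - fourier f \<xi> - ?L h)
      = norm (LINT x|lborel. ?E \<eta> x * f x - ?E \<xi> x * f x - ?E \<xi> x * (- \<i> * of_real (x \<bullet> h) * f x))"
    unfolding L unfolding fourier_def using i0 iL by simp
  also have "\<dots> \<le> (LINT x|lborel. norm h ^ 2 * norm (norm x ^ 2 *\<^sub>R f x))"
    by (rule Bochner_Integration.integral_norm_bound_integral[OF Bochner_Integration.integrable_diff[OF
        Bochner_Integration.integrable_diff[OF i0 i0] iL] _ pt])
      (intro integrable_mult_right integrable_norm schwartz_mult_power_integrable f)
  also have "\<dots> = norm h ^ 2 * C" by (simp add: C_def)
  finally show "norm (fourier f \<eta> - fourier f \<xi> - ?L (\<eta> - \<xi>)) / norm (\<eta> - \<xi>) \<le> C * norm (\<eta> - \<xi>)"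
    using ne by (simp add: h_def divide_le_eq power2_eq_square mult_ac)
next
  show "((\<lambda>y. (LINT x|lborel. norm (norm x ^ 2 *\<^sub>R f x)) * norm (y - \<xi>)) \<longlongrightarrow> 0) (at \<xi>)"
    by (auto intro!: tendsto_eq_intros)
qed simp

lemma pd_fourier:
  assumes "schwartz f"
  shows "pd k (fourier f) = fourier (\<lambda>x. - \<i> * (of_real (x $ k) * f x))"
  by (rule ext, subst pd_eq[OF has_derivative_fourier[OF assms]])
     (simp add: axis_def if_distrib[where f=complex_of_real] if_distrib[where f="\<lambda>z. z * _"] cong: if_cong)

text \<open>Differentiation becomes multiplication by a coordinate, so smoothness of the transform is
  obtained by iterating \<open>pd_fourier\<close> inside Schwartz space.\<close>

lemma iter_pd_fourier:
  assumes "schwartz f"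
  shows "\<exists>g. schwartz g \<and> iter_pd ks (fourier f) = fourier g"
proof (induction ks)
  case (Cons k ks)
  then obtain g where "schwartz g" "iter_pd ks (fourier f) = fourier g" by blast
  then show ?case
    using pd_fourier[of g k] schwartz_scale[OF schwartz_mult_coordinate[of g k], of "-\<i>"]
    by (intro exI[of _ "\<lambda>x. - \<i> * (of_real (x $ k) * g x)"]) simp
qed (use assms in auto)

lemma fourier_iter_pd:
  assumes "schwartz f"
  shows "fourier (iter_pd (replicate m k) f) \<xi> = (\<i> * of_real (\<xi> $ k)) ^ m * fourier f \<xi>"
proof (induction m)
  case (Suc m)
  then show ?case
    using fourier_pd[OF schwartz_iter_pd[OF assms, of "replicate m k"]] by (simp add: mult.assoc)
qed simp

text \<open>Decay comes from transforming derivatives: every power of \<open>\<xi>\<^sub>k\<close> is absorbed by \<open>fourier_pd\<close>.\<close>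

lemma fourier_decay:
  assumes "schwartz f"
  shows "\<exists>C. \<forall>\<xi>. (1 + norm \<xi>) ^ m * norm (fourier f \<xi>) \<le> C"
proof (intro exI allI)
  fix \<xi> :: "real^3"
  define D where "D = (\<lambda>ks. LINT x|lborel. norm (iter_pd ks f x))"
  have D: "norm (\<xi> $ k) ^ m * norm (fourier f \<xi>) \<le> D (replicate m k)" for k
    using norm_fourier_le[OF schwartz_integrable[OF schwartz_iter_pd[OF assms]], of "replicate m k" \<xi>]
    by (simp add: fourier_iter_pd[OF assms] norm_mult norm_power D_def del: foldr_replicate)
  have D0: "norm (fourier f \<xi>) \<le> D []"
    using norm_fourier_le[OF schwartz_integrable[OF assms]] by (simp add: D_def)
  obtain k where k: "\<And>j. \<bar>\<xi> $ j\<bar> \<le> \<bar>\<xi> $ k\<bar>"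
    using finite_imageI[of UNIV "\<lambda>j. \<bar>\<xi> $ j\<bar>"] Max_ge[of "range (\<lambda>j. \<bar>\<xi> $ j\<bar>)"]
      Max_in[of "range (\<lambda>j. \<bar>\<xi> $ j\<bar>)"] by fastforce
  have "norm \<xi> \<le> (\<Sum>j\<in>UNIV. \<bar>\<xi> $ j\<bar>)" by (rule norm_le_l1_cart)
  also have "\<dots> \<le> 3 * \<bar>\<xi> $ k\<bar>" using k[of 1] k[of 2] k[of 3] unfolding sum_3 by linarith
  finally have "1 + norm \<xi> \<le> 4 * max 1 \<bar>\<xi> $ k\<bar>" by simp
  then have "(1 + norm \<xi>) ^ m \<le> (4 * max 1 \<bar>\<xi> $ k\<bar>) ^ m" by (intro power_mono) auto
  also have "\<dots> \<le> 4 ^ m * (1 + \<bar>\<xi> $ k\<bar> ^ m)"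
    by (auto simp: power_mult_distrib max_def)
  finally have "(1 + norm \<xi>) ^ m * norm (fourier f \<xi>) \<le> 4 ^ m * (1 + \<bar>\<xi> $ k\<bar> ^ m) * norm (fourier f \<xi>)"
    by (rule mult_right_mono) simp
  also have "\<dots> = 4 ^ m * (norm (fourier f \<xi>) + norm (\<xi> $ k) ^ m * norm (fourier f \<xi>))"
    by (simp add: algebra_simps)
  also have "\<dots> \<le> 4 ^ m * (D [] + D (replicate m k))"
    by (intro mult_left_mono add_mono D D0) auto
  also have "\<dots> \<le> 4 ^ m * (D [] + (\<Sum>k\<in>UNIV. D (replicate m k)))"
    by (intro mult_left_mono add_mono member_le_sum[where f="\<lambda>k. D (replicate m k)"])
      (auto simp: D_def intro!: integral_nonneg_AE)
  finally show "(1 + norm \<xi>) ^ m * norm (fourier f \<xi>)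
     \<le> 4 ^ m * ((LINT x|lborel. norm (iter_pd [] f x)) + (\<Sum>k\<in>UNIV. LINT x|lborel. norm (iter_pd (replicate m k) f x)))"
    by (simp only: D_def)
qed

lemma schwartz_fourier:
  assumes "schwartz f"
  shows "schwartz (fourier f)"
  unfolding schwartz_def smooth_def
proof (intro conjI allI)
  fix ks and \<xi> :: "real^3"
  obtain g where g: "schwartz g" "iter_pd ks (fourier f) = fourier g"
    using iter_pd_fourier[OF assms] by blast
  show "iter_pd ks (fourier f) differentiable (at \<xi>)"
    unfolding g(2) using has_derivative_fourier[OF g(1)] differentiableI by blast
  show "\<exists>C. \<forall>\<xi>. (1 + norm \<xi>) ^ m * norm (iter_pd ks (fourier f) \<xi>) \<le> C" for m
    unfolding g(2) by (rule fourier_decay[OF g(1)])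
qed

section \<open>Gaussian integrals and Fourier inversion\<close>

lemma
  fixes f :: "'a::euclidean_space \<Rightarrow> real \<Rightarrow> complex"
  assumes f: "\<And>b. b \<in> Basis \<Longrightarrow> integrable lborel (f b)"
  shows integral_lborel_prod:
      "(LINT x|lborel. (\<Prod>b\<in>Basis. f b (x \<bullet> b))) = (\<Prod>b\<in>Basis. LINT x|lborel. f b x)"
    and integrable_lborel_prod: "integrable lborel (\<lambda>x. \<Prod>b\<in>Basis. f b (x \<bullet> b))"
proof -
  interpret product_sigma_finite "\<lambda>_::'a. lborel :: real measure" ..
  have [measurable]: "f b \<in> borel_measurable borel" if "b \<in> Basis" for b
    using f[OF that] by (simp add: integrable_iff_bounded)
  have S: "(\<lambda>g. \<Sum>b\<in>Basis. g b *\<^sub>R b) \<in> (\<Pi>\<^sub>M b\<in>(Basis::'a set). lborel :: real measure) \<rightarrow>\<^sub>M borel"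
    by measurable
  have eq: "(\<Prod>b\<in>Basis. f b ((\<Sum>b\<in>Basis. g b *\<^sub>R b) \<bullet> b)) = (\<Prod>b\<in>Basis. f b (g b))" for g
    by (intro prod.cong refl) simp
  have m: "(\<lambda>x. \<Prod>b\<in>Basis. f b (x \<bullet> b)) \<in> borel_measurable borel" by measurable
  show "(LINT x|lborel. (\<Prod>b\<in>Basis. f b (x \<bullet> b))) = (\<Prod>b\<in>Basis. LINT x|lborel. f b x)"
    by (subst lborel_eq[where 'a='a], subst integral_distr[OF S m], simp only: eq,
        rule product_integral_prod) (auto simp: f)
  show "integrable lborel (\<lambda>x. \<Prod>b\<in>Basis. f b (x \<bullet> b))"
    by (subst lborel_eq[where 'a='a], subst integrable_distr_eq[OF S m], simp only: eq,
        rule product_integrable_prod) (auto simp: f)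
qed

lemma
  shows gaussian_char_1: "(LINT x|lborel. iexp (t * x) * of_real (exp (- x\<^sup>2 / 2)))
      = of_real (sqrt (2 * pi) * exp (- t\<^sup>2 / 2))"
    and integrable_gaussian_char_1: "integrable lborel (\<lambda>x. iexp (t * x) * of_real (exp (- x\<^sup>2 / 2)))"
proof -
  have eq: "iexp (t * x) * of_real (exp (- x\<^sup>2 / 2)) = sqrt (2 * pi) *\<^sub>R (std_normal_density x *\<^sub>R iexp (t * x))" for x
    by (simp add: std_normal_density_def scaleR_conv_of_real)
  have "(LINT x|lborel. std_normal_density x *\<^sub>R iexp (t * x)) = char std_normal_distribution t"
    unfolding char_def by (subst integral_density) auto
  then show "(LINT x|lborel. iexp (t * x) * of_real (exp (- x\<^sup>2 / 2)))
      = of_real (sqrt (2 * pi) * exp (- t\<^sup>2 / 2))"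
    unfolding eq by (simp add: char_std_normal_distribution scaleR_conv_of_real)
  have "integrable lborel (\<lambda>x. std_normal_density x *\<^sub>R iexp (t * x))"
    by (rule Bochner_Integration.integrable_bound[of _ std_normal_density]) auto
  then show "integrable lborel (\<lambda>x. iexp (t * x) * of_real (exp (- x\<^sup>2 / 2)))"
    unfolding eq by (rule integrable_scaleR_right)
qed

definition gaussian :: "real^3 \<Rightarrow> real" where
  "gaussian x = exp (- (norm x)\<^sup>2 / 2)"

lemma gaussian_measurable [measurable]: "gaussian \<in> borel_measurable borel"
  unfolding gaussian_def[abs_def] by measurable

lemma
  shows gaussian_char: "(LINT x|lborel. iexp (x \<bullet> y) * of_real (gaussian x))
      = of_real (sqrt (2 * pi) ^ 3 * gaussian y)"
    and integrable_gaussian_char: "integrable lborel (\<lambda>x. iexp (x \<bullet> y) * of_real (gaussian x))"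
proof -
  let ?f = "\<lambda>b s. iexp ((y \<bullet> b) * s) * complex_of_real (exp (- s\<^sup>2 / 2))"
  have n2: "(norm z)\<^sup>2 = (\<Sum>b\<in>Basis. (z \<bullet> b)\<^sup>2)" for z :: "real^3"
    by (subst power2_norm_eq_inner, subst euclidean_inner) (simp add: power2_eq_square)
  have eq: "iexp (x \<bullet> y) * of_real (gaussian x) = (\<Prod>b\<in>Basis. ?f b (x \<bullet> b))" for x
  proof -
    have "(\<Prod>b\<in>Basis. ?f b (x \<bullet> b)) = exp (\<Sum>b\<in>Basis. \<i> * of_real ((y \<bullet> b) * (x \<bullet> b)))
        * of_real (exp (\<Sum>b\<in>Basis. - (x \<bullet> b)\<^sup>2 / 2))"
      by (simp add: prod.distrib exp_sum)
    also have "(\<Sum>b\<in>Basis. \<i> * complex_of_real ((y \<bullet> b) * (x \<bullet> b))) = \<i> * of_real (x \<bullet> y)"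
      by (simp add: euclidean_inner[of x y] sum_distrib_left mult_ac)
    also have "(\<Sum>b\<in>Basis. - (x \<bullet> b)\<^sup>2 / 2) = - (norm x)\<^sup>2 / 2"
      by (simp add: n2 sum_negf sum_divide_distrib)
    finally show ?thesis by (simp add: gaussian_def)
  qed
  show "integrable lborel (\<lambda>x. iexp (x \<bullet> y) * of_real (gaussian x))"
    unfolding eq by (rule integrable_lborel_prod) (rule integrable_gaussian_char_1)
  have "(LINT x|lborel. iexp (x \<bullet> y) * of_real (gaussian x))
      = (\<Prod>b\<in>Basis. of_real (sqrt (2 * pi) * exp (- (y \<bullet> b)\<^sup>2 / 2)))"
    unfolding eq by (subst integral_lborel_prod, rule integrable_gaussian_char_1, simp only: gaussian_char_1)
  also have "\<dots> = of_real (sqrt (2 * pi) ^ 3 * exp (\<Sum>b\<in>Basis. - (y \<bullet> b)\<^sup>2 / 2))"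
    by (simp add: prod.distrib exp_sum)
  also have "(\<Sum>b\<in>Basis. - (y \<bullet> b)\<^sup>2 / 2) = - (norm y)\<^sup>2 / 2"
    by (simp add: n2 sum_negf sum_divide_distrib)
  finally show "(LINT x|lborel. iexp (x \<bullet> y) * of_real (gaussian x))
      = of_real (sqrt (2 * pi) ^ 3 * gaussian y)" by (simp add: gaussian_def)
qed

lemma gaussian_bounds: "0 \<le> gaussian x" "gaussian x \<le> 1"
  unfolding gaussian_def by auto

lemma integrable_gaussian: "integrable lborel gaussian"
  using integrable_norm[OF integrable_gaussian_char[of 0]] gaussian_bounds by simp

lemma integral_gaussian: "(LINT x|lborel. gaussian x) = sqrt (2 * pi) ^ 3"
proof -
  have "complex_of_real (LINT x|lborel. gaussian x) = of_real (sqrt (2 * pi) ^ 3)"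
    using gaussian_char[of 0] by (simp add: gaussian_def integral_complex_of_real)
  then show ?thesis by (rule of_real_eq_iff[THEN iffD1])
qed

lemma integrable_tensor:
  fixes f :: "'a::euclidean_space \<Rightarrow> complex" and g :: "'b::euclidean_space \<Rightarrow> complex"
  assumes f: "integrable lborel f" and g: "integrable lborel g"
    and k: "k \<in> borel_measurable borel" "\<And>p. norm (k p) \<le> C"
  shows "integrable (lborel \<Otimes>\<^sub>M lborel) (\<lambda>(x, y). f x * g y * k (x, y))"
proof -
  have [measurable]: "f \<in> borel_measurable borel" "g \<in> borel_measurable borel" "k \<in> borel_measurable borel"
    using f g k(1) by (auto simp: integrable_iff_bounded)
  have km: "k \<in> borel_measurable (lborel \<Otimes>\<^sub>M lborel)" by (simp add: lborel_prod)
  have "integrable (lborel \<Otimes>\<^sub>M lborel) (\<lambda>p. f (fst p) * g (snd p))"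
  proof (rule lborel_pair.Fubini_integrable)
    show "(\<lambda>p. f (fst p) * g (snd p)) \<in> borel_measurable (lborel \<Otimes>\<^sub>M lborel)" by measurable
    show "integrable lborel (\<lambda>x. LINT y|lborel. norm (f (fst (x, y)) * g (snd (x, y))))"
      using f by (simp add: norm_mult)
    show "AE x in lborel. integrable lborel (\<lambda>y. f (fst (x, y)) * g (snd (x, y)))"
      using g by simp
  qed
  then have "integrable (lborel \<Otimes>\<^sub>M lborel) (\<lambda>p. C * norm (f (fst p) * g (snd p)))"
    by (intro integrable_mult_right integrable_norm)
  then show ?thesis
  proof (rule Bochner_Integration.integrable_bound)
    show "(\<lambda>(x, y). f x * g y * k (x, y)) \<in> borel_measurable (lborel \<Otimes>\<^sub>M lborel)"
      using km by measurable
    have "norm (f (fst p) * g (snd p) * k p) \<le> C * norm (f (fst p) * g (snd p))" for p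
      using mult_left_mono[OF k(2)[of p], of "norm (f (fst p) * g (snd p))"] by (simp add: norm_mult mult.commute)
    then show "AE p in lborel \<Otimes>\<^sub>M lborel. norm (case p of (x, y) \<Rightarrow> f x * g y * k (x, y))
        \<le> norm (C * norm (f (fst p) * g (snd p)))"
      by (intro AE_I2) (auto simp: split_beta intro: order_trans[OF _ abs_ge_self])
  qed
qed

text \<open>Inversion by Gaussian regularisation: inserting \<open>gaussian (\<epsilon> x)\<close> makes Fubini
  applicable, and the Gaussian is, up to a factor, its own Fourier transform.\<close>

theorem fourier_inversion:
  assumes f: "schwartz f"
  shows "fourier (fourier f) (- \<xi>) = of_real ((2 * pi) ^ 3) * f \<xi>"
proof -
  let ?F = "fourier f"
  let ?e = "\<lambda>n. 1 / real (Suc n)"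
  let ?c = "sqrt (2 * pi) ^ 3"
  let ?J = "\<lambda>n. LINT x|lborel. ?F x * iexp (x \<bullet> \<xi>) * of_real (gaussian (?e n *\<^sub>R x))"
  note [measurable] = schwartz_measurable[OF f] schwartz_measurable[OF schwartz_fourier[OF f]]
  have e0: "?e n > 0" for n by simp
  have e: "?e \<longlonglongrightarrow> 0" by (rule LIMSEQ_Suc[OF lim_1_over_n])
  obtain C where C: "C \<ge> 0" "\<And>x. norm (f x) \<le> C"
    using schwartz_decay[OF f, of 0] by auto
  have "?J \<longlonglongrightarrow> (LINT x|lborel. ?F x * iexp (x \<bullet> \<xi>) * of_real (gaussian (0 *\<^sub>R x)))"
  proof (rule integral_dominated_convergence[where w="\<lambda>x. norm (?F x)"])
    show "integrable lborel (\<lambda>x. norm (?F x))"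
      by (intro integrable_norm schwartz_integrable schwartz_fourier f)
    have "(\<lambda>n. gaussian (?e n *\<^sub>R x)) \<longlonglongrightarrow> gaussian (0 *\<^sub>R x)" for x
      unfolding gaussian_def using e by (intro tendsto_intros) auto
    then show "AE x in lborel. (\<lambda>n. ?F x * iexp (x \<bullet> \<xi>) * of_real (gaussian (?e n *\<^sub>R x)))
        \<longlonglongrightarrow> ?F x * iexp (x \<bullet> \<xi>) * of_real (gaussian (0 *\<^sub>R x))"
      by (intro AE_I2 tendsto_mult tendsto_const tendsto_of_real)
    show "AE x in lborel. norm (?F x * iexp (x \<bullet> \<xi>) * of_real (gaussian (?e n *\<^sub>R x))) \<le> norm (?F x)" for n
      using gaussian_bounds by (intro AE_I2) (auto simp: norm_mult mult_left_le)
  qed measurable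
  moreover have "(LINT x|lborel. ?F x * iexp (x \<bullet> \<xi>) * of_real (gaussian (0 *\<^sub>R x))) = fourier ?F (- \<xi>)"
    unfolding fourier_def[of ?F] by (intro Bochner_Integration.integral_cong) (auto simp: gaussian_def mult_ac)
  ultimately have lim1: "?J \<longlonglongrightarrow> fourier ?F (- \<xi>)" by simp
  have inner: "(LINT x|lborel. iexp (x \<bullet> w) * of_real (gaussian (s *\<^sub>R x)))
      = of_real ((1 / s) ^ 3 * (?c * gaussian ((1 / s) *\<^sub>R w)))" if "s > 0" for s w
  proof -
    have "(LINT x|lborel. iexp (x \<bullet> w) * of_real (gaussian (s *\<^sub>R x)))
        = (1 / s) ^ 3 *\<^sub>R (LINT x|lborel. iexp (x \<bullet> ((1 / s) *\<^sub>R w)) * of_real (gaussian x))"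
      using that by (subst integral_affine[of _ "1/s" 0]) auto
    then show ?thesis unfolding gaussian_char by (simp add: scaleR_conv_of_real)
  qed
  have J: "?J n = (LINT z|lborel. f (\<xi> - ?e n *\<^sub>R z) * of_real (?c * gaussian z))" for n
  proof -
    let ?k = "\<lambda>p. exp (- \<i> * complex_of_real (snd p \<bullet> fst p)) * iexp (fst p \<bullet> \<xi>)"
    have G: "integrable lborel (\<lambda>x. complex_of_real (gaussian (?e n *\<^sub>R x)))"
      using integrable_affine[OF integrable_gaussian, of "?e n" 0] e0[of n] by simp
    have "?J n = (LINT x|lborel. LINT y|lborel. of_real (gaussian (?e n *\<^sub>R x)) * f y * ?k (x, y))"
      unfolding fourier_def
      by (intro Bochner_Integration.integral_cong refl)
         (simp add: mult_ac flip: integral_mult_right_zero)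
    also have "\<dots> = (LINT y|lborel. LINT x|lborel. of_real (gaussian (?e n *\<^sub>R x)) * f y * ?k (x, y))"
      by (rule lborel_pair.Fubini_integral[symmetric], rule integrable_tensor[OF G schwartz_integrable[OF f], of _ 1])
        (auto simp: norm_mult intro!: borel_measurable_continuous_onI continuous_intros)
    also have "\<dots> = (LINT y|lborel. f y * (LINT x|lborel. iexp (x \<bullet> (\<xi> - y)) * of_real (gaussian (?e n *\<^sub>R x))))"
    proof (intro Bochner_Integration.integral_cong refl)
      fix y
      have "of_real (gaussian (?e n *\<^sub>R x)) * f y * ?k (x, y)
          = f y * (iexp (x \<bullet> (\<xi> - y)) * of_real (gaussian (?e n *\<^sub>R x)))" for x
      proof -
        have "?k (x, y) = iexp (x \<bullet> (\<xi> - y))"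
          unfolding exp_add[symmetric] by (rule arg_cong[where f=exp]) (simp add: inner_diff_right inner_commute algebra_simps)
        then show ?thesis by simp
      qed
      then show "(LINT x|lborel. of_real (gaussian (?e n *\<^sub>R x)) * f y * ?k (x, y))
          = f y * (LINT x|lborel. iexp (x \<bullet> (\<xi> - y)) * of_real (gaussian (?e n *\<^sub>R x)))"
        by (simp only: integral_mult_right_zero)
    qed
    also have "\<dots> = (LINT y|lborel. f y * of_real ((1 / ?e n) ^ 3 * (?c * gaussian ((1 / ?e n) *\<^sub>R (\<xi> - y)))))"
      by (simp only: inner[OF e0])
    also have "\<dots> = \<bar>- ?e n\<bar> ^ 3 *\<^sub>R (LINT z|lborel. f (\<xi> + (- ?e n) *\<^sub>R z) *
         of_real ((1 / ?e n) ^ 3 * (?c * gaussian ((1 / ?e n) *\<^sub>R (\<xi> - (\<xi> + (- ?e n) *\<^sub>R z))))))"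
      using e0[of n] by (subst integral_affine[of _ "- ?e n" \<xi>]) auto
    also have "\<dots> = (LINT z|lborel. f (\<xi> - ?e n *\<^sub>R z) * of_real (?c * gaussian z))"
    proof -
      have "\<bar>- s\<bar> ^ 3 *\<^sub>R (f (\<xi> + (- s) *\<^sub>R z) *
         of_real ((1 / s) ^ 3 * (?c * gaussian ((1 / s) *\<^sub>R (\<xi> - (\<xi> + (- s) *\<^sub>R z))))))
         = f (\<xi> - s *\<^sub>R z) * of_real (?c * gaussian z)" if "s > 0" for s z
      proof -
        have A: "(1 / s) *\<^sub>R (\<xi> - (\<xi> + (- s) *\<^sub>R z)) = z" using that by simp
        have B: "\<bar>- s\<bar> ^ 3 * (1 / s) ^ 3 = 1" using that by (simp add: power_divide)
        have C: "r *\<^sub>R (F * of_real (p * q)) = (r * p) *\<^sub>R (F * of_real q)" for r p q and F :: complex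
          by (simp add: scaleR_conv_of_real)
        show ?thesis unfolding A C[of _ _ "(1 / s) ^ 3"] B by simp
      qed
      from this[OF e0[of n]] show ?thesis by (simp only: flip: integral_scaleR_right)
    qed
    finally show ?thesis .
  qed
  have "(\<lambda>n. LINT z|lborel. f (\<xi> - ?e n *\<^sub>R z) * of_real (?c * gaussian z))
      \<longlonglongrightarrow> (LINT z|lborel. f (\<xi> - 0 *\<^sub>R z) * of_real (?c * gaussian z))"
  proof (rule integral_dominated_convergence[where w="\<lambda>z. C * (?c * gaussian z)"])
    show "integrable lborel (\<lambda>z. C * (?c * gaussian z))"
      by (intro integrable_mult_right integrable_gaussian)
    have "(\<lambda>n. f (\<xi> - ?e n *\<^sub>R z)) \<longlonglongrightarrow> f (\<xi> - 0 *\<^sub>R z)" for z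
      by (rule continuous_on_tendsto_compose[OF schwartz_continuous_on[OF f]])
        (rule tendsto_diff[OF tendsto_const tendsto_scaleR[OF e tendsto_const]], simp_all)
    then show "AE z in lborel. (\<lambda>n. f (\<xi> - ?e n *\<^sub>R z) * of_real (?c * gaussian z))
        \<longlonglongrightarrow> f (\<xi> - 0 *\<^sub>R z) * of_real (?c * gaussian z)"
      by (intro AE_I2 tendsto_mult tendsto_const)
    show "AE z in lborel. norm (f (\<xi> - ?e n *\<^sub>R z) * of_real (?c * gaussian z)) \<le> C * (?c * gaussian z)" for n
    proof (rule AE_I2)
      fix z
      have "0 \<le> ?c * gaussian z" using gaussian_bounds(1) by simp
      then show "norm (f (\<xi> - ?e n *\<^sub>R z) * of_real (?c * gaussian z)) \<le> C * (?c * gaussian z)"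
        unfolding norm_mult norm_of_real using C by (intro mult_mono) auto
    qed
  qed measurable
  moreover have "(LINT z|lborel. f (\<xi> - 0 *\<^sub>R z) * of_real (?c * gaussian z)) = of_real ((2 * pi) ^ 3) * f \<xi>"
  proof -
    have "(LINT z|lborel. f (\<xi> - 0 *\<^sub>R z) * of_real (?c * gaussian z)) = f \<xi> * (LINT z|lborel. of_real (?c * gaussian z))"
      by (simp only: scaleR_zero_left diff_zero integral_mult_right_zero)
    also have "(LINT z|lborel. complex_of_real (?c * gaussian z)) = of_real (?c * (LINT z|lborel. gaussian z))"
      by (simp only: integral_complex_of_real integral_mult_right_zero)
    also have "?c * (LINT z|lborel. gaussian z) = (2 * pi) ^ 3"
      unfolding integral_gaussian by (simp flip: power_mult_distrib)
    finally show ?thesis by simp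
  qed
  ultimately have "?J \<longlonglongrightarrow> of_real ((2 * pi) ^ 3) * f \<xi>" by (simp only: J)
  from LIMSEQ_unique[OF lim1 this] show ?thesis .
qed

section \<open>Uniqueness of the locally integrable Fourier transform\<close>

lemma pd_zero_on_open:
  assumes "open S" "\<And>x. x \<in> S \<Longrightarrow> f x = 0" "x \<in> S"
  shows "pd k f x = 0"
proof -
  have "((\<lambda>x. 0) has_derivative (\<lambda>_. 0)) (at x)" by simp
  then have "(f has_derivative (\<lambda>_. 0)) (at x)"
    by (rule has_derivative_transform_within_open[OF _ assms(1,3)]) (simp add: assms(2))
  then show ?thesis by (rule pd_eq)
qed

lemma iter_pd_zero_on_open:
  assumes "open S" "\<And>x. x \<in> S \<Longrightarrow> f x = 0"
  shows "x \<in> S \<Longrightarrow> iter_pd ks f x = 0"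
proof (induction ks arbitrary: x)
  case (Cons k ks)
  then show ?case using pd_zero_on_open[OF assms(1), of "iter_pd ks f"] by simp
qed (use assms in auto)

lemma test_function_schwartz:
  assumes "test_function f"
  shows "schwartz f"
  unfolding schwartz_def
proof (intro conjI allI)
  obtain K where K: "compact K" "\<And>x. x \<notin> K \<Longrightarrow> f x = 0" and sm: "smooth f"
    using assms unfolding test_function_def by blast
  show "smooth f" by fact
  fix m ks
  have cont: "continuous_on K (\<lambda>x. (1 + norm x) ^ m * norm (iter_pd ks f x))"
    by (intro continuous_intros continuous_on_subset[OF smooth_continuous_on[OF sm] subset_UNIV])
  obtain C where "\<forall>y\<in>(\<lambda>x. (1 + norm x) ^ m * norm (iter_pd ks f x)) ` K. norm y \<le> C"
    using compact_imp_bounded[OF compact_continuous_image[OF cont K(1)]] unfolding bounded_iff by blast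
  then have C: "(1 + norm x) ^ m * norm (iter_pd ks f x) \<le> C" if "x \<in> K" for x
    using that by auto
  have "(1 + norm x) ^ m * norm (iter_pd ks f x) \<le> max C 0" for x
  proof (cases "x \<in> K")
    case False
    then have "iter_pd ks f x = 0"
      using iter_pd_zero_on_open[of "- K" f x ks] K compact_imp_closed[OF K(1)] by auto
    then show ?thesis by simp
  qed (metis C max.coboundedI1)
  then show "\<exists>C. \<forall>x. (1 + norm x) ^ m * norm (iter_pd ks f x) \<le> C" by blast
qed

text \<open>A polynomial multiple of \<open>fourier f\<close> is the transform of a combination of derivatives of
  \<open>f\<close>, which vanishes wherever \<open>f\<close> vanishes locally.\<close>

lemma real_polynomial_mult_fourier:
  assumes "real_polynomial_function q"
  shows "schwartz f \<Longrightarrow> (\<And>x. x \<in> ball 0 e \<Longrightarrow> f x = 0) \<Longrightarrow>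
    \<exists>h. schwartz h \<and> (\<forall>x\<in>ball 0 e. h x = 0) \<and> (\<forall>\<xi>. of_real (q \<xi>) * fourier f \<xi> = fourier h \<xi>)"
  using assms
proof (induction q arbitrary: f rule: real_polynomial_function.induct)
  case (linear q)
  have q: "q \<xi> = (\<Sum>k\<in>UNIV. \<xi> $ k * q (axis k 1))" for \<xi>
  proof -
    have "q \<xi> = q (\<Sum>k\<in>UNIV. (\<xi> $ k) *\<^sub>R axis k 1)"
      by (simp add: basis_expansion flip: scalar_mult_eq_scaleR)
    also have "\<dots> = (\<Sum>k\<in>UNIV. \<xi> $ k * q (axis k 1))"
      using bounded_linear.linear[OF linear(1)] by (simp add: linear_sum linear_scale)
    finally show ?thesis .
  qed
  let ?a = "\<lambda>k. - \<i> * of_real (q (axis k 1))"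
  let ?h = "\<lambda>x. ?a 1 * pd 1 f x + 1 * (?a 2 * pd 2 f x + ?a 3 * pd 3 f x)"
  note s = schwartz_pd[OF linear(2)]
  have s23: "schwartz (\<lambda>x. ?a 2 * pd 2 f x + ?a 3 * pd 3 f x)"
    by (intro schwartz_lincomb s)
  have "schwartz ?h" by (intro schwartz_lincomb s)
  moreover have "\<forall>x\<in>ball 0 e. ?h x = 0"
  proof
    fix x :: "real^3" assume "x \<in> ball 0 e"
    then have "pd k f x = 0" for k
      by (rule pd_zero_on_open[OF open_ball, where f=f, rotated]) (rule linear(3))
    then show "?h x = 0" by simp
  qed
  moreover have "of_real (q \<xi>) * fourier f \<xi> = fourier ?h \<xi>" for \<xi>
  proof -
    have "fourier ?h \<xi> = ?a 1 * fourier (pd 1 f) \<xi> + 1 * (?a 2 * fourier (pd 2 f) \<xi> + ?a 3 * fourier (pd 3 f) \<xi>)"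
      by (simp only: fourier_lincomb[OF schwartz_integrable[OF s] schwartz_integrable[OF s23]]
        fourier_lincomb[OF schwartz_integrable[OF s] schwartz_integrable[OF s]])
    also have "\<dots> = of_real (q \<xi>) * fourier f \<xi>"
      unfolding fourier_pd[OF linear(2)] q[of \<xi>] sum_3 by (simp add: algebra_simps)
    finally show ?thesis by simp
  qed
  ultimately show ?case by blast
next
  case (const c)
  have "schwartz (\<lambda>x. of_real c * f x)" by (rule schwartz_scale[OF const(1)])
  then show ?case using const(2) fourier_scale[of "of_real c" f] by (intro exI[of _ "\<lambda>x. of_real c * f x"]) auto
next
  case (add p q)
  obtain h1 where h1: "schwartz h1" "\<forall>x\<in>ball 0 e. h1 x = 0" "\<And>\<xi>. of_real (p \<xi>) * fourier f \<xi> = fourier h1 \<xi>"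
    using add by metis
  obtain h2 where h2: "schwartz h2" "\<forall>x\<in>ball 0 e. h2 x = 0" "\<And>\<xi>. of_real (q \<xi>) * fourier f \<xi> = fourier h2 \<xi>"
    using add by metis
  let ?h = "\<lambda>x. 1 * h1 x + 1 * h2 x"
  have "schwartz ?h" by (intro schwartz_lincomb h1 h2)
  moreover have "of_real (p \<xi> + q \<xi>) * fourier f \<xi> = fourier ?h \<xi>" for \<xi>
    unfolding fourier_lincomb[OF schwartz_integrable[OF h1(1)] schwartz_integrable[OF h2(1)]]
    using h1(3)[of \<xi>] h2(3)[of \<xi>] by (simp add: algebra_simps)
  ultimately show ?case using h1(2) h2(2) by (intro exI[of _ ?h]) auto
next
  case (mult p q)
  obtain h1 where h1: "schwartz h1" "\<And>x. x\<in>ball 0 e \<Longrightarrow> h1 x = 0" "\<And>\<xi>. of_real (q \<xi>) * fourier f \<xi> = fourier h1 \<xi>"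
    using mult.IH(2)[OF mult.prems] by metis
  obtain h2 where h2: "schwartz h2" "\<forall>x\<in>ball 0 e. h2 x = 0" "\<And>\<xi>. of_real (p \<xi>) * fourier h1 \<xi> = fourier h2 \<xi>"
    using mult.IH(1)[OF h1(1,2)] by metis
  then show ?case using h1(3) by (intro exI[of _ h2]) (auto simp: mult.assoc)
qed

text \<open>This says that the Fourier transform of a polynomial is supported at the origin: absorbing the
  polynomial into the test function turns the integral into a value at \<open>0\<close> by inversion.\<close>

lemma integral_polynomial_fourier_eq_0:
  assumes p: "polynomial_function p" and f: "schwartz f" "e > 0" "\<And>x. x \<in> ball 0 e \<Longrightarrow> f x = 0"
  shows "(LINT x|lborel. p x * fourier f x) = 0"
proof -
  have re: "real_polynomial_function (\<lambda>x. Re (p x))" and im: "real_polynomial_function (\<lambda>x. Im (p x))"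
    using p bounded_linear_Re bounded_linear_Im unfolding polynomial_function_def o_def by auto
  obtain h1 where h1: "schwartz h1" "\<forall>x\<in>ball 0 e. h1 x = 0" "\<And>\<xi>. of_real (Re (p \<xi>)) * fourier f \<xi> = fourier h1 \<xi>"
    using real_polynomial_mult_fourier[OF re f(1,3)] by metis
  obtain h2 where h2: "schwartz h2" "\<forall>x\<in>ball 0 e. h2 x = 0" "\<And>\<xi>. of_real (Im (p \<xi>)) * fourier f \<xi> = fourier h2 \<xi>"
    using real_polynomial_mult_fourier[OF im f(1,3)] by metis
  let ?h = "\<lambda>x. 1 * h1 x + \<i> * h2 x"
  have h: "schwartz ?h" by (intro schwartz_lincomb h1 h2)
  have eq: "p x * fourier f x = fourier ?h x" for x
    unfolding fourier_lincomb[OF schwartz_integrable[OF h1(1)] schwartz_integrable[OF h2(1)]]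
      h1(3)[symmetric] h2(3)[symmetric]
    by (subst complex_eq[of "p x"]) (simp add: algebra_simps)
  have "(LINT x|lborel. p x * fourier f x) = fourier (fourier ?h) (- 0)"
    unfolding eq by (subst (2) fourier_def) simp
  also have "\<dots> = of_real ((2 * pi) ^ 3) * ?h 0" by (rule fourier_inversion[OF h])
  also have "?h 0 = 0" using h1(2) h2(2) f(2) by simp
  finally show ?thesis by simp
qed

lemma iter_pd_affine:
  assumes "smooth f"
  shows "iter_pd ks (\<lambda>y. f (c *\<^sub>R y + b)) = (\<lambda>y. of_real (c ^ length ks) * iter_pd ks f (c *\<^sub>R y + b))"
proof (induction ks)
  case (Cons k ks)
  let ?G = "iter_pd ks f"
  have "pd k (\<lambda>y. of_real (c ^ length ks) * ?G (c *\<^sub>R y + b)) y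
      = of_real (c ^ length ks) * (of_real c * pd k ?G (c *\<^sub>R y + b))" for y
  proof -
    let ?D = "frechet_derivative ?G (at (c *\<^sub>R y + b))"
    have D: "(?G has_derivative ?D) (at (c *\<^sub>R y + b))"
      using smooth_differentiable[OF assms] frechet_derivative_works by blast
    have "((\<lambda>y. ?G (c *\<^sub>R y + b)) has_derivative (\<lambda>d. ?D (c *\<^sub>R d))) (at y)"
      by (rule has_derivative_compose[where g="?G", of "\<lambda>y. c *\<^sub>R y + b" "\<lambda>d. c *\<^sub>R d", OF _ D])
        (auto intro!: derivative_eq_intros)
    then have "((\<lambda>y. of_real (c ^ length ks) * ?G (c *\<^sub>R y + b)) has_derivative
        (\<lambda>d. of_real (c ^ length ks) * ?D (c *\<^sub>R d))) (at y)"
      by (rule has_derivative_mult_right)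
    from pd_eq[OF this, of k] show ?thesis
      using linear_scale[OF has_derivative_linear[OF D], of c "axis k 1"]
      by (simp only: pd_def scaleR_conv_of_real[where 'a=complex])
  qed
  then show ?case using Cons by auto
qed simp

lemma smooth_affine:
  assumes "smooth f"
  shows "smooth (\<lambda>y. f (c *\<^sub>R y + b))"
  unfolding smooth_def iter_pd_affine[OF assms]
proof (intro allI differentiable_mult differentiable_const)
  fix ks and y :: "real^3"
  let ?G = "iter_pd ks f"
  have D: "(?G has_derivative frechet_derivative ?G (at (c *\<^sub>R y + b))) (at (c *\<^sub>R y + b))"
    using smooth_differentiable[OF assms] frechet_derivative_works by blast
  have "((\<lambda>y. ?G (c *\<^sub>R y + b)) has_derivative (\<lambda>d. frechet_derivative ?G (at (c *\<^sub>R y + b)) (c *\<^sub>R d))) (at y)"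
    by (rule has_derivative_compose[where g="?G", of "\<lambda>y. c *\<^sub>R y + b" "\<lambda>d. c *\<^sub>R d", OF _ D])
      (auto intro!: derivative_eq_intros)
  then show "(\<lambda>y. ?G (c *\<^sub>R y + b)) differentiable (at y)" by (rule differentiableI)
qed

context
  fixes \<psi> :: "real^3 \<Rightarrow> real"
  assumes lp: "littlewood_paley \<psi>"
begin

lemma lp_schwartz: "schwartz (\<lambda>\<xi>. complex_of_real (\<psi> \<xi>))"
  and lp_nonneg: "0 \<le> \<psi> \<xi>"
  and lp_support: "\<psi> \<xi> \<noteq> 0 \<Longrightarrow> 3/4 \<le> norm \<xi> \<and> norm \<xi> \<le> 8/3"
  and lp_has_sum: "\<xi> \<noteq> 0 \<Longrightarrow> ((\<lambda>j::int. \<psi> ((2 powi (- j)) *\<^sub>R \<xi>)) has_sum 1) UNIV"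
  using lp unfolding littlewood_paley_def by blast+

lemma lp_measurable [measurable]: "\<psi> \<in> borel_measurable borel"
proof -
  have "(\<lambda>\<xi>. Re (complex_of_real (\<psi> \<xi>))) \<in> borel_measurable borel"
    using schwartz_measurable[OF lp_schwartz] by measurable
  then show ?thesis by simp
qed

lemma lp_integrable: "integrable lborel \<psi>"
  using schwartz_integrable[OF lp_schwartz] by (simp add: complex_of_real_integrable_eq)

lemma lp_bounded: obtains C where "C > 0" "\<And>\<xi>. \<psi> \<xi> \<le> C"
proof -
  obtain C where "C \<ge> 0" "\<And>x. norm (complex_of_real (\<psi> x)) \<le> C / (1 + norm x) ^ 0"
    using schwartz_decay[OF lp_schwartz] by blast
  then have "0 < C + 1" "\<And>x. \<psi> x \<le> C + 1" by (auto simp: lp_nonneg) (smt (verit))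
  then show ?thesis using that by blast
qed

text \<open>On this annulus no other dyadic dilate of \<open>\<psi>\<close> is nonzero.\<close>

lemma lp_eq_1:
  assumes "4/3 < norm \<xi>" "norm \<xi> < 3/2"
  shows "\<psi> \<xi> = 1"
proof -
  have 0: "\<psi> ((2 powi (- j)) *\<^sub>R \<xi>) = 0" if "j \<noteq> 0" for j :: int
  proof (rule ccontr)
    assume "\<psi> ((2 powi (- j)) *\<^sub>R \<xi>) \<noteq> 0"
    from lp_support[OF this] have *: "3/4 \<le> 2 powi (- j) * norm \<xi>" "2 powi (- j) * norm \<xi> \<le> 8/3"
      by auto
    show False
    proof (cases "j > 0")
      case True
      then have "(2::real) powi (- j) \<le> 2 powi (- 1)" by (intro power_int_increasing) auto
      then have "2 powi (- j) * norm \<xi> \<le> (1/2) * norm \<xi>" by (intro mult_right_mono) auto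
      then show False using * assms by linarith
    next
      case False
      then have "(2::real) powi 1 \<le> 2 powi (- j)" using that by (intro power_int_increasing) auto
      then have "2 * norm \<xi> \<le> 2 powi (- j) * norm \<xi>" by (intro mult_right_mono) auto
      then show False using * assms by linarith
    qed
  qed
  have "((\<lambda>j::int. \<psi> ((2 powi (- j)) *\<^sub>R \<xi>)) has_sum 1) {0}"
    by (rule has_sum_cong_neutral[THEN iffD1, OF _ _ _ lp_has_sum]) (use 0 assms in auto)
  then show ?thesis by (simp add: has_sum_finite_iff)
qed

lemma lp_mass_pos: "0 < (LINT x|lborel. \<psi> x)"
proof -
  let ?c = "vector [1, 1, 0] :: real^3"
  have c: "norm ?c = sqrt 2" by (simp add: norm_vec_def L2_set_def sum_3)
  have "1 * measure lborel (ball ?c (1/20)) = (LINT x|lborel. indicator (ball ?c (1/20)) x)"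
    by simp
  also have "\<dots> \<le> (LINT x|lborel. \<psi> x)"
  proof (rule integral_mono[OF _ lp_integrable])
    show "indicator (ball ?c (1/20)) x \<le> \<psi> x" for x
    proof (cases "x \<in> ball ?c (1/20)")
      case True
      then have "norm (?c - x) < 1/20" by (simp add: dist_norm)
      moreover have "norm x \<le> norm ?c + norm (?c - x)" "norm ?c \<le> norm x + norm (?c - x)"
        by norm+
      moreover have "141/100 < sqrt (2::real)" by (rule real_less_rsqrt) (simp add: power2_eq_square)
      moreover have "sqrt (2::real) < 142/100" by (rule real_less_lsqrt) (simp_all add: power2_eq_square)
      ultimately have "\<psi> x = 1" unfolding c by (intro lp_eq_1) linarith+
      then show ?thesis by simp
    qed (simp add: lp_nonneg)
  qed (rule integrable_real_indicator, simp, rule emeasure_lborel_ball_finite)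
  finally have "measure lborel (ball ?c (1/20)) \<le> (LINT x|lborel. \<psi> x)" by simp
  moreover have "0 < measure lborel (ball ?c (1/20))" by (intro content_ball_pos) simp
  ultimately show ?thesis by linarith
qed

text \<open>Mollifying with dilates of \<open>\<psi>\<close>: the convolution of the indicator of \<open>Q\<close> with a small
  dilate is a superposition of test functions vanishing near the origin.\<close>

lemma test_functions_detect_sets:
  fixes d :: "real^3 \<Rightarrow> complex"
  assumes d: "locally_integrable d"
    and zero: "\<And>f. test_function f \<Longrightarrow> (\<exists>e>0. \<forall>x\<in>ball 0 e. f x = 0) \<Longrightarrow> (LINT x|lborel. d x * f x) = 0"
    and Q: "convex Q" "bounded Q" "0 \<notin> closure Q" "Q \<in> sets borel"
  shows "(LINT x|lborel. d x * indicator Q x) = 0"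
proof -
  obtain \<rho> where \<rho>: "\<rho> > 0" "ball 0 \<rho> \<inter> closure Q = {}"
    using Q(3) open_contains_ball[of "- closure Q"] by (auto simp: disjoint_eq_subset_Compl)
  obtain R where R: "R > 0" "\<And>x. x \<in> Q \<Longrightarrow> norm x \<le> R" using Q(2) by (meson bounded_pos)
  obtain C where C: "C > 0" "\<And>\<xi>. \<psi> \<xi> \<le> C" using lp_bounded by blast
  define e where "e = (\<lambda>n. min 1 (\<rho> / 8) * (1 / real (Suc n)))"
  have e0: "e n > 0" "e n \<le> 1" "e n \<le> \<rho> / 8" for n
  proof -
    have "0 < 1 / real (Suc n)" "1 / real (Suc n) \<le> 1" by (auto simp: field_simps)
    then have "e n \<le> min 1 (\<rho> / 8) * 1" unfolding e_def using \<rho>(1) by (intro mult_left_mono) auto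
    then show "e n \<le> 1" "e n \<le> \<rho> / 8" by auto
    show "e n > 0" unfolding e_def using \<rho>(1) by auto
  qed
  have elim: "e \<longlonglongrightarrow> 0" unfolding e_def
    using tendsto_mult_right[OF LIMSEQ_Suc[OF lim_1_over_n], of "min 1 (\<rho> / 8)"] by simp
  let ?B = "cball (0::real^3) (R + 3)"
  have dB: "integrable lborel (\<lambda>y. indicator ?B y *\<^sub>R d y)"
    using d unfolding locally_integrable_def set_integrable_def by auto
  note [measurable] = Q(4)
  have dBm [measurable]: "(\<lambda>y. indicator ?B y *\<^sub>R d y) \<in> borel_measurable borel"
    using dB by (simp add: integrable_iff_bounded)
  let ?d = "\<lambda>y. indicator ?B y *\<^sub>R d y"
  let ?\<phi> = "\<lambda>n y. LINT z|lborel. indicator Q (y - e n *\<^sub>R z) * \<psi> z"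
  let ?c = "LINT x|lborel. \<psi> x"
  have \<phi>lim: "(\<lambda>n. ?\<phi> n y) \<longlonglongrightarrow> indicator Q y * ?c" if y: "y \<notin> frontier Q" for y
  proof -
    have lim0: "(\<lambda>n. indicator Q (y - e n *\<^sub>R z) :: real) \<longlonglongrightarrow> indicator Q y" for z
    proof -
      have yz: "(\<lambda>n. y - e n *\<^sub>R z) \<longlonglongrightarrow> y"
        using tendsto_diff[OF tendsto_const tendsto_scaleR[OF elim tendsto_const], of y z] by simp
      have "y \<in> interior Q \<or> y \<in> - closure Q" using y by (auto simp: frontier_def)
      then show ?thesis
      proof
        assume "y \<in> interior Q"
        with yz have "\<forall>\<^sub>F n in sequentially. y - e n *\<^sub>R z \<in> interior Q"
          by (rule topological_tendstoD[OF _ open_interior])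
        then have "\<forall>\<^sub>F n in sequentially. indicator Q (y - e n *\<^sub>R z) = (indicator Q y :: real)"
          by (rule eventually_mono) (use \<open>y \<in> interior Q\<close> interior_subset in \<open>auto simp: indicator_def\<close>)
        then show ?thesis by (rule tendsto_eventually)
      next
        assume "y \<in> - closure Q"
        with yz have "\<forall>\<^sub>F n in sequentially. y - e n *\<^sub>R z \<in> - closure Q"
          by (intro topological_tendstoD) auto
        then have "\<forall>\<^sub>F n in sequentially. indicator Q (y - e n *\<^sub>R z) = (indicator Q y :: real)"
          by (rule eventually_mono) (use \<open>y \<in> - closure Q\<close> closure_subset in \<open>auto simp: indicator_def\<close>)
        then show ?thesis by (rule tendsto_eventually)
      qed
    qed
    have "(\<lambda>n. ?\<phi> n y) \<longlonglongrightarrow> (LINT z|lborel. indicator Q y * \<psi> z)"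
    proof (rule integral_dominated_convergence[where w=\<psi>])
      show "AE z in lborel. (\<lambda>n. indicator Q (y - e n *\<^sub>R z) * \<psi> z) \<longlonglongrightarrow> indicator Q y * \<psi> z"
        by (intro AE_I2 tendsto_mult lim0 tendsto_const)
      show "AE z in lborel. norm (indicator Q (y - e n *\<^sub>R z) * \<psi> z) \<le> \<psi> z" for n
        by (intro AE_I2) (auto simp: lp_nonneg indicator_def)
    qed (use lp_integrable in measurable)
    then show ?thesis by simp
  qed
  have \<phi>bd: "\<bar>?\<phi> n y\<bar> \<le> ?c" for n y
  proof -
    have "norm (?\<phi> n y) \<le> (LINT z|lborel. norm (indicator Q (y - e n *\<^sub>R z) * \<psi> z))"
      by (rule integral_norm_bound)
    also have "\<dots> \<le> ?c"
    proof (rule integral_mono[OF _ lp_integrable])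
      show "integrable lborel (\<lambda>z. norm (indicator Q (y - e n *\<^sub>R z) * \<psi> z))"
        by (rule Bochner_Integration.integrable_bound[OF lp_integrable])
          (auto simp: lp_nonneg indicator_def)
    qed (auto simp: lp_nonneg indicator_def)
    finally show ?thesis by simp
  qed
  have null: "AE y in lborel. y \<notin> frontier Q"
    using negligible_convex_frontier[OF Q(1)] unfolding negligible_iff_null_sets
    by (intro AE_not_in) (simp add: null_sets_completion_iff)
  have "(\<lambda>n. LINT y|lborel. ?d y * of_real (?\<phi> n y)) \<longlonglongrightarrow> (LINT y|lborel. ?d y * of_real (indicator Q y * ?c))"
  proof (rule integral_dominated_convergence[where w="\<lambda>y. norm (?d y) * ?c"])
    show "integrable lborel (\<lambda>y. norm (?d y) * ?c)" by (intro integrable_mult_left integrable_norm dB)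
    show "AE y in lborel. (\<lambda>n. ?d y * of_real (?\<phi> n y)) \<longlonglongrightarrow> ?d y * of_real (indicator Q y * ?c)"
      using null by (rule eventually_mono) (intro tendsto_mult tendsto_const tendsto_of_real \<phi>lim)
    show "AE y in lborel. norm (?d y * of_real (?\<phi> n y)) \<le> norm (?d y) * ?c" for n
      unfolding norm_mult norm_of_real by (intro AE_I2 mult_left_mono \<phi>bd norm_ge_zero)
  qed measurable
  moreover have "(LINT y|lborel. ?d y * of_real (?\<phi> n y)) = 0" for n
  proof -
    let ?k = "\<lambda>x y. of_real (\<psi> ((1 / e n) *\<^sub>R (y - x))) :: complex"
    have \<phi>eq: "complex_of_real (?\<phi> n y) = of_real ((1 / e n) ^ 3) * (LINT x|lborel. indicator Q x * ?k x y)" for y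
    proof -
      have "?\<phi> n y = (1 / e n) ^ 3 * (LINT x|lborel. indicator Q x * \<psi> ((1 / e n) *\<^sub>R (y - x)))"
      proof -
        define s where "s = e n"
        have s: "s > 0" using e0(1)[of n] by (simp add: s_def)
        have m: "(\<lambda>z. indicator Q (y - s *\<^sub>R z) * \<psi> z) \<in> borel_measurable borel" by measurable
        have 1: "y - s *\<^sub>R ((1 / s) *\<^sub>R y + (- 1 / s) *\<^sub>R x) = x" for x
          using s by (simp add: algebra_simps)
        have 2: "(1 / s) *\<^sub>R y + (- 1 / s) *\<^sub>R x = (1 / s) *\<^sub>R (y - x)" for x
          by (simp add: scaleR_diff_right)
        have "(LINT z|lborel. indicator Q (y - s *\<^sub>R z) * \<psi> z) = \<bar>- 1 / s\<bar> ^ DIM(real^3) *\<^sub>R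
            (LINT x|lborel. indicator Q x * \<psi> ((1 / s) *\<^sub>R (y - x)))"
          using integral_affine[OF m, of "- 1 / s" "(1 / s) *\<^sub>R y"] s unfolding 1 2 by simp
        then show ?thesis using s by (simp add: s_def)
      qed
      then have "complex_of_real (?\<phi> n y) = of_real ((1 / e n) ^ 3)
          * of_real (LINT x|lborel. indicator Q x * \<psi> ((1 / e n) *\<^sub>R (y - x)))"
        by (simp only: of_real_mult)
      also have "complex_of_real (LINT x|lborel. indicator Q x * \<psi> ((1 / e n) *\<^sub>R (y - x)))
          = (LINT x|lborel. of_real (indicator Q x * \<psi> ((1 / e n) *\<^sub>R (y - x))))"
        by (rule integral_complex_of_real[symmetric])
      also have "\<dots> = (LINT x|lborel. indicator Q x * ?k x y)"
        by (intro Bochner_Integration.integral_cong refl) (auto simp: indicator_def)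
      finally show ?thesis .
    qed
    have iQ: "integrable lborel (\<lambda>x. indicator Q x :: complex)"
    proof -
      have "emeasure lborel Q < \<infinity>" by (rule emeasure_bounded_finite[OF Q(2)])
      then have "integrable lborel (\<lambda>x. indicator Q x :: real)" using Q(4) by (intro integrable_real_indicator) auto
      then have "integrable lborel (\<lambda>x. complex_of_real (indicator Q x))" by (rule integrable_of_real)
      moreover have "complex_of_real (indicator Q x) = indicator Q x" for x by (simp add: indicator_def)
      ultimately show ?thesis by simp
    qed
    have "(LINT y|lborel. ?d y * of_real (?\<phi> n y))
        = of_real ((1 / e n) ^ 3) * (LINT y|lborel. LINT x|lborel. indicator Q x * ?d y * ?k x y)"
      unfolding \<phi>eq by (simp add: mult_ac flip: integral_mult_right_zero)
    also have "(LINT y|lborel. LINT x|lborel. indicator Q x * ?d y * ?k x y)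
        = (LINT x|lborel. LINT y|lborel. indicator Q x * ?d y * ?k x y)"
    proof (rule lborel_pair.Fubini_integral)
      have "integrable (lborel \<Otimes>\<^sub>M lborel) (\<lambda>(x, y). indicator Q x * ?d y * (case (x, y) of (x, y) \<Rightarrow> ?k x y))"
      proof (rule integrable_tensor[OF iQ dB, of _ C])
        have "(\<lambda>p::(real^3) \<times> (real^3). (1 / e n) *\<^sub>R (snd p - fst p)) \<in> borel_measurable borel"
          by (intro borel_measurable_continuous_onI continuous_intros)
        from measurable_compose[OF this lp_measurable]
        show "(\<lambda>p. case p of (x, y) \<Rightarrow> ?k x y) \<in> borel_measurable borel"
          unfolding split_beta by measurable
      qed (use C lp_nonneg in \<open>auto simp: split_beta\<close>)
      then show "integrable (lborel \<Otimes>\<^sub>M lborel) (\<lambda>(x, y). indicator Q x * ?d y * ?k x y)" by simp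
    qed
    also have "\<dots> = (LINT x::real^3|lborel. 0)"
    proof (intro Bochner_Integration.integral_cong refl)
      fix x
      show "(LINT y|lborel. indicator Q x * ?d y * ?k x y) = 0"
      proof (cases "x \<in> Q")
        case True
        let ?f = "\<lambda>y. complex_of_real (\<psi> ((1 / e n) *\<^sub>R y + (- (1 / e n) *\<^sub>R x)))"
        have supp: "norm (y - x) \<le> \<rho> / 3" "norm (y - x) \<le> 3" if "?f y \<noteq> 0" for y
        proof -
          have "\<psi> ((1 / e n) *\<^sub>R (y - x)) \<noteq> 0" using that by (simp add: scaleR_diff_right)
          from lp_support[OF this] have "\<bar>1 / e n\<bar> * norm (y - x) \<le> 8/3" unfolding norm_scaleR by blast
          then have "norm (y - x) \<le> 8/3 * e n" using e0(1)[of n] by (simp add: field_simps)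
          then show "norm (y - x) \<le> \<rho> / 3" "norm (y - x) \<le> 3" using e0(2,3)[of n] by linarith+
        qed
        have "x \<notin> ball 0 \<rho>" using \<rho>(2) subsetD[OF closure_subset True] by blast
        then have far: "norm x \<ge> \<rho>" by simp
        have "test_function ?f"
          unfolding test_function_def
        proof
          show "smooth ?f" by (rule smooth_affine[OF schwartz_smooth[OF lp_schwartz]])
          show "\<exists>K. compact K \<and> (\<forall>y. y \<notin> K \<longrightarrow> ?f y = 0)"
            using supp(2) by (intro exI[of _ "cball x 3"]) (auto simp: dist_norm norm_minus_commute)
        qed
        moreover have "\<exists>e>0. \<forall>y\<in>ball 0 e. ?f y = 0"
        proof (intro exI[of _ "\<rho> / 3"] conjI ballI)
          fix y :: "real^3" assume "y \<in> ball 0 (\<rho> / 3)"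
          then have "norm y < \<rho> / 3" by simp
          moreover have "norm x \<le> norm y + norm (y - x)" by norm
          ultimately have "\<not> norm (y - x) \<le> \<rho> / 3" using far \<rho>(1) by linarith
          then show "?f y = 0" using supp(1) by blast
        qed (use \<rho> in auto)
        ultimately have "(LINT y|lborel. d y * ?f y) = 0" by (rule zero)
        moreover have "indicator Q x * ?d y * ?k x y = d y * ?f y" for y
        proof (cases "?f y = 0")
          case False
          have "norm y \<le> norm x + norm (y - x)" by norm
          then have "y \<in> ?B" using supp(2)[OF False] R(2)[OF True] by simp
          then show ?thesis using True by (simp add: scaleR_diff_right)
        qed (simp add: scaleR_diff_right)
        ultimately show ?thesis by simp
      qed simp
    qed
    finally show ?thesis by simp
  qed
  ultimately have "(\<lambda>n. 0) \<longlonglongrightarrow> (LINT y|lborel. ?d y * of_real (indicator Q y * ?c))"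
    by (simp only:)
  from LIMSEQ_unique[OF tendsto_const this]
  have "(LINT y|lborel. ?d y * of_real (indicator Q y * ?c)) = 0" by (rule sym)
  moreover have "?d y * of_real (indicator Q y * ?c) = (d y * indicator Q y) * of_real ?c" for y
    using R(2)[of y] by (auto simp: indicator_def)
  ultimately have "(LINT y|lborel. d y * indicator Q y) * of_real ?c = 0"
    by (simp only: integral_mult_left_zero)
  then show ?thesis using lp_mass_pos by simp
qed

end

text \<open>The positive and the negative part define finite measures that agree on a generator of the
  Borel sets stable under intersection.\<close>

lemma AE_eq_0_if_box_integrals_0:
  fixes g :: "'a::euclidean_space \<Rightarrow> real"
  assumes g: "integrable lborel g" and box: "\<And>a b. (LINT x|lborel. g x * indicator (box a b) x) = 0"
  shows "AE x in lborel. g x = 0"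
proof -
  have [measurable]: "g \<in> borel_measurable borel" using g by (simp add: integrable_iff_bounded)
  have fin: "(\<integral>\<^sup>+x. ennreal (norm (g x)) \<partial>lborel) < \<infinity>" using g by (simp add: integrable_iff_bounded)
  let ?P = "density lborel (\<lambda>x. ennreal (g x))" and ?N = "density lborel (\<lambda>x. ennreal (- g x))"
  have em: "emeasure ?P (box a b) = emeasure ?N (box a b)" for a b
  proof -
    let ?h = "\<lambda>x. g x * indicator (box a b) x"
    have h: "integrable lborel ?h"
      using integrable_real_mult_indicator[OF _ g, of "box a b"] by simp
    have "(\<integral>\<^sup>+x. ennreal (?h x) \<partial>lborel) = (\<integral>\<^sup>+x. ennreal (- ?h x) \<partial>lborel)"
    proof -
      have uniq: "a = b" if "enn2real a = enn2real b" "a \<noteq> \<infinity>" "b \<noteq> \<infinity>" for a b :: ennreal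
      proof -
        have "a = ennreal (enn2real a)" using that(2) by (simp add: less_top)
        also have "\<dots> = b" unfolding that(1) using that(3) by (simp add: less_top)
        finally show ?thesis .
      qed
      show ?thesis
      proof (rule uniq)
        show "enn2real (\<integral>\<^sup>+x. ennreal (?h x) \<partial>lborel) = enn2real (\<integral>\<^sup>+x. ennreal (- ?h x) \<partial>lborel)"
          using real_lebesgue_integral_def[OF h] box[of a b] by linarith
        show "(\<integral>\<^sup>+x. ennreal (?h x) \<partial>lborel) \<noteq> \<infinity>" "(\<integral>\<^sup>+x. ennreal (- ?h x) \<partial>lborel) \<noteq> \<infinity>"
          using real_integrable_def[of lborel ?h] h by blast+
      qed
    qed
    moreover have "ennreal (g x) * indicator (box a b) x = ennreal (?h x)"
      "ennreal (- g x) * indicator (box a b) x = ennreal (- ?h x)" for x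
      by (auto simp: indicator_def)
    ultimately show ?thesis by (simp add: emeasure_density)
  qed
  have "?P = ?N"
  proof (rule measure_eqI_generator_eq)
    let ?E = "range (\<lambda>(a, b). box a b::'a set)"
    show "Int_stable ?E" by (auto simp: Int_stable_def box_Int_box)
    show "?E \<subseteq> Pow UNIV" "sets ?P = sigma_sets UNIV ?E" "sets ?N = sigma_sets UNIV ?E"
      by (simp_all add: borel_eq_box)
    let ?A = "\<lambda>n::nat. box (- (real n *\<^sub>R One)) (real n *\<^sub>R One) :: 'a set"
    show "range ?A \<subseteq> ?E" "(\<Union>i. ?A i) = UNIV" unfolding UN_box_eq_UNIV by auto
    show "emeasure ?P (?A i) \<noteq> \<infinity>" for i
    proof -
      have "emeasure ?P (?A i) \<le> (\<integral>\<^sup>+x. ennreal (norm (g x)) \<partial>lborel)"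
        by (subst emeasure_density) (auto intro!: nn_integral_mono simp: indicator_def ennreal_leI)
      then show ?thesis using fin by (auto simp: top_unique)
    qed
    show "emeasure ?P X = emeasure ?N X" if "X \<in> ?E" for X using that em by auto
  qed
  then have "AE x in lborel. ennreal (g x) = ennreal (- g x)"
    by (intro sigma_finite_measure.density_unique[OF sigma_finite_lborel]) auto
  then show ?thesis
  proof (rule eventually_mono)
    fix x assume "ennreal (g x) = ennreal (- g x)"
    then show "g x = 0" by (metis ennreal_eq_0_iff ennreal_neg linorder_le_cases neg_0_le_iff_le order_antisym neg_le_0_iff_le)
  qed
qed

text \<open>Test functions vanishing near the origin see everything except the origin, a null set; the
  complement of the origin is exhausted by countably many boxes.\<close>

lemma AE_eq_0_if_test_integrals_0:
  fixes d :: "real^3 \<Rightarrow> complex"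
  assumes lp: "littlewood_paley \<psi>" and d: "locally_integrable d"
    and zero: "\<And>f. test_function f \<Longrightarrow> (\<exists>e>0. \<forall>x\<in>ball 0 e. f x = 0) \<Longrightarrow> (LINT x|lborel. d x * f x) = 0"
  shows "AE x in lborel. d x = 0"
proof -
  have 1: "AE x in lborel. x \<in> cbox a b \<longrightarrow> d x = 0" if ab: "0 \<notin> cbox a b" for a b
  proof -
    let ?g = "\<lambda>x. d x * indicator (cbox a b) x"
    have g: "integrable lborel ?g"
      using d unfolding locally_integrable_def set_integrable_def
      by (auto simp: scaleR_conv_of_real mult.commute of_real_indicator)
    have b0: "(LINT x|lborel. ?g x * indicator (box u v) x) = 0" for u v
    proof -
      have "(LINT x|lborel. d x * indicator (cbox a b \<inter> box u v) x) = 0"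
      proof (rule test_functions_detect_sets[OF lp d zero])
        have "closure (cbox a b \<inter> box u v) \<subseteq> cbox a b" by (rule closure_minimal) auto
        then show "0 \<notin> closure (cbox a b \<inter> box u v)" using ab by auto
      qed (auto intro: convex_Int convex_box bounded_Int bounded_subset[OF bounded_cbox])
      then show ?thesis by (simp add: indicator_inter_arith mult.assoc)
    qed
    have "AE x in lborel. Re (?g x) = 0"
    proof (rule AE_eq_0_if_box_integrals_0)
      fix u v
      have "(LINT x|lborel. Re (?g x) * indicator (box u v) x) = (LINT x|lborel. Re (?g x * indicator (box u v) x))"
        by (intro Bochner_Integration.integral_cong) (auto simp: indicator_def)
      also have "\<dots> = Re (LINT x|lborel. ?g x * indicator (box u v) x)"
        using integrable_mult_indicator[OF _ g, of "box u v"]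
        by (intro integral_Re) (simp add: scaleR_conv_of_real mult.commute of_real_indicator)
      finally show "(LINT x|lborel. Re (?g x) * indicator (box u v) x) = 0" using b0 by simp
    qed (use g in \<open>rule integrable_Re\<close>)
    moreover have "AE x in lborel. Im (?g x) = 0"
    proof (rule AE_eq_0_if_box_integrals_0)
      fix u v
      have "(LINT x|lborel. Im (?g x) * indicator (box u v) x) = (LINT x|lborel. Im (?g x * indicator (box u v) x))"
        by (intro Bochner_Integration.integral_cong) (auto simp: indicator_def)
      also have "\<dots> = Im (LINT x|lborel. ?g x * indicator (box u v) x)"
        using integrable_mult_indicator[OF _ g, of "box u v"]
        by (intro integral_Im) (simp add: scaleR_conv_of_real mult.commute of_real_indicator)
      finally show "(LINT x|lborel. Im (?g x) * indicator (box u v) x) = 0" using b0 by simp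
    qed (use g in \<open>rule integrable_Im\<close>)
    ultimately show ?thesis by eventually_elim (auto simp: complex_eq_iff indicator_def)
  qed
  have "open (- {0::real^3})" by (simp add: open_Compl)
  from open_countable_Union_open_cbox[OF this]
  obtain D where D: "countable D" "D \<subseteq> Pow (- {0::real^3})" "\<And>X. X \<in> D \<Longrightarrow> \<exists>a b. X = cbox a b" "\<Union>D = - {0}"
    by metis
  have "AE x in lborel. \<forall>X\<in>D. x \<in> X \<longrightarrow> d x = 0"
    unfolding AE_ball_countable[OF D(1)]
  proof
    fix X assume "X \<in> D"
    then obtain a b where X: "X = cbox a b" "X \<subseteq> - {0}" using D(2,3) by blast
    then show "AE x in lborel. x \<in> X \<longrightarrow> d x = 0" using 1[of a b] by auto
  qed
  moreover have "AE x in lborel. x \<noteq> (0::real^3)" by (rule AE_lborel_singleton)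
  ultimately show ?thesis
  proof eventually_elim
    case (elim x)
    then have "x \<in> \<Union>D" unfolding D(4) by simp
    then show ?case using elim by auto
  qed
qed

lemma abs_sh_eq_iff: "tempered T \<Longrightarrow> tempered S \<Longrightarrow> abs_sh T = abs_sh S \<longleftrightarrow> eq_mod_poly T S"
  using Quotient_rel[OF Quotient_sh, of T S] eq_mod_poly_refl by blast

text \<open>Two representatives differ by a polynomial, whose transform is invisible to test functions
  vanishing near the origin. Hence the choice made in \<open>fhat\<close> is harmless.\<close>

theorem sh_has_fourier_unique:
  assumes lp: "littlewood_paley \<psi>" and "sh_has_fourier f g" "sh_has_fourier f h"
  shows "AE \<xi> in lborel. g \<xi> = h \<xi>"
proof -
  obtain T S where T: "represents T f" "has_fourier T g" and S: "represents S f" "has_fourier S h"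
    using assms unfolding sh_has_fourier_def by blast
  have "eq_mod_poly T S"
    using T(1) S(1) abs_sh_eq_iff unfolding represents_def by metis
  then obtain p where p: "polynomial_function p" "is_function (\<lambda>f. T f - S f) p"
    unfolding eq_mod_poly_def by blast
  have lg: "locally_integrable g" "locally_integrable h"
    using T(2) S(2) unfolding has_fourier_def by auto
  have "AE \<xi> in lborel. g \<xi> - h \<xi> = 0"
  proof (rule AE_eq_0_if_test_integrals_0[OF lp])
    show "locally_integrable (\<lambda>\<xi>. g \<xi> - h \<xi>)"
      using lg unfolding locally_integrable_def by (auto intro: set_integral_diff)
    fix f assume f: "test_function f" and "\<exists>e>0. \<forall>x\<in>ball 0 e. f x = 0"
    then obtain e where e: "e > 0" "\<And>x. x \<in> ball 0 e \<Longrightarrow> f x = 0" by blast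
    have sf: "schwartz f" by (rule test_function_schwartz[OF f])
    obtain K where K: "compact K" "\<And>x. x \<notin> K \<Longrightarrow> f x = 0" using f unfolding test_function_def by blast
    obtain C where C: "C \<ge> 0" "\<And>x. norm (f x) \<le> C" using schwartz_decay[OF sf, of 0] by auto
    have int: "integrable lborel (\<lambda>x. q x * f x)" if "locally_integrable q" for q
    proof -
      have q: "integrable lborel (\<lambda>x. indicator K x *\<^sub>R q x)"
        using that K(1) unfolding locally_integrable_def set_integrable_def by auto
      have "integrable lborel (\<lambda>x. (indicator K x *\<^sub>R q x) * f x)"
      proof (rule Bochner_Integration.integrable_bound[OF integrable_mult_right[OF integrable_norm[OF q], of C]])
        show "(\<lambda>x. indicat_real K x *\<^sub>R q x * f x) \<in> borel_measurable lborel"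
          using q schwartz_measurable[OF sf] by (intro borel_measurable_times) (auto simp: integrable_iff_bounded)
        show "AE x in lborel. norm (indicat_real K x *\<^sub>R q x * f x) \<le> norm (C * norm (indicat_real K x *\<^sub>R q x))"
          using C by (intro AE_I2) (auto simp: norm_mult mult.assoc mult.commute[of C] intro!: mult_left_mono)
      qed
      moreover have "(indicator K x *\<^sub>R q x) * f x = q x * f x" for x
        using K(2)[of x] by (auto simp: indicator_def)
      ultimately show ?thesis by simp
    qed
    have "(LINT x|lborel. (g x - h x) * f x) = (LINT x|lborel. g x * f x) - (LINT x|lborel. h x * f x)"
      using int[OF lg(1)] int[OF lg(2)] by (simp add: left_diff_distrib)
    also have "\<dots> = T (fourier f) - S (fourier f)"
      using T(2) S(2) f unfolding has_fourier_def by simp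
    also have "\<dots> = (LINT x|lborel. p x * fourier f x)"
      using p(2) schwartz_fourier[OF sf] unfolding is_function_def
      by (metis has_bochner_integral_integral_eq)
    also have "\<dots> = 0" by (rule integral_polynomial_fourier_eq_0[OF p(1) sf e])
    finally show "(LINT x|lborel. (g x - h x) * f x) = 0" .
  qed
  then show ?thesis by simp
qed

section \<open>Distributions with a given Fourier transform\<close>

definition Finv :: "(real^3 \<Rightarrow> complex) \<Rightarrow> real^3 \<Rightarrow> complex" where
  "Finv f x = fourier f (- x) / of_real ((2 * pi) ^ 3)"

text \<open>Growth up to first order at infinity is allowed, so that both integrable functions and
  \<open>\<xi>\<close> times integrable functions are covered.\<close>

definition admissible :: "(real^3 \<Rightarrow> complex) \<Rightarrow> bool" where
  "admissible g \<longleftrightarrow> g \<in> borel_measurable borel \<and>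
     (\<integral>\<^sup>+\<xi>. ennreal (norm (g \<xi>) / (1 + norm \<xi>)) \<partial>lborel) < \<infinity>"

definition dist_of :: "(real^3 \<Rightarrow> complex) \<Rightarrow> functional" where
  "dist_of g f = (LINT \<xi>|lborel. g \<xi> * Finv f \<xi>)"

definition sh_of :: "(real^3 \<Rightarrow> complex) \<Rightarrow> sh" where
  "sh_of g = abs_sh (dist_of g)"

lemma admissible_measurable: "admissible g \<Longrightarrow> g \<in> borel_measurable borel"
  by (simp add: admissible_def)

lemma admissible_bound:
  assumes "admissible h" "g \<in> borel_measurable borel" "AE \<xi> in lborel. norm (g \<xi>) \<le> norm (h \<xi>)"
  shows "admissible g"
proof -
  have "(\<integral>\<^sup>+\<xi>. ennreal (norm (g \<xi>) / (1 + norm \<xi>)) \<partial>lborel) \<le> (\<integral>\<^sup>+\<xi>. ennreal (norm (h \<xi>) / (1 + norm \<xi>)) \<partial>lborel)"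
    using assms(3) by (intro nn_integral_mono_AE) (auto elim!: eventually_mono intro!: ennreal_leI divide_right_mono)
  then show ?thesis using assms(1,2) unfolding admissible_def by auto
qed

lemma admissible_if_weighted:
  assumes "g \<in> borel_measurable borel" "(\<integral>\<^sup>+\<xi>. ennreal (norm (g \<xi>) / norm \<xi>) \<partial>lborel) < \<infinity>"
  shows "admissible g"
proof -
  have "(\<integral>\<^sup>+\<xi>. ennreal (norm (g \<xi>) / (1 + norm \<xi>)) \<partial>lborel) \<le> (\<integral>\<^sup>+\<xi>. ennreal (norm (g \<xi>) / norm \<xi>) \<partial>lborel)"
  proof (rule nn_integral_mono_AE)
    have "AE \<xi> in lborel. \<xi> \<noteq> (0::real^3)" by (rule AE_lborel_singleton)
    then show "AE \<xi> in lborel. ennreal (norm (g \<xi>) / (1 + norm \<xi>)) \<le> ennreal (norm (g \<xi>) / norm \<xi>)"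
      by eventually_elim (intro ennreal_leI divide_left_mono mult_pos_pos, auto simp: one_plus_norm_pos)
  qed
  then show ?thesis using assms unfolding admissible_def by auto
qed

lemma admissible_if_integrable:
  assumes "integrable lborel g"
  shows "admissible g"
proof -
  have "(\<integral>\<^sup>+\<xi>. ennreal (norm (g \<xi>) / (1 + norm \<xi>)) \<partial>lborel) \<le> (\<integral>\<^sup>+\<xi>. ennreal (norm (g \<xi>)) \<partial>lborel)"
    by (intro nn_integral_mono ennreal_leI) (simp add: divide_le_eq one_plus_norm_pos mult_left_le mult_left_mono distrib_left)
  then show ?thesis using assms by (auto simp: admissible_def integrable_iff_bounded)
qed

lemma admissible_diff:
  assumes "admissible g" "admissible h"
  shows "admissible (\<lambda>\<xi>. g \<xi> - h \<xi>)"
proof -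
  note [measurable] = assms[THEN admissible_measurable]
  have "(\<integral>\<^sup>+\<xi>. ennreal (norm (g \<xi> - h \<xi>) / (1 + norm \<xi>)) \<partial>lborel)
     \<le> (\<integral>\<^sup>+\<xi>. ennreal (norm (g \<xi>) / (1 + norm \<xi>)) + ennreal (norm (h \<xi>) / (1 + norm \<xi>)) \<partial>lborel)"
    by (intro nn_integral_mono)
      (auto simp flip: ennreal_plus add_divide_distrib intro!: ennreal_leI divide_right_mono norm_triangle_ineq4)
  also have "\<dots> = (\<integral>\<^sup>+\<xi>. ennreal (norm (g \<xi>) / (1 + norm \<xi>)) \<partial>lborel)
     + (\<integral>\<^sup>+\<xi>. ennreal (norm (h \<xi>) / (1 + norm \<xi>)) \<partial>lborel)"
    by (intro nn_integral_add) measurable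
  also have "\<dots> < \<infinity>" using assms by (simp add: admissible_def)
  finally show ?thesis unfolding admissible_def by simp
qed

lemma measurable_cnj [measurable]: "cnj \<in> borel_measurable borel"
  by (intro borel_measurable_continuous_onI continuous_intros)

definition inversion_const :: real where
  "inversion_const = 4 * weight_mass / (2 * pi) ^ 3"

text \<open>One integration by parts gains the factor \<open>1 + \<bar>\<xi>\<bar>\<close>.\<close>

lemma Finv_bound:
  assumes "schwartz f"
  shows "(1 + norm \<xi>) * norm (Finv f \<xi>) \<le> inversion_const * schwartz_seminorm 6 f"
proof -
  let ?S = "weight_mass * schwartz_seminorm 6 f"
  have 0: "norm (fourier f (- \<xi>)) \<le> ?S"
    using norm_fourier_le[OF schwartz_integrable[OF assms]] schwartz_L1_bound[OF assms, of "[]"]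
    by (auto intro: order_trans)
  have k: "\<bar>\<xi> $ k\<bar> * norm (fourier f (- \<xi>)) \<le> ?S" for k
  proof -
    have "\<bar>\<xi> $ k\<bar> * norm (fourier f (- \<xi>)) = norm (fourier (pd k f) (- \<xi>))"
      unfolding fourier_pd[OF assms] by (simp add: norm_mult)
    also have "\<dots> \<le> ?S"
      using norm_fourier_le[OF schwartz_integrable[OF schwartz_pd[OF assms]], of k "- \<xi>"]
        schwartz_L1_bound[OF assms, of "[k]"] by simp
    finally show ?thesis .
  qed
  have "norm \<xi> * norm (fourier f (- \<xi>)) \<le> (\<Sum>k\<in>UNIV. \<bar>\<xi> $ k\<bar>) * norm (fourier f (- \<xi>))"
    by (intro mult_right_mono norm_le_l1_cart) auto
  also have "\<dots> \<le> 3 * ?S"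
    using k[of 1] k[of 2] k[of 3] by (simp add: sum_3 distrib_right)
  finally have "(1 + norm \<xi>) * norm (fourier f (- \<xi>)) \<le> 4 * ?S"
    using 0 by (simp add: distrib_right)
  then have "(1 + norm \<xi>) * norm (fourier f (- \<xi>)) / (2 * pi) ^ 3 \<le> 4 * ?S / (2 * pi) ^ 3"
    by (intro divide_right_mono) auto
  then show ?thesis
    unfolding Finv_def inversion_const_def by (simp add: norm_divide norm_mult norm_power)
qed

lemma Finv_measurable:
  assumes "schwartz f"
  shows "Finv f \<in> borel_measurable borel"
proof -
  have "(\<lambda>x. fourier f (- x)) \<in> borel_measurable borel"
    by (rule measurable_compose[OF _ schwartz_measurable[OF schwartz_fourier[OF assms]]]) simp
  then show ?thesis unfolding Finv_def[abs_def] by measurable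
qed

lemma Finv_fourier: "schwartz f \<Longrightarrow> Finv (fourier f) \<xi> = f \<xi>"
  unfolding Finv_def by (simp add: fourier_inversion)

lemma nn_integral_dist_of_bound:
  assumes "schwartz f" "g \<in> borel_measurable borel"
  shows "(\<integral>\<^sup>+\<xi>. ennreal (norm (g \<xi> * Finv f \<xi>)) \<partial>lborel)
    \<le> ennreal (inversion_const * schwartz_seminorm 6 f) * (\<integral>\<^sup>+\<xi>. ennreal (norm (g \<xi>) / (1 + norm \<xi>)) \<partial>lborel)"
proof -
  let ?c = "inversion_const * schwartz_seminorm 6 f"
  note [measurable] = assms(2)
  have c: "0 \<le> ?c"
    unfolding inversion_const_def using weight_mass_nonneg schwartz_seminorm_nonneg[OF assms(1)] by simp
  have "(\<integral>\<^sup>+\<xi>. ennreal (norm (g \<xi> * Finv f \<xi>)) \<partial>lborel) \<le> (\<integral>\<^sup>+\<xi>. ennreal ?c * ennreal (norm (g \<xi>) / (1 + norm \<xi>)) \<partial>lborel)"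
  proof (intro nn_integral_mono)
    fix \<xi>
    have "norm (Finv f \<xi>) \<le> ?c / (1 + norm \<xi>)"
      using Finv_bound[OF assms(1), of \<xi>] by (simp add: pos_le_divide_eq one_plus_norm_pos mult.commute)
    then have "norm (g \<xi> * Finv f \<xi>) \<le> norm (g \<xi>) * (?c / (1 + norm \<xi>))"
      unfolding norm_mult by (intro mult_left_mono) auto
    then have "ennreal (norm (g \<xi> * Finv f \<xi>)) \<le> ennreal (?c * (norm (g \<xi>) / (1 + norm \<xi>)))"
      by (intro ennreal_leI) (simp add: mult.commute)
    then show "ennreal (norm (g \<xi> * Finv f \<xi>)) \<le> ennreal ?c * ennreal (norm (g \<xi>) / (1 + norm \<xi>))"
      by (simp only: ennreal_mult[OF c divide_nonneg_pos[OF norm_ge_zero one_plus_norm_pos]])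
  qed
  also have "\<dots> = ennreal ?c * (\<integral>\<^sup>+\<xi>. ennreal (norm (g \<xi>) / (1 + norm \<xi>)) \<partial>lborel)"
    by (rule nn_integral_cmult) measurable
  finally show ?thesis .
qed

lemma integrable_dist_of:
  assumes "admissible g" "schwartz f"
  shows "integrable lborel (\<lambda>\<xi>. g \<xi> * Finv f \<xi>)"
proof (rule integrableI_bounded)
  note [measurable] = admissible_measurable[OF assms(1)] Finv_measurable[OF assms(2)]
  show "(\<lambda>\<xi>. g \<xi> * Finv f \<xi>) \<in> borel_measurable lborel" by measurable
  show "(\<integral>\<^sup>+\<xi>. ennreal (norm (g \<xi> * Finv f \<xi>)) \<partial>lborel) < \<infinity>"
    using assms unfolding admissible_def
    by (intro le_less_trans[OF nn_integral_dist_of_bound]) (auto simp: ennreal_mult_less_top)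
qed

lemma tempered_cong:
  assumes "tempered T" "\<And>f. schwartz f \<Longrightarrow> S f = T f"
  shows "tempered S"
  using assms(1) schwartz_lincomb unfolding tempered_def by (simp add: assms(2))

text \<open>The loss of one power of \<open>1 + \<bar>\<xi>\<bar>\<close> in \<open>admissible\<close> is paid by \<open>Finv_bound\<close>.\<close>

lemma tempered_dist_of:
  assumes "admissible g"
  shows "tempered (dist_of g)"
  unfolding tempered_def
proof (intro conjI allI impI)
  fix f h a b assume f: "schwartz f" and h: "schwartz h"
  have "Finv (\<lambda>x. a * f x + b * h x) \<xi> = a * Finv f \<xi> + b * Finv h \<xi>" for \<xi>
    unfolding Finv_def fourier_lincomb[OF schwartz_integrable[OF f] schwartz_integrable[OF h]]
    by (simp add: add_divide_distrib)
  then have "dist_of g (\<lambda>x. a * f x + b * h x)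
      = (LINT \<xi>|lborel. a * (g \<xi> * Finv f \<xi>) + b * (g \<xi> * Finv h \<xi>))"
    unfolding dist_of_def by (simp add: algebra_simps)
  then show "dist_of g (\<lambda>x. a * f x + b * h x) = a * dist_of g f + b * dist_of g h"
    using integrable_dist_of[OF assms f] integrable_dist_of[OF assms h] by (simp add: dist_of_def)
next
  let ?I = "\<integral>\<^sup>+\<xi>. ennreal (norm (g \<xi>) / (1 + norm \<xi>)) \<partial>lborel"
  have I: "?I = ennreal (enn2real ?I)" using assms by (simp add: admissible_def)
  show "\<exists>C N. \<forall>f. schwartz f \<longrightarrow> norm (dist_of g f) \<le> C * schwartz_seminorm N f"
  proof (intro exI allI impI)
    fix f assume f: "schwartz f"
    have c: "0 \<le> inversion_const * schwartz_seminorm 6 f"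
      unfolding inversion_const_def using weight_mass_nonneg schwartz_seminorm_nonneg[OF f] by simp
    have "ennreal (norm (dist_of g f)) \<le> ennreal (inversion_const * schwartz_seminorm 6 f) * ?I"
      unfolding dist_of_def
      by (rule order_trans[OF ennreal_norm_integral_le nn_integral_dist_of_bound[OF f admissible_measurable[OF assms]]])
    also have "\<dots> = ennreal (inversion_const * schwartz_seminorm 6 f * enn2real ?I)"
      using c by (subst I) (simp add: ennreal_mult)
    finally have "norm (dist_of g f) \<le> inversion_const * schwartz_seminorm 6 f * enn2real ?I"
      using c by (subst (asm) ennreal_le_iff) (auto intro: mult_nonneg_nonneg)
    then show "norm (dist_of g f) \<le> (inversion_const * enn2real ?I) * schwartz_seminorm 6 f"
      by (simp add: mult_ac)
  qed
qed

lemma locally_integrable_if_admissible: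
  assumes "admissible g"
  shows "locally_integrable g"
  unfolding locally_integrable_def set_integrable_def
proof (intro allI impI)
  fix K :: "(real^3) set" assume K: "compact K"
  then obtain R where R: "\<And>x. x \<in> K \<Longrightarrow> norm x \<le> R" using compact_imp_bounded bounded_iff by metis
  note [measurable] = admissible_measurable[OF assms]
  have [measurable]: "K \<in> sets borel" using K by (simp add: borel_compact)
  show "integrable lborel (\<lambda>x. indicator K x *\<^sub>R g x)"
  proof (rule integrableI_bounded)
    have "(\<integral>\<^sup>+x. ennreal (norm (indicator K x *\<^sub>R g x)) \<partial>lborel)
       \<le> (\<integral>\<^sup>+x. ennreal (1 + \<bar>R\<bar>) * ennreal (norm (g x) / (1 + norm x)) \<partial>lborel)"
    proof (intro nn_integral_mono)
      fix x
      have "norm (indicator K x *\<^sub>R g x) \<le> (1 + \<bar>R\<bar>) * (norm (g x) / (1 + norm x))"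
      proof (cases "x \<in> K")
        case True
        then have "1 + norm x \<le> 1 + \<bar>R\<bar>" using R[of x] by linarith
        then have "(1 + norm x) * (norm (g x) / (1 + norm x)) \<le> (1 + \<bar>R\<bar>) * (norm (g x) / (1 + norm x))"
          by (intro mult_right_mono) auto
        then show ?thesis using True one_plus_norm_pos[of x] by simp
      qed auto
      then show "ennreal (norm (indicator K x *\<^sub>R g x)) \<le> ennreal (1 + \<bar>R\<bar>) * ennreal (norm (g x) / (1 + norm x))"
        by (subst ennreal_mult[symmetric]) (auto intro!: ennreal_leI)
    qed
    also have "\<dots> = ennreal (1 + \<bar>R\<bar>) * (\<integral>\<^sup>+x. ennreal (norm (g x) / (1 + norm x)) \<partial>lborel)"
      by (rule nn_integral_cmult) measurable
    also have "\<dots> < \<infinity>" using assms by (simp add: admissible_def ennreal_mult_less_top)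
    finally show "(\<integral>\<^sup>+x. ennreal (norm (indicator K x *\<^sub>R g x)) \<partial>lborel) < \<infinity>" .
  qed measurable
qed

text \<open>By inversion, pairing with \<open>Finv (fourier f)\<close> is pairing with \<open>f\<close>.\<close>

lemma has_fourier_dist_of:
  assumes "admissible g"
  shows "has_fourier (dist_of g) g"
  unfolding has_fourier_def
  using tempered_dist_of[OF assms] locally_integrable_if_admissible[OF assms]
  by (auto simp: dist_of_def Finv_fourier test_function_schwartz)

lemma dist_of_cong_AE:
  assumes "AE \<xi> in lborel. g \<xi> = h \<xi>" "g \<in> borel_measurable borel" "h \<in> borel_measurable borel" "schwartz f"
  shows "dist_of g f = dist_of h f"
  unfolding dist_of_def
  using assms Finv_measurable[OF assms(4)] by (intro integral_cong_AE) (auto elim!: eventually_mono)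

lemma admissible_cong_AE:
  assumes "AE \<xi> in lborel. g \<xi> = h \<xi>" "admissible g" "h \<in> borel_measurable borel"
  shows "admissible h"
  using assms(1) by (intro admissible_bound[OF assms(2,3)]) (auto elim!: eventually_mono)

lemma represents_sh_of:
  assumes "admissible g" "\<And>f. schwartz f \<Longrightarrow> T f = dist_of g f"
  shows "represents T (sh_of g)"
proof -
  have T: "tempered T" by (rule tempered_cong[OF tempered_dist_of[OF assms(1)] assms(2)])
  have "is_function (\<lambda>f. T f - dist_of g f) (\<lambda>x. 0)"
    unfolding is_function_def
    using tempered_cong[OF tempered_zero, of "\<lambda>f. T f - dist_of g f"]
    by (auto simp: assms(2))
  then have "eq_mod_poly T (dist_of g)"
    unfolding eq_mod_poly_def using T tempered_dist_of[OF assms(1)]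
    by (intro conjI exI[of _ "\<lambda>x. 0"]) auto
  then show ?thesis
    unfolding represents_def sh_of_def using T tempered_dist_of[OF assms(1)] by (simp add: abs_sh_eq_iff)
qed

lemma sh_has_fourier_sh_of: "admissible g \<Longrightarrow> sh_has_fourier (sh_of g) g"
  unfolding sh_has_fourier_def using represents_sh_of has_fourier_dist_of by blast

lemma locally_integrable_measurable:
  assumes "locally_integrable g"
  shows "g \<in> borel_measurable borel"
proof -
  have "(\<lambda>x. indicator (cball 0 (real n)) x *\<^sub>R g x) \<in> borel_measurable borel" for n :: nat
  proof -
    have "integrable lborel (\<lambda>x. indicator (cball 0 (real n)) x *\<^sub>R g x)"
      using assms[unfolded locally_integrable_def set_integrable_def, rule_format, OF compact_cball] .
    then show ?thesis by (simp add: integrable_iff_bounded)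
  qed
  moreover have "(\<lambda>n. indicator (cball 0 (real n)) x *\<^sub>R g x) \<longlonglongrightarrow> g x" for x
  proof (rule tendsto_eventually)
    have "\<forall>\<^sub>F n in sequentially. norm x \<le> real n"
      using eventually_ge_at_top[of "nat \<lceil>norm x\<rceil>"] by (rule eventually_mono) linarith
    then show "\<forall>\<^sub>F n in sequentially. indicator (cball 0 (real n)) x *\<^sub>R g x = g x"
      by (rule eventually_mono) auto
  qed
  ultimately show ?thesis by (rule borel_measurable_LIMSEQ_metric)
qed

lemma fhat_sh_of:
  assumes "littlewood_paley \<psi>" "admissible g"
  shows "AE \<xi> in lborel. fhat (sh_of g) \<xi> = g \<xi>" "fhat (sh_of g) \<in> borel_measurable borel"
proof -
  have "sh_has_fourier (sh_of g) (fhat (sh_of g))"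
    unfolding fhat_def by (rule someI[of "sh_has_fourier (sh_of g)"]) (rule sh_has_fourier_sh_of[OF assms(2)])
  then show "AE \<xi> in lborel. fhat (sh_of g) \<xi> = g \<xi>" "fhat (sh_of g) \<in> borel_measurable borel"
    using sh_has_fourier_unique[OF assms(1) _ sh_has_fourier_sh_of[OF assms(2)]] locally_integrable_measurable
    unfolding sh_has_fourier_def has_fourier_def by blast+
qed

lemma minus_sh_of:
  assumes "admissible g" "admissible h"
  shows "sh_of g - sh_of h = sh_of (\<lambda>\<xi>. g \<xi> - h \<xi>)"
proof -
  have "sh_of g - sh_of h = abs_sh (\<lambda>f. dist_of g f - dist_of h f)"
    unfolding sh_of_def
    by (rule minus_sh.abs_eq) (auto intro!: eq_mod_poly_refl tempered_dist_of assms)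
  moreover have "represents (\<lambda>f. dist_of g f - dist_of h f) (sh_of (\<lambda>\<xi>. g \<xi> - h \<xi>))"
  proof (rule represents_sh_of[OF admissible_diff[OF assms]])
    fix f assume "schwartz f"
    then show "dist_of g f - dist_of h f = dist_of (\<lambda>\<xi>. g \<xi> - h \<xi>) f"
      using integrable_dist_of[OF assms(1)] integrable_dist_of[OF assms(2)]
      by (simp add: dist_of_def left_diff_distrib)
  qed
  ultimately show ?thesis unfolding represents_def by simp
qed

text \<open>Hermitian symmetry of the transform makes the field real: for real \<open>f\<close> the integrand
  at \<open>- \<xi>\<close> is the conjugate of the integrand at \<open>\<xi>\<close>, so the integral equals its conjugate.\<close>

lemma real_valued_sh_of:
  assumes "admissible g" "AE \<xi> in lborel. g (- \<xi>) = cnj (g \<xi>)"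
  shows "real_valued (sh_of g)"
  unfolding real_valued_def
proof (intro exI conjI allI impI)
  show "represents (dist_of g) (sh_of g)" by (rule represents_sh_of[OF assms(1)]) simp
  fix f assume f: "schwartz f" "range f \<subseteq> \<real>"
  have f_cnj: "cnj (f x) = f x" for x using f(2) by (auto intro: Reals_cnj_iff[THEN iffD1])
  have F: "Finv f (- \<xi>) = cnj (Finv f \<xi>)" for \<xi>
  proof -
    have "cnj (fourier f (- \<xi>)) = (LINT x|lborel. cnj (exp (- \<i> * of_real (x \<bullet> - \<xi>)) * f x))"
      unfolding fourier_def by (simp only: Bochner_Integration.integral_cnj)
    also have "\<dots> = fourier f \<xi>"
      unfolding fourier_def by (intro Bochner_Integration.integral_cong refl) (simp add: exp_cnj f_cnj)
    finally show ?thesis by (simp add: Finv_def)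
  qed
  note [measurable] = admissible_measurable[OF assms(1)] Finv_measurable[OF f(1)]
  have "cnj (dist_of g f) = (LINT \<xi>|lborel. cnj (g \<xi> * Finv f \<xi>))"
    unfolding dist_of_def by (simp only: Bochner_Integration.integral_cnj)
  also have "\<dots> = (LINT \<xi>|lborel. g (0 - \<xi>) * Finv f (0 - \<xi>))"
  proof (rule integral_cong_AE)
    show "AE \<xi> in lborel. cnj (g \<xi> * Finv f \<xi>) = g (0 - \<xi>) * Finv f (0 - \<xi>)"
      using assms(2) by (rule eventually_mono) (simp add: F)
    have [measurable]: "(\<lambda>\<xi>. g (0 - \<xi>)) \<in> borel_measurable borel" "(\<lambda>\<xi>. Finv f (0 - \<xi>)) \<in> borel_measurable borel"
      by (rule measurable_compose[where N=borel]; measurable)+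
    show "(\<lambda>\<xi>. g (0 - \<xi>) * Finv f (0 - \<xi>)) \<in> borel_measurable lborel" by measurable
  qed measurable
  also have "\<dots> = dist_of g f"
    unfolding dist_of_def by (rule integral_reflect[of "\<lambda>\<xi>. g \<xi> * Finv f \<xi>" 0]) measurable
  finally show "dist_of g f \<in> \<real>" by (simp add: Reals_cnj_iff)
qed

text \<open>For an integrable transform the inverse Fourier integral converges, and Fubini moves it from the
  test function to \<open>g\<close>.\<close>

lemma is_function_dist_of:
  assumes g: "integrable lborel g"
  shows "is_function (dist_of g) (Finv g)"
  unfolding is_function_def
proof (intro conjI allI impI)
  show "tempered (dist_of g)" by (intro tempered_dist_of admissible_if_integrable g)
  fix f assume f: "schwartz f"
  let ?k = "\<lambda>p. exp (\<i> * complex_of_real (fst p \<bullet> snd p))"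
  have I: "integrable (lborel \<Otimes>\<^sub>M lborel) (\<lambda>(\<xi>, x). g \<xi> * f x * ?k (\<xi>, x))"
    by (rule integrable_tensor[OF g schwartz_integrable[OF f], of _ 1])
       (auto intro!: borel_measurable_continuous_onI continuous_intros)
  have eq1: "(LINT x|lborel. g \<xi> * f x * ?k (\<xi>, x)) = of_real ((2 * pi) ^ 3) * (g \<xi> * Finv f \<xi>)" for \<xi>
  proof -
    have "(LINT x|lborel. g \<xi> * f x * ?k (\<xi>, x)) = (LINT x|lborel. g \<xi> * (exp (- \<i> * of_real (x \<bullet> - \<xi>)) * f x))"
      by (intro Bochner_Integration.integral_cong refl) (simp add: inner_commute mult_ac)
    also have "\<dots> = g \<xi> * fourier f (- \<xi>)" unfolding fourier_def by (rule integral_mult_right_zero)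
    finally show ?thesis by (simp add: Finv_def)
  qed
  have eq2: "(LINT \<xi>|lborel. g \<xi> * f x * ?k (\<xi>, x)) = of_real ((2 * pi) ^ 3) * (Finv g x * f x)" for x
  proof -
    have "(LINT \<xi>|lborel. g \<xi> * f x * ?k (\<xi>, x)) = (LINT \<xi>|lborel. f x * (exp (- \<i> * of_real (\<xi> \<bullet> - x)) * g \<xi>))"
      by (intro Bochner_Integration.integral_cong refl) (simp add: inner_commute mult_ac)
    also have "\<dots> = f x * fourier g (- x)" unfolding fourier_def by (rule integral_mult_right_zero)
    finally show ?thesis by (simp add: Finv_def)
  qed
  have "integrable lborel (\<lambda>x. LINT \<xi>|lborel. g \<xi> * f x * ?k (\<xi>, x))"
    using lborel_pair.integrable_snd[OF I] by simp
  then have "integrable lborel (\<lambda>x. of_real (1 / (2 * pi) ^ 3) * (of_real ((2 * pi) ^ 3) * (Finv g x * f x)))"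
    unfolding eq2 by (rule integrable_mult_right)
  then have i: "integrable lborel (\<lambda>x. Finv g x * f x)"
    by (simp flip: mult.assoc)
  have "of_real ((2 * pi) ^ 3) * dist_of g f = (LINT \<xi>|lborel. LINT x|lborel. g \<xi> * f x * ?k (\<xi>, x))"
    unfolding eq1 dist_of_def by simp
  also have "\<dots> = (LINT x|lborel. LINT \<xi>|lborel. g \<xi> * f x * ?k (\<xi>, x))"
    using lborel_pair.Fubini_integral[OF I] by simp
  also have "\<dots> = of_real ((2 * pi) ^ 3) * (LINT x|lborel. Finv g x * f x)"
    unfolding eq2 by simp
  finally have "dist_of g f = (LINT x|lborel. Finv g x * f x)" by simp
  then show "has_bochner_integral lborel (\<lambda>x. Finv g x * f x) (dist_of g f)"
    using i by (simp add: has_bochner_integral_iff)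
qed

lemma dist_of_pd:
  assumes "schwartz f"
  shows "- dist_of g (pd k f) = dist_of (\<lambda>\<xi>. \<i> * of_real (\<xi> $ k) * g \<xi>) f"
  unfolding dist_of_def Finv_def fourier_pd[OF assms]
  by (subst integral_minus[symmetric], rule Bochner_Integration.integral_cong) (auto simp: mult_ac)

section \<open>Norms of Fourier-Besov type\<close>

lemma epowr_1: "epowr x 1 = x"
  by (cases x) (auto simp: epowr_def)

lemma epowr_mono: "0 < a \<Longrightarrow> x \<le> y \<Longrightarrow> epowr x a \<le> epowr y a"
  by (cases x; cases y) (auto simp: epowr_def powr_mono2 ennreal_leI top_unique)

lemma epowr_ennreal: "0 \<le> x \<Longrightarrow> epowr (ennreal x) a = ennreal (x powr a)"
  by (simp add: epowr_def)

lemma epowr_inverse: "0 < a \<Longrightarrow> epowr (epowr x a) (1 / a) = x"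
  by (cases x) (auto simp: epowr_def powr_powr)

lemma epowr_mult:
  assumes "0 < a" "0 < c"
  shows "epowr (ennreal c * x) a = ennreal (c powr a) * epowr x a"
  using assms by (cases x) (auto simp: epowr_def powr_mult ennreal_mult_top simp flip: ennreal_mult)

lemma infsum_ennreal_le:
  fixes f :: "'a \<Rightarrow> ennreal"
  assumes "\<And>F. finite F \<Longrightarrow> sum f F \<le> B"
  shows "infsum f UNIV \<le> B"
  by (subst nonneg_infsum_complete) (auto intro!: SUP_least assms)

lemma infsum_ennreal_ge: "(f j :: ennreal) \<le> infsum f UNIV"
proof -
  have "sum f {j} \<le> infsum f UNIV"
    using SUP_upper[of "{j}" "{F. finite F \<and> F \<subseteq> UNIV}" "sum f"] by (subst nonneg_infsum_complete) simp_all
  then show ?thesis by simp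
qed

text \<open>Up to constants this is the Fourier-Besov norm with regularity \<open>- 1\<close>, \<open>p = 1\<close> and summation
  index 1. It dominates all the norms considered here, and the time slices of the solution depend continuously on time
  even in this norm.\<close>

definition weighted_norm :: "(real^3 \<Rightarrow> complex) \<Rightarrow> ennreal" where
  "weighted_norm g = (\<integral>\<^sup>+\<xi>. ennreal (norm (g \<xi>) / norm \<xi>) \<partial>lborel)"

text \<open>The term with index \<open>j\<close> of the Fourier-Besov norm with regularity \<open>- 1\<close> and \<open>p = 1\<close>,
  as a functional of the Fourier transform.\<close>

definition dyadic_mass :: "(real^3 \<Rightarrow> real) \<Rightarrow> int \<Rightarrow> (real^3 \<Rightarrow> complex) \<Rightarrow> ennreal" where
  "dyadic_mass \<psi> j g = ennreal (2 powr (- real_of_int j)) *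
     (\<integral>\<^sup>+\<xi>. ennreal (\<psi> ((2 powi (- j)) *\<^sub>R \<xi>) * norm (g \<xi>)) \<partial>lborel)"

lemma Lp_norm_1: "Lp_norm 1 g = (\<integral>\<^sup>+x. ennreal (norm (g x)) \<partial>lborel)"
  by (simp add: Lp_norm_def epowr_1)

context
  fixes \<psi> :: "real^3 \<Rightarrow> real"
  assumes lp: "littlewood_paley \<psi>"
begin

lemma FB_norm_sh_of:
  assumes g: "admissible g"
  shows "FB_norm \<psi> (-1) 1 r (sh_of g) = (if r = \<infinity> then SUP j. dyadic_mass \<psi> j g
    else if r = 0 then FB_norm \<psi> (-1) 1 r (sh_of g)
    else epowr (\<Sum>\<^sub>\<infinity>j. epowr (dyadic_mass \<psi> j g) (enn2real r)) (1 / enn2real r))"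
proof -
  have L: "Lp_norm 1 (block_hat \<psi> j (sh_of g)) = (\<integral>\<^sup>+\<xi>. ennreal (\<psi> ((2 powi (- j)) *\<^sub>R \<xi>) * norm (g \<xi>)) \<partial>lborel)" for j
    unfolding Lp_norm_1
  proof (rule nn_integral_cong_AE)
    show "AE \<xi> in lborel. ennreal (norm (block_hat \<psi> j (sh_of g) \<xi>)) = ennreal (\<psi> ((2 powi (- j)) *\<^sub>R \<xi>) * norm (g \<xi>))"
      using fhat_sh_of(1)[OF lp g]
      by (rule eventually_mono) (simp add: block_hat_def norm_mult lp_nonneg[OF lp])
  qed
  have "ennreal (2 powr (real_of_int j * - 1 * enn2real r)) * epowr (Lp_norm 1 (block_hat \<psi> j (sh_of g))) (enn2real r)
      = epowr (dyadic_mass \<psi> j g) (enn2real r)" if "0 < enn2real r" for j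
    unfolding dyadic_mass_def L using that by (subst epowr_mult) (auto simp: powr_powr)
  moreover have "0 < enn2real r" if "r \<noteq> \<infinity>" "r \<noteq> 0"
    using that by (cases r) (auto simp: ennreal_eq_0_iff)
  ultimately show ?thesis
    unfolding FB_norm_def by (auto simp: dyadic_mass_def L)
qed

text \<open>On the support of the dilate with index \<open>j\<close> one has \<open>2 ^ (- j) \<le> (8/3) / \<bar>\<xi>\<bar>\<close>, and the
  dilates sum up to 1.\<close>

lemma sum_dyadic_mass_le:
  assumes [measurable]: "g \<in> borel_measurable borel" and "finite F"
  shows "(\<Sum>j\<in>F. dyadic_mass \<psi> j g) \<le> ennreal (8/3) * weighted_norm g"
proof -
  note [measurable] = lp_measurable[OF lp]
  have "(\<Sum>j\<in>F. dyadic_mass \<psi> j g) =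
     (\<Sum>j\<in>F. \<integral>\<^sup>+\<xi>. ennreal (2 powr (- real_of_int j)) * ennreal (\<psi> ((2 powi (- j)) *\<^sub>R \<xi>) * norm (g \<xi>)) \<partial>lborel)"
    unfolding dyadic_mass_def by (intro sum.cong refl nn_integral_cmult[symmetric]) measurable
  also have "\<dots> = (\<integral>\<^sup>+\<xi>. (\<Sum>j\<in>F. ennreal (2 powr (- real_of_int j)) * ennreal (\<psi> ((2 powi (- j)) *\<^sub>R \<xi>) * norm (g \<xi>))) \<partial>lborel)"
    by (intro nn_integral_sum[symmetric]) measurable
  also have "\<dots> \<le> (\<integral>\<^sup>+\<xi>. ennreal (8/3) * ennreal (norm (g \<xi>) / norm \<xi>) \<partial>lborel)"
  proof (rule nn_integral_mono_AE)
    have "AE \<xi> in lborel. \<xi> \<noteq> (0::real^3)" by (rule AE_lborel_singleton)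
    then show "AE \<xi> in lborel. (\<Sum>j\<in>F. ennreal (2 powr (- real_of_int j)) * ennreal (\<psi> ((2 powi (- j)) *\<^sub>R \<xi>) * norm (g \<xi>)))
      \<le> ennreal (8/3) * ennreal (norm (g \<xi>) / norm \<xi>)"
    proof eventually_elim
      case (elim \<xi>)
      let ?p = "\<lambda>j. \<psi> ((2 powi (- j)) *\<^sub>R \<xi>)"
      have 1: "2 powr (- real_of_int j) * ?p j \<le> (8/3) / norm \<xi> * ?p j" for j
      proof (cases "?p j = 0")
        case False
        from lp_support[OF lp this] have "2 powi (- j) * norm \<xi> \<le> 8/3" by simp
        then have "2 powi (- j) \<le> (8/3) / norm \<xi>" using elim by (simp add: field_simps)
        then show ?thesis
          using lp_nonneg[OF lp] by (intro mult_right_mono) (auto simp: powr_real_of_int' simp flip: of_int_minus)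
      qed simp
      have 2: "(\<Sum>j\<in>F. ?p j) \<le> 1"
        by (rule finite_sum_le_has_sum[OF lp_has_sum[OF lp elim] assms(2)]) (auto simp: lp_nonneg[OF lp])
      have "(\<Sum>j\<in>F. 2 powr (- real_of_int j) * (?p j * norm (g \<xi>))) \<le> (\<Sum>j\<in>F. ((8/3) / norm \<xi> * ?p j) * norm (g \<xi>))"
        unfolding mult.assoc[symmetric] by (intro sum_mono mult_right_mono 1) auto
      also have "\<dots> = (8/3) / norm \<xi> * norm (g \<xi>) * (\<Sum>j\<in>F. ?p j)"
        unfolding sum_distrib_left by (intro sum.cong) simp_all
      also have "\<dots> \<le> (8/3) / norm \<xi> * norm (g \<xi>) * 1" by (intro mult_left_mono 2) auto
      finally have 3: "(\<Sum>j\<in>F. 2 powr (- real_of_int j) * (?p j * norm (g \<xi>))) \<le> (8/3) * (norm (g \<xi>) / norm \<xi>)" by simp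
      have "(\<Sum>j\<in>F. ennreal (2 powr (- real_of_int j)) * ennreal (?p j * norm (g \<xi>)))
          = ennreal (\<Sum>j\<in>F. 2 powr (- real_of_int j) * (?p j * norm (g \<xi>)))"
        using lp_nonneg[OF lp] by (subst sum_ennreal[symmetric]) (auto simp: ennreal_mult)
      also have "\<dots> \<le> ennreal ((8/3) * (norm (g \<xi>) / norm \<xi>))" by (rule ennreal_leI[OF 3])
      also have "\<dots> = ennreal (8/3) * ennreal (norm (g \<xi>) / norm \<xi>)" by (rule ennreal_mult) auto
      finally show ?case .
    qed
  qed
  also have "\<dots> = ennreal (8/3) * weighted_norm g"
    unfolding weighted_norm_def by (rule nn_integral_cmult) measurable
  finally show ?thesis .
qed

text \<open>A square-summable norm is at most the corresponding summable one.\<close>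

lemma FB_norm_2_le:
  assumes g: "g \<in> borel_measurable borel" "weighted_norm g < \<infinity>"
  shows "FB_norm \<psi> (-1) 1 2 (sh_of g) \<le> ennreal (8/3) * weighted_norm g"
proof -
  have adm: "admissible g" using g unfolding weighted_norm_def by (rule admissible_if_weighted)
  let ?S = "ennreal (8/3) * weighted_norm g"
  have sq: "epowr x 2 = x\<^sup>2" for x :: ennreal
    by (cases x) (auto simp: epowr_def ennreal_power power2_eq_square ennreal_mult_top ennreal_mult)
  have "sum (\<lambda>j. epowr (dyadic_mass \<psi> j g) 2) F \<le> ?S\<^sup>2" if F: "finite F" for F
  proof -
    have "sum (\<lambda>j. epowr (dyadic_mass \<psi> j g) 2) F \<le> (\<Sum>j\<in>F. dyadic_mass \<psi> j g * (\<Sum>j\<in>F. dyadic_mass \<psi> j g))"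
      unfolding sq power2_eq_square using F
      by (intro sum_mono mult_left_mono member_le_sum[where f="\<lambda>j. dyadic_mass \<psi> j g"]) auto
    also have "\<dots> = (\<Sum>j\<in>F. dyadic_mass \<psi> j g)\<^sup>2" by (simp add: power2_eq_square sum_distrib_right)
    also have "\<dots> \<le> ?S\<^sup>2" by (intro power_mono sum_dyadic_mass_le g F) auto
    finally show ?thesis .
  qed
  then have "(\<Sum>\<^sub>\<infinity>j. epowr (dyadic_mass \<psi> j g) 2) \<le> epowr ?S 2"
    unfolding sq[of ?S] by (rule infsum_ennreal_le)
  then have "epowr (\<Sum>\<^sub>\<infinity>j. epowr (dyadic_mass \<psi> j g) 2) (1/2) \<le> epowr (epowr ?S 2) (1/2)"
    by (intro epowr_mono) auto
  then show ?thesis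
    using epowr_inverse[of 2 ?S] by (simp add: FB_norm_sh_of[OF adm])
qed

lemma sh_of_in_FB:
  assumes g: "g \<in> borel_measurable borel" "weighted_norm g < \<infinity>"
  shows "sh_of g \<in> FB \<psi> (-1) 1 2"
proof -
  have adm: "admissible g" using g unfolding weighted_norm_def by (rule admissible_if_weighted)
  have "FB_norm \<psi> (-1) 1 2 (sh_of g) < \<infinity>"
    using g(2) by (intro le_less_trans[OF FB_norm_2_le[OF g]]) (auto simp: ennreal_mult_less_top)
  then show ?thesis using sh_has_fourier_sh_of[OF adm] unfolding FB_def by blast
qed

lemma FB_norm_ge_dyadic_mass:
  assumes g: "admissible g" and r: "r \<noteq> 0"
  shows "dyadic_mass \<psi> j g \<le> FB_norm \<psi> (-1) 1 r (sh_of g)"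
proof (cases "r = \<infinity>")
  case True then show ?thesis by (auto simp: FB_norm_sh_of[OF g] intro: SUP_upper)
next
  case False
  then have "0 < enn2real r" using r by (cases r) (auto simp: ennreal_eq_0_iff)
  then have "dyadic_mass \<psi> j g = epowr (epowr (dyadic_mass \<psi> j g) (enn2real r)) (1 / enn2real r)"
    by (simp add: epowr_inverse)
  also have "\<dots> \<le> epowr (\<Sum>\<^sub>\<infinity>j. epowr (dyadic_mass \<psi> j g) (enn2real r)) (1 / enn2real r)"
    using \<open>0 < enn2real r\<close> infsum_ennreal_ge[of "\<lambda>j. epowr (dyadic_mass \<psi> j g) (enn2real r)" j]
    by (intro epowr_mono) auto
  finally show ?thesis using False r by (simp add: FB_norm_sh_of[OF g])
qed

text \<open>Interpolation between the supremum and the sum of the dyadic masses: a mass \<open>x \<le> e\<close> satisfies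
  \<open>x powr r \<le> e powr (r - 1) * x\<close>.\<close>

lemma FB_norm_le_interpolation:
  assumes g: "admissible g" and r: "1 < r" and e: "0 \<le> e" and B: "0 \<le> B"
    and sup: "\<And>j. dyadic_mass \<psi> j g \<le> ennreal e" and sum: "\<And>F. finite F \<Longrightarrow> (\<Sum>j\<in>F. dyadic_mass \<psi> j g) \<le> ennreal B"
  shows "FB_norm \<psi> (-1) 1 r (sh_of g)
    \<le> (if r = \<infinity> then ennreal e else ennreal ((e powr (enn2real r - 1) * B) powr (1 / enn2real r)))"
proof (cases "r = \<infinity>")
  case True then show ?thesis by (auto simp: FB_norm_sh_of[OF g] intro: SUP_least sup)
next
  case False
  then obtain q where q: "r = ennreal q" "q > 1" using r by (cases r) auto
  have "epowr x q \<le> ennreal (e powr (q - 1)) * x" if "x \<le> ennreal e" for x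
  proof -
    define y where "y = enn2real x"
    have "x < top" using that by (rule le_less_trans) simp
    then have y: "x = ennreal y" "0 \<le> y" "y \<le> e"
      using that e by (auto simp: y_def intro: enn2real_leI)
    have "y powr q = y powr (q - 1) * y"
      using y(2) q(2) by (cases "y = 0") (auto simp: powr_diff)
    also have "\<dots> \<le> e powr (q - 1) * y" using y q(2) by (intro mult_right_mono powr_mono2) auto
    finally show ?thesis using y by (simp add: epowr_ennreal ennreal_leI flip: ennreal_mult)
  qed
  then have "(\<Sum>j\<in>F. epowr (dyadic_mass \<psi> j g) q) \<le> (\<Sum>j\<in>F. ennreal (e powr (q - 1)) * dyadic_mass \<psi> j g)" for F
    using sup by (intro sum_mono) auto
  moreover have "(\<Sum>j\<in>F. ennreal (e powr (q - 1)) * dyadic_mass \<psi> j g) \<le> ennreal (e powr (q - 1) * B)" if "finite F" for F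
    using mult_left_mono[OF sum[OF that], of "ennreal (e powr (q - 1))"] B
    by (simp add: sum_distrib_left ennreal_mult)
  ultimately have "(\<Sum>\<^sub>\<infinity>j. epowr (dyadic_mass \<psi> j g) q) \<le> ennreal (e powr (q - 1) * B)"
    by (intro infsum_ennreal_le) (blast intro: order_trans)
  then have "epowr (\<Sum>\<^sub>\<infinity>j. epowr (dyadic_mass \<psi> j g) q) (1 / q) \<le> epowr (ennreal (e powr (q - 1) * B)) (1 / q)"
    using q(2) by (intro epowr_mono) auto
  then show ?thesis
    using q B by (auto simp: FB_norm_sh_of[OF g] epowr_ennreal)
qed

end

section \<open>The exponential of a linear map\<close>

text \<open>The flow is developed for real-linear maps on real vector spaces because complex conjugation,
  which has to be commuted with it, is linear only over the reals.\<close>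

definition flow :: "('a \<Rightarrow> 'a) \<Rightarrow> real \<Rightarrow> 'a \<Rightarrow> 'a::euclidean_space" where
  "flow L t v = (\<Sum>n. (t ^ n / fact n) *\<^sub>R (L ^^ n) v)"

context
  fixes L :: "'a::euclidean_space \<Rightarrow> 'a"
  assumes L: "linear L"
begin

lemma linear_funpow: "linear (L ^^ n)"
proof (induction n)
  case (Suc n)
  then show ?case using linear_compose[OF Suc L] by (simp add: o_def)
qed (simp add: linear_iff)

lemma summable_flow: "summable (\<lambda>n. norm ((t ^ n / fact n) *\<^sub>R (L ^^ n) v))"
proof -
  obtain K where K: "K > 0" "\<And>x. norm (L x) \<le> norm x * K"
    using bounded_linear.pos_bounded[OF linear_conv_bounded_linear[THEN iffD1, OF L]] by blast
  have n: "norm ((L ^^ n) v) \<le> K ^ n * norm v" for n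
  proof (induction n)
    case (Suc n)
    have "norm ((L ^^ Suc n) v) \<le> norm ((L ^^ n) v) * K" using K(2) by simp
    also have "\<dots> \<le> (K ^ n * norm v) * K" using K(1) Suc by (intro mult_right_mono) auto
    finally show ?case by (simp add: mult_ac)
  qed simp
  have "summable (\<lambda>n. inverse (fact n) * (\<bar>t\<bar> * K) ^ n * norm v)"
    using summable_exp[of "\<bar>t\<bar> * K"] by (rule summable_mult2)
  then show ?thesis
  proof (rule summable_comparison_test_ev[rotated])
    show "\<forall>\<^sub>F m in sequentially. norm (norm ((t ^ m / fact m) *\<^sub>R (L ^^ m) v)) \<le> inverse (fact m) * (\<bar>t\<bar> * K) ^ m * norm v"
    proof (intro always_eventually allI)
      fix m
      have "norm ((t ^ m / fact m) *\<^sub>R (L ^^ m) v) = \<bar>t\<bar> ^ m / fact m * norm ((L ^^ m) v)"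
        by (simp add: power_abs)
      also have "\<dots> \<le> \<bar>t\<bar> ^ m / fact m * (K ^ m * norm v)" by (intro mult_left_mono n) auto
      finally show "norm (norm ((t ^ m / fact m) *\<^sub>R (L ^^ m) v)) \<le> inverse (fact m) * (\<bar>t\<bar> * K) ^ m * norm v"
        by (simp add: power_mult_distrib divide_inverse mult_ac)
    qed
  qed
qed

lemma flow_sums: "(\<lambda>n. (t ^ n / fact n) *\<^sub>R (L ^^ n) v) sums flow L t v"
  unfolding flow_def using summable_norm_cancel[OF summable_flow] by (rule summable_sums)

lemma flow_0: "flow L 0 v = v"
proof -
  have "(\<lambda>n. (0 ^ n / fact n) *\<^sub>R (L ^^ n) v) sums (\<Sum>n\<in>{0}. (0 ^ n / fact n) *\<^sub>R (L ^^ n) v)"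
    by (rule sums_finite) auto
  then show ?thesis using sums_unique2[OF flow_sums[of 0 v]] by simp
qed

lemma L_flow_sums: "(\<lambda>n. (t ^ n / fact n) *\<^sub>R (L ^^ Suc n) v) sums L (flow L t v)"
  using bounded_linear.sums[OF linear_conv_bounded_linear[THEN iffD1, OF L] flow_sums[of t v]] L
  by (simp add: linear_scale)

lemma flow_commute: "L (flow L t v) = flow L t (L v)"
proof -
  have "(L ^^ n) (L v) = (L ^^ Suc n) v" for n by (simp add: funpow_swap1)
  from sums_unique2[OF L_flow_sums flow_sums[of t "L v", unfolded this]] show ?thesis .
qed

lemma linear_flow: "linear (flow L t)"
proof (rule linearI)
  fix x y and c :: real
  have "(\<lambda>n. (t ^ n / fact n) *\<^sub>R (L ^^ n) x + (t ^ n / fact n) *\<^sub>R (L ^^ n) y) sums (flow L t x + flow L t y)"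
    by (intro sums_add flow_sums)
  then show "flow L t (x + y) = flow L t x + flow L t y"
    using flow_sums[of t "x + y"] by (simp add: linear_add[OF linear_funpow] scaleR_add_right sums_unique2)
  have "(\<lambda>n. c *\<^sub>R ((t ^ n / fact n) *\<^sub>R (L ^^ n) x)) sums (c *\<^sub>R flow L t x)"
    by (intro sums_scaleR_right flow_sums)
  then show "flow L t (c *\<^sub>R x) = c *\<^sub>R flow L t x"
    using flow_sums[of t "c *\<^sub>R x"] by (simp add: linear_scale[OF linear_funpow] scaleR_left_commute mult.commute sums_unique2)
qed

text \<open>Each coordinate of the flow is a real power series, which is differentiated termwise.\<close>

lemma flow_has_vector_derivative:
  "((\<lambda>t. flow L t v) has_vector_derivative L (flow L t v)) (at t)"
  unfolding has_vector_derivative_def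
proof (subst has_derivative_componentwise_within, rule ballI)
  fix b :: 'a assume "b \<in> Basis"
  let ?c = "\<lambda>n. ((L ^^ n) v \<bullet> b) / fact n"
  have s: "(\<lambda>n. ?c n * t ^ n) sums (flow L t v \<bullet> b)" for t
    using bounded_linear.sums[OF bounded_linear_inner_left[of b] flow_sums[of t v]] by (simp add: mult_ac)
  have d: "(\<lambda>n. diffs ?c n * t ^ n) sums (L (flow L t v) \<bullet> b)"
  proof -
    have "diffs ?c n * t ^ n = ((t ^ n / fact n) *\<^sub>R (L ^^ Suc n) v) \<bullet> b" for n
      unfolding diffs_def by (simp add: field_simps del: of_nat_Suc)
    then show ?thesis
      using bounded_linear.sums[OF bounded_linear_inner_left[of b] L_flow_sums[of t v]] by (simp only:)
  qed
  have "((\<lambda>t. \<Sum>n. ?c n * t ^ n) has_field_derivative (\<Sum>n. diffs ?c n * t ^ n)) (at t)"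
    by (rule termdiffs_strong_converges_everywhere) (rule sums_summable[OF s])
  then have "((\<lambda>t. flow L t v \<bullet> b) has_field_derivative L (flow L t v) \<bullet> b) (at t)"
    using s d by (simp add: sums_iff)
  then show "((\<lambda>t. flow L t v \<bullet> b) has_derivative (\<lambda>x. x *\<^sub>R L (flow L t v) \<bullet> b)) (at t)"
    by (simp add: has_field_derivative_def mult.commute[of "_ \<bullet> b"] mult_commute_abs)
qed

text \<open>The function \<open>e^(2 c t) \<bar>flow L t v\<bar>\<^sup>2\<close> is nonincreasing.\<close>

lemma norm_flow_le:
  assumes coercive: "\<And>w. w \<bullet> L w \<le> - c * (norm w)\<^sup>2" and t: "0 \<le> t"
  shows "norm (flow L t v) \<le> exp (- c * t) * norm v"
proof -
  let ?p = "\<lambda>t. exp (2 * c * t) * (flow L t v \<bullet> flow L t v)"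
  have "?p t \<le> ?p 0"
  proof (rule DERIV_nonpos_imp_nonincreasing[OF t])
    fix s
    let ?w = "flow L s v"
    have "((\<lambda>t. flow L t v \<bullet> flow L t v) has_vector_derivative (?w \<bullet> L ?w + L ?w \<bullet> ?w)) (at s)"
      by (rule bounded_bilinear.has_vector_derivative[OF bounded_bilinear_inner flow_has_vector_derivative flow_has_vector_derivative])
    then have "((\<lambda>t. flow L t v \<bullet> flow L t v) has_real_derivative 2 * (?w \<bullet> L ?w)) (at s)"
      by (simp add: has_real_derivative_iff_has_vector_derivative inner_commute)
    then have "(?p has_real_derivative (exp (2 * c * s) * (2 * (?w \<bullet> L ?w)) + exp (2 * c * s) * (2 * c) * (?w \<bullet> ?w))) (at s)"
      by (auto intro!: derivative_eq_intros)
    moreover have "exp (2 * c * s) * (2 * (?w \<bullet> L ?w)) + exp (2 * c * s) * (2 * c) * (?w \<bullet> ?w)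
        = 2 * exp (2 * c * s) * (?w \<bullet> L ?w + c * (norm ?w)\<^sup>2)"
      by (simp add: algebra_simps power2_norm_eq_inner)
    moreover have "\<dots> \<le> 0" using coercive[of ?w] by (intro mult_nonneg_nonpos) auto
    ultimately show "\<exists>y. (?p has_real_derivative y) (at s) \<and> y \<le> 0" by auto
  qed
  then have "exp (2 * c * t) * (norm (flow L t v))\<^sup>2 \<le> (norm v)\<^sup>2"
    by (simp add: flow_0 power2_norm_eq_inner)
  then have "(exp (c * t) * norm (flow L t v))\<^sup>2 \<le> (norm v)\<^sup>2"
    by (simp add: power_mult_distrib flip: exp_double) (simp add: mult_ac)
  then have "exp (c * t) * norm (flow L t v) \<le> norm v" by (rule power2_le_imp_le) simp
  then have "exp (- c * t) * (exp (c * t) * norm (flow L t v)) \<le> exp (- c * t) * norm v" by (intro mult_left_mono) auto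
  then show ?thesis by (simp flip: mult.assoc exp_add)
qed

text \<open>Comparison with a scalar propagator by the mean value inequality along
  \<open>s \<mapsto> e^(-m s) flow (t - s) v\<close>.\<close>

lemma norm_flow_diff_le:
  assumes coercive: "\<And>w. w \<bullet> L w \<le> - c * (norm w)\<^sup>2" and t: "0 \<le> t" and cm: "c \<le> m"
  shows "norm (flow L t v - exp (- m * t) *\<^sub>R v) \<le> t * exp (- c * t) * norm (L v + m *\<^sub>R v)"
proof (cases "t = 0")
  case True then show ?thesis by (simp add: flow_0)
next
  case False
  then have t0: "0 < t" using t by simp
  let ?p = "\<lambda>s. exp (- m * s) *\<^sub>R flow L (t - s) v"
  have d: "(?p has_derivative (\<lambda>h. h *\<^sub>R (exp (- m * s) *\<^sub>R flow L (t - s) (- (L v + m *\<^sub>R v))))) (at s)" for s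
  proof -
    have 1: "((\<lambda>s. t - s) has_vector_derivative (-1)) (at s)"
      by (auto intro!: derivative_eq_intros)
    have "((\<lambda>s. flow L (t - s) v) has_vector_derivative (-1) *\<^sub>R L (flow L (t - s) v)) (at s)"
      using vector_diff_chain_at[OF 1, of "\<lambda>t. flow L t v"] flow_has_vector_derivative by (auto simp: o_def)
    moreover have "((\<lambda>s. exp (- m * s)) has_real_derivative (- m * exp (- m * s))) (at s)"
      by (auto intro!: derivative_eq_intros)
    ultimately have "(?p has_vector_derivative (exp (- m * s) *\<^sub>R ((-1) *\<^sub>R L (flow L (t - s) v)) + (- m * exp (- m * s)) *\<^sub>R flow L (t - s) v)) (at s)"
      by (intro has_vector_derivative_scaleR)
    moreover have "exp (- m * s) *\<^sub>R ((-1) *\<^sub>R L (flow L (t - s) v)) + (- m * exp (- m * s)) *\<^sub>R flow L (t - s) v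
        = exp (- m * s) *\<^sub>R flow L (t - s) (- (L v + m *\<^sub>R v))"
      using linear_flow[of "t - s"] unfolding flow_commute
      by (simp add: linear_neg linear_add linear_scale algebra_simps linear_diff)
    ultimately show ?thesis by (simp add: has_vector_derivative_def)
  qed
  have cont: "continuous_on {0..t} ?p"
    using d by (intro has_derivative_continuous_on[where f'="\<lambda>s h. h *\<^sub>R (exp (- m * s) *\<^sub>R flow L (t - s) (- (L v + m *\<^sub>R v)))"])
      (rule has_derivative_at_withinI)
  obtain s where s: "s \<in> {0<..<t}" "norm (?p t - ?p 0) \<le> norm ((t - 0) *\<^sub>R (exp (- m * s) *\<^sub>R flow L (t - s) (- (L v + m *\<^sub>R v))))"
    using mvt_general[OF t0 cont d] by auto
  have "norm (flow L t v - exp (- m * t) *\<^sub>R v) = norm (?p t - ?p 0)" by (simp add: flow_0 norm_minus_commute)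
  also have "\<dots> \<le> t * (exp (- m * s) * norm (flow L (t - s) (- (L v + m *\<^sub>R v))))" using s t by simp
  also have "\<dots> \<le> t * (exp (- m * s) * (exp (- c * (t - s)) * norm (- (L v + m *\<^sub>R v))))"
    using s t by (intro mult_left_mono norm_flow_le coercive) auto
  also have "\<dots> = t * (exp (- m * s - c * (t - s)) * norm (L v + m *\<^sub>R v))"
    unfolding norm_minus_cancel by (simp flip: mult.assoc exp_add)
  also have "\<dots> \<le> t * (exp (- c * t) * norm (L v + m *\<^sub>R v))"
  proof (intro mult_left_mono mult_right_mono)
    have "c * s \<le> m * s" using cm s(1) by (intro mult_right_mono) auto
    then show "exp (- m * s - c * (t - s)) \<le> exp (- c * t)" by (simp add: algebra_simps)
  qed (use t in auto)
  finally show ?thesis by (simp add: mult_ac)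
qed

end

lemma flow_intertwine:
  assumes L: "linear L" and L': "linear L'" and J: "linear J" "\<And>v. J (L v) = L' (J v)"
  shows "J (flow L t v) = flow L' t (J v)"
proof -
  have "J ((L ^^ n) v) = (L' ^^ n) (J v)" for n by (induction n) (auto simp: J(2))
  then have "(\<lambda>n. (t ^ n / fact n) *\<^sub>R (L' ^^ n) (J v)) sums J (flow L t v)"
    using bounded_linear.sums[OF linear_conv_bounded_linear[THEN iffD1, OF J(1)] flow_sums[OF L, of t v]]
    by (simp add: linear_scale[OF J(1)])
  then show ?thesis by (rule sums_unique2[OF _ flow_sums[OF L']])
qed

lemma linear_matrix_vector: "linear (\<lambda>v. (M :: complex^'n^'m) *v v)"
  by (rule linearI) (simp_all add: matrix_vector_right_distrib matrix_vector_mult_def vec_eq_iff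
     sum_distrib_left scaleR_sum_right sum.distrib distrib_left)

lemma mat_exp_mult_vector:
  fixes M :: "complex^'n^'n"
  shows "mat_exp (t *\<^sub>R M) *v v = flow (\<lambda>v. M *v v) t v"
proof -
  let ?P = "\<lambda>n. (((**) (t *\<^sub>R M) ^^ n) (mat 1)) :: complex^'n^'n"
  have P: "?P n *v v = t ^ n *\<^sub>R ((\<lambda>v. M *v v) ^^ n) v" for n v
  proof (induction n)
    case (Suc n)
    have "?P (Suc n) *v v = (t *\<^sub>R M) *v (?P n *v v)" by (simp add: matrix_vector_mul_assoc)
    also have "\<dots> = t *\<^sub>R (M *v (?P n *v v))"
      by (simp add: matrix_vector_mult_def vec_eq_iff scaleR_sum_right)
    finally show ?case unfolding Suc using linear_scale[OF linear_matrix_vector, of M] by simp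
  qed simp
  have lin: "linear (\<lambda>N. (t *\<^sub>R M) ** (N :: complex^'n^'n))"
    by (rule linearI) (simp_all add: matrix_matrix_mult_def vec_eq_iff sum.distrib distrib_left scaleR_sum_right)
  have "(\<lambda>n. (1 ^ n / fact n) *\<^sub>R ?P n) sums mat_exp (t *\<^sub>R M)"
    using flow_sums[OF lin, of 1 "mat 1"] by (simp add: mat_exp_def flow_def)
  moreover have "bounded_linear (\<lambda>N :: complex^'n^'n. N *v v)"
    by (rule linear_conv_bounded_linear[THEN iffD1], rule linearI)
       (simp_all add: matrix_vector_mult_def vec_eq_iff sum.distrib distrib_right scaleR_sum_right)
  ultimately have "(\<lambda>n. ((1 ^ n / fact n) *\<^sub>R ?P n) *v v) sums (mat_exp (t *\<^sub>R M) *v v)"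
    by (rule bounded_linear.sums[rotated])
  moreover have "((1 ^ n / fact n) *\<^sub>R ?P n) *v v = (t ^ n / fact n) *\<^sub>R ((\<lambda>v. M *v v) ^^ n) v" for n
  proof -
    have "((1 ^ n / fact n) *\<^sub>R ?P n) *v v = (1 / fact n) *\<^sub>R (?P n *v v)"
      by (simp add: matrix_vector_mult_def vec_eq_iff scaleR_sum_right)
    then show ?thesis unfolding P by simp
  qed
  ultimately have "(\<lambda>n. (t ^ n / fact n) *\<^sub>R ((\<lambda>v. M *v v) ^^ n) v) sums (mat_exp (t *\<^sub>R M) *v v)"
    by (simp only:)
  then show ?thesis by (rule sums_unique2[OF _ flow_sums[OF linear_matrix_vector]])
qed

section \<open>The linear propagator of the micropolar system\<close>

definition propagator :: "real \<Rightarrow> real^3 \<Rightarrow> complex^(3 + 3) \<Rightarrow> complex^(3 + 3)" where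
  "propagator t \<xi> = flow (\<lambda>v. (- A_symbol \<xi>) *v v) t"

lemma G_hat_eq: "G_hat t h \<xi> = propagator t \<xi> (h \<xi>)"
  unfolding G_hat_def propagator_def using mat_exp_mult_vector[of t "- A_symbol \<xi>" "h \<xi>"] by simp

lemma linear_propagator: "linear (propagator t \<xi>)"
  unfolding propagator_def by (rule linear_flow[OF linear_matrix_vector])

lemma propagator_0: "propagator 0 \<xi> v = v"
  unfolding propagator_def by (rule flow_0[OF linear_matrix_vector])

lemma sum_UNIV_plus: "(\<Sum>i\<in>(UNIV::('a::finite + 'b::finite) set). f i) = (\<Sum>k\<in>UNIV. f (Inl k)) + (\<Sum>k\<in>UNIV. f (Inr k))"
  unfolding UNIV_Plus_UNIV[symmetric] by (subst sum.Plus) (simp_all add: o_def)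

lemma vector_3_nth [simp]:
  "vector [x, y, z] $ (1::3) = x" "vector [x, y, z] $ (2::3) = y" "vector [x, y, z] $ (3::3) = z"
  by (simp_all add: vector_def)

lemma A_symbol_Inl:
  "(A_symbol \<xi> *v w) $ Inl k = of_real ((norm \<xi>)\<^sup>2) * w $ Inl k + (\<Sum>l\<in>UNIV. B_symbol \<xi> $ k $ l * w $ Inr l)"
  by (simp add: A_symbol_def matrix_vector_mult_def sum_UNIV_plus if_distrib[where f="\<lambda>x. x * _"] cong: if_cong)

lemma A_symbol_Inr:
  "(A_symbol \<xi> *v w) $ Inr k = (\<Sum>l\<in>UNIV. B_symbol \<xi> $ k $ l * w $ Inl l)
    + of_real ((norm \<xi>)\<^sup>2 + 2) * w $ Inr k + of_real (\<xi> $ k) * (\<Sum>l\<in>UNIV. of_real (\<xi> $ l) * w $ Inr l)"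
proof -
  have "(\<Sum>l\<in>UNIV. ((if k = l then of_real ((norm \<xi>)\<^sup>2 + 2) else 0) + of_real (\<xi> $ k * \<xi> $ l)) * w $ Inr l)
    = (\<Sum>l\<in>UNIV. (if k = l then of_real ((norm \<xi>)\<^sup>2 + 2) * w $ Inr l else 0)) + (\<Sum>l\<in>UNIV. of_real (\<xi> $ k) * (of_real (\<xi> $ l) * w $ Inr l))"
    unfolding sum.distrib[symmetric] by (intro sum.cong refl) (auto simp: distrib_right mult.assoc)
  then show ?thesis
    by (simp add: A_symbol_def matrix_vector_mult_def sum_UNIV_plus sum_distrib_left)
qed

lemma norm_vec3: "(norm (x::real^3))\<^sup>2 = (x $ 1)\<^sup>2 + (x $ 2)\<^sup>2 + (x $ 3)\<^sup>2"
  by (simp add: norm_vec_def L2_set_def sum_3)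

text \<open>Completing the square: the sum equals \<open>2 \<bar>a + (b \<times> x)/2\<bar>\<^sup>2 + (x \<cdot> b)\<^sup>2 / 2\<close>.\<close>

lemma cross_term_bound:
  fixes x1 x2 x3 a1 a2 a3 b1 b2 b3 :: real
  shows "0 \<le> (x1\<^sup>2 + x2\<^sup>2 + x3\<^sup>2) * (b1\<^sup>2 + b2\<^sup>2 + b3\<^sup>2) / 2 + 2 * (a1\<^sup>2 + a2\<^sup>2 + a3\<^sup>2)
    + 2 * (a1 * (x3 * b2 - x2 * b3) + a2 * (x1 * b3 - x3 * b1) + a3 * (x2 * b1 - x1 * b2))"
proof -
  have "(x1\<^sup>2 + x2\<^sup>2 + x3\<^sup>2) * (b1\<^sup>2 + b2\<^sup>2 + b3\<^sup>2) / 2 + 2 * (a1\<^sup>2 + a2\<^sup>2 + a3\<^sup>2)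
    + 2 * (a1 * (x3 * b2 - x2 * b3) + a2 * (x1 * b3 - x3 * b1) + a3 * (x2 * b1 - x1 * b2))
    = 2 * ((a1 + (x3 * b2 - x2 * b3) / 2)\<^sup>2 + (a2 + (x1 * b3 - x3 * b1) / 2)\<^sup>2 + (a3 + (x2 * b1 - x1 * b2) / 2)\<^sup>2)
      + (x1 * b1 + x2 * b2 + x3 * b3)\<^sup>2 / 2"
    by (simp add: field_simps power2_eq_square)
  also have "\<dots> \<ge> 0" by simp
  finally show ?thesis .
qed

text \<open>The coupling terms of first order and the damping term \<open>2 \<bar>\<omega>\<bar>\<^sup>2\<close> complete a square that costs half
  of the diffusion of the velocity; the compressible part only helps.\<close>

lemma A_symbol_coercive: "w \<bullet> ((- A_symbol \<xi>) *v w) \<le> - ((norm \<xi>)\<^sup>2 / 2) * (norm w)\<^sup>2"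
proof -
  define x1 x2 x3 where "x1 = \<xi> $ 1" and "x2 = \<xi> $ 2" and "x3 = \<xi> $ 3"
  note x = x1_def[symmetric] x2_def[symmetric] x3_def[symmetric]
  define u o' where "u = (\<lambda>k. w $ Inl k)" and "o' = (\<lambda>k. w $ Inr k)"
  note uo = fun_cong[OF u_def, symmetric] fun_cong[OF o'_def, symmetric]
  have neg: "(- A_symbol \<xi>) *v w = - (A_symbol \<xi> *v w)"
    by (simp add: matrix_vector_mult_def vec_eq_iff sum_negf)
  have W: "(norm w)\<^sup>2 = (\<Sum>k\<in>UNIV. (Re (u k))\<^sup>2 + (Im (u k))\<^sup>2) + (\<Sum>k\<in>UNIV. (Re (o' k))\<^sup>2 + (Im (o' k))\<^sup>2)"
    by (simp add: norm_vec_def L2_set_def sum_nonneg sum_UNIV_plus u_def o'_def cmod_power2)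
  have "w \<bullet> (A_symbol \<xi> *v w) - (norm \<xi>)\<^sup>2 / 2 * (norm w)\<^sup>2 =
     ((x1\<^sup>2 + x2\<^sup>2 + x3\<^sup>2) * ((- Im (u 1))\<^sup>2 + (- Im (u 2))\<^sup>2 + (- Im (u 3))\<^sup>2) / 2 + 2 * ((Re (o' 1))\<^sup>2 + (Re (o' 2))\<^sup>2 + (Re (o' 3))\<^sup>2)
    + 2 * (Re (o' 1) * (x3 * (- Im (u 2)) - x2 * (- Im (u 3))) + Re (o' 2) * (x1 * (- Im (u 3)) - x3 * (- Im (u 1))) + Re (o' 3) * (x2 * (- Im (u 1)) - x1 * (- Im (u 2)))))
    + ((x1\<^sup>2 + x2\<^sup>2 + x3\<^sup>2) * ((Re (u 1))\<^sup>2 + (Re (u 2))\<^sup>2 + (Re (u 3))\<^sup>2) / 2 + 2 * ((Im (o' 1))\<^sup>2 + (Im (o' 2))\<^sup>2 + (Im (o' 3))\<^sup>2)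
    + 2 * (Im (o' 1) * (x3 * Re (u 2) - x2 * Re (u 3)) + Im (o' 2) * (x1 * Re (u 3) - x3 * Re (u 1)) + Im (o' 3) * (x2 * Re (u 1) - x1 * Re (u 2))))
    + (x1\<^sup>2 + x2\<^sup>2 + x3\<^sup>2) / 2 * ((Re (o' 1))\<^sup>2 + (Re (o' 2))\<^sup>2 + (Re (o' 3))\<^sup>2 + (Im (o' 1))\<^sup>2 + (Im (o' 2))\<^sup>2 + (Im (o' 3))\<^sup>2)
    + (x1 * Re (o' 1) + x2 * Re (o' 2) + x3 * Re (o' 3))\<^sup>2 + (x1 * Im (o' 1) + x2 * Im (o' 2) + x3 * Im (o' 3))\<^sup>2"
    unfolding W unfolding inner_vec_def sum_UNIV_plus A_symbol_Inl A_symbol_Inr uo norm_vec3 x sum_3 B_symbol_def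
    by (simp add: inner_complex_def x) (simp add: field_simps power2_eq_square)
  also have "\<dots> \<ge> 0"
    by (rule add_nonneg_nonneg[OF add_nonneg_nonneg[OF add_nonneg_nonneg[OF add_nonneg_nonneg[OF
        cross_term_bound cross_term_bound]]]]) auto
  finally show ?thesis unfolding neg by simp
qed

lemma norm_propagator_le:
  "0 \<le> t \<Longrightarrow> norm (propagator t \<xi> v) \<le> exp (- t * (norm \<xi>)\<^sup>2 / 2) * norm v"
  unfolding propagator_def
  using norm_flow_le[OF linear_matrix_vector, of "- A_symbol \<xi>" "(norm \<xi>)\<^sup>2 / 2" t v] A_symbol_coercive[of _ \<xi>]
  by (simp add: mult.commute)

lemma propagator_continuous: "continuous_on UNIV (\<lambda>t. propagator t \<xi> v)"
  unfolding propagator_def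
  using flow_has_vector_derivative[OF linear_matrix_vector]
  by (intro continuous_at_imp_continuous_on ballI) (rule has_vector_derivative_continuous)

definition cnjv :: "complex^'n \<Rightarrow> complex^'n" where
  "cnjv v = (\<chi> i. cnj (v $ i))"

lemma cnjv_nth [simp]: "cnjv v $ i = cnj (v $ i)"
  by (simp add: cnjv_def)

lemma linear_cnjv: "linear cnjv"
  by (rule linearI) (simp_all add: vec_eq_iff)

lemma propagator_cnjv: "cnjv (propagator t \<xi> v) = propagator t (- \<xi>) (cnjv v)"
  unfolding propagator_def
proof (rule flow_intertwine[OF linear_matrix_vector linear_matrix_vector linear_cnjv])
  fix v
  have B: "cnj (B_symbol \<xi> $ k $ l) = B_symbol (- \<xi>) $ k $ l" for k l
    using exhaust_3[of k] exhaust_3[of l] by (auto simp: B_symbol_def)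
  show "cnjv (- A_symbol \<xi> *v v) = - A_symbol (- \<xi>) *v cnjv v"
  proof -
    have neg: "(- A_symbol \<xi>) *v v = - (A_symbol \<xi> *v v)" for \<xi> v
      by (simp add: matrix_vector_mult_def vec_eq_iff sum_negf)
    have "cnj ((A_symbol \<xi> *v v) $ i) = (A_symbol (- \<xi>) *v cnjv v) $ i" for i
      by (cases i) (simp_all add: A_symbol_Inl A_symbol_Inr B sum_negf)
    then show ?thesis unfolding neg by (simp add: vec_eq_iff)
  qed
qed

lemma A_symbol_continuous: "continuous_on UNIV (\<lambda>p. (- A_symbol (fst p)) *v snd p)"
proof -
  have B: "continuous_on UNIV (\<lambda>p::(real^3) \<times> (complex^(3 + 3)). B_symbol (fst p) $ k $ l)" for k l
    using exhaust_3[of k] exhaust_3[of l]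
    by (elim disjE) (simp_all add: B_symbol_def continuous_intros)
  have neg: "(- A_symbol \<xi>) *v v = - (A_symbol \<xi> *v v)" for \<xi> v
    by (simp add: matrix_vector_mult_def vec_eq_iff sum_negf)
  have "continuous_on UNIV (\<lambda>p. (A_symbol (fst p) *v snd p) $ i)" for i
    by (cases i) (auto simp: A_symbol_Inl A_symbol_Inr intro!: continuous_intros B)
  then have "continuous_on UNIV (\<lambda>p. \<chi> i. (A_symbol (fst p) *v snd p) $ i)"
    by (rule continuous_on_vec_lambda)
  then show ?thesis unfolding neg by (intro continuous_intros) simp
qed

lemma propagator_measurable [measurable (raw)]:
  assumes [measurable]: "f \<in> borel_measurable M" "g \<in> borel_measurable M" "h \<in> borel_measurable M"
  shows "(\<lambda>x. propagator (f x) (g x) (h x)) \<in> borel_measurable M"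
proof -
  have [measurable]: "(\<lambda>x. ((\<lambda>v. (- A_symbol (g x)) *v v) ^^ n) (h x)) \<in> borel_measurable M" for n
  proof (induction n)
    case (Suc n)
    have "(\<lambda>x. (\<lambda>p. (- A_symbol (fst p)) *v snd p) (g x, ((\<lambda>v. (- A_symbol (g x)) *v v) ^^ n) (h x))) \<in> borel_measurable M"
      by (rule measurable_compose[OF _ borel_measurable_continuous_onI[OF A_symbol_continuous]])
         (use Suc in measurable)
    then show ?case by simp
  qed simp
  have "(\<lambda>n. \<Sum>k<n. (f x ^ k / fact k) *\<^sub>R ((\<lambda>v. (- A_symbol (g x)) *v v) ^^ k) (h x)) \<longlonglongrightarrow> propagator (f x) (g x) (h x)" for x
    using flow_sums[OF linear_matrix_vector, of "f x" "- A_symbol (g x)" "h x"] unfolding propagator_def sums_def .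
  then show ?thesis by (rule borel_measurable_LIMSEQ_metric[rotated]) measurable
qed

section \<open>A scalar majorant for the Picard iteration\<close>

abbreviation spacetime :: "(real \<times> (real^3)) measure" where
  "spacetime \<equiv> lborel \<Otimes>\<^sub>M lborel"

text \<open>A common bound for the time kernel of the linear part combined with the derivative in the
  nonlinearity.\<close>

definition duhamel_kernel :: "real \<Rightarrow> real \<Rightarrow> real \<Rightarrow> real^3 \<Rightarrow> ennreal" where
  "duhamel_kernel K t \<tau> \<xi> = ennreal (K * norm \<xi> * exp (- (t - \<tau>) * (norm \<xi>)\<^sup>2 / 2)) * indicator {0..t} \<tau>"

definition majorant_product ::
  "real \<Rightarrow> (real \<times> (real^3) \<Rightarrow> ennreal) \<Rightarrow> (real \<times> (real^3) \<Rightarrow> ennreal) \<Rightarrow> real \<times> (real^3) \<Rightarrow> ennreal" where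
  "majorant_product K m n q = (\<integral>\<^sup>+p. duhamel_kernel K (fst q) (fst p) (snd q) *
     (m (fst p, snd q - snd p) * n p) \<partial>spacetime)"

text \<open>The square of the norm in \<open>L\<^sup>2\<close> in time with values in \<open>L\<^sup>1\<close>.\<close>

definition energy :: "(real \<times> (real^3) \<Rightarrow> ennreal) \<Rightarrow> ennreal" where
  "energy m = (\<integral>\<^sup>+t. (\<integral>\<^sup>+\<xi>. m (t, \<xi>) \<partial>lborel)\<^sup>2 \<partial>lborel)"

definition pairing :: "(real \<times> (real^3) \<Rightarrow> ennreal) \<Rightarrow> (real \<times> (real^3) \<Rightarrow> ennreal) \<Rightarrow> ennreal" where
  "pairing m n = (\<integral>\<^sup>+t. (\<integral>\<^sup>+\<xi>. m (t, \<xi>) \<partial>lborel) * (\<integral>\<^sup>+\<xi>. n (t, \<xi>) \<partial>lborel) \<partial>lborel)"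

definition space_conv :: "(real \<times> (real^3) \<Rightarrow> ennreal) \<Rightarrow> (real \<times> (real^3) \<Rightarrow> ennreal) \<Rightarrow> real \<times> (real^3) \<Rightarrow> ennreal" where
  "space_conv m n q = (\<integral>\<^sup>+\<eta>. m (fst q, snd q - \<eta>) * n (fst q, \<eta>) \<partial>lborel)"

lemma duhamel_kernel_measurable [measurable (raw)]:
  assumes [measurable]: "f \<in> borel_measurable M" "g \<in> borel_measurable M" "h \<in> borel_measurable M"
  shows "(\<lambda>x. duhamel_kernel K (f x) (g x) (h x)) \<in> borel_measurable M"
proof -
  have "(\<lambda>x. ennreal (K * norm (h x) * exp (- (f x - g x) * (norm (h x))\<^sup>2 / 2)) * (if 0 \<le> g x \<and> g x \<le> f x then 1 else 0)) \<in> borel_measurable M"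
    by measurable
  moreover have "indicator {0..f x} (g x) = (if 0 \<le> g x \<and> g x \<le> f x then 1 else 0 :: ennreal)" for x
    by (simp add: indicator_def)
  ultimately show ?thesis unfolding duhamel_kernel_def by simp
qed

lemma majorant_product_measurable:
  assumes [measurable]: "m \<in> borel_measurable spacetime" "n \<in> borel_measurable spacetime"
  shows "majorant_product K m n \<in> borel_measurable spacetime"
  unfolding majorant_product_def[abs_def] by measurable

lemma space_conv_measurable:
  assumes [measurable]: "m \<in> borel_measurable spacetime" "n \<in> borel_measurable spacetime"
  shows "space_conv m n \<in> borel_measurable spacetime"
  unfolding space_conv_def[abs_def] by measurable

lemma nn_integral_space_time:
  fixes f :: "real \<times> (real^3) \<Rightarrow> ennreal"
  assumes "f \<in> borel_measurable spacetime"
  shows "(\<integral>\<^sup>+p. f p \<partial>spacetime) = (\<integral>\<^sup>+t. \<integral>\<^sup>+\<xi>. f (t, \<xi>) \<partial>lborel \<partial>lborel)"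
  using lborel.nn_integral_fst[of f lborel] assms by simp

lemma nn_integral_space_conv_slice:
  assumes [measurable]: "m \<in> borel_measurable spacetime" "n \<in> borel_measurable spacetime"
  shows "(\<integral>\<^sup>+\<xi>. space_conv m n (t, \<xi>) \<partial>lborel) = (\<integral>\<^sup>+\<xi>. m (t, \<xi>) \<partial>lborel) * (\<integral>\<^sup>+\<xi>. n (t, \<xi>) \<partial>lborel)"
proof -
  have "(\<integral>\<^sup>+\<xi>. space_conv m n (t, \<xi>) \<partial>lborel) = (\<integral>\<^sup>+\<eta>. \<integral>\<^sup>+\<xi>. m (t, \<xi> - \<eta>) * n (t, \<eta>) \<partial>lborel \<partial>lborel)"
    unfolding space_conv_def fst_conv snd_conv by (rule lborel_pair.Fubini') measurable
  also have "\<dots> = (\<integral>\<^sup>+\<eta>. (\<integral>\<^sup>+\<xi>. m (t, \<xi>) \<partial>lborel) * n (t, \<eta>) \<partial>lborel)"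
  proof (rule nn_integral_cong)
    fix \<eta>
    have "(\<integral>\<^sup>+\<xi>. m (t, \<xi> - \<eta>) * n (t, \<eta>) \<partial>lborel) = (\<integral>\<^sup>+\<xi>. m (t, \<xi> - \<eta>) \<partial>lborel) * n (t, \<eta>)"
      by (rule nn_integral_multc) measurable
    also have "(\<integral>\<^sup>+\<xi>. m (t, \<xi> - \<eta>) \<partial>lborel) = (\<integral>\<^sup>+\<xi>. m (t, \<xi>) \<partial>lborel)"
      by (rule nn_integral_translate[of "\<lambda>\<xi>. m (t, \<xi>)"]) measurable
    finally show "(\<integral>\<^sup>+\<xi>. m (t, \<xi> - \<eta>) * n (t, \<eta>) \<partial>lborel) = (\<integral>\<^sup>+\<xi>. m (t, \<xi>) \<partial>lborel) * n (t, \<eta>)" .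
  qed
  also have "\<dots> = (\<integral>\<^sup>+\<xi>. m (t, \<xi>) \<partial>lborel) * (\<integral>\<^sup>+\<xi>. n (t, \<xi>) \<partial>lborel)"
    by (rule nn_integral_cmult) measurable
  finally show ?thesis .
qed

lemma nn_integral_space_conv:
  assumes "m \<in> borel_measurable spacetime" "n \<in> borel_measurable spacetime"
  shows "(\<integral>\<^sup>+p. space_conv m n p \<partial>spacetime) = pairing m n"
  using space_conv_measurable[OF assms] nn_integral_space_conv_slice[OF assms]
  by (simp add: nn_integral_space_time pairing_def)

lemma majorant_product_eq:
  assumes [measurable]: "m \<in> borel_measurable spacetime" "n \<in> borel_measurable spacetime"
  shows "majorant_product K m n q = (\<integral>\<^sup>+\<tau>. duhamel_kernel K (fst q) \<tau> (snd q) * space_conv m n (\<tau>, snd q) \<partial>lborel)"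
  unfolding majorant_product_def by (subst nn_integral_space_time) (simp_all add: space_conv_def nn_integral_cmult)

lemma pairing_square_le:
  assumes [measurable]: "m \<in> borel_measurable spacetime" "n \<in> borel_measurable spacetime"
  shows "(pairing m n)\<^sup>2 \<le> energy m * energy n"
  unfolding pairing_def energy_def by (rule Cauchy_Schwarz_nn_integral) measurable

text \<open>The substitution \<open>s = t \<bar>\<xi>\<bar>\<^sup>2\<close> removes \<open>\<xi>\<close>: this scale invariance is what makes the energy
  the right quantity.\<close>

lemma nn_integral_duhamel_kernel_square:
  assumes "0 \<le> K"
  shows "(\<integral>\<^sup>+t. (duhamel_kernel K t \<tau> \<xi>)\<^sup>2 \<partial>lborel) \<le> ennreal (K\<^sup>2)"
proof (cases "\<xi> = 0")
  case True then show ?thesis by (simp add: duhamel_kernel_def)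
next
  case False
  let ?a = "(norm \<xi>)\<^sup>2"
  let ?f = "\<lambda>t. K\<^sup>2 * ?a * exp (- (t - \<tau>) * ?a)"
  have a: "0 < ?a" using False by simp
  have "(\<integral>\<^sup>+t. (duhamel_kernel K t \<tau> \<xi>)\<^sup>2 \<partial>lborel) \<le> (\<integral>\<^sup>+t. ennreal (?f t) * indicator {\<tau>..} t \<partial>lborel)"
  proof (intro nn_integral_mono)
    fix t
    have "(K * norm \<xi> * exp (- (t - \<tau>) * ?a / 2))\<^sup>2 = ?f t"
      by (simp add: power_mult_distrib flip: exp_double)
    then show "(duhamel_kernel K t \<tau> \<xi>)\<^sup>2 \<le> ennreal (?f t) * indicator {\<tau>..} t"
      using assms by (auto simp: duhamel_kernel_def indicator_def ennreal_power)
  qed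
  also have "\<dots> = ennreal (0 - (- (K\<^sup>2) * exp (- (\<tau> - \<tau>) * ?a)))"
  proof (rule nn_integral_FTC_atLeast[where F="\<lambda>t. - (K\<^sup>2) * exp (- (t - \<tau>) * ?a)" and T=0])
    show "((\<lambda>t. - (K\<^sup>2) * exp (- (t - \<tau>) * ?a)) has_real_derivative ?f t) (at t)" for t
      by (auto intro!: derivative_eq_intros)
    have "filterlim (\<lambda>t. (t - \<tau>) * ?a) at_top at_top"
      by (intro filterlim_at_top_mult_tendsto_pos[OF tendsto_const a]
        filterlim_tendsto_add_at_top[OF tendsto_const filterlim_ident, of "- \<tau>", simplified])
    then have "((\<lambda>t. exp (- ((t - \<tau>) * ?a))) \<longlongrightarrow> 0) at_top"
      by (intro filterlim_compose[OF exp_at_bot] filterlim_compose[OF filterlim_uminus_at_bot_at_top])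
    from tendsto_mult_left[OF this, of "- (K\<^sup>2)"]
    show "((\<lambda>t. - (K\<^sup>2) * exp (- (t - \<tau>) * ?a)) \<longlongrightarrow> 0) at_top"
      by (simp only: minus_mult_left mult_zero_right)
  qed (use a in auto)
  finally show ?thesis by simp
qed

text \<open>The bilinear estimate: Cauchy-Schwarz with respect to the measure with density
  \<open>space_conv m n\<close>, and the time integral of the squared kernel does not depend on frequency.\<close>

lemma energy_majorant_product_le:
  assumes [measurable]: "m \<in> borel_measurable spacetime" "n \<in> borel_measurable spacetime" and K: "0 \<le> K"
  shows "energy (majorant_product K m n) \<le> ennreal (K\<^sup>2) * (pairing m n)\<^sup>2"
proof -
  let ?W = "space_conv m n"
  have [measurable]: "?W \<in> borel_measurable spacetime" by (rule space_conv_measurable[OF assms(1,2)])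
  let ?\<mu> = "density spacetime ?W"
  have W: "(\<integral>\<^sup>+q. 1 \<partial>?\<mu>) = pairing m n"
    by (subst nn_integral_density) (simp_all add: nn_integral_space_conv)
  have 1: "(\<integral>\<^sup>+\<xi>. majorant_product K m n (t, \<xi>) \<partial>lborel) = (\<integral>\<^sup>+q. duhamel_kernel K t (fst q) (snd q) * 1 \<partial>?\<mu>)" for t
  proof -
    have "(\<integral>\<^sup>+\<xi>. majorant_product K m n (t, \<xi>) \<partial>lborel)
        = (\<integral>\<^sup>+\<xi>. \<integral>\<^sup>+\<tau>. duhamel_kernel K t \<tau> \<xi> * ?W (\<tau>, \<xi>) \<partial>lborel \<partial>lborel)"
      by (simp add: majorant_product_eq)
    also have "\<dots> = (\<integral>\<^sup>+\<tau>. \<integral>\<^sup>+\<xi>. duhamel_kernel K t \<tau> \<xi> * ?W (\<tau>, \<xi>) \<partial>lborel \<partial>lborel)"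
      by (rule lborel_pair.Fubini') measurable
    also have "\<dots> = (\<integral>\<^sup>+q. duhamel_kernel K t (fst q) (snd q) * ?W q \<partial>spacetime)"
      by (subst nn_integral_space_time) simp_all
    also have "\<dots> = (\<integral>\<^sup>+q. duhamel_kernel K t (fst q) (snd q) * 1 \<partial>?\<mu>)"
      by (subst nn_integral_density) (simp_all add: mult.commute)
    finally show ?thesis .
  qed
  have "energy (majorant_product K m n)
      \<le> (\<integral>\<^sup>+t. (\<integral>\<^sup>+q. (duhamel_kernel K t (fst q) (snd q))\<^sup>2 \<partial>?\<mu>) * (\<integral>\<^sup>+q. 1\<^sup>2 \<partial>?\<mu>) \<partial>lborel)"
    unfolding energy_def 1 by (intro nn_integral_mono Cauchy_Schwarz_nn_integral) simp_all
  also have "\<dots> = (\<integral>\<^sup>+t. (\<integral>\<^sup>+q. ?W q * (duhamel_kernel K t (fst q) (snd q))\<^sup>2 \<partial>spacetime) \<partial>lborel) * pairing m n"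
    using W by (subst nn_integral_density) (simp_all add: nn_integral_multc)
  also have "(\<integral>\<^sup>+t. (\<integral>\<^sup>+q. ?W q * (duhamel_kernel K t (fst q) (snd q))\<^sup>2 \<partial>spacetime) \<partial>lborel)
      = (\<integral>\<^sup>+q. (\<integral>\<^sup>+t. ?W q * (duhamel_kernel K t (fst q) (snd q))\<^sup>2 \<partial>lborel) \<partial>spacetime)"
  proof -
    interpret pair_sigma_finite "lborel \<Otimes>\<^sub>M lborel :: (real \<times> (real^3)) measure" "lborel :: real measure"
      by (intro pair_sigma_finite.intro) (simp_all add: lborel_prod sigma_finite_lborel)
    show ?thesis by (rule Fubini') measurable
  qed
  also have "\<dots> \<le> (\<integral>\<^sup>+q. ?W q * ennreal (K\<^sup>2) \<partial>spacetime)"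
    by (intro nn_integral_mono) (simp add: nn_integral_cmult mult_left_mono nn_integral_duhamel_kernel_square K)
  also have "\<dots> = pairing m n * ennreal (K\<^sup>2)"
    by (simp add: nn_integral_multc nn_integral_space_conv)
  finally show ?thesis by (simp add: mult_right_mono power2_eq_square mult_ac)
qed

text \<open>The weight cancels the derivative in the nonlinearity, and the exponential is at most 1. This
  bound holds at every single time, in contrast to the energy.\<close>

lemma weighted_majorant_product_le:
  assumes [measurable]: "m \<in> borel_measurable spacetime" "n \<in> borel_measurable spacetime" and K: "0 \<le> K"
  shows "(\<integral>\<^sup>+\<xi>. majorant_product K m n (t, \<xi>) * ennreal (1 / norm \<xi>) \<partial>lborel) \<le> ennreal K * pairing m n"
proof -
  have [measurable]: "space_conv m n \<in> borel_measurable spacetime"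
    by (rule space_conv_measurable[OF assms(1,2)])
  have k: "duhamel_kernel K t \<tau> \<xi> * ennreal (1 / norm \<xi>) \<le> ennreal K" for \<tau> \<xi>
  proof (cases "\<xi> = 0 \<or> \<tau> \<notin> {0..t}")
    case False
    then have "K * norm \<xi> * exp (- (t - \<tau>) * (norm \<xi>)\<^sup>2 / 2) * (1 / norm \<xi>) = K * exp (- (t - \<tau>) * (norm \<xi>)\<^sup>2 / 2)"
      by simp
    also have "\<dots> \<le> K * 1"
    proof (intro mult_left_mono K)
      have "0 \<le> (t - \<tau>) * (norm \<xi>)\<^sup>2" using False by simp
      then show "exp (- (t - \<tau>) * (norm \<xi>)\<^sup>2 / 2) \<le> 1"
        unfolding exp_le_one_iff minus_mult_left[symmetric] by linarith
    qed
    finally show ?thesis using False K by (simp add: duhamel_kernel_def ennreal_leI flip: ennreal_mult)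
  qed (auto simp: duhamel_kernel_def)
  have "(\<integral>\<^sup>+\<xi>. majorant_product K m n (t, \<xi>) * ennreal (1 / norm \<xi>) \<partial>lborel)
      = (\<integral>\<^sup>+\<xi>. \<integral>\<^sup>+\<tau>. duhamel_kernel K t \<tau> \<xi> * space_conv m n (\<tau>, \<xi>) * ennreal (1 / norm \<xi>) \<partial>lborel \<partial>lborel)"
    unfolding majorant_product_eq[OF assms(1,2)] fst_conv snd_conv
    by (intro nn_integral_cong nn_integral_multc[symmetric]) measurable
  also have "\<dots> \<le> (\<integral>\<^sup>+\<xi>. \<integral>\<^sup>+\<tau>. ennreal K * space_conv m n (\<tau>, \<xi>) \<partial>lborel \<partial>lborel)"
  proof (intro nn_integral_mono)
    fix \<xi> \<tau>
    show "duhamel_kernel K t \<tau> \<xi> * space_conv m n (\<tau>, \<xi>) * ennreal (1 / norm \<xi>) \<le> ennreal K * space_conv m n (\<tau>, \<xi>)"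
      using mult_right_mono[OF k[of \<tau> \<xi>], of "space_conv m n (\<tau>, \<xi>)"] by (simp add: mult_ac)
  qed
  also have "\<dots> = (\<integral>\<^sup>+\<tau>. \<integral>\<^sup>+\<xi>. ennreal K * space_conv m n (\<tau>, \<xi>) \<partial>lborel \<partial>lborel)"
    by (rule lborel_pair.Fubini') measurable
  also have "\<dots> = ennreal K * pairing m n"
    by (simp add: nn_integral_space_time nn_integral_cmult flip: nn_integral_space_conv)
  finally show ?thesis .
qed

lemma majorant_product_mono:
  assumes "\<And>p. m p \<le> m' p" "\<And>p. n p \<le> n' p"
  shows "majorant_product K m n q \<le> majorant_product K m' n' q"
  unfolding majorant_product_def by (intro nn_integral_mono mult_mono assms) auto

lemma ennreal_power2_add_le: "(a + b)\<^sup>2 \<le> 2 * a\<^sup>2 + 2 * (b::ennreal)\<^sup>2"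
proof (cases "a = top \<or> b = top")
  case True
  then show ?thesis by (auto simp: power2_eq_square ennreal_mult_top)
next
  case False
  then obtain x y where "a = ennreal x" "b = ennreal y" "0 \<le> x" "0 \<le> y"
    by (metis ennreal_cases)
  moreover have "(x + y)\<^sup>2 \<le> 2 * x\<^sup>2 + 2 * y\<^sup>2"
    using sum_squares_bound[of x y] by (simp add: power2_sum)
  ultimately show ?thesis
    by (simp add: ennreal_power ennreal_leI flip: ennreal_plus ennreal_mult ennreal_numeral)
qed

lemma ennreal_SUP_mult_incseq:
  fixes f g :: "nat \<Rightarrow> ennreal"
  assumes "incseq f" "incseq g"
  shows "(SUP k. f k) * (SUP k. g k) = (SUP k. f k * g k)"
proof (rule antisym)
  show "(SUP k. f k) * (SUP k. g k) \<le> (SUP k. f k * g k)"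
    unfolding SUP_mult_left_ennreal SUP_mult_right_ennreal
  proof (intro SUP_least)
    fix j i
    have "f i * g j \<le> f (max i j) * g (max i j)"
      using assms by (intro mult_mono) (auto simp: incseq_def)
    also have "\<dots> \<le> (SUP k. f k * g k)" by (rule SUP_upper) simp
    finally show "f i * g j \<le> (SUP k. f k * g k)" .
  qed
  show "(SUP k. f k * g k) \<le> (SUP k. f k) * (SUP k. g k)"
    by (intro SUP_least mult_mono SUP_upper) auto
qed

primrec majorant_iter :: "real \<Rightarrow> (real \<times> (real^3) \<Rightarrow> ennreal) \<Rightarrow> nat \<Rightarrow> real \<times> (real^3) \<Rightarrow> ennreal" where
  "majorant_iter K m 0 = (\<lambda>q. 0)"
| "majorant_iter K m (Suc k) = (\<lambda>q. m q + majorant_product K (majorant_iter K m k) (majorant_iter K m k) q)"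

text \<open>The least solution of \<open>M = m + B (M, M)\<close>. It may take the value \<open>\<infinity>\<close>, so that no convergence has
  to be discussed before the energy estimate is applied.\<close>

definition majorant :: "real \<Rightarrow> (real \<times> (real^3) \<Rightarrow> ennreal) \<Rightarrow> real \<times> (real^3) \<Rightarrow> ennreal" where
  "majorant K m q = (SUP k. majorant_iter K m k q)"

lemma majorant_iter_measurable:
  assumes "m \<in> borel_measurable spacetime"
  shows "majorant_iter K m k \<in> borel_measurable spacetime"
  by (induction k) (auto intro!: borel_measurable_add assms majorant_product_measurable)

lemma majorant_measurable:
  assumes [measurable]: "m \<in> borel_measurable spacetime"
  shows "majorant K m \<in> borel_measurable spacetime"
  unfolding majorant_def[abs_def] using majorant_iter_measurable[OF assms] by measurable

lemma majorant_iter_le_Suc: "majorant_iter K m k q \<le> majorant_iter K m (Suc k) q"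
proof (induction k arbitrary: q)
  case (Suc k)
  show ?case unfolding majorant_iter.simps(2)[of K m "Suc k"]
    by (subst majorant_iter.simps(2)) (intro add_left_mono majorant_product_mono Suc)
qed simp

lemma majorant_iter_incseq: "incseq (\<lambda>k. majorant_iter K m k q)"
  by (rule incseq_SucI) (rule majorant_iter_le_Suc)

lemma majorant_iter_le: "majorant_iter K m k q \<le> majorant K m q"
  unfolding majorant_def by (rule SUP_upper) simp

lemma majorant_product_SUP:
  assumes [measurable]: "m \<in> borel_measurable spacetime"
  shows "majorant_product K (majorant K m) (majorant K m) q
    = (SUP k. majorant_product K (majorant_iter K m k) (majorant_iter K m k) q)"
proof -
  let ?f = "\<lambda>k p. duhamel_kernel K (fst q) (fst p) (snd q) * (majorant_iter K m k (fst p, snd q - snd p) * majorant_iter K m k p)"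
  have "majorant_product K (majorant K m) (majorant K m) q = (\<integral>\<^sup>+p. (SUP k. ?f k p) \<partial>spacetime)"
    unfolding majorant_product_def majorant_def
    by (simp only: ennreal_SUP_mult_incseq[OF majorant_iter_incseq majorant_iter_incseq])
      (simp only: SUP_mult_left_ennreal)
  also have "\<dots> = (SUP k. \<integral>\<^sup>+p. ?f k p \<partial>spacetime)"
  proof (rule nn_integral_monotone_convergence_SUP)
    show "incseq ?f"
      using majorant_iter_incseq[of K m] by (auto simp: incseq_def le_fun_def intro!: mult_mono)
    show "?f k \<in> borel_measurable spacetime" for k
      using majorant_iter_measurable[OF assms] by measurable
  qed
  finally show ?thesis by (simp add: majorant_product_def)
qed

lemma majorant_eq:
  assumes "m \<in> borel_measurable spacetime"
  shows "majorant K m q = m q + majorant_product K (majorant K m) (majorant K m) q"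
proof -
  have "majorant K m q = (SUP k. majorant_iter K m (Suc k) q)"
    unfolding majorant_def
  proof (rule antisym)
    show "(SUP k. majorant_iter K m k q) \<le> (SUP k. majorant_iter K m (Suc k) q)"
      by (rule SUP_mono) (use majorant_iter_le_Suc in blast)
    show "(SUP k. majorant_iter K m (Suc k) q) \<le> (SUP k. majorant_iter K m k q)"
      by (rule SUP_mono) blast
  qed
  also have "\<dots> = m q + (SUP k. majorant_product K (majorant_iter K m k) (majorant_iter K m k) q)"
    by (simp add: ennreal_SUP_add_right)
  finally show ?thesis unfolding majorant_product_SUP[OF assms] .
qed

lemma energy_add_le:
  assumes [measurable]: "m \<in> borel_measurable spacetime" "n \<in> borel_measurable spacetime"
  shows "energy (\<lambda>q. m q + n q) \<le> 2 * energy m + 2 * energy n"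
proof -
  have "energy (\<lambda>q. m q + n q) = (\<integral>\<^sup>+t. ((\<integral>\<^sup>+\<xi>. m (t, \<xi>) \<partial>lborel) + (\<integral>\<^sup>+\<xi>. n (t, \<xi>) \<partial>lborel))\<^sup>2 \<partial>lborel)"
    unfolding energy_def by (simp add: nn_integral_add)
  also have "\<dots> \<le> (\<integral>\<^sup>+t. 2 * (\<integral>\<^sup>+\<xi>. m (t, \<xi>) \<partial>lborel)\<^sup>2 + 2 * (\<integral>\<^sup>+\<xi>. n (t, \<xi>) \<partial>lborel)\<^sup>2 \<partial>lborel)"
    by (intro nn_integral_mono ennreal_power2_add_le)
  also have "\<dots> = 2 * energy m + 2 * energy n"
    unfolding energy_def by (simp add: nn_integral_add nn_integral_cmult)
  finally show ?thesis .
qed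

lemma energy_majorant_product_le_energy:
  assumes "m \<in> borel_measurable spacetime" "0 \<le> K" "energy m \<le> ennreal e" "0 \<le> e"
  shows "energy (majorant_product K m m) \<le> ennreal (K\<^sup>2 * e\<^sup>2)"
proof -
  have "energy (majorant_product K m m) \<le> ennreal (K\<^sup>2) * (energy m * energy m)"
    using energy_majorant_product_le[OF assms(1,1,2)] pairing_square_le[OF assms(1,1)]
    by (meson mult_left_mono order_trans zero_le)
  also have "\<dots> \<le> ennreal (K\<^sup>2) * (ennreal e * ennreal e)" using assms(3) by (intro mult_left_mono mult_mono) auto
  also have "\<dots> = ennreal (K\<^sup>2 * (e * e))"
    unfolding ennreal_mult[OF assms(4,4), symmetric]
    by (rule ennreal_mult[symmetric]) (auto simp: assms(4))
  finally show ?thesis by (simp add: power2_eq_square)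
qed

text \<open>The bound \<open>4 e\<close> is propagated along the iteration: \<open>2 e + 2 K\<^sup>2 (4 e)\<^sup>2 \<le> 4 e\<close> as soon as
  \<open>16 K\<^sup>2 e \<le> 1\<close>. The constant is inherited by the supremum.\<close>

lemma energy_majorant_le:
  assumes m: "m \<in> borel_measurable spacetime" and K: "0 \<le> K" and e: "0 \<le> e" "energy m \<le> ennreal e" "16 * K\<^sup>2 * e \<le> 1"
  shows "energy (majorant K m) \<le> ennreal (4 * e)"
proof -
  note [measurable] = m
  have [measurable]: "majorant_iter K m k \<in> borel_measurable spacetime" for k
    by (rule majorant_iter_measurable[OF m])
  have it: "energy (majorant_iter K m k) \<le> ennreal (4 * e)" for k
  proof (induction k)
    case 0 then show ?case by (simp add: energy_def)
  next
    case (Suc k)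
    have "energy (majorant_iter K m (Suc k)) \<le> 2 * energy m + 2 * energy (majorant_product K (majorant_iter K m k) (majorant_iter K m k))"
      unfolding majorant_iter.simps
      by (intro energy_add_le m majorant_product_measurable majorant_iter_measurable)
    also have "\<dots> \<le> 2 * ennreal e + 2 * ennreal (K\<^sup>2 * (4 * e)\<^sup>2)"
      using e Suc by (intro add_mono mult_left_mono energy_majorant_product_le_energy majorant_iter_measurable m K) auto
    also have "\<dots> = ennreal (2 * e + 2 * (K\<^sup>2 * (4 * e)\<^sup>2))"
    proof -
      have "2 * ennreal a + 2 * ennreal b = ennreal (2 * a + 2 * b)" if "0 \<le> a" "0 \<le> b" for a b
        using that by (simp add: ennreal_mult)
      from this[of e "K\<^sup>2 * (4 * e)\<^sup>2"] show ?thesis using e by simp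
    qed
    also have "\<dots> \<le> ennreal (4 * e)"
      using mult_right_mono[OF e(3) e(1)] by (intro ennreal_leI) (simp add: power2_eq_square algebra_simps)
    finally show ?case .
  qed
  have "energy (majorant K m) = (\<integral>\<^sup>+t. (SUP k. (\<integral>\<^sup>+\<xi>. majorant_iter K m k (t, \<xi>) \<partial>lborel)\<^sup>2) \<partial>lborel)"
  proof -
    have "(\<integral>\<^sup>+\<xi>. majorant K m (t, \<xi>) \<partial>lborel) = (SUP k. \<integral>\<^sup>+\<xi>. majorant_iter K m k (t, \<xi>) \<partial>lborel)" for t
      unfolding majorant_def
    proof (rule nn_integral_monotone_convergence_SUP)
      show "incseq (\<lambda>k \<xi>. majorant_iter K m k (t, \<xi>))"
        using majorant_iter_incseq[of K m] by (auto simp: incseq_def le_fun_def)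
    qed measurable
    moreover have "incseq (\<lambda>k. \<integral>\<^sup>+\<xi>. majorant_iter K m k (t, \<xi>) \<partial>lborel)" for t
      using majorant_iter_incseq[of K m] by (auto simp: incseq_def intro!: nn_integral_mono)
    ultimately show ?thesis
      unfolding energy_def by (simp add: power2_eq_square ennreal_SUP_mult_incseq)
  qed
  also have "\<dots> = (SUP k. energy (majorant_iter K m k))"
    unfolding energy_def
  proof (rule nn_integral_monotone_convergence_SUP)
    show "incseq (\<lambda>k t. (\<integral>\<^sup>+\<xi>. majorant_iter K m k (t, \<xi>) \<partial>lborel)\<^sup>2)"
      using majorant_iter_incseq[of K m]
      by (auto simp: incseq_def le_fun_def intro!: power_mono nn_integral_mono)
  qed measurable
  also have "\<dots> \<le> ennreal (4 * e)" by (intro SUP_least it)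
  finally show ?thesis .
qed

section \<open>The Picard iteration under the majorant\<close>

text \<open>A quadratic integral equation in Fourier variables: \<open>lin\<close> is the solution of the linear problem and
  \<open>kq t \<tau> \<xi>\<close> is the contribution of the frequencies \<open>\<xi> - \<eta>\<close> and \<open>\<eta>\<close> at time \<open>\<tau>\<close> to
  \<open>\<xi>\<close> at time \<open>t\<close>. Points \<open>q = (t, \<xi>)\<close> and \<open>p = (\<tau>, \<eta>)\<close> of space-time are treated as one
  variable, so that the Duhamel term is a single integral.\<close>

locale bilinear_duhamel =
  fixes K :: real and m :: "real \<times> (real^3) \<Rightarrow> ennreal"
    and lin :: "real \<times> (real^3) \<Rightarrow> 'v::euclidean_space"
    and kq :: "real \<Rightarrow> real \<Rightarrow> real^3 \<Rightarrow> 'v \<Rightarrow> 'v \<Rightarrow> 'v"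
  assumes K: "0 \<le> K"
    and m_measurable [measurable]: "m \<in> borel_measurable spacetime"
    and lin_measurable [measurable]: "lin \<in> borel_measurable spacetime"
    and lin_le: "ennreal (norm (lin q)) \<le> m q"
    and kq_bilinear: "bounded_bilinear (kq t \<tau> \<xi>)"
    and kq_measurable: "f \<in> borel_measurable spacetime \<Longrightarrow> g \<in> borel_measurable spacetime \<Longrightarrow>
        (\<lambda>(q, p). kq (fst q) (fst p) (snd q) (f (fst p, snd q - snd p)) (g p)) \<in>
          borel_measurable (spacetime \<Otimes>\<^sub>M spacetime)"
    and kq_le: "0 \<le> \<tau> \<Longrightarrow> \<tau> \<le> t \<Longrightarrow>
        norm (kq t \<tau> \<xi> a b) \<le> K * norm \<xi> * exp (- (t - \<tau>) * (norm \<xi>)\<^sup>2 / 2) * (norm a * norm b)"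
    and energy_finite: "energy (majorant K m) < \<infinity>"
begin

abbreviation "M \<equiv> majorant K m"

definition integrand where
  "integrand f g q p = indicator {0..fst q} (fst p) *\<^sub>R
     kq (fst q) (fst p) (snd q) (f (fst p, snd q - snd p)) (g p)"

definition duhamel where
  "duhamel f g q = (LINT p|spacetime. integrand f g q p)"

primrec picard where
  "picard 0 = (\<lambda>q. 0)"
| "picard (Suc k) = (\<lambda>q. lin q - duhamel (picard k) (picard k) q)"

text \<open>The iteration converges pointwise wherever the majorant is finite. The value 0 elsewhere keeps the
  estimate by the majorant valid everywhere.\<close>

definition solution where
  "solution q = (if M q < \<infinity> then lim (\<lambda>k. picard k q) else 0)"

lemma M_measurable [measurable]: "M \<in> borel_measurable spacetime"
  by (rule majorant_measurable[OF m_measurable])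

lemma M_iter_measurable [measurable]: "majorant_iter K m k \<in> borel_measurable spacetime"
  by (rule majorant_iter_measurable[OF m_measurable])

lemma M_eq: "M q = m q + majorant_product K M M q"
  by (rule majorant_eq[OF m_measurable])

lemma integrand_measurable2:
  assumes "f \<in> borel_measurable spacetime" "g \<in> borel_measurable spacetime"
  shows "(\<lambda>(q, p). integrand f g q p) \<in> borel_measurable (spacetime \<Otimes>\<^sub>M spacetime)"
proof -
  note [measurable] = kq_measurable[OF assms]
  have "(\<lambda>x. (if 0 \<le> fst (snd x) \<and> fst (snd x) \<le> fst (fst x) then 1 else 0 :: real) *\<^sub>R
     (case x of (q, p) \<Rightarrow> kq (fst q) (fst p) (snd q) (f (fst p, snd q - snd p)) (g p)))
     \<in> borel_measurable (spacetime \<Otimes>\<^sub>M spacetime)"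
    by measurable
  then show ?thesis
    by (rule measurable_cong[THEN iffD1, rotated]) (auto simp: integrand_def indicator_def)
qed

lemma integrand_measurable:
  assumes "f \<in> borel_measurable spacetime" "g \<in> borel_measurable spacetime"
  shows "integrand f g q \<in> borel_measurable spacetime"
  using measurable_Pair2[OF integrand_measurable2[OF assms], of q] by (simp add: space_pair_measure)

lemma duhamel_measurable:
  assumes "f \<in> borel_measurable spacetime" "g \<in> borel_measurable spacetime"
  shows "duhamel f g \<in> borel_measurable spacetime"
  unfolding duhamel_def[abs_def]
  by (rule sigma_finite_measure.borel_measurable_lebesgue_integral[OF _ integrand_measurable2[OF assms]])
     (simp add: lborel_prod sigma_finite_lborel)

lemma picard_measurable [measurable]: "picard k \<in> borel_measurable spacetime"
  by (induction k) (auto intro!: borel_measurable_diff duhamel_measurable lin_measurable)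

lemma integrand_le:
  "ennreal (norm (integrand f g q p))
    \<le> duhamel_kernel K (fst q) (fst p) (snd q) * (ennreal (norm (f (fst p, snd q - snd p))) * ennreal (norm (g p)))"
proof (cases "fst p \<in> {0..fst q}")
  case True
  then have "norm (integrand f g q p) \<le> K * norm (snd q) * exp (- (fst q - fst p) * (norm (snd q))\<^sup>2 / 2)
      * (norm (f (fst p, snd q - snd p)) * norm (g p))"
    using kq_le[of "fst p" "fst q" "snd q" "f (fst p, snd q - snd p)" "g p"] by (simp add: integrand_def)
  then have "ennreal (norm (integrand f g q p)) \<le> ennreal (K * norm (snd q) * exp (- (fst q - fst p) * (norm (snd q))\<^sup>2 / 2)
      * (norm (f (fst p, snd q - snd p)) * norm (g p)))"
    by (rule ennreal_leI)
  also have "\<dots> = duhamel_kernel K (fst q) (fst p) (snd q) * (ennreal (norm (f (fst p, snd q - snd p))) * ennreal (norm (g p)))"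
    using True K by (simp add: duhamel_kernel_def ennreal_mult)
  finally show ?thesis .
qed (simp add: integrand_def)

lemma nn_integral_integrand_le:
  assumes "AE p in lborel \<Otimes>\<^sub>M lborel. ennreal (norm (f (fst p, snd q - snd p))) * ennreal (norm (g p)) \<le> a (fst p, snd q - snd p) * b p"
  shows "(\<integral>\<^sup>+p. ennreal (norm (integrand f g q p)) \<partial>spacetime) \<le> majorant_product K a b q"
  unfolding majorant_product_def
  using assms by (intro nn_integral_mono_AE) (auto elim!: eventually_mono intro!: order_trans[OF integrand_le] mult_left_mono)

lemma norm_duhamel_le:
  assumes "\<And>p. ennreal (norm (f p)) \<le> a p" "\<And>p. ennreal (norm (g p)) \<le> b p"
  shows "ennreal (norm (duhamel f g q)) \<le> majorant_product K a b q"
  unfolding duhamel_def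
  by (rule order_trans[OF ennreal_norm_integral_le nn_integral_integrand_le]) (auto intro!: AE_I2 mult_mono assms)

lemma norm_picard_le: "ennreal (norm (picard k q)) \<le> majorant_iter K m k q"
proof (induction k arbitrary: q)
  case (Suc k)
  have "ennreal (norm (picard (Suc k) q)) \<le> ennreal (norm (lin q) + norm (duhamel (picard k) (picard k) q))"
    by (intro ennreal_leI) (simp add: norm_triangle_ineq4)
  also have "\<dots> = ennreal (norm (lin q)) + ennreal (norm (duhamel (picard k) (picard k) q))" by simp
  also have "\<dots> \<le> majorant_iter K m (Suc k) q"
    unfolding majorant_iter.simps by (intro add_mono lin_le norm_duhamel_le Suc)
  finally show ?case .
qed simp

lemma norm_picard_le_M: "ennreal (norm (picard k q)) \<le> M q"
  by (rule order_trans[OF norm_picard_le majorant_iter_le])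

lemma AE_M_integrable: "AE t in lborel. (\<integral>\<^sup>+\<xi>. M (t, \<xi>) \<partial>lborel) < \<infinity>"
proof -
  have "AE t in lborel. (\<integral>\<^sup>+\<xi>. M (t, \<xi>) \<partial>lborel)\<^sup>2 \<noteq> \<infinity>"
    using energy_finite unfolding energy_def by (intro nn_integral_PInf_AE) auto
  then show ?thesis
    by (rule eventually_mono) (auto simp: power2_eq_square ennreal_mult_eq_top_iff less_top)
qed

text \<open>The majorant is finite almost everywhere on almost every time slice; the reflected statement
  is needed since the products pair the frequencies \<open>\<eta>\<close> and \<open>\<xi> - \<eta>\<close>.\<close>

lemma AE_M_finite:
  "AE p in lborel \<Otimes>\<^sub>M lborel. M p < \<infinity> \<and> M (fst p, \<xi> - snd p) < \<infinity>"
proof (rule lborel_pair.AE_pair_measure)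
  show "AE t in lborel. AE \<eta> in lborel. M (t, \<eta>) < \<infinity> \<and> M (fst (t, \<eta>), \<xi> - snd (t, \<eta>)) < \<infinity>"
    using AE_M_integrable
  proof eventually_elim
    case (elim t)
    then have "AE \<eta> in lborel. M (t, \<eta>) \<noteq> \<infinity>" by (intro nn_integral_PInf_AE) auto
    then have 1: "AE \<eta> in lborel. M (t, \<eta>) < \<infinity>" by (simp add: less_top)
    then show ?case using AE_lborel_reflect[OF 1, of \<xi>] by simp
  qed
qed measurable

lemma integrable_integrand:
  assumes [measurable]: "f \<in> borel_measurable spacetime" "g \<in> borel_measurable spacetime"
    and "\<And>p. ennreal (norm (f p)) \<le> M p" "\<And>p. ennreal (norm (g p)) \<le> M p" "M q < \<infinity>"
  shows "integrable spacetime (integrand f g q)"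
proof (rule integrableI_bounded)
  show "integrand f g q \<in> borel_measurable spacetime" by (rule integrand_measurable[OF assms(1,2)])
  have "(\<integral>\<^sup>+p. ennreal (norm (integrand f g q p)) \<partial>spacetime) \<le> majorant_product K M M q"
    by (rule nn_integral_integrand_le) (auto intro!: AE_I2 mult_mono assms)
  also have "\<dots> \<le> M q" unfolding M_eq[of q] by simp
  finally show "(\<integral>\<^sup>+p. ennreal (norm (integrand f g q p)) \<partial>spacetime) < \<infinity>"
    using assms(5) by simp
qed

text \<open>The increments of the iteration are controlled by those of the majorant, because
  \<open>d a' + a d' + a a' \<le> (a + d) (a' + d')\<close>.\<close>

lemma picard_increment:
  "M q < \<infinity> \<Longrightarrow> ennreal (norm (picard (Suc k) q - picard k q)) + majorant_iter K m k q \<le> majorant_iter K m (Suc k) q"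
proof (induction k arbitrary: q)
  case 0
  have "duhamel (\<lambda>q. 0) (\<lambda>q. 0) q = 0"
    unfolding duhamel_def integrand_def by (simp add: bounded_bilinear.zero_left[OF kq_bilinear])
  moreover have "majorant_product K (\<lambda>q. 0) (\<lambda>q. 0) q = 0" by (simp add: majorant_product_def)
  ultimately show ?case using lin_le by simp
next
  case (Suc k)
  let ?u = "picard k" and ?v = "picard (Suc k)"
  let ?a = "majorant_iter K m k" and ?b = "majorant_iter K m (Suc k)"
  let ?D = "\<lambda>p. integrand ?v ?v q p - integrand ?u ?u q p"
  have int: "integrable spacetime (integrand (picard j) (picard j) q)" for j
    using Suc.prems by (intro integrable_integrand norm_picard_le_M) measurable
  have "picard (Suc (Suc k)) q - ?v q = - (LINT p|spacetime. ?D p)"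
    unfolding picard.simps(2)[of "Suc k"] by (subst (2) picard.simps(2)) (simp only: duhamel_def, simp add: int del: picard.simps)
  then have "ennreal (norm (picard (Suc (Suc k)) q - ?v q)) \<le> (\<integral>\<^sup>+p. ennreal (norm (?D p)) \<partial>spacetime)"
    by (simp only: norm_minus_cancel ennreal_norm_integral_le)
  then have "ennreal (norm (picard (Suc (Suc k)) q - ?v q)) + majorant_product K ?a ?a q
      \<le> (\<integral>\<^sup>+p. ennreal (norm (?D p)) \<partial>spacetime) + majorant_product K ?a ?a q"
    by (rule add_right_mono)
  also have "\<dots> = (\<integral>\<^sup>+p. ennreal (norm (?D p)) + duhamel_kernel K (fst q) (fst p) (snd q) * (?a (fst p, snd q - snd p) * ?a p) \<partial>spacetime)"
  proof -
    note [measurable] = integrand_measurable[OF picard_measurable picard_measurable]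
    show ?thesis unfolding majorant_product_def
      by (rule nn_integral_add[symmetric]) measurable
  qed
  also have "\<dots> \<le> majorant_product K ?b ?b q"
    unfolding majorant_product_def
  proof (rule nn_integral_mono_AE)
    show "AE p in lborel \<Otimes>\<^sub>M lborel. ennreal (norm (?D p)) + duhamel_kernel K (fst q) (fst p) (snd q) * (?a (fst p, snd q - snd p) * ?a p)
        \<le> duhamel_kernel K (fst q) (fst p) (snd q) * (?b (fst p, snd q - snd p) * ?b p)"
      using AE_M_finite[of "snd q"]
    proof eventually_elim
      case (elim p)
      let ?x = "(fst p, snd q - snd p)"
      let ?k = "duhamel_kernel K (fst q) (fst p) (snd q)"
      have "?D p = integrand (\<lambda>p. ?v p - ?u p) ?v q p + integrand ?u (\<lambda>p. ?v p - ?u p) q p"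
        unfolding integrand_def
        by (simp add: bounded_bilinear.diff_left[OF kq_bilinear] bounded_bilinear.diff_right[OF kq_bilinear]
          scaleR_diff_right del: picard.simps)
      then have "ennreal (norm (?D p)) \<le> ennreal (norm (integrand (\<lambda>p. ?v p - ?u p) ?v q p)) + ennreal (norm (integrand ?u (\<lambda>p. ?v p - ?u p) q p))"
        by (simp only: ennreal_plus[symmetric] norm_ge_zero) (intro ennreal_leI norm_triangle_ineq)
      also have "\<dots> \<le> ?k * (ennreal (norm (?v ?x - ?u ?x)) * ennreal (norm (?v p))) + ?k * (ennreal (norm (?u ?x)) * ennreal (norm (?v p - ?u p)))"
        by (intro add_mono integrand_le)
      finally have "ennreal (norm (?D p)) + ?k * (?a ?x * ?a p)
          \<le> ?k * (ennreal (norm (?v ?x - ?u ?x)) * ennreal (norm (?v p)) + ennreal (norm (?u ?x)) * ennreal (norm (?v p - ?u p)) + ?a ?x * ?a p)"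
        by (simp add: distrib_left add_right_mono del: picard.simps majorant_iter.simps)
      also have "\<dots> \<le> ?k * (ennreal (norm (?v ?x - ?u ?x)) * ?b p + (?a ?x * ennreal (norm (?v p - ?u p)) + ?a ?x * ?a p))"
        unfolding add.assoc by (intro mult_left_mono add_mono mult_mono norm_picard_le) auto
      also have "\<dots> = ?k * (ennreal (norm (?v ?x - ?u ?x)) * ?b p + ?a ?x * (ennreal (norm (?v p - ?u p)) + ?a p))"
        by (simp only: distrib_left)
      also have "\<dots> \<le> ?k * (ennreal (norm (?v ?x - ?u ?x)) * ?b p + ?a ?x * ?b p)"
        using elim by (intro mult_left_mono add_left_mono Suc.IH) auto
      also have "\<dots> = ?k * ((ennreal (norm (?v ?x - ?u ?x)) + ?a ?x) * ?b p)"
        by (simp only: distrib_right)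
      also have "\<dots> \<le> ?k * (?b ?x * ?b p)"
        using elim by (intro mult_left_mono mult_right_mono Suc.IH) auto
      finally show ?case .
    qed
  qed
  finally have "ennreal (norm (picard (Suc (Suc k)) q - ?v q)) + majorant_product K ?a ?a q \<le> majorant_product K ?b ?b q" .
  then have "m q + (ennreal (norm (picard (Suc (Suc k)) q - ?v q)) + majorant_product K ?a ?a q) \<le> m q + majorant_product K ?b ?b q"
    by (rule add_left_mono)
  then show ?case
    unfolding majorant_iter.simps(2)[of K m "Suc k"] by (subst majorant_iter.simps(2)) (simp only: add.left_commute)
qed

text \<open>The increments telescope against the increments of the majorant, hence they are summable where
  the majorant is finite.\<close>

lemma picard_convergent:
  assumes "M q < \<infinity>"
  shows "(\<lambda>k. picard k q) \<longlonglongrightarrow> solution q"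
proof -
  let ?d = "\<lambda>k. norm (picard (Suc k) q - picard k q)"
  have sum: "ennreal (\<Sum>k<n. ?d k) \<le> majorant_iter K m n q" for n
  proof (induction n)
    case (Suc n)
    have "ennreal (\<Sum>k<Suc n. ?d k) = ennreal (\<Sum>k<n. ?d k) + ennreal (?d n)"
      by (simp add: sum_nonneg del: picard.simps)
    also have "\<dots> \<le> majorant_iter K m n q + ennreal (?d n)" by (rule add_right_mono[OF Suc])
    also have "\<dots> \<le> majorant_iter K m (Suc n) q" using picard_increment[OF assms, of n] by (simp only: add.commute)
    finally show ?case .
  qed simp
  have "(\<Sum>k<n. ?d k) \<le> enn2real (M q)" for n
  proof -
    have "ennreal (\<Sum>k<n. ?d k) \<le> ennreal (enn2real (M q))"
      using order_trans[OF sum majorant_iter_le, of n] assms by simp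
    then show ?thesis by (subst (asm) ennreal_le_iff) auto
  qed
  then have "summable ?d" by (intro summableI_nonneg_bounded) auto
  then have "summable (\<lambda>k. picard (Suc k) q - picard k q)" by (rule summable_norm_cancel)
  then have "convergent (\<lambda>n. \<Sum>k<n. picard (Suc k) q - picard k q)" by (simp only: summable_iff_convergent)
  then have "convergent (\<lambda>n. picard n q)" by (simp only: sum_lessThan_telescope[of "\<lambda>k. picard k q"] picard.simps(1) diff_zero)
  then show ?thesis using assms unfolding solution_def by (simp add: convergent_LIMSEQ_iff)
qed

lemma solution_measurable [measurable]: "solution \<in> borel_measurable spacetime"
  unfolding solution_def[abs_def] by measurable

lemma norm_solution_le: "ennreal (norm (solution q)) \<le> M q"
proof (cases "M q < \<infinity>")
  case True
  have "(\<lambda>k. ennreal (norm (picard k q))) \<longlonglongrightarrow> ennreal (norm (solution q))"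
    by (intro tendsto_ennrealI tendsto_norm picard_convergent True)
  then show ?thesis by (rule LIMSEQ_le_const2) (auto intro: norm_picard_le_M)
qed (simp add: solution_def)

text \<open>Passage to the limit in the iteration by dominated convergence; the dominating function has the
  integral \<open>majorant_product K M M q \<le> M q\<close>.\<close>

lemma solution_eq:
  assumes "M q < \<infinity>"
  shows "solution q = lin q - duhamel solution solution q"
proof -
  have "(\<lambda>k. duhamel (picard k) (picard k) q) \<longlonglongrightarrow> duhamel solution solution q"
    unfolding duhamel_def
  proof (rule integral_dominated_convergence)
    let ?w = "\<lambda>p. enn2real (duhamel_kernel K (fst q) (fst p) (snd q) * (M (fst p, snd q - snd p) * M p))"
    let ?W = "\<lambda>p. duhamel_kernel K (fst q) (fst p) (snd q) * (M (fst p, snd q - snd p) * M p)"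
    have fin: "(\<integral>\<^sup>+p. ?W p \<partial>spacetime) < \<infinity>"
    proof -
      have "majorant_product K M M q \<le> M q" unfolding M_eq[of q] by simp
      then show ?thesis using assms unfolding majorant_product_def by simp
    qed
    have Wm: "?W \<in> borel_measurable spacetime" by measurable
    have AEW: "AE p in lborel \<Otimes>\<^sub>M lborel. ?W p \<noteq> \<infinity>"
      using fin by (intro nn_integral_PInf_AE Wm) auto
    show "integrable spacetime ?w"
    proof (rule integrableI_bounded)
      have "(\<integral>\<^sup>+p. ennreal (norm (?w p)) \<partial>spacetime) = (\<integral>\<^sup>+p. ?W p \<partial>spacetime)"
        using AEW by (intro nn_integral_cong_AE) (auto elim!: eventually_mono simp: less_top)
      then show "(\<integral>\<^sup>+p. ennreal (norm (?w p)) \<partial>spacetime) < \<infinity>" using fin by simp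
    qed measurable
    show "AE p in lborel \<Otimes>\<^sub>M lborel. norm (integrand (picard k) (picard k) q p) \<le> ?w p" for k
      using AEW
    proof eventually_elim
      case (elim p)
      have "ennreal (norm (integrand (picard k) (picard k) q p)) \<le> ?W p"
        by (rule order_trans[OF integrand_le]) (intro mult_left_mono mult_mono norm_picard_le_M, auto)
      also have "\<dots> = ennreal (?w p)" using elim by (simp add: less_top)
      finally show ?case by (subst (asm) ennreal_le_iff) auto
    qed
    show "AE p in lborel \<Otimes>\<^sub>M lborel. (\<lambda>k. integrand (picard k) (picard k) q p) \<longlonglongrightarrow> integrand solution solution q p"
      using AE_M_finite[of "snd q"]
      by (rule eventually_mono)
         (auto simp: integrand_def intro!: tendsto_scaleR bounded_bilinear.tendsto[OF kq_bilinear] picard_convergent)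
  qed (intro integrand_measurable picard_measurable solution_measurable)+
  then have "(\<lambda>k. picard (Suc k) q) \<longlonglongrightarrow> lin q - duhamel solution solution q"
    unfolding picard.simps by (intro tendsto_diff tendsto_const)
  moreover have "(\<lambda>k. picard (Suc k) q) \<longlonglongrightarrow> solution q"
    by (rule LIMSEQ_Suc[OF picard_convergent[OF assms]])
  ultimately show ?thesis by (metis LIMSEQ_unique)
qed

end

section \<open>The nonlinearity on the Fourier side\<close>

type_synonym field = "complex^(3 + 3)"

lemma norm_le_sum_components: "norm (v :: complex^'n) \<le> (\<Sum>i\<in>UNIV. norm (v $ i))"
  unfolding norm_vec_def by (rule L2_set_le_sum) simp

lemma norm_component_le: "norm ((v :: complex^'n) $ i) \<le> norm v"
  by (rule Finite_Cartesian_Product.norm_nth_le)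

lemma measurable_component [measurable (raw)]:
  fixes f :: "'a \<Rightarrow> complex^'n"
  assumes "f \<in> borel_measurable M"
  shows "(\<lambda>x. f x $ i) \<in> borel_measurable M"
  by (rule measurable_compose[OF assms borel_measurable_continuous_onI]) (intro continuous_intros)

lemma measurable_component_real [measurable (raw)]:
  fixes f :: "'a \<Rightarrow> real^'n"
  assumes "f \<in> borel_measurable M"
  shows "(\<lambda>x. f x $ i) \<in> borel_measurable M"
  by (rule measurable_compose[OF assms borel_measurable_continuous_onI]) (intro continuous_intros)

lemma measurable_vec_lambda:
  fixes f :: "'a \<Rightarrow> complex^'n"
  assumes "\<And>i. (\<lambda>x. f x $ i) \<in> borel_measurable M"
  shows "f \<in> borel_measurable M"
proof -
  have ax: "continuous_on UNIV (\<lambda>z. axis i z :: complex^'n)" for i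
    unfolding axis_def
  proof (rule continuous_on_vec_lambda)
    fix j show "continuous_on UNIV (\<lambda>z. if j = i then z else 0 :: complex)"
      by (cases "j = i") (auto intro!: continuous_intros)
  qed
  have "(\<lambda>x. \<Sum>i\<in>UNIV. axis i (f x $ i)) \<in> borel_measurable M"
    by (intro borel_measurable_sum measurable_compose[OF assms borel_measurable_continuous_onI[OF ax]])
  moreover have "(\<Sum>i\<in>UNIV. axis i (f x $ i)) = f x" for x
    by (simp add: vec_eq_iff axis_def if_distrib cong: if_cong)
  ultimately show ?thesis by simp
qed

definition proj :: "real^3 \<Rightarrow> field \<Rightarrow> field" where
  "proj \<xi> v = leray_hat (\<lambda>_. v) \<xi>"

lemma leray_hat_eq: "leray_hat h \<xi> = proj \<xi> (h \<xi>)"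
  by (simp add: proj_def leray_hat_def)

lemma proj_Inl: "proj \<xi> v $ Inl k = (\<Sum>l\<in>UNIV. of_real ((if k = l then 1 else 0) - \<xi> $ k * \<xi> $ l / (norm \<xi>)\<^sup>2) * v $ Inl l)"
  and proj_Inr: "proj \<xi> v $ Inr k = v $ Inr k"
  by (simp_all add: proj_def leray_hat_def)

lemma linear_proj: "linear (proj \<xi>)"
proof (rule linearI)
  fix v w :: field and c :: real
  have "proj \<xi> (v + w) $ i = (proj \<xi> v + proj \<xi> w) $ i" for i
    by (cases i) (simp_all add: proj_Inl proj_Inr distrib_left sum.distrib)
  then show "proj \<xi> (v + w) = proj \<xi> v + proj \<xi> w" by (simp add: vec_eq_iff)
  have "proj \<xi> (c *\<^sub>R v) $ i = (c *\<^sub>R proj \<xi> v) $ i" for i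
    by (cases i) (simp_all add: proj_Inl proj_Inr scaleR_sum_right)
  then show "proj \<xi> (c *\<^sub>R v) = c *\<^sub>R proj \<xi> v" by (simp add: vec_eq_iff)
qed

lemma norm_proj_le: "norm (proj \<xi> v) \<le> 36 * norm v"
proof -
  have "norm (proj \<xi> v $ i) \<le> 6 * norm v" for i
  proof (cases i)
    case (Inl k)
    have c: "\<bar>(if k = l then 1 else 0) - \<xi> $ k * \<xi> $ l / (norm \<xi>)\<^sup>2\<bar> \<le> 2" for l
    proof -
      have "\<bar>\<xi> $ k * \<xi> $ l\<bar> \<le> norm \<xi> * norm \<xi>"
        unfolding abs_mult by (intro mult_mono component_le_norm_cart) auto
      then have "\<bar>\<xi> $ k * \<xi> $ l / (norm \<xi>)\<^sup>2\<bar> \<le> 1"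
        by (simp add: power2_eq_square divide_le_eq abs_mult)
      moreover have "\<bar>(if b then 1 else 0) - x\<bar> \<le> 2" if "\<bar>x\<bar> \<le> 1" for b and x :: real
        using that by (cases b) auto
      ultimately show ?thesis by blast
    qed
    have "norm (proj \<xi> v $ i) \<le> (\<Sum>l\<in>UNIV. norm (of_real ((if k = l then 1 else 0) - \<xi> $ k * \<xi> $ l / (norm \<xi>)\<^sup>2) * v $ Inl l))"
      unfolding Inl proj_Inl by (rule norm_sum)
    also have "\<dots> \<le> (\<Sum>l\<in>(UNIV::3 set). 2 * norm v)"
      unfolding norm_mult norm_of_real by (intro sum_mono mult_mono c norm_component_le) auto
    finally show ?thesis by simp
  next
    case (Inr k)
    have "norm (v $ Inr k) \<le> norm v" by (rule norm_component_le)
    then show ?thesis unfolding Inr proj_Inr using norm_ge_zero[of v] by linarith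
  qed
  then have "(\<Sum>i\<in>UNIV. norm (proj \<xi> v $ i)) \<le> (\<Sum>i\<in>(UNIV::(3+3) set). 6 * norm v)" by (intro sum_mono)
  then show ?thesis using norm_le_sum_components[of "proj \<xi> v"] by simp
qed

lemma proj_measurable [measurable (raw)]:
  assumes [measurable]: "f \<in> borel_measurable M" "g \<in> borel_measurable M"
  shows "(\<lambda>x. proj (f x) (g x)) \<in> borel_measurable M"
proof (rule measurable_vec_lambda)
  fix i :: "3 + 3"
  show "(\<lambda>x. proj (f x) (g x) $ i) \<in> borel_measurable M"
    by (cases i) (simp_all only: proj_Inl proj_Inr, measurable)
qed

text \<open>The Fourier transform of \<open>div (u \<otimes> U)\<close> for plane waves: \<open>flux \<xi> a b\<close> is the contribution
  of the amplitudes \<open>a\<close> at \<open>\<xi> - \<eta>\<close> and \<open>b\<close> at \<open>\<eta>\<close>.\<close>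

definition flux :: "real^3 \<Rightarrow> field \<Rightarrow> field \<Rightarrow> field" where
  "flux \<xi> a b = (\<chi> i. of_real (1 / (2 * pi) ^ 3) * (\<Sum>k\<in>UNIV. \<i> * of_real (\<xi> $ k) * a $ Inl k) * b $ i)"

definition micropolar_kernel :: "real \<Rightarrow> real \<Rightarrow> real^3 \<Rightarrow> field \<Rightarrow> field \<Rightarrow> field" where
  "micropolar_kernel t \<tau> \<xi> a b = propagator (t - \<tau>) \<xi> (proj \<xi> (flux \<xi> a b))"

lemma norm_flux_le: "norm (flux \<xi> a b) \<le> 18 * norm \<xi> * (norm a * norm b)"
proof -
  have pi1: "1 \<le> (2 * pi) ^ 3" using pi_gt3 by (intro one_le_power) linarith
  have s: "norm (\<Sum>k\<in>UNIV. \<i> * of_real (\<xi> $ k) * a $ Inl k) \<le> 3 * norm \<xi> * norm a"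
  proof -
    have "norm (\<Sum>k\<in>UNIV. \<i> * of_real (\<xi> $ k) * a $ Inl k) \<le> (\<Sum>k\<in>UNIV. norm (\<i> * of_real (\<xi> $ k) * a $ Inl k))"
      by (rule norm_sum)
    also have "\<dots> \<le> (\<Sum>k\<in>(UNIV::3 set). norm \<xi> * norm a)"
      by (intro sum_mono) (auto simp: norm_mult intro!: mult_mono component_le_norm_cart norm_component_le)
    finally show ?thesis by simp
  qed
  have "norm (flux \<xi> a b $ i) \<le> 3 * norm \<xi> * norm a * norm b" for i
  proof -
    have "norm (flux \<xi> a b $ i) = (1 / (2 * pi) ^ 3) * norm (\<Sum>k\<in>UNIV. \<i> * of_real (\<xi> $ k) * a $ Inl k) * norm (b $ i)"
      by (simp add: flux_def norm_mult norm_divide norm_power)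
    also have "\<dots> \<le> 1 * (3 * norm \<xi> * norm a) * norm b"
      using pi1 by (intro mult_mono s norm_component_le) (auto simp: divide_le_eq)
    finally show ?thesis by simp
  qed
  then have "(\<Sum>i\<in>UNIV. norm (flux \<xi> a b $ i)) \<le> (\<Sum>i\<in>(UNIV::(3+3) set). 3 * norm \<xi> * norm a * norm b)" by (intro sum_mono)
  then show ?thesis using norm_le_sum_components[of "flux \<xi> a b"] by simp
qed

lemma norm_proj_flux_le: "norm (proj \<xi> (flux \<xi> a b)) \<le> 648 * norm \<xi> * (norm a * norm b)"
  using norm_proj_le[of \<xi> "flux \<xi> a b"] norm_flux_le[of \<xi> a b] by simp

lemma bilinear_flux: "bilinear (flux \<xi>)"
proof -
  let ?S = "\<lambda>a :: field. of_real (1 / (2 * pi) ^ 3) * (\<Sum>k\<in>UNIV. \<i> * of_real (\<xi> $ k) * a $ Inl k)"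
  have S: "linear ?S"
    by (rule linearI) (simp_all only: vector_add_component vector_scaleR_component distrib_left sum.distrib
      mult_scaleR_right flip: scaleR_sum_right)
  define T where "T = ?S"
  have flux: "flux \<xi> a b $ i = T a * b $ i" for a b i by (simp add: flux_def T_def)
  have "linear (flux \<xi> a)" for a
    by (rule linearI) (simp_all add: flux vec_eq_iff distrib_left)
  moreover have "linear (\<lambda>a. flux \<xi> a b)" for b
    using S[folded T_def] by (intro linearI) (simp_all add: flux vec_eq_iff linear_add linear_scale distrib_right)
  ultimately show ?thesis unfolding bilinear_def by blast
qed

lemma bounded_bilinear_kernel: "bounded_bilinear (micropolar_kernel t \<tau> \<xi>)"
proof -
  have L: "linear (\<lambda>v. propagator (t - \<tau>) \<xi> (proj \<xi> v))"
    using linear_compose[OF linear_proj linear_propagator] by (simp add: o_def)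
  have "bilinear (micropolar_kernel t \<tau> \<xi>)"
    unfolding bilinear_def micropolar_kernel_def
  proof (intro conjI allI)
    fix a b
    show "linear (\<lambda>b. propagator (t - \<tau>) \<xi> (proj \<xi> (flux \<xi> a b)))"
      using linear_compose[OF _ L, of "flux \<xi> a"] bilinear_flux[of \<xi>] by (simp add: o_def bilinear_def)
    show "linear (\<lambda>a. propagator (t - \<tau>) \<xi> (proj \<xi> (flux \<xi> a b)))"
      using linear_compose[OF _ L, of "\<lambda>a. flux \<xi> a b"] bilinear_flux[of \<xi>] by (simp add: o_def bilinear_def)
  qed
  then show ?thesis by (simp add: bilinear_conv_bounded_bilinear)
qed

lemma norm_kernel_le:
  assumes "\<tau> \<le> t"
  shows "norm (micropolar_kernel t \<tau> \<xi> a b) \<le> 648 * norm \<xi> * exp (- (t - \<tau>) * (norm \<xi>)\<^sup>2 / 2) * (norm a * norm b)"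
proof -
  have "norm (micropolar_kernel t \<tau> \<xi> a b) \<le> exp (- (t - \<tau>) * (norm \<xi>)\<^sup>2 / 2) * norm (proj \<xi> (flux \<xi> a b))"
    unfolding micropolar_kernel_def by (rule norm_propagator_le) (use assms in simp)
  also have "\<dots> \<le> exp (- (t - \<tau>) * (norm \<xi>)\<^sup>2 / 2) * (648 * norm \<xi> * (norm a * norm b))"
    by (intro mult_left_mono norm_proj_flux_le) auto
  finally show ?thesis by (simp add: mult_ac)
qed

lemma flux_measurable [measurable (raw)]:
  assumes [measurable]: "f \<in> borel_measurable M" "g \<in> borel_measurable M" "h \<in> borel_measurable M"
  shows "(\<lambda>x. flux (f x) (g x) (h x)) \<in> borel_measurable M"
  by (rule measurable_vec_lambda) (simp add: flux_def)

lemma kernel_measurable [measurable (raw)]: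
  assumes [measurable]: "s \<in> borel_measurable M" "t \<in> borel_measurable M" "f \<in> borel_measurable M" "g \<in> borel_measurable M" "h \<in> borel_measurable M"
  shows "(\<lambda>x. micropolar_kernel (s x) (t x) (f x) (g x) (h x)) \<in> borel_measurable M"
  unfolding micropolar_kernel_def by measurable

text \<open>All symbols are Hermitian symmetric, so the iteration preserves real fields.\<close>

lemma kernel_cnjv: "micropolar_kernel t \<tau> (- \<xi>) (cnjv a) (cnjv b) = cnjv (micropolar_kernel t \<tau> \<xi> a b)"
proof -
  have F: "flux (- \<xi>) (cnjv a) (cnjv b) = cnjv (flux \<xi> a b)"
    by (simp add: flux_def vec_eq_iff)
  have P: "proj (- \<xi>) (cnjv v) = cnjv (proj \<xi> v)" for v
  proof -
    have "proj (- \<xi>) (cnjv v) $ i = cnj (proj \<xi> v $ i)" for i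
      by (cases i) (simp_all add: proj_Inl proj_Inr)
    then show ?thesis by (simp add: vec_eq_iff)
  qed
  show ?thesis unfolding micropolar_kernel_def F P propagator_cnjv ..
qed

text \<open>The propagator decays at half of the rate of the heat flow, see \<open>norm_propagator_le\<close>.\<close>

definition heat_majorant :: "(real^3 \<Rightarrow> field) \<Rightarrow> real \<times> (real^3) \<Rightarrow> ennreal" where
  "heat_majorant f q = ennreal (exp (- fst q * (norm (snd q))\<^sup>2 / 2) * norm (f (snd q))) * indicator {0..} (fst q)"

definition linear_part :: "(real^3 \<Rightarrow> field) \<Rightarrow> real \<times> (real^3) \<Rightarrow> field" where
  "linear_part f q = indicator {0..} (fst q) *\<^sub>R propagator (fst q) (snd q) (f (snd q))"

locale small_data =
  fixes \<psi> :: "real^3 \<Rightarrow> real" and f :: "real^3 \<Rightarrow> field" and e :: real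
  assumes lp: "littlewood_paley \<psi>"
    and f_measurable [measurable]: "f \<in> borel_measurable borel"
    and f_weighted: "(\<integral>\<^sup>+\<xi>. ennreal (norm (f \<xi>) / norm \<xi>) \<partial>lborel) < \<infinity>"
    and f_symmetric: "f (- \<xi>) = cnjv (f \<xi>)"
    and e_nonneg: "0 \<le> e" and e_small: "16 * 648\<^sup>2 * e \<le> 1"
    and f_small: "energy (heat_majorant f) \<le> ennreal e"

lemma heat_majorant_measurable:
  assumes [measurable]: "f \<in> borel_measurable borel"
  shows "heat_majorant f \<in> borel_measurable spacetime"
  unfolding heat_majorant_def[abs_def] by measurable

lemma linear_part_measurable:
  assumes [measurable]: "f \<in> borel_measurable borel"
  shows "linear_part f \<in> borel_measurable spacetime"
  unfolding linear_part_def[abs_def] by measurable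

lemma norm_linear_part_le: "ennreal (norm (linear_part f q)) \<le> heat_majorant f q"
  unfolding linear_part_def heat_majorant_def
  using norm_propagator_le[of "fst q" "snd q" "f (snd q)"] by (auto simp: indicator_def intro!: ennreal_leI)

sublocale small_data \<subseteq> bilinear_duhamel 648 "heat_majorant f" "linear_part f" micropolar_kernel
proof (rule bilinear_duhamel.intro)
  show "energy (majorant 648 (heat_majorant f)) < \<infinity>"
    using energy_majorant_le[OF heat_majorant_measurable[OF f_measurable], of 648 e] e_nonneg e_small f_small
    by (auto intro: le_less_trans)
  fix g h :: "real \<times> (real^3) \<Rightarrow> field"
  assume [measurable]: "g \<in> borel_measurable spacetime" "h \<in> borel_measurable spacetime"
  show "(\<lambda>(q, p). micropolar_kernel (fst q) (fst p) (snd q) (g (fst p, snd q - snd p)) (h p))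
    \<in> borel_measurable (spacetime \<Otimes>\<^sub>M spacetime)"
    unfolding split_beta by measurable
qed (simp_all only: heat_majorant_measurable linear_part_measurable norm_linear_part_le bounded_bilinear_kernel
  norm_kernel_le f_measurable zero_le_numeral)

context small_data
begin

lemma energy_M_le: "energy M \<le> ennreal (4 * e)"
  using energy_majorant_le[OF heat_majorant_measurable[OF f_measurable], of 648 e] e_nonneg e_small f_small by simp

lemma pairing_M_finite: "pairing M M < \<infinity>"
proof -
  have "(pairing M M)\<^sup>2 \<le> energy M * energy M" by (rule pairing_square_le) measurable
  also have "\<dots> < \<infinity>" using energy_finite by (simp add: ennreal_mult_less_top)
  finally have "(pairing M M)\<^sup>2 < \<infinity>" .
  moreover have "(top :: ennreal)\<^sup>2 = top" by (simp add: power2_eq_square ennreal_top_mult)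
  ultimately show ?thesis by (cases "pairing M M = top") (auto simp: less_top)
qed

lemma weighted_M_finite: "(\<integral>\<^sup>+\<xi>. M (t, \<xi>) * ennreal (1 / norm \<xi>) \<partial>lborel) < \<infinity>"
proof -
  note [measurable] = heat_majorant_measurable[OF f_measurable]
  note [measurable] = majorant_product_measurable[OF M_measurable M_measurable, of 648]
  have "(\<integral>\<^sup>+\<xi>. M (t, \<xi>) * ennreal (1 / norm \<xi>) \<partial>lborel)
     = (\<integral>\<^sup>+\<xi>. heat_majorant f (t, \<xi>) * ennreal (1 / norm \<xi>) + majorant_product 648 M M (t, \<xi>) * ennreal (1 / norm \<xi>) \<partial>lborel)"
    by (subst M_eq) (simp add: distrib_right)
  also have "\<dots> = (\<integral>\<^sup>+\<xi>. heat_majorant f (t, \<xi>) * ennreal (1 / norm \<xi>) \<partial>lborel)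
      + (\<integral>\<^sup>+\<xi>. majorant_product 648 M M (t, \<xi>) * ennreal (1 / norm \<xi>) \<partial>lborel)"
    by (rule nn_integral_add) measurable
  also have "\<dots> \<le> (\<integral>\<^sup>+\<xi>. ennreal (norm (f \<xi>) / norm \<xi>) \<partial>lborel) + ennreal 648 * pairing M M"
  proof (intro add_mono weighted_majorant_product_le nn_integral_mono M_measurable)
    fix \<xi>
    show "heat_majorant f (t, \<xi>) * ennreal (1 / norm \<xi>) \<le> ennreal (norm (f \<xi>) / norm \<xi>)"
    proof (cases "0 \<le> t")
      case True
      then have "exp (- t * (norm \<xi>)\<^sup>2 / 2) * norm (f \<xi>) * (1 / norm \<xi>) \<le> 1 * norm (f \<xi>) * (1 / norm \<xi>)"
        by (intro mult_right_mono) auto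
      then show ?thesis using True by (auto simp: heat_majorant_def ennreal_leI simp flip: ennreal_mult)
    qed (simp add: heat_majorant_def)
  qed simp
  also have "\<dots> < \<infinity>"
    using f_weighted pairing_M_finite by (auto simp: ennreal_mult_less_top)
  finally show ?thesis .
qed

text \<open>This holds on every slice, not only on almost every one: the weighted norm is bounded
  uniformly in time.\<close>

lemma AE_M_finite_slice: "AE \<xi> in lborel. M (t, \<xi>) < \<infinity>"
proof -
  have "AE \<xi> in lborel. M (t, \<xi>) * ennreal (1 / norm \<xi>) \<noteq> \<infinity>"
  proof (rule nn_integral_PInf_AE)
    show "(\<integral>\<^sup>+\<xi>. M (t, \<xi>) * ennreal (1 / norm \<xi>) \<partial>lborel) \<noteq> \<infinity>"
      using weighted_M_finite[of t] by (simp add: less_top)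
  qed measurable
  moreover have "AE \<xi> in lborel. \<xi> \<noteq> (0::real^3)" by (rule AE_lborel_singleton)
  ultimately show ?thesis
    by eventually_elim (auto simp: ennreal_mult_eq_top_iff less_top ennreal_eq_0_iff)
qed

lemma weighted_norm_solution: "weighted_norm (\<lambda>\<xi>. solution (t, \<xi>) $ i) < \<infinity>"
proof -
  have "weighted_norm (\<lambda>\<xi>. solution (t, \<xi>) $ i) \<le> (\<integral>\<^sup>+\<xi>. M (t, \<xi>) * ennreal (1 / norm \<xi>) \<partial>lborel)"
    unfolding weighted_norm_def
  proof (intro nn_integral_mono)
    fix \<xi>
    have "ennreal (norm (solution (t, \<xi>) $ i) / norm \<xi>) \<le> ennreal (norm (solution (t, \<xi>)) * (1 / norm \<xi>))"
      by (intro ennreal_leI) (simp add: divide_right_mono norm_component_le)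
    also have "\<dots> = ennreal (norm (solution (t, \<xi>))) * ennreal (1 / norm \<xi>)" by (rule ennreal_mult) auto
    also have "\<dots> \<le> M (t, \<xi>) * ennreal (1 / norm \<xi>)" by (intro mult_right_mono norm_solution_le) auto
    finally show "ennreal (norm (solution (t, \<xi>) $ i) / norm \<xi>) \<le> M (t, \<xi>) * ennreal (1 / norm \<xi>)" .
  qed
  then show ?thesis using weighted_M_finite by (rule le_less_trans)
qed

lemma solution_slice_measurable [measurable]: "(\<lambda>\<xi>. solution (t, \<xi>)) \<in> borel_measurable borel"
  by measurable

lemma admissible_solution: "admissible (\<lambda>\<xi>. solution (t, \<xi>) $ i)"
  using weighted_norm_solution unfolding weighted_norm_def
  by (intro admissible_if_weighted) measurable

text \<open>Reflecting the integration variable \<open>\<eta>\<close> transports the symmetry from one iterate to the next.\<close>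

lemma picard_symmetric: "picard k (t, - \<xi>) = cnjv (picard k (t, \<xi>))"
proof (induction k arbitrary: t \<xi>)
  case 0 then show ?case by (simp add: vec_eq_iff)
next
  case (Suc k)
  have lin: "linear_part f (t, - \<xi>) = cnjv (linear_part f (t, \<xi>))"
    unfolding linear_part_def fst_conv snd_conv f_symmetric propagator_cnjv[symmetric] linear_scale[OF linear_cnjv] ..
  let ?R = "\<lambda>(\<tau>, \<eta>). (\<tau>::real, - \<eta>::real^3)"
  have R: "distr spacetime (borel \<Otimes>\<^sub>M borel) ?R = lborel \<Otimes>\<^sub>M lborel"
  proof -
    have 1: "distr lborel borel (\<lambda>\<eta>. - \<eta>) = (lborel :: (real^3) measure)"
      using distr_lborel_reflect[of "0::real^3"] by simp
    have 2: "distr lborel borel (\<lambda>\<tau>. \<tau>) = (lborel :: real measure)"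
      using distr_id2[of borel "lborel :: real measure"] by (simp add: id_def)
    show ?thesis
      using pair_measure_distr[of "\<lambda>\<tau>::real. \<tau>" lborel borel "\<lambda>\<eta>::real^3. - \<eta>" lborel borel]
      unfolding 1 2 by (simp add: sigma_finite_lborel)
  qed
  have "duhamel (picard k) (picard k) (t, - \<xi>)
      = (LINT p|distr spacetime (borel \<Otimes>\<^sub>M borel) ?R. integrand (picard k) (picard k) (t, - \<xi>) p)"
    unfolding duhamel_def R ..
  also have "\<dots> = (LINT p|spacetime. integrand (picard k) (picard k) (t, - \<xi>) (?R p))"
  proof (rule integral_distr)
    show "integrand (picard k) (picard k) (t, - \<xi>) \<in> borel_measurable (borel \<Otimes>\<^sub>M borel)"
    proof -
      have "measurable (borel \<Otimes>\<^sub>M borel) borel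
          = measurable (lborel \<Otimes>\<^sub>M lborel :: (real \<times> (real^3)) measure) (borel :: field measure)"
        by (intro measurable_cong_sets sets_pair_measure_cong) simp_all
      with integrand_measurable[OF picard_measurable picard_measurable, of k k "(t, - \<xi>)"]
      show ?thesis by (simp only:)
    qed
  qed measurable
  also have "\<dots> = (LINT p|spacetime. cnjv (integrand (picard k) (picard k) (t, \<xi>) p))"
  proof (intro Bochner_Integration.integral_cong refl)
    fix p :: "real \<times> (real^3)"
    obtain \<tau> \<eta> where p: "p = (\<tau>, \<eta>)" by (cases p)
    have "- \<xi> - - \<eta> = - (\<xi> - \<eta>)" by simp
    then show "integrand (picard k) (picard k) (t, - \<xi>) (?R p) = cnjv (integrand (picard k) (picard k) (t, \<xi>) p)"
      unfolding p integrand_def prod.case fst_conv snd_conv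
      by (simp only: Suc kernel_cnjv linear_scale[OF linear_cnjv])
  qed
  also have "\<dots> = cnjv (duhamel (picard k) (picard k) (t, \<xi>))"
    unfolding duhamel_def
  proof (rule integral_bounded_linear')
    show "bounded_linear (cnjv :: field \<Rightarrow> field)" "bounded_linear (cnjv :: field \<Rightarrow> field)"
      using linear_cnjv linear_conv_bounded_linear by blast+
    show "\<forall>x::field. cnjv (cnjv x) = x" by (simp add: vec_eq_iff)
  qed
  finally show ?case
    using lin by (simp add: linear_diff[OF linear_cnjv])
qed

lemma solution_symmetric: "AE \<xi> in lborel. solution (t, - \<xi>) = cnjv (solution (t, \<xi>))"
  using AE_M_finite_slice[of t] AE_lborel_reflect[OF AE_M_finite_slice[of t], of 0]
proof eventually_elim
  case (elim \<xi>)
  have "(\<lambda>k. picard k (t, - \<xi>)) \<longlonglongrightarrow> solution (t, - \<xi>)" using elim by (intro picard_convergent) simp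
  moreover have "(\<lambda>k. picard k (t, - \<xi>)) \<longlonglongrightarrow> cnjv (solution (t, \<xi>))"
    unfolding picard_symmetric
    by (rule bounded_linear.tendsto[OF linear_conv_bounded_linear[THEN iffD1, OF linear_cnjv] picard_convergent])
      (rule elim(1))
  ultimately show ?case by (rule LIMSEQ_unique)
qed

end

section \<open>The solution as a mild solution\<close>

lemma has_fourier_cong:
  assumes g: "admissible g" and T: "\<And>f. schwartz f \<Longrightarrow> T f = dist_of g f"
    and h: "AE \<xi> in lborel. g \<xi> = h \<xi>" "h \<in> borel_measurable borel"
  shows "has_fourier T h"
proof -
  have adm: "admissible h" by (rule admissible_cong_AE[OF h(1) g h(2)])
  have T': "T f = dist_of h f" if "schwartz f" for f
    using T[OF that] dist_of_cong_AE[OF h(1) admissible_measurable[OF g] h(2) that] by simp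
  show ?thesis
    unfolding has_fourier_def
    using tempered_cong[OF tempered_dist_of[OF adm] T'] locally_integrable_if_admissible[OF adm]
      has_fourier_dist_of[OF adm]
    by (auto simp: T' has_fourier_def schwartz_fourier test_function_schwartz)
qed

lemma sh_of_cong_AE:
  assumes "AE \<xi> in lborel. g \<xi> = h \<xi>" "admissible g" "h \<in> borel_measurable borel"
  shows "sh_of g = sh_of h"
proof -
  have "represents (dist_of h) (sh_of g)"
    by (rule represents_sh_of[OF assms(2)])
      (rule dist_of_cong_AE[OF assms(1) admissible_measurable[OF assms(2)] assms(3), symmetric])
  then show ?thesis by (simp add: represents_def sh_of_def)
qed

lemma integrable_convolution_kernel:
  fixes g h :: "real^3 \<Rightarrow> complex"
  assumes g: "integrable lborel g" and h: "integrable lborel h"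
  shows "integrable (lborel \<Otimes>\<^sub>M lborel) (\<lambda>(\<eta>, \<xi>). exp (- \<i> * of_real (\<xi> \<bullet> x)) * (g (\<xi> - \<eta>) * h \<eta>))"
proof -
  have [measurable]: "g \<in> borel_measurable borel" "h \<in> borel_measurable borel"
    using g h by (auto simp: integrable_iff_bounded)
  have tr: "integrable lborel (\<lambda>\<xi>. g (\<xi> - \<eta>))" for \<eta>
    using integrable_affine[OF g, of 1 "- \<eta>"] by simp
  have norm_tr: "(LINT \<xi>|lborel. norm (g (\<xi> - \<eta>))) = (LINT \<xi>|lborel. norm (g \<xi>))" for \<eta>
    using integral_translate[of "\<lambda>\<xi>. norm (g \<xi>)" "- \<eta>"] by simp
  show ?thesis
  proof (rule lborel_pair.Fubini_integrable)
    show "(\<lambda>(\<eta>, \<xi>). exp (- \<i> * of_real (\<xi> \<bullet> x)) * (g (\<xi> - \<eta>) * h \<eta>)) \<in> borel_measurable (lborel \<Otimes>\<^sub>M lborel)"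
      by measurable
    show "integrable lborel (\<lambda>\<eta>. LINT \<xi>|lborel. norm (case (\<eta>, \<xi>) of (\<eta>, \<xi>) \<Rightarrow> exp (- \<i> * of_real (\<xi> \<bullet> x)) * (g (\<xi> - \<eta>) * h \<eta>)))"
      using h by (simp add: norm_mult norm_tr)
    show "AE \<eta> in lborel. integrable lborel (\<lambda>\<xi>. case (\<eta>, \<xi>) of (\<eta>, \<xi>) \<Rightarrow> exp (- \<i> * of_real (\<xi> \<bullet> x)) * (g (\<xi> - \<eta>) * h \<eta>))"
    proof (rule AE_I2)
      fix \<eta>
      have "integrable lborel (\<lambda>\<xi>. g (\<xi> - \<eta>) * h \<eta>)" by (intro integrable_mult_left tr)
      from integrable_char_mult[OF this, of x]
      show "integrable lborel (\<lambda>\<xi>. case (\<eta>, \<xi>) of (\<eta>, \<xi>) \<Rightarrow> exp (- \<i> * of_real (\<xi> \<bullet> x)) * (g (\<xi> - \<eta>) * h \<eta>))" by simp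
    qed
  qed
qed

lemma integrable_convolution:
  fixes g h :: "real^3 \<Rightarrow> complex"
  assumes "integrable lborel g" "integrable lborel h"
  shows "integrable lborel (\<lambda>\<xi>. LINT \<eta>|lborel. g (\<xi> - \<eta>) * h \<eta>)"
  using lborel_pair.integrable_snd[OF integrable_convolution_kernel[OF assms, of 0]] by simp

text \<open>Products in space are convolutions in frequency. The factor \<open>1 / (2 \<pi>)\<^sup>3\<close> is the one contained in
  \<open>flux\<close>.\<close>

lemma Finv_convolution:
  fixes g h :: "real^3 \<Rightarrow> complex"
  assumes g: "integrable lborel g" and h: "integrable lborel h"
  shows "Finv (\<lambda>\<xi>. of_real (1 / (2 * pi) ^ 3) * (LINT \<eta>|lborel. g (\<xi> - \<eta>) * h \<eta>)) x = Finv g x * Finv h x"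
proof -
  have [measurable]: "g \<in> borel_measurable borel" using g by (auto simp: integrable_iff_bounded)
  let ?E = "\<lambda>\<xi>. exp (- \<i> * complex_of_real (\<xi> \<bullet> - x))"
  have "fourier (\<lambda>\<xi>. LINT \<eta>|lborel. g (\<xi> - \<eta>) * h \<eta>) (- x)
      = (LINT \<xi>|lborel. LINT \<eta>|lborel. ?E \<xi> * (g (\<xi> - \<eta>) * h \<eta>))"
    unfolding fourier_def integral_mult_right_zero ..
  also have "\<dots> = (LINT \<eta>|lborel. LINT \<xi>|lborel. ?E \<xi> * (g (\<xi> - \<eta>) * h \<eta>))"
    using lborel_pair.Fubini_integral[OF integrable_convolution_kernel[OF g h, of "- x"]] by simp
  also have "\<dots> = (LINT \<eta>|lborel. fourier g (- x) * (?E \<eta> * h \<eta>))"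
  proof (intro Bochner_Integration.integral_cong refl)
    fix \<eta>
    have "(LINT \<xi>|lborel. ?E \<xi> * (g (\<xi> - \<eta>) * h \<eta>)) = (LINT \<xi>|lborel. (?E (\<xi> - \<eta>) * g (\<xi> - \<eta>)) * (?E \<eta> * h \<eta>))"
    proof (intro Bochner_Integration.integral_cong refl)
      fix \<xi>
      have "?E \<xi> = ?E (\<xi> - \<eta>) * ?E \<eta>"
        unfolding exp_add[symmetric] by (rule arg_cong[where f=exp]) (simp add: inner_diff_left algebra_simps)
      then show "?E \<xi> * (g (\<xi> - \<eta>) * h \<eta>) = (?E (\<xi> - \<eta>) * g (\<xi> - \<eta>)) * (?E \<eta> * h \<eta>)" by simp
    qed
    also have "\<dots> = (LINT \<xi>|lborel. ?E (\<xi> + (- \<eta>)) * g (\<xi> + (- \<eta>))) * (?E \<eta> * h \<eta>)"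
      by (simp only: integral_mult_left_zero diff_conv_add_uminus)
    also have "(LINT \<xi>|lborel. ?E (\<xi> + (- \<eta>)) * g (\<xi> + (- \<eta>))) = (LINT \<xi>|lborel. ?E \<xi> * g \<xi>)"
      by (rule integral_translate) measurable
    finally show "(LINT \<xi>|lborel. ?E \<xi> * (g (\<xi> - \<eta>) * h \<eta>)) = fourier g (- x) * (?E \<eta> * h \<eta>)"
      by (simp only: fourier_def)
  qed
  also have "\<dots> = fourier g (- x) * fourier h (- x)"
    unfolding fourier_def[of h] by (rule integral_mult_right_zero)
  finally show ?thesis unfolding Finv_def fourier_scale by simp
qed

context small_data
begin

text \<open>The Fourier transform of the divergence of \<open>u \<otimes> U\<close> at time \<open>\<tau>\<close>.\<close>

definition flux_conv :: "real \<Rightarrow> real^3 \<Rightarrow> field" where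
  "flux_conv \<tau> \<xi> = (LINT \<eta>|lborel. flux \<xi> (solution (\<tau>, \<xi> - \<eta>)) (solution (\<tau>, \<eta>)))"

text \<open>The integrand of the Duhamel term at frequency \<open>\<xi>\<close>, after the integration over \<open>\<eta>\<close>.\<close>

definition force :: "real \<Rightarrow> real \<Rightarrow> real^3 \<Rightarrow> field" where
  "force t \<tau> \<xi> = indicator {0..t} \<tau> *\<^sub>R propagator (t - \<tau>) \<xi> (proj \<xi> (flux_conv \<tau> \<xi>))"

lemma M_conv_measurable [measurable]: "space_conv M M \<in> borel_measurable spacetime"
  by (rule space_conv_measurable) measurable

lemma flux_conv_measurable [measurable]: "(\<lambda>p. flux_conv (fst p) (snd p)) \<in> borel_measurable spacetime"
  unfolding flux_conv_def by measurable

lemma flux_conv_slice_measurable [measurable (raw)]: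
  assumes "g \<in> borel_measurable N"
  shows "(\<lambda>x. flux_conv \<tau> (g x)) \<in> borel_measurable N"
proof -
  have "flux_conv \<tau> \<in> borel_measurable borel"
    using measurable_compose[OF measurable_Pair1'[of \<tau> lborel lborel] flux_conv_measurable] by simp
  then show ?thesis by (rule measurable_compose[OF assms])
qed

lemma force_measurable [measurable]: "(\<lambda>p. force t (fst p) (snd p)) \<in> borel_measurable spacetime"
  unfolding force_def by measurable

lemma norm_flux_solution_le:
  "ennreal (norm (flux \<xi> (solution (\<tau>, \<xi> - \<eta>)) (solution (\<tau>, \<eta>)))) \<le> ennreal (18 * norm \<xi>) * (M (\<tau>, \<xi> - \<eta>) * M (\<tau>, \<eta>))"
proof -
  have "ennreal (norm (flux \<xi> (solution (\<tau>, \<xi> - \<eta>)) (solution (\<tau>, \<eta>))))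
    \<le> ennreal (18 * norm \<xi> * (norm (solution (\<tau>, \<xi> - \<eta>)) * norm (solution (\<tau>, \<eta>))))"
    by (intro ennreal_leI norm_flux_le)
  also have "\<dots> = ennreal (18 * norm \<xi>) * (ennreal (norm (solution (\<tau>, \<xi> - \<eta>))) * ennreal (norm (solution (\<tau>, \<eta>))))"
    by (simp add: ennreal_mult)
  also have "\<dots> \<le> ennreal (18 * norm \<xi>) * (M (\<tau>, \<xi> - \<eta>) * M (\<tau>, \<eta>))"
    by (intro mult_left_mono mult_mono norm_solution_le) auto
  finally show ?thesis .
qed

lemma nn_integral_flux_le:
  "(\<integral>\<^sup>+\<eta>. ennreal (norm (flux \<xi> (solution (\<tau>, \<xi> - \<eta>)) (solution (\<tau>, \<eta>)))) \<partial>lborel)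
    \<le> ennreal (18 * norm \<xi>) * space_conv M M (\<tau>, \<xi>)"
proof -
  have "(\<integral>\<^sup>+\<eta>. ennreal (norm (flux \<xi> (solution (\<tau>, \<xi> - \<eta>)) (solution (\<tau>, \<eta>)))) \<partial>lborel)
    \<le> (\<integral>\<^sup>+\<eta>. ennreal (18 * norm \<xi>) * (M (\<tau>, \<xi> - \<eta>) * M (\<tau>, \<eta>)) \<partial>lborel)"
    by (intro nn_integral_mono norm_flux_solution_le)
  also have "\<dots> = ennreal (18 * norm \<xi>) * space_conv M M (\<tau>, \<xi>)"
    unfolding space_conv_def fst_conv snd_conv by (rule nn_integral_cmult) measurable
  finally show ?thesis .
qed

lemma norm_flux_conv_le: "ennreal (norm (flux_conv \<tau> \<xi>)) \<le> ennreal (18 * norm \<xi>) * space_conv M M (\<tau>, \<xi>)"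
  unfolding flux_conv_def by (rule order_trans[OF ennreal_norm_integral_le nn_integral_flux_le])

lemma norm_propagator_proj_le:
  assumes "0 \<le> s"
  shows "ennreal (norm (propagator s \<xi> (proj \<xi> (flux_conv \<tau> \<xi>)))) \<le> ennreal (648 * norm \<xi>) * space_conv M M (\<tau>, \<xi>)"
proof -
  have "exp (- s * (norm \<xi>)\<^sup>2 / 2) \<le> 1" using assms by simp
  then have "norm (propagator s \<xi> (proj \<xi> (flux_conv \<tau> \<xi>))) \<le> 1 * norm (proj \<xi> (flux_conv \<tau> \<xi>))"
    by (intro order_trans[OF norm_propagator_le[OF assms]] mult_right_mono) auto
  also have "\<dots> \<le> 36 * norm (flux_conv \<tau> \<xi>)" using norm_proj_le by simp
  finally have "ennreal (norm (propagator s \<xi> (proj \<xi> (flux_conv \<tau> \<xi>)))) \<le> ennreal (36 * norm (flux_conv \<tau> \<xi>))"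
    by (rule ennreal_leI)
  also have "\<dots> = ennreal 36 * ennreal (norm (flux_conv \<tau> \<xi>))" by (rule ennreal_mult) auto
  also have "\<dots> \<le> ennreal 36 * (ennreal (18 * norm \<xi>) * space_conv M M (\<tau>, \<xi>))"
    by (intro mult_left_mono norm_flux_conv_le) auto
  also have "\<dots> = ennreal (648 * norm \<xi>) * space_conv M M (\<tau>, \<xi>)"
    by (simp add: mult.assoc[symmetric] del: ennreal_numeral flip: ennreal_mult)
  finally show ?thesis .
qed

lemma norm_force_le: "ennreal (norm (force t \<tau> \<xi>)) \<le> ennreal (648 * norm \<xi>) * space_conv M M (\<tau>, \<xi>)"
  using norm_propagator_proj_le[of "t - \<tau>" \<xi> \<tau>] by (auto simp: force_def indicator_def)

lemma nn_integral_M_conv_slice: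
  "(\<integral>\<^sup>+\<xi>. space_conv M M (\<tau>, \<xi>) \<partial>lborel) = (\<integral>\<^sup>+\<xi>. M (\<tau>, \<xi>) \<partial>lborel) * (\<integral>\<^sup>+\<xi>. M (\<tau>, \<xi>) \<partial>lborel)"
  by (rule nn_integral_space_conv_slice) measurable

lemma AE_M_conv_finite: "AE \<xi> in lborel. (\<integral>\<^sup>+\<tau>. space_conv M M (\<tau>, \<xi>) \<partial>lborel) < \<infinity>"
proof -
  have "(\<integral>\<^sup>+\<xi>. (\<integral>\<^sup>+\<tau>. space_conv M M (\<tau>, \<xi>) \<partial>lborel) \<partial>lborel) = (\<integral>\<^sup>+\<tau>. (\<integral>\<^sup>+\<xi>. space_conv M M (\<tau>, \<xi>) \<partial>lborel) \<partial>lborel)"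
    by (rule lborel_pair.Fubini') measurable
  also have "\<dots> = pairing M M" unfolding pairing_def nn_integral_M_conv_slice ..
  finally have "(\<integral>\<^sup>+\<xi>. (\<integral>\<^sup>+\<tau>. space_conv M M (\<tau>, \<xi>) \<partial>lborel) \<partial>lborel) \<noteq> \<infinity>"
    using pairing_M_finite by (simp add: less_top)
  then have "AE \<xi> in lborel. (\<integral>\<^sup>+\<tau>. space_conv M M (\<tau>, \<xi>) \<partial>lborel) \<noteq> \<infinity>"
    by (rule nn_integral_PInf_AE[rotated]) measurable
  then show ?thesis by (simp add: less_top)
qed

lemma force_slice_measurable [measurable]: "(\<lambda>\<tau>. force t \<tau> \<xi>) \<in> borel_measurable borel"
  using measurable_compose[OF measurable_Pair2'[of \<xi> lborel lborel] force_measurable[of t]] by simp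

lemma integrable_force:
  assumes "(\<integral>\<^sup>+\<tau>. space_conv M M (\<tau>, \<xi>) \<partial>lborel) < \<infinity>"
  shows "integrable lborel (\<lambda>\<tau>. force t \<tau> \<xi>)"
proof (rule integrableI_bounded)
  have "(\<integral>\<^sup>+\<tau>. ennreal (norm (force t \<tau> \<xi>)) \<partial>lborel) \<le> (\<integral>\<^sup>+\<tau>. ennreal (648 * norm \<xi>) * space_conv M M (\<tau>, \<xi>) \<partial>lborel)"
    by (intro nn_integral_mono norm_force_le)
  also have "\<dots> = ennreal (648 * norm \<xi>) * (\<integral>\<^sup>+\<tau>. space_conv M M (\<tau>, \<xi>) \<partial>lborel)"
    by (rule nn_integral_cmult) measurable
  also have "\<dots> < \<infinity>" using assms by (simp add: ennreal_mult_less_top)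
  finally show "(\<integral>\<^sup>+\<tau>. ennreal (norm (force t \<tau> \<xi>)) \<partial>lborel) < \<infinity>" .
qed measurable

lemma duhamel_eq_force: "AE \<xi> in lborel. duhamel solution solution (t, \<xi>) $ i = (LINT \<tau>|lborel. force t \<tau> \<xi> $ i)"
  using AE_M_finite_slice[of t] AE_M_conv_finite
proof eventually_elim
  case (elim \<xi>)
  have int: "integrable spacetime (integrand solution solution (t, \<xi>))"
    by (intro integrable_integrand norm_solution_le elim) measurable
  have fin: "AE \<tau> in lborel. space_conv M M (\<tau>, \<xi>) \<noteq> \<infinity>"
    using elim(2) by (intro nn_integral_PInf_AE) (auto simp: less_top)
  have "duhamel solution solution (t, \<xi>) = (LINT \<tau>|lborel. LINT \<eta>|lborel. integrand solution solution (t, \<xi>) (\<tau>, \<eta>))"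
    unfolding duhamel_def by (rule lborel_pair.integral_fst'[OF int, symmetric])
  also have "\<dots> = (LINT \<tau>|lborel. force t \<tau> \<xi>)"
  proof (rule integral_cong_AE)
    have [measurable]: "integrand solution solution (t, \<xi>) \<in> borel_measurable spacetime"
      by (rule integrand_measurable) measurable
    show "(\<lambda>\<tau>. LINT \<eta>|lborel. integrand solution solution (t, \<xi>) (\<tau>, \<eta>)) \<in> borel_measurable lborel" by measurable
    show "AE \<tau> in lborel. (LINT \<eta>|lborel. integrand solution solution (t, \<xi>) (\<tau>, \<eta>)) = force t \<tau> \<xi>"
      using fin
    proof eventually_elim
      case (elim \<tau>)
      let ?T = "\<lambda>v. indicat_real {0..t} \<tau> *\<^sub>R propagator (t - \<tau>) \<xi> (proj \<xi> v)"
      have "linear ?T"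
        using linear_compose[OF linear_compose[OF linear_proj linear_propagator], of "\<lambda>v. indicat_real {0..t} \<tau> *\<^sub>R v"]
        by (simp add: o_def linear_iff scaleR_add_right)
      then have T: "bounded_linear ?T" by (simp add: linear_conv_bounded_linear)
      have "integrable lborel (\<lambda>\<eta>. flux \<xi> (solution (\<tau>, \<xi> - \<eta>)) (solution (\<tau>, \<eta>)))"
      proof (rule integrableI_bounded)
        show "(\<integral>\<^sup>+\<eta>. ennreal (norm (flux \<xi> (solution (\<tau>, \<xi> - \<eta>)) (solution (\<tau>, \<eta>)))) \<partial>lborel) < \<infinity>"
          using elim by (intro le_less_trans[OF nn_integral_flux_le]) (auto simp: ennreal_mult_less_top less_top)
      qed measurable
      from integral_bounded_linear[OF T this] show ?case
        by (simp add: integrand_def force_def flux_conv_def micropolar_kernel_def)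
    qed
  qed measurable
  finally have d: "duhamel solution solution (t, \<xi>) = (LINT \<tau>|lborel. force t \<tau> \<xi>)" .
  from integral_bounded_linear[OF bounded_linear_vec_nth[of i] integrable_force[OF elim(2)]] show ?case unfolding d by simp
qed

lemma solution_eq_force:
  assumes "0 \<le> t"
  shows "AE \<xi> in lborel. solution (t, \<xi>) $ i = propagator t \<xi> (f \<xi>) $ i - (LINT \<tau>|lborel. force t \<tau> \<xi> $ i)"
  using AE_M_finite_slice[of t] duhamel_eq_force[of t i]
proof eventually_elim
  case (elim \<xi>)
  then show ?case using assms by (simp add: solution_eq linear_part_def)
qed

lemma admissible_linear: "0 \<le> t \<Longrightarrow> admissible (\<lambda>\<xi>. propagator t \<xi> (f \<xi>) $ i)"
proof (rule admissible_if_weighted)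
  assume t: "0 \<le> t"
  have "norm (propagator t \<xi> (f \<xi>) $ i) \<le> norm (f \<xi>)" for \<xi>
  proof -
    have "norm (propagator t \<xi> (f \<xi>) $ i) \<le> exp (- t * (norm \<xi>)\<^sup>2 / 2) * norm (f \<xi>)"
      by (rule order_trans[OF norm_component_le norm_propagator_le[OF t]])
    also have "\<dots> \<le> 1 * norm (f \<xi>)" using t by (intro mult_right_mono) auto
    finally show ?thesis by simp
  qed
  then have "(\<integral>\<^sup>+\<xi>. ennreal (norm (propagator t \<xi> (f \<xi>) $ i) / norm \<xi>) \<partial>lborel) \<le> (\<integral>\<^sup>+\<xi>. ennreal (norm (f \<xi>) / norm \<xi>) \<partial>lborel)"
    by (intro nn_integral_mono ennreal_leI divide_right_mono) auto
  then show "(\<integral>\<^sup>+\<xi>. ennreal (norm (propagator t \<xi> (f \<xi>) $ i) / norm \<xi>) \<partial>lborel) < \<infinity>"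
    using f_weighted by (rule le_less_trans)
qed measurable

definition data :: "sh^(3 + 3)" where
  "data = (\<chi> i. sh_of (\<lambda>\<xi>. f \<xi> $ i))"

definition evolution :: "real \<Rightarrow> sh^(3 + 3)" where
  "evolution t = (\<chi> i. sh_of (\<lambda>\<xi>. solution (t, \<xi>) $ i))"

lemma admissible_data: "admissible (\<lambda>\<xi>. f \<xi> $ i)"
  using admissible_linear[of 0 i] by (simp add: propagator_0)

lemma fhat_data: "AE \<xi> in lborel. (\<chi> j. fhat (data $ j) \<xi>) = f \<xi>"
proof -
  have "AE \<xi> in lborel. \<forall>j\<in>UNIV. fhat (data $ j) \<xi> = f \<xi> $ j"
    unfolding data_def
    by (subst AE_ball_countable) (auto intro!: fhat_sh_of(1)[OF lp admissible_data] countable_finite)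
  then show ?thesis by (rule eventually_mono) (simp add: vec_eq_iff)
qed

lemma integrable_solution_slice:
  assumes "(\<integral>\<^sup>+\<xi>. M (\<tau>, \<xi>) \<partial>lborel) < \<infinity>"
  shows "integrable lborel (\<lambda>\<xi>. solution (\<tau>, \<xi>) $ i)"
proof (rule integrableI_bounded)
  have "(\<integral>\<^sup>+\<xi>. ennreal (norm (solution (\<tau>, \<xi>) $ i)) \<partial>lborel) \<le> (\<integral>\<^sup>+\<xi>. M (\<tau>, \<xi>) \<partial>lborel)"
    by (intro nn_integral_mono order_trans[OF ennreal_leI[OF norm_component_le] norm_solution_le])
  then show "(\<integral>\<^sup>+\<xi>. ennreal (norm (solution (\<tau>, \<xi>) $ i)) \<partial>lborel) < \<infinity>" using assms by (rule le_less_trans)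
qed measurable

text \<open>A slice of \<open>space_conv M M\<close> is integrable, and one factor \<open>\<bar>\<xi>\<bar>\<close> is allowed in
  \<open>admissible\<close>.\<close>

lemma admissible_frequency_mult:
  assumes [measurable]: "g \<in> borel_measurable borel" and "\<And>\<xi>. ennreal (norm (g \<xi>)) \<le> ennreal (c * norm \<xi>) * space_conv M M (\<tau>, \<xi>)"
    and "(\<integral>\<^sup>+\<xi>. M (\<tau>, \<xi>) \<partial>lborel) < \<infinity>" "0 \<le> c"
  shows "admissible g"
proof -
  have "(\<integral>\<^sup>+\<xi>. ennreal (norm (g \<xi>) / (1 + norm \<xi>)) \<partial>lborel) \<le> (\<integral>\<^sup>+\<xi>. ennreal c * space_conv M M (\<tau>, \<xi>) \<partial>lborel)"
  proof (intro nn_integral_mono)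
    fix \<xi> :: "real^3"
    have "ennreal (norm (g \<xi>) / (1 + norm \<xi>)) = ennreal (norm (g \<xi>)) * ennreal (1 / (1 + norm \<xi>))"
      by (simp flip: ennreal_mult)
    also have "\<dots> \<le> (ennreal (c * norm \<xi>) * space_conv M M (\<tau>, \<xi>)) * ennreal (1 / (1 + norm \<xi>))"
      by (intro mult_right_mono assms) auto
    also have "\<dots> = (ennreal (c * norm \<xi>) * ennreal (1 / (1 + norm \<xi>))) * space_conv M M (\<tau>, \<xi>)"
      by (simp add: mult_ac)
    also have "\<dots> \<le> ennreal c * space_conv M M (\<tau>, \<xi>)"
    proof (intro mult_right_mono)
      have "c * norm \<xi> * (1 / (1 + norm \<xi>)) \<le> c"
        using assms(4) by (simp add: divide_le_eq one_plus_norm_pos distrib_left)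
      then show "ennreal (c * norm \<xi>) * ennreal (1 / (1 + norm \<xi>)) \<le> ennreal c"
        using assms(4) by (simp add: ennreal_leI flip: ennreal_mult)
    qed simp
    finally show "ennreal (norm (g \<xi>) / (1 + norm \<xi>)) \<le> ennreal c * space_conv M M (\<tau>, \<xi>)" .
  qed
  also have "\<dots> = ennreal c * (\<integral>\<^sup>+\<xi>. space_conv M M (\<tau>, \<xi>) \<partial>lborel)" by (rule nn_integral_cmult) measurable
  also have "\<dots> < \<infinity>" unfolding nn_integral_M_conv_slice using assms(3) by (simp add: ennreal_mult_less_top)
  finally show ?thesis unfolding admissible_def by simp
qed

text \<open>On almost every time slice the solution has an integrable Fourier transform, hence it is a bounded
  function and its products are honest functions.\<close>

lemma nonlinearity_evolution:
  assumes fin: "(\<integral>\<^sup>+\<xi>. M (\<tau>, \<xi>) \<partial>lborel) < \<infinity>"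
  shows "nonlinearity_hat (evolution \<tau>) (\<lambda>\<xi>. proj \<xi> (flux_conv \<tau> \<xi>))"
proof -
  let ?s = "\<lambda>i \<xi>. solution (\<tau>, \<xi>) $ i"
  let ?c = "complex_of_real (1 / (2 * pi) ^ 3)"
  let ?q = "\<lambda>k i \<xi>. ?c * (LINT \<eta>|lborel. ?s (Inl k) (\<xi> - \<eta>) * ?s i \<eta>)"
  note s = integrable_solution_slice[OF fin]
  have q: "integrable lborel (?q k i)" for k i by (intro integrable_mult_right integrable_convolution s)
  define a where "a = (\<lambda>x. \<chi> i. Finv (?s i) x)"
  define D where "D = (\<lambda>i \<phi>. \<Sum>k\<in>UNIV. - dist_of (?q k i) (pd k \<phi>))"
  show ?thesis
    unfolding nonlinearity_hat_def
  proof (intro exI conjI allI)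
    fix i :: "3 + 3"
    show "sh_is_function (evolution \<tau> $ i) (\<lambda>x. a x $ i)"
      unfolding sh_is_function_def
    proof (intro exI conjI)
      show "represents (dist_of (?s i)) (evolution \<tau> $ i)"
        unfolding evolution_def vec_lambda_beta by (rule represents_sh_of[OF admissible_solution]) simp
      show "has_fourier (dist_of (?s i)) (?s i)" by (rule has_fourier_dist_of[OF admissible_solution])
      show "is_function (dist_of (?s i)) (\<lambda>x. a x $ i)"
        using is_function_dist_of[OF s] by (simp add: a_def)
    qed
  next
    show "is_div_tensor a D"
      unfolding is_div_tensor_def
    proof (intro exI conjI allI impI)
      fix k :: 3 and i :: "3 + 3"
      have "(\<lambda>x. a x $ Inl k * a x $ i) = Finv (?q k i)"
        unfolding a_def using Finv_convolution[OF s s] by auto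
      then show "is_function (dist_of (?q k i)) (\<lambda>x. a x $ Inl k * a x $ i)"
        using is_function_dist_of[OF q] by simp
    next
      show "D i \<phi> = (\<Sum>k\<in>UNIV. - dist_of (?q k i) (pd k \<phi>))" for i \<phi> by (simp add: D_def)
    qed
  next
    fix i :: "3 + 3"
    have adm: "admissible (\<lambda>\<xi>. flux_conv \<tau> \<xi> $ i)"
    proof (rule admissible_frequency_mult[OF _ _ fin, of _ 18])
      show "ennreal (norm (flux_conv \<tau> \<xi> $ i)) \<le> ennreal (18 * norm \<xi>) * space_conv M M (\<tau>, \<xi>)" for \<xi>
        by (rule order_trans[OF ennreal_leI[OF norm_component_le] norm_flux_conv_le])
    qed simp_all
    have "AE \<xi> in lborel. space_conv M M (\<tau>, \<xi>) \<noteq> \<infinity>"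
    proof (rule nn_integral_PInf_AE)
      show "(\<integral>\<^sup>+\<xi>. space_conv M M (\<tau>, \<xi>) \<partial>lborel) \<noteq> \<infinity>"
        unfolding nn_integral_M_conv_slice using fin by (simp add: ennreal_mult_eq_top_iff less_top)
    qed measurable
    then have eq: "AE \<xi> in lborel. flux_conv \<tau> \<xi> $ i = (\<Sum>k\<in>UNIV. \<i> * of_real (\<xi> $ k) * ?q k i \<xi>)"
    proof eventually_elim
      case (elim \<xi>)
      have "integrable lborel (\<lambda>\<eta>. flux \<xi> (solution (\<tau>, \<xi> - \<eta>)) (solution (\<tau>, \<eta>)))"
      proof (rule integrableI_bounded)
        show "(\<integral>\<^sup>+\<eta>. ennreal (norm (flux \<xi> (solution (\<tau>, \<xi> - \<eta>)) (solution (\<tau>, \<eta>)))) \<partial>lborel) < \<infinity>"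
          using elim by (intro le_less_trans[OF nn_integral_flux_le]) (auto simp: ennreal_mult_less_top less_top)
      qed measurable
      from integral_bounded_linear[OF bounded_linear_vec_nth[of i] this]
      have "flux_conv \<tau> \<xi> $ i = (LINT \<eta>|lborel. flux \<xi> (solution (\<tau>, \<xi> - \<eta>)) (solution (\<tau>, \<eta>)) $ i)"
        by (simp add: flux_conv_def)
      also have "\<dots> = (LINT \<eta>|lborel. (\<Sum>k\<in>UNIV. \<i> * of_real (\<xi> $ k) * (?c * (?s (Inl k) (\<xi> - \<eta>) * ?s i \<eta>))))"
        unfolding flux_def vec_lambda_beta
        by (intro Bochner_Integration.integral_cong refl) (simp only: sum_distrib_left sum_distrib_right mult_ac)
      also have "\<dots> = (\<Sum>k\<in>UNIV. (LINT \<eta>|lborel. \<i> * of_real (\<xi> $ k) * (?c * (?s (Inl k) (\<xi> - \<eta>) * ?s i \<eta>))))"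
      proof (rule Bochner_Integration.integral_sum)
        fix k :: 3
        have "integrable lborel (\<lambda>\<eta>. ?s (Inl k) (\<xi> - \<eta>) * ?s i \<eta>)"
        proof (rule integrableI_bounded)
          have "(\<integral>\<^sup>+\<eta>. ennreal (norm (?s (Inl k) (\<xi> - \<eta>) * ?s i \<eta>)) \<partial>lborel) \<le> space_conv M M (\<tau>, \<xi>)"
            unfolding space_conv_def fst_conv snd_conv norm_mult
            by (intro nn_integral_mono)
              (simp add: ennreal_mult mult_mono order_trans[OF ennreal_leI[OF norm_component_le] norm_solution_le])
          then show "(\<integral>\<^sup>+\<eta>. ennreal (norm (?s (Inl k) (\<xi> - \<eta>) * ?s i \<eta>)) \<partial>lborel) < \<infinity>"
            using elim by (auto simp: less_top intro: le_less_trans)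
        qed measurable
        then show "integrable lborel (\<lambda>\<eta>. \<i> * of_real (\<xi> $ k) * (?c * (?s (Inl k) (\<xi> - \<eta>) * ?s i \<eta>)))"
          by (intro integrable_mult_right)
      qed
      finally show ?case by (simp only: integral_mult_right_zero)
    qed
    have ki: "admissible (\<lambda>\<xi>. \<i> * of_real (\<xi> $ k) * ?q k i \<xi>)" for k
    proof (rule admissible_frequency_mult[OF _ _ fin, of _ 1])
      have [measurable]: "?q k i \<in> borel_measurable borel" using q[of k i] by (simp add: integrable_iff_bounded)
      show "(\<lambda>\<xi>. \<i> * of_real (\<xi> $ k) * ?q k i \<xi>) \<in> borel_measurable borel" by measurable
      fix \<xi>
      have pi1: "1 \<le> (2 * pi) ^ 3" using pi_gt3 by (intro one_le_power) linarith
      have b1: "ennreal (norm (LINT \<eta>|lborel. ?s (Inl k) (\<xi> - \<eta>) * ?s i \<eta>)) \<le> space_conv M M (\<tau>, \<xi>)"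
        unfolding space_conv_def fst_conv snd_conv
        by (intro order_trans[OF ennreal_norm_integral_le] nn_integral_mono)
          (simp add: norm_mult ennreal_mult mult_mono order_trans[OF ennreal_leI[OF norm_component_le] norm_solution_le])
      have "norm (\<i> * of_real (\<xi> $ k) * ?q k i \<xi>) \<le> (1 * norm \<xi>) * norm (LINT \<eta>|lborel. ?s (Inl k) (\<xi> - \<eta>) * ?s i \<eta>)"
      proof -
        have "norm (\<i> * of_real (\<xi> $ k) * ?q k i \<xi>) = \<bar>\<xi> $ k\<bar> * ((1 / (2 * pi) ^ 3) * norm (LINT \<eta>|lborel. ?s (Inl k) (\<xi> - \<eta>) * ?s i \<eta>))"
          by (simp add: norm_mult norm_divide norm_power)
        also have "\<dots> \<le> norm \<xi> * (1 * norm (LINT \<eta>|lborel. ?s (Inl k) (\<xi> - \<eta>) * ?s i \<eta>))"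
          using pi1 by (intro mult_mono component_le_norm_cart mult_right_mono) (auto simp: divide_le_eq)
        finally show ?thesis by simp
      qed
      then have "ennreal (norm (\<i> * of_real (\<xi> $ k) * ?q k i \<xi>))
          \<le> ennreal ((1 * norm \<xi>) * norm (LINT \<eta>|lborel. ?s (Inl k) (\<xi> - \<eta>) * ?s i \<eta>))"
        by (rule ennreal_leI)
      also have "\<dots> = ennreal (1 * norm \<xi>) * ennreal (norm (LINT \<eta>|lborel. ?s (Inl k) (\<xi> - \<eta>) * ?s i \<eta>))"
        by (rule ennreal_mult) auto
      also have "\<dots> \<le> ennreal (1 * norm \<xi>) * space_conv M M (\<tau>, \<xi>)" by (intro mult_left_mono b1) auto
      finally show "ennreal (norm (\<i> * of_real (\<xi> $ k) * ?q k i \<xi>)) \<le> ennreal (1 * norm \<xi>) * space_conv M M (\<tau>, \<xi>)" .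
    qed simp
    show "has_fourier (D i) (\<lambda>\<xi>. flux_conv \<tau> \<xi> $ i)"
    proof (rule has_fourier_cong[OF adm])
      fix \<phi> assume \<phi>: "schwartz \<phi>"
      have "D i \<phi> = (\<Sum>k\<in>UNIV. dist_of (\<lambda>\<xi>. \<i> * of_real (\<xi> $ k) * ?q k i \<xi>) \<phi>)"
        unfolding D_def by (intro sum.cong refl dist_of_pd \<phi>)
      also have "\<dots> = (LINT \<xi>|lborel. (\<Sum>k\<in>UNIV. (\<i> * of_real (\<xi> $ k) * ?q k i \<xi>) * Finv \<phi> \<xi>))"
        unfolding dist_of_def by (rule Bochner_Integration.integral_sum[symmetric]) (rule integrable_dist_of[OF ki \<phi>])
      also have "\<dots> = dist_of (\<lambda>\<xi>. \<Sum>k\<in>UNIV. \<i> * of_real (\<xi> $ k) * ?q k i \<xi>) \<phi>"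
        unfolding dist_of_def sum_distrib_right ..
      also have "\<dots> = dist_of (\<lambda>\<xi>. flux_conv \<tau> \<xi> $ i) \<phi>"
        using eq ki[THEN admissible_measurable] \<phi>
        by (intro dist_of_cong_AE borel_measurable_sum) (auto elim!: eventually_mono)
      finally show "D i \<phi> = dist_of (\<lambda>\<xi>. flux_conv \<tau> \<xi> $ i) \<phi>" .
    qed (auto intro!: measurable_component)
  next
    show "(\<lambda>\<xi>. proj \<xi> (flux_conv \<tau> \<xi>)) = leray_hat (flux_conv \<tau>)"
      by (rule ext) (simp only: leray_hat_eq)
  qed
qed

text \<open>Tested with a Schwartz function, the equation on the Fourier side becomes the weak one by Fubini.
  The double integral converges absolutely because the derivative in the nonlinearity is absorbed by the decay of
  \<open>Finv \<phi>\<close>.\<close>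

theorem mild_evolution: "mild_solution data evolution"
  unfolding mild_solution_def
proof (intro allI impI)
  fix t :: real assume t: "0 \<le> t"
  define V where "V = (\<lambda>i. dist_of (\<lambda>\<xi>. propagator t \<xi> (f \<xi>) $ i))"
  define F where "F = (\<lambda>\<tau> i. dist_of (\<lambda>\<xi>. propagator (t - \<tau>) \<xi> (proj \<xi> (flux_conv \<tau> \<xi>)) $ i))"
  \<comment> \<open>The integrand of the double integral over time and frequency.\<close>
  let ?Z = "\<lambda>i \<phi> p. force t (fst p) (snd p) $ i * Finv \<phi> (snd p)"
  have Z: "integrable spacetime (?Z i \<phi>)" if \<phi>: "schwartz \<phi>" for i \<phi>
  proof (rule integrableI_bounded)
    note [measurable] = Finv_measurable[OF \<phi>]
    show "?Z i \<phi> \<in> borel_measurable spacetime" by measurable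
    define C where "C = inversion_const * schwartz_seminorm 6 \<phi>"
    have C: "norm \<xi> * norm (Finv \<phi> \<xi>) \<le> C" for \<xi>
    proof -
      have "norm \<xi> * norm (Finv \<phi> \<xi>) \<le> (1 + norm \<xi>) * norm (Finv \<phi> \<xi>)" by (intro mult_right_mono) auto
      also have "\<dots> \<le> C" unfolding C_def by (rule Finv_bound[OF \<phi>])
      finally show ?thesis .
    qed
    have "(\<integral>\<^sup>+p. ennreal (norm (?Z i \<phi> p)) \<partial>spacetime) \<le> (\<integral>\<^sup>+p. ennreal (648 * C) * space_conv M M p \<partial>spacetime)"
    proof (intro nn_integral_mono)
      fix p :: "real \<times> (real^3)"
      obtain \<tau> \<xi> where p: "p = (\<tau>, \<xi>)" by (cases p)
      have "ennreal (norm (?Z i \<phi> p)) = ennreal (norm (force t \<tau> \<xi> $ i)) * ennreal (norm (Finv \<phi> \<xi>))"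
        by (simp add: p norm_mult ennreal_mult)
      also have "\<dots> \<le> (ennreal (648 * norm \<xi>) * space_conv M M (\<tau>, \<xi>)) * ennreal (norm (Finv \<phi> \<xi>))"
        by (intro mult_right_mono order_trans[OF ennreal_leI[OF norm_component_le] norm_force_le]) auto
      also have "\<dots> = ennreal (648 * (norm \<xi> * norm (Finv \<phi> \<xi>))) * space_conv M M (\<tau>, \<xi>)"
        by (simp add: ennreal_mult mult_ac)
      also have "\<dots> \<le> ennreal (648 * C) * space_conv M M (\<tau>, \<xi>)"
        using C by (intro mult_right_mono ennreal_leI) auto
      finally show "ennreal (norm (?Z i \<phi> p)) \<le> ennreal (648 * C) * space_conv M M p" by (simp add: p)
    qed
    also have "\<dots> = ennreal (648 * C) * pairing M M"
      by (simp add: nn_integral_cmult nn_integral_space_conv)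
    also have "\<dots> < \<infinity>" using pairing_M_finite by (simp add: ennreal_mult_less_top)
    finally show "(\<integral>\<^sup>+p. ennreal (norm (?Z i \<phi> p)) \<partial>spacetime) < \<infinity>" .
  qed
  have FZ: "indicator {0..t} \<tau> *\<^sub>R F \<tau> i \<phi> = (LINT \<xi>|lborel. ?Z i \<phi> (\<tau>, \<xi>))" for \<tau> i \<phi>
    by (simp add: F_def dist_of_def force_def indicator_def)
  show "\<exists>V F.
     (\<forall>i. has_fourier (V i) (\<lambda>\<xi>. G_hat t (\<lambda>\<xi>. \<chi> j. fhat (data $ j) \<xi>) \<xi> $ i)) \<and>
     (AE \<tau> in lborel. 0 < \<tau> \<and> \<tau> < t \<longrightarrow>
        (\<exists>h. nonlinearity_hat (evolution \<tau>) h \<and>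
             (\<forall>i. has_fourier (F \<tau> i) (\<lambda>\<xi>. G_hat (t - \<tau>) h \<xi> $ i)))) \<and>
     (\<forall>i f. schwartz f \<longrightarrow> set_integrable lborel {0..t} (\<lambda>\<tau>. F \<tau> i f)) \<and>
     (\<forall>i. represents (\<lambda>f. V i f - (LINT \<tau>:{0..t}|lborel. F \<tau> i f)) (evolution t $ i))"
  proof (intro exI[of _ V] exI[of _ F] conjI allI impI)
    fix i :: "3 + 3"
    have [measurable]: "(\<lambda>\<xi>. \<chi> j. fhat (data $ j) \<xi>) \<in> borel_measurable borel"
      using fhat_sh_of(2)[OF lp admissible_data] by (intro measurable_vec_lambda) (simp add: data_def)
    show "has_fourier (V i) (\<lambda>\<xi>. G_hat t (\<lambda>\<xi>. \<chi> j. fhat (data $ j) \<xi>) \<xi> $ i)"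
      unfolding G_hat_eq
    proof (rule has_fourier_cong[OF admissible_linear[OF t]])
      show "V i \<phi> = dist_of (\<lambda>\<xi>. propagator t \<xi> (f \<xi>) $ i) \<phi>" for \<phi> by (simp add: V_def)
      show "AE \<xi> in lborel. propagator t \<xi> (f \<xi>) $ i = propagator t \<xi> (\<chi> j. fhat (data $ j) \<xi>) $ i"
        using fhat_data by (rule eventually_mono) simp
    qed measurable
  next
    show "AE \<tau> in lborel. 0 < \<tau> \<and> \<tau> < t \<longrightarrow>
        (\<exists>h. nonlinearity_hat (evolution \<tau>) h \<and> (\<forall>i. has_fourier (F \<tau> i) (\<lambda>\<xi>. G_hat (t - \<tau>) h \<xi> $ i)))"
      using AE_M_integrable
    proof eventually_elim
      case (elim \<tau>)
      show ?case
      proof (intro impI exI[of _ "\<lambda>\<xi>. proj \<xi> (flux_conv \<tau> \<xi>)"] conjI allI)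
        assume \<tau>: "0 < \<tau> \<and> \<tau> < t"
        show "nonlinearity_hat (evolution \<tau>) (\<lambda>\<xi>. proj \<xi> (flux_conv \<tau> \<xi>))"
          by (rule nonlinearity_evolution[OF elim])
        fix i
        show "has_fourier (F \<tau> i) (\<lambda>\<xi>. G_hat (t - \<tau>) (\<lambda>\<xi>. proj \<xi> (flux_conv \<tau> \<xi>)) \<xi> $ i)"
          unfolding G_hat_eq F_def
        proof (rule has_fourier_dist_of, rule admissible_frequency_mult[OF _ _ elim, of _ 648])
          show "ennreal (norm (propagator (t - \<tau>) \<xi> (proj \<xi> (flux_conv \<tau> \<xi>)) $ i)) \<le> ennreal (648 * norm \<xi>) * space_conv M M (\<tau>, \<xi>)" for \<xi>
            using \<tau> by (intro order_trans[OF ennreal_leI[OF norm_component_le] norm_propagator_proj_le]) simp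
        qed simp_all
      qed
    qed
  next
    fix i \<phi> assume "schwartz \<phi>"
    from lborel_pair.integrable_fst'[OF Z[OF this, of i]]
    show "set_integrable lborel {0..t} (\<lambda>\<tau>. F \<tau> i \<phi>)"
      unfolding set_integrable_def FZ by simp
  next
    fix i :: "3 + 3"
    show "represents (\<lambda>f. V i f - (LINT \<tau>:{0..t}|lborel. F \<tau> i f)) (evolution t $ i)"
      unfolding evolution_def vec_lambda_beta
    proof (rule represents_sh_of[OF admissible_solution])
      fix \<phi> assume \<phi>: "schwartz \<phi>"
      note [measurable] = Finv_measurable[OF \<phi>]
      have Zc: "integrable spacetime (\<lambda>(\<tau>, \<xi>). ?Z i \<phi> (\<tau>, \<xi>))"
        using Z[OF \<phi>, of i] by (simp add: case_prod_beta')
      have "(LINT \<tau>:{0..t}|lborel. F \<tau> i \<phi>) = (LINT \<tau>|lborel. LINT \<xi>|lborel. ?Z i \<phi> (\<tau>, \<xi>))"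
        unfolding set_lebesgue_integral_def FZ ..
      also have "\<dots> = (LINT \<xi>|lborel. LINT \<tau>|lborel. ?Z i \<phi> (\<tau>, \<xi>))"
        by (rule lborel_pair.Fubini_integral[OF Zc, symmetric])
      also have "\<dots> = (LINT \<xi>|lborel. (LINT \<tau>|lborel. force t \<tau> \<xi> $ i) * Finv \<phi> \<xi>)" by simp
      finally have D: "(LINT \<tau>:{0..t}|lborel. F \<tau> i \<phi>) = (LINT \<xi>|lborel. (LINT \<tau>|lborel. force t \<tau> \<xi> $ i) * Finv \<phi> \<xi>)" .
      have iD: "integrable lborel (\<lambda>\<xi>. (LINT \<tau>|lborel. force t \<tau> \<xi> $ i) * Finv \<phi> \<xi>)"
        using lborel_pair.integrable_snd[OF Zc] by simp
      have "V i \<phi> - (LINT \<tau>:{0..t}|lborel. F \<tau> i \<phi>)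
          = (LINT \<xi>|lborel. propagator t \<xi> (f \<xi>) $ i * Finv \<phi> \<xi> - (LINT \<tau>|lborel. force t \<tau> \<xi> $ i) * Finv \<phi> \<xi>)"
        unfolding D V_def dist_of_def
        by (rule Bochner_Integration.integral_diff[symmetric, OF integrable_dist_of[OF admissible_linear[OF t] \<phi>] iD])
      also have "\<dots> = dist_of (\<lambda>\<xi>. solution (t, \<xi>) $ i) \<phi>"
        unfolding dist_of_def
      proof (rule integral_cong_AE)
        show "(\<lambda>\<xi>. propagator t \<xi> (f \<xi>) $ i * Finv \<phi> \<xi> - (LINT \<tau>|lborel. force t \<tau> \<xi> $ i) * Finv \<phi> \<xi>) \<in> borel_measurable lborel"
          using borel_measurable_integrable[OF iD] by measurable
        show "AE \<xi> in lborel. propagator t \<xi> (f \<xi>) $ i * Finv \<phi> \<xi> - (LINT \<tau>|lborel. force t \<tau> \<xi> $ i) * Finv \<phi> \<xi> = solution (t, \<xi>) $ i * Finv \<phi> \<xi>"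
          using solution_eq_force[OF t, of i] by (rule eventually_mono) (simp add: left_diff_distrib)
      qed measurable
      finally show "V i \<phi> - (LINT \<tau>:{0..t}|lborel. F \<tau> i \<phi>) = dist_of (\<lambda>\<xi>. solution (t, \<xi>) $ i) \<phi>" .
    qed
  qed
qed

lemma evolution_0: "evolution 0 = data"
proof -
  have "AE \<xi> in lborel. solution (0, \<xi>) $ i = f \<xi> $ i" for i
    using solution_eq_force[of 0 i, OF order_refl]
  proof eventually_elim
    case (elim \<xi>)
    have "AE \<tau> in lborel. \<tau> \<noteq> (0::real)" by (rule AE_lborel_singleton)
    then have "AE \<tau> in lborel. force 0 \<tau> \<xi> $ i = 0" by (rule eventually_mono) (simp add: force_def)
    then have "(LINT \<tau>|lborel. force 0 \<tau> \<xi> $ i) = 0" by (rule integral_eq_zero_AE)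
    then show ?case using elim by (simp add: propagator_0)
  qed
  then show ?thesis
    unfolding evolution_def data_def vec_eq_iff vec_lambda_beta
    by (intro allI sh_of_cong_AE admissible_solution) measurable
qed

lemma evolution_in_FBv: "evolution t \<in> FBv \<psi> (-1) 1 2"
  unfolding FBv_def evolution_def mem_Collect_eq vec_lambda_beta
  by (intro allI sh_of_in_FB[OF lp _ weighted_norm_solution]) measurable

lemma real_valued_evolution: "real_valued (evolution t $ i)"
  unfolding evolution_def vec_lambda_beta
  using solution_symmetric[of t] by (intro real_valued_sh_of admissible_solution) (auto elim!: eventually_mono)

text \<open>Only \<open>\<tau> = t\<close> is excluded, where the indicator of \<open>{0..t}\<close> jumps.\<close>

lemma force_tendsto:
  assumes X: "X \<longlonglongrightarrow> t" and "\<tau> \<noteq> t"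
  shows "(\<lambda>n. force (X n) \<tau> \<xi>) \<longlonglongrightarrow> force t \<tau> \<xi>"
proof -
  have "\<forall>\<^sub>F n in sequentially. indicator {0..X n} \<tau> = (indicator {0..t} \<tau> :: real)"
  proof (cases "\<tau> < t")
    case True
    have "\<forall>\<^sub>F n in sequentially. \<tau> < X n" by (rule order_tendstoD(1)[OF X True])
    then show ?thesis by (rule eventually_mono) (use True in \<open>auto simp: indicator_def\<close>)
  next
    case False
    then have "t < \<tau>" using assms(2) by simp
    have "\<forall>\<^sub>F n in sequentially. X n < \<tau>" by (rule order_tendstoD(2)[OF X \<open>t < \<tau>\<close>])
    then show ?thesis by (rule eventually_mono) (use \<open>t < \<tau>\<close> in \<open>auto simp: indicator_def\<close>)
  qed
  then have 1: "(\<lambda>n. indicator {0..X n} \<tau>) \<longlonglongrightarrow> (indicator {0..t} \<tau> :: real)" by (rule tendsto_eventually)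
  have 2: "(\<lambda>n. propagator (X n - \<tau>) \<xi> (proj \<xi> (flux_conv \<tau> \<xi>))) \<longlonglongrightarrow> propagator (t - \<tau>) \<xi> (proj \<xi> (flux_conv \<tau> \<xi>))"
    by (rule continuous_on_tendsto_compose[OF propagator_continuous]) (use X in \<open>auto intro!: tendsto_intros\<close>)
  show ?thesis unfolding force_def by (rule tendsto_scaleR[OF 1 2])
qed

lemma solution_difference_le:
  assumes "0 \<le> s" "0 \<le> t"
  shows "AE \<xi> in lborel. ennreal (norm (solution (s, \<xi>) $ i - solution (t, \<xi>) $ i))
    \<le> ennreal (norm (propagator s \<xi> (f \<xi>) - propagator t \<xi> (f \<xi>))) + (\<integral>\<^sup>+\<tau>. ennreal (norm (force s \<tau> \<xi> - force t \<tau> \<xi>)) \<partial>lborel)"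
  using solution_eq_force[OF assms(1), of i] solution_eq_force[OF assms(2), of i] AE_M_conv_finite
proof eventually_elim
  case (elim \<xi>)
  have int: "integrable lborel (\<lambda>\<tau>. force t \<tau> \<xi> $ i)" for t
    by (rule integrable_bounded_linear[OF bounded_linear_vec_nth integrable_force[OF elim(3)]])
  have "solution (s, \<xi>) $ i - solution (t, \<xi>) $ i = (propagator s \<xi> (f \<xi>) - propagator t \<xi> (f \<xi>)) $ i
      - (LINT \<tau>|lborel. (force s \<tau> \<xi> - force t \<tau> \<xi>) $ i)"
    using elim(1,2) int by simp
  then have "norm (solution (s, \<xi>) $ i - solution (t, \<xi>) $ i) \<le> norm (propagator s \<xi> (f \<xi>) - propagator t \<xi> (f \<xi>))
      + norm (LINT \<tau>|lborel. (force s \<tau> \<xi> - force t \<tau> \<xi>) $ i)"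
    using norm_component_le[of "propagator s \<xi> (f \<xi>) - propagator t \<xi> (f \<xi>)" i]
    by (simp only:) (rule order_trans[OF norm_triangle_ineq4], simp)
  then have "ennreal (norm (solution (s, \<xi>) $ i - solution (t, \<xi>) $ i)) \<le> ennreal (norm (propagator s \<xi> (f \<xi>) - propagator t \<xi> (f \<xi>)))
      + ennreal (norm (LINT \<tau>|lborel. (force s \<tau> \<xi> - force t \<tau> \<xi>) $ i))"
    by (simp add: ennreal_leI flip: ennreal_plus)
  also have "ennreal (norm (LINT \<tau>|lborel. (force s \<tau> \<xi> - force t \<tau> \<xi>) $ i)) \<le> (\<integral>\<^sup>+\<tau>. ennreal (norm (force s \<tau> \<xi> - force t \<tau> \<xi>)) \<partial>lborel)"
    by (rule order_trans[OF ennreal_norm_integral_le]) (intro nn_integral_mono ennreal_leI norm_component_le)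
  finally show ?case by (simp add: add_left_mono)
qed

text \<open>Dominated convergence, in the frequency for the linear part and in space-time for the Duhamel
  term; the weight \<open>1 / \<bar>\<xi>\<bar>\<close> compensates the derivative in the nonlinearity.\<close>

lemma solution_continuous:
  assumes X: "X \<longlonglongrightarrow> t" "\<And>n. 0 \<le> X n" and t: "0 \<le> t"
  shows "(\<lambda>n. weighted_norm (\<lambda>\<xi>. solution (X n, \<xi>) $ i - solution (t, \<xi>) $ i)) \<longlonglongrightarrow> 0"
proof -
  let ?A = "\<lambda>n. \<integral>\<^sup>+\<xi>. ennreal (norm (propagator (X n) \<xi> (f \<xi>) - propagator t \<xi> (f \<xi>)) / norm \<xi>) \<partial>lborel"
  let ?B = "\<lambda>n. \<integral>\<^sup>+p. ennreal (norm (force (X n) (fst p) (snd p) - force t (fst p) (snd p)) / norm (snd p)) \<partial>spacetime"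
  have A: "?A \<longlonglongrightarrow> (\<integral>\<^sup>+\<xi>. 0 \<partial>(lborel :: (real^3) measure))"
  proof (rule nn_integral_dominated_convergence[where w="\<lambda>\<xi>. 2 * ennreal (norm (f \<xi>) / norm \<xi>)"])
    show "(\<integral>\<^sup>+\<xi>. 2 * ennreal (norm (f \<xi>) / norm \<xi>) \<partial>lborel) < \<infinity>"
      using f_weighted by (simp add: nn_integral_cmult ennreal_mult_less_top)
    have b: "norm (propagator s \<xi> (f \<xi>)) \<le> norm (f \<xi>)" if "0 \<le> s" for s \<xi>
    proof -
      have "exp (- s * (norm \<xi>)\<^sup>2 / 2) * norm (f \<xi>) \<le> 1 * norm (f \<xi>)" using that by (intro mult_right_mono) auto
      then show ?thesis using norm_propagator_le[OF that, of \<xi> "f \<xi>"] by simp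
    qed
    show "AE \<xi> in lborel. ennreal (norm (propagator (X n) \<xi> (f \<xi>) - propagator t \<xi> (f \<xi>)) / norm \<xi>) \<le> 2 * ennreal (norm (f \<xi>) / norm \<xi>)" for n
    proof (rule AE_I2)
      fix \<xi>
      have "norm (propagator (X n) \<xi> (f \<xi>) - propagator t \<xi> (f \<xi>)) \<le> 2 * norm (f \<xi>)"
        using norm_triangle_ineq4[of "propagator (X n) \<xi> (f \<xi>)" "propagator t \<xi> (f \<xi>)"] b[OF X(2)[of n], of \<xi>] b[OF t, of \<xi>] by linarith
      then have "norm (propagator (X n) \<xi> (f \<xi>) - propagator t \<xi> (f \<xi>)) / norm \<xi> \<le> 2 * norm (f \<xi>) / norm \<xi>"
        by (rule divide_right_mono) simp
      then have "ennreal (norm (propagator (X n) \<xi> (f \<xi>) - propagator t \<xi> (f \<xi>)) / norm \<xi>) \<le> ennreal (2 * (norm (f \<xi>) / norm \<xi>))"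
        by (intro ennreal_leI) simp
      also have "\<dots> = 2 * ennreal (norm (f \<xi>) / norm \<xi>)" by (subst ennreal_mult) auto
      finally show "ennreal (norm (propagator (X n) \<xi> (f \<xi>) - propagator t \<xi> (f \<xi>)) / norm \<xi>) \<le> 2 * ennreal (norm (f \<xi>) / norm \<xi>)" .
    qed
    show "AE \<xi> in lborel. (\<lambda>n. ennreal (norm (propagator (X n) \<xi> (f \<xi>) - propagator t \<xi> (f \<xi>)) / norm \<xi>)) \<longlonglongrightarrow> 0"
    proof (rule AE_I2)
      fix \<xi>
      have "(\<lambda>n. propagator (X n) \<xi> (f \<xi>)) \<longlonglongrightarrow> propagator t \<xi> (f \<xi>)"
        by (rule continuous_on_tendsto_compose[OF propagator_continuous X(1)]) auto
      then have "(\<lambda>n. norm (propagator (X n) \<xi> (f \<xi>) - propagator t \<xi> (f \<xi>)) * (1 / norm \<xi>)) \<longlonglongrightarrow> 0 * (1 / norm \<xi>)"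
        by (intro tendsto_mult_right tendsto_norm_zero) (simp add: LIM_zero_iff)
      from tendsto_ennrealI[OF this]
      show "(\<lambda>n. ennreal (norm (propagator (X n) \<xi> (f \<xi>) - propagator t \<xi> (f \<xi>)) / norm \<xi>)) \<longlonglongrightarrow> 0" by simp
    qed
  qed measurable
  have B: "?B \<longlonglongrightarrow> (\<integral>\<^sup>+p. 0 \<partial>(lborel \<Otimes>\<^sub>M lborel :: (real \<times> (real^3)) measure))"
  proof (rule nn_integral_dominated_convergence[where w="\<lambda>p. ennreal 1296 * space_conv M M p"])
    show "(\<integral>\<^sup>+p. ennreal 1296 * space_conv M M p \<partial>spacetime) < \<infinity>"
      using pairing_M_finite by (simp add: nn_integral_cmult nn_integral_space_conv ennreal_mult_less_top)
    have b: "ennreal (norm (force s \<tau> \<xi>) / norm \<xi>) \<le> ennreal 648 * space_conv M M (\<tau>, \<xi>)" for s \<tau> \<xi>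
    proof (cases "\<xi> = 0")
      case False
      have "ennreal (norm (force s \<tau> \<xi>) / norm \<xi>) = ennreal (norm (force s \<tau> \<xi>)) * ennreal (1 / norm \<xi>)"
        by (simp flip: ennreal_mult)
      also have "\<dots> \<le> (ennreal (648 * norm \<xi>) * space_conv M M (\<tau>, \<xi>)) * ennreal (1 / norm \<xi>)"
        by (intro mult_right_mono norm_force_le) auto
      also have "\<dots> = ennreal (648 * norm \<xi> * (1 / norm \<xi>)) * space_conv M M (\<tau>, \<xi>)"
        by (subst ennreal_mult) (auto simp: mult_ac)
      finally show ?thesis using False by simp
    qed simp
    show "AE p in lborel \<Otimes>\<^sub>M lborel. ennreal (norm (force (X n) (fst p) (snd p) - force t (fst p) (snd p)) / norm (snd p)) \<le> ennreal 1296 * space_conv M M p" for n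
    proof (rule AE_I2)
      fix p :: "real \<times> (real^3)"
      obtain \<tau> \<xi> where p: "p = (\<tau>, \<xi>)" by (cases p)
      have "norm (force (X n) \<tau> \<xi> - force t \<tau> \<xi>) / norm \<xi> \<le> norm (force (X n) \<tau> \<xi>) / norm \<xi> + norm (force t \<tau> \<xi>) / norm \<xi>"
        unfolding add_divide_distrib[symmetric] by (intro divide_right_mono norm_triangle_ineq4) simp
      then have "ennreal (norm (force (X n) \<tau> \<xi> - force t \<tau> \<xi>) / norm \<xi>)
          \<le> ennreal (norm (force (X n) \<tau> \<xi>) / norm \<xi>) + ennreal (norm (force t \<tau> \<xi>) / norm \<xi>)"
        by (simp add: ennreal_leI flip: ennreal_plus)
      also have "\<dots> \<le> ennreal 648 * space_conv M M (\<tau>, \<xi>) + ennreal 648 * space_conv M M (\<tau>, \<xi>)"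
        by (intro add_mono b)
      also have "\<dots> = ennreal 1296 * space_conv M M (\<tau>, \<xi>)"
        unfolding distrib_right[symmetric] by (subst ennreal_plus[symmetric]) auto
      finally show "ennreal (norm (force (X n) (fst p) (snd p) - force t (fst p) (snd p)) / norm (snd p)) \<le> ennreal 1296 * space_conv M M p"
        by (simp add: p)
    qed
    have "AE p in lborel \<Otimes>\<^sub>M (lborel :: (real^3) measure). fst p \<noteq> t"
    proof (rule lborel_pair.AE_pair_measure)
      show "AE \<tau> in lborel. AE \<xi> in (lborel :: (real^3) measure). fst (\<tau>, \<xi>) \<noteq> t"
        using AE_lborel_singleton[of t] by (rule eventually_mono) simp
      have "{p \<in> space (lborel \<Otimes>\<^sub>M (lborel :: (real^3) measure)). fst p \<noteq> t} = (- {t}) \<times> UNIV"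
        by (auto simp: space_pair_measure)
      then show "{p \<in> space (lborel \<Otimes>\<^sub>M (lborel :: (real^3) measure)). fst p \<noteq> t} \<in> sets spacetime"
        by (simp add: pair_measureI)
    qed
    then show "AE p in lborel \<Otimes>\<^sub>M lborel. (\<lambda>n. ennreal (norm (force (X n) (fst p) (snd p) - force t (fst p) (snd p)) / norm (snd p))) \<longlonglongrightarrow> 0"
    proof (rule eventually_mono)
      fix p :: "real \<times> (real^3)" assume "fst p \<noteq> t"
      from force_tendsto[OF X(1) this, of "snd p"]
      have "(\<lambda>n. norm (force (X n) (fst p) (snd p) - force t (fst p) (snd p)) * (1 / norm (snd p))) \<longlonglongrightarrow> 0 * (1 / norm (snd p))"
        by (intro tendsto_mult_right tendsto_norm_zero) (simp add: LIM_zero_iff)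
      from tendsto_ennrealI[OF this]
      show "(\<lambda>n. ennreal (norm (force (X n) (fst p) (snd p) - force t (fst p) (snd p)) / norm (snd p))) \<longlonglongrightarrow> 0" by simp
    qed
  qed measurable
  have le: "weighted_norm (\<lambda>\<xi>. solution (X n, \<xi>) $ i - solution (t, \<xi>) $ i) \<le> ?A n + ?B n" for n
  proof -
    have "weighted_norm (\<lambda>\<xi>. solution (X n, \<xi>) $ i - solution (t, \<xi>) $ i)
      \<le> (\<integral>\<^sup>+\<xi>. ennreal (norm (propagator (X n) \<xi> (f \<xi>) - propagator t \<xi> (f \<xi>)) / norm \<xi>)
          + (\<integral>\<^sup>+\<tau>. ennreal (norm (force (X n) \<tau> \<xi> - force t \<tau> \<xi>) / norm \<xi>) \<partial>lborel) \<partial>lborel)"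
      unfolding weighted_norm_def
    proof (rule nn_integral_mono_AE)
      show "AE \<xi> in lborel. ennreal (norm (solution (X n, \<xi>) $ i - solution (t, \<xi>) $ i) / norm \<xi>)
        \<le> ennreal (norm (propagator (X n) \<xi> (f \<xi>) - propagator t \<xi> (f \<xi>)) / norm \<xi>)
          + (\<integral>\<^sup>+\<tau>. ennreal (norm (force (X n) \<tau> \<xi> - force t \<tau> \<xi>) / norm \<xi>) \<partial>lborel)"
        using solution_difference_le[OF X(2)[of n] t, of i]
      proof eventually_elim
        case (elim \<xi>)
        have d: "ennreal (a / norm \<xi>) = ennreal a * ennreal (1 / norm \<xi>)" if "0 \<le> a" for a
          using that by (simp flip: ennreal_mult)
        have "(\<integral>\<^sup>+\<tau>. ennreal (norm (force (X n) \<tau> \<xi> - force t \<tau> \<xi>) / norm \<xi>) \<partial>lborel)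
            = (\<integral>\<^sup>+\<tau>. ennreal (norm (force (X n) \<tau> \<xi> - force t \<tau> \<xi>)) \<partial>lborel) * ennreal (1 / norm \<xi>)"
          unfolding d[OF norm_ge_zero] by (rule nn_integral_multc) measurable
        then show ?case
          unfolding d[OF norm_ge_zero] using mult_right_mono[OF elim, of "ennreal (1 / norm \<xi>)"]
          by (simp add: distrib_right)
      qed
    qed
    also have "\<dots> = ?A n + (\<integral>\<^sup>+\<xi>. (\<integral>\<^sup>+\<tau>. ennreal (norm (force (X n) \<tau> \<xi> - force t \<tau> \<xi>) / norm \<xi>) \<partial>lborel) \<partial>lborel)"
    proof (rule nn_integral_add)
      show "(\<lambda>\<xi>. \<integral>\<^sup>+\<tau>. ennreal (norm (force (X n) \<tau> \<xi> - force t \<tau> \<xi>) / norm \<xi>) \<partial>lborel) \<in> borel_measurable lborel"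
      proof (rule lborel.borel_measurable_nn_integral)
        have [measurable]: "(\<lambda>x. force s (snd x) (fst x)) \<in> borel_measurable (lborel \<Otimes>\<^sub>M lborel)" for s
          using measurable_compose[OF measurable_Pair[OF measurable_snd measurable_fst] force_measurable[of s]] by simp
        show "(\<lambda>(\<xi>, \<tau>). ennreal (norm (force (X n) \<tau> \<xi> - force t \<tau> \<xi>) / norm \<xi>)) \<in> borel_measurable (lborel \<Otimes>\<^sub>M lborel)"
          unfolding split_beta by measurable
      qed
    qed measurable
    also have "(\<integral>\<^sup>+\<xi>. (\<integral>\<^sup>+\<tau>. ennreal (norm (force (X n) \<tau> \<xi> - force t \<tau> \<xi>) / norm \<xi>) \<partial>lborel) \<partial>lborel)
        = (\<integral>\<^sup>+\<tau>. (\<integral>\<^sup>+\<xi>. ennreal (norm (force (X n) \<tau> \<xi> - force t \<tau> \<xi>) / norm \<xi>) \<partial>lborel) \<partial>lborel)"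
    proof (rule lborel_pair.Fubini')
      show "(\<lambda>(\<tau>, \<xi>). ennreal (norm (force (X n) \<tau> \<xi> - force t \<tau> \<xi>) / norm \<xi>)) \<in> borel_measurable spacetime"
        unfolding split_beta by measurable
    qed
    also have "\<dots> = ?B n" by (subst nn_integral_space_time) simp_all
    finally show ?thesis .
  qed
  have lim: "(\<lambda>n. ?A n + ?B n) \<longlonglongrightarrow> 0" using tendsto_add[OF A B] by simp
  show ?thesis
    by (rule tendsto_sandwich[OF _ _ tendsto_const lim]; rule always_eventually, rule allI, (rule le | rule zero_le))
qed

theorem evolution_continuous: "FBv_continuous \<psi> (-1) 1 2 evolution"
  unfolding FBv_continuous_def
proof (intro allI impI conjI evolution_in_FBv)
  fix t :: real assume t: "0 \<le> t"
  show "((\<lambda>t'. FBv_norm \<psi> (-1) 1 2 (evolution t' - evolution t)) \<longlongrightarrow> 0) (at t within {0..})"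
    unfolding tendsto_at_iff_sequentially comp_def
  proof (intro allI impI)
    fix X assume "\<forall>n. X n \<in> {0..} - {t}" and X: "X \<longlonglongrightarrow> t"
    then have X0: "0 \<le> X n" for n by auto
    let ?w = "\<lambda>n i. weighted_norm (\<lambda>\<xi>. solution (X n, \<xi>) $ i - solution (t, \<xi>) $ i)"
    have le: "FBv_norm \<psi> (-1) 1 2 (evolution (X n) - evolution t) \<le> (\<Sum>i\<in>UNIV. ennreal (8/3) * ?w n i)" for n
      unfolding FBv_norm_def
    proof (rule sum_mono)
      fix i :: "3 + 3"
      have eq: "(evolution (X n) - evolution t) $ i = sh_of (\<lambda>\<xi>. solution (X n, \<xi>) $ i - solution (t, \<xi>) $ i)"
        unfolding evolution_def by (simp add: minus_sh_of admissible_solution)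
      show "FB_norm \<psi> (-1) 1 2 ((evolution (X n) - evolution t) $ i) \<le> ennreal (8/3) * ?w n i"
      proof (cases "?w n i < \<infinity>")
        case True then show ?thesis unfolding eq by (intro FB_norm_2_le[OF lp]) measurable
      next
        case False
        then have "?w n i = top" by (simp add: less_top[symmetric])
        then show ?thesis by (simp add: ennreal_mult_top)
      qed
    qed
    have "(\<lambda>n. \<Sum>i\<in>UNIV. ennreal (8/3) * ?w n i) \<longlonglongrightarrow> (\<Sum>i\<in>(UNIV :: (3 + 3) set). ennreal (8/3) * 0)"
      by (intro tendsto_sum ennreal_tendsto_cmult solution_continuous[OF X X0 t]) simp
    then have lim: "(\<lambda>n. \<Sum>i\<in>UNIV. ennreal (8/3) * ?w n i) \<longlonglongrightarrow> 0" by simp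
    show "(\<lambda>n. FBv_norm \<psi> (-1) 1 2 (evolution (X n) - evolution t)) \<longlonglongrightarrow> 0"
      by (rule tendsto_sandwich[OF _ _ tendsto_const lim]; rule always_eventually, rule allI, (rule le | rule zero_le))
  qed
qed

end

section \<open>Oscillating initial data\<close>

definition pulse_center :: "nat \<Rightarrow> nat \<Rightarrow> real^3" where
  "pulse_center n k = axis 1 (2 ^ (n + k))"

definition pulse_support :: "nat \<Rightarrow> (real^3) set" where
  "pulse_support n = (\<Union>k<n. ball (pulse_center n k) 1 \<union> ball (- pulse_center n k) 1)"

text \<open>The vector product of \<open>\<xi>\<close> with \<open>e\<^sub>3\<close>, which is orthogonal to \<open>\<xi>\<close>.\<close>

definition pulse_direction :: "real^3 \<Rightarrow> real^3" where
  "pulse_direction \<xi> = vector [\<xi> $ 2, - \<xi> $ 1, 0]"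

text \<open>Velocity and angular velocity agree, so that the velocity transports both alike. The factor
  \<open>\<i>\<close> turns the odd function \<open>pulse_direction\<close> into a Hermitian symmetric one.\<close>

definition pulse_field :: "real^3 \<Rightarrow> field" where
  "pulse_field \<xi> = (\<chi> i. case i of Inl k \<Rightarrow> \<i> * of_real (pulse_direction \<xi> $ k) | Inr k \<Rightarrow> \<i> * of_real (pulse_direction \<xi> $ k))"

definition pulses :: "nat \<Rightarrow> real \<Rightarrow> real^3 \<Rightarrow> field" where
  "pulses n \<delta> \<xi> = (\<delta> / sqrt (real n) * indicator (pulse_support n) \<xi>) *\<^sub>R pulse_field \<xi>"

definition unit_vol :: real where
  "unit_vol = measure lborel (ball (0::real^3) 1)"

lemma measure_ball_unit: "measure lborel (ball (c::real^3) 1) = unit_vol"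
  unfolding unit_vol_def using content_ball_conv_unit_ball[of 1 c] by simp

lemma emeasure_ball_unit: "emeasure lborel (ball (c::real^3) 1) = ennreal unit_vol"
  using emeasure_eq_ennreal_measure[of lborel "ball c 1"] emeasure_lborel_ball_finite[of c 1]
  by (simp add: measure_ball_unit less_top)

lemma unit_vol_pos: "0 < unit_vol"
  unfolding unit_vol_def by (intro content_ball_pos) simp

lemma norm_pulse_center [simp]: "norm (pulse_center n k) = 2 ^ (n + k)"
proof -
  have "pulse_center n k = 2 ^ (n + k) *\<^sub>R axis 1 1"
    by (simp add: pulse_center_def vec_eq_iff axis_def)
  then show ?thesis by simp
qed

lemma pulse_support_measurable [measurable]: "pulse_support n \<in> sets borel"
  unfolding pulse_support_def by (intro sets.finite_UN sets.Un) auto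

lemma pulse_support_uminus: "- \<xi> \<in> pulse_support n \<longleftrightarrow> \<xi> \<in> pulse_support n"
proof -
  have "- \<xi> \<in> ball c 1 \<longleftrightarrow> \<xi> \<in> ball (- c) 1" "- \<xi> \<in> ball (- c) 1 \<longleftrightarrow> \<xi> \<in> ball c 1" for c :: "real^3"
    using norm_minus_cancel[of "c + \<xi>"] norm_minus_cancel[of "\<xi> - c"] by (auto simp: dist_norm)
  then show ?thesis unfolding pulse_support_def by blast
qed

lemma pulse_supportE:
  assumes "\<xi> \<in> pulse_support n"
  obtains k where "k < n" "\<xi> \<in> ball (pulse_center n k) 1 \<union> ball (- pulse_center n k) 1"
    "2 ^ (n + k) - 1 < norm \<xi>" "norm \<xi> < 2 ^ (n + k) + 1"
proof -
  obtain k where k: "k < n" "\<xi> \<in> ball (pulse_center n k) 1 \<union> ball (- pulse_center n k) 1"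
    using assms unfolding pulse_support_def by blast
  then have "norm (pulse_center n k - \<xi>) < 1 \<or> norm (- pulse_center n k - \<xi>) < 1"
    by (auto simp: dist_norm)
  then have "\<bar>2 ^ (n + k) - norm \<xi>\<bar> < 1"
    using norm_triangle_ineq3[of "pulse_center n k" \<xi>] norm_triangle_ineq3[of "- pulse_center n k" \<xi>]
    unfolding norm_minus_cancel norm_pulse_center by linarith
  then show ?thesis using that[OF k] by linarith
qed

lemma norm_pulse_field_le: "norm (pulse_field \<xi>) \<le> 2 * norm \<xi>"
proof -
  have "(norm (pulse_field \<xi>))\<^sup>2 = 2 * ((\<xi> $ 1)\<^sup>2 + (\<xi> $ 2)\<^sup>2)"
    by (simp add: norm_vec_def L2_set_def sum_nonneg sum_UNIV_plus sum_3 pulse_field_def pulse_direction_def norm_mult)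
  also have "\<dots> \<le> (2 * norm \<xi>)\<^sup>2" by (simp add: norm_vec3 power_mult_distrib)
  finally show ?thesis by (rule power2_le_imp_le) simp
qed

lemma pulses_zero: "\<xi> \<notin> pulse_support n \<Longrightarrow> pulses n \<delta> \<xi> = 0"
  by (simp add: pulses_def)

lemma norm_pulses_le:
  assumes "0 \<le> \<delta>"
  shows "norm (pulses n \<delta> \<xi>) \<le> 2 * (\<delta> / sqrt (real n)) * norm \<xi> * indicator (pulse_support n) \<xi>"
proof (cases "\<xi> \<in> pulse_support n")
  case True
  have "norm (pulses n \<delta> \<xi>) = \<delta> / sqrt (real n) * norm (pulse_field \<xi>)"
    using True assms by (simp add: pulses_def)
  also have "\<dots> \<le> \<delta> / sqrt (real n) * (2 * norm \<xi>)"
    using assms by (intro mult_left_mono norm_pulse_field_le) simp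
  finally show ?thesis using True by (simp add: mult_ac)
qed (simp add: pulses_zero)

lemma pulse_field_measurable [measurable]: "pulse_field \<in> borel_measurable borel"
proof (rule measurable_vec_lambda)
  fix i :: "3 + 3"
  have [measurable]: "(\<lambda>\<xi>. pulse_direction \<xi> $ k) \<in> borel_measurable borel" for k
    using exhaust_3[of k] by (elim disjE; simp add: pulse_direction_def; measurable)
  show "(\<lambda>\<xi>. pulse_field \<xi> $ i) \<in> borel_measurable borel"
    by (cases i) (simp_all add: pulse_field_def)
qed

lemma pulses_measurable [measurable]: "pulses n \<delta> \<in> borel_measurable borel"
  unfolding pulses_def[abs_def] by measurable

lemma pulses_symmetric: "pulses n \<delta> (- \<xi>) = cnjv (pulses n \<delta> \<xi>)"
proof -
  have "pulse_direction (- \<xi>) $ k = - (pulse_direction \<xi> $ k)" for k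
    using exhaust_3[of k] by (elim disjE) (simp_all add: pulse_direction_def)
  then have "pulse_field (- \<xi>) $ i = cnj (pulse_field \<xi> $ i)" for i
    by (cases i) (simp_all add: pulse_field_def)
  then have F: "pulse_field (- \<xi>) = cnjv (pulse_field \<xi>)" by (simp add: vec_eq_iff)
  have I: "indicator (pulse_support n) (- \<xi>) = (indicator (pulse_support n) \<xi> :: real)"
    using pulse_support_uminus[of \<xi> n] by (simp add: indicator_def)
  show ?thesis unfolding pulses_def F I linear_scale[OF linear_cnjv] ..
qed

text \<open>The balls may overlap; only a union bound is used.\<close>

lemma nn_integral_pulse_support_le:
  assumes [measurable]: "h \<in> borel_measurable borel" and a: "\<And>k. k < n \<Longrightarrow> 0 \<le> a k"
    and h: "\<And>k \<xi>. k < n \<Longrightarrow> \<xi> \<in> ball (pulse_center n k) 1 \<union> ball (- pulse_center n k) 1 \<Longrightarrow> h \<xi> \<le> a k"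
  shows "(\<integral>\<^sup>+\<xi>. ennreal (h \<xi> * indicator (pulse_support n) \<xi>) \<partial>lborel) \<le> ennreal (2 * unit_vol * (\<Sum>k<n. a k))"
proof -
  have ball: "(\<lambda>\<xi>. indicator (ball c 1) \<xi> :: ennreal) \<in> borel_measurable lborel" for c :: "real^3"
    by (rule borel_measurable_indicator) simp
  have "(\<integral>\<^sup>+\<xi>. ennreal (h \<xi> * indicator (pulse_support n) \<xi>) \<partial>lborel)
      \<le> (\<integral>\<^sup>+\<xi>. (\<Sum>k<n. ennreal (a k) * (indicator (ball (pulse_center n k) 1) \<xi> + indicator (ball (- pulse_center n k) 1) \<xi>)) \<partial>lborel)"
  proof (intro nn_integral_mono)
    fix \<xi>
    show "ennreal (h \<xi> * indicator (pulse_support n) \<xi>)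
      \<le> (\<Sum>k<n. ennreal (a k) * (indicator (ball (pulse_center n k) 1) \<xi> + indicator (ball (- pulse_center n k) 1) \<xi>))"
    proof (cases "\<xi> \<in> pulse_support n")
      case True
      then obtain k where k: "k < n" "\<xi> \<in> ball (pulse_center n k) 1 \<union> ball (- pulse_center n k) 1"
        unfolding pulse_support_def by blast
      have "ennreal (h \<xi> * indicator (pulse_support n) \<xi>) \<le> ennreal (a k) * 1"
        using h[OF k] True by (simp add: ennreal_leI)
      also have "\<dots> \<le> ennreal (a k) * (indicator (ball (pulse_center n k) 1) \<xi> + indicator (ball (- pulse_center n k) 1) \<xi>)"
        using k(2) by (intro mult_left_mono) (auto simp: indicator_def)
      also have "\<dots> \<le> (\<Sum>k<n. ennreal (a k) * (indicator (ball (pulse_center n k) 1) \<xi> + indicator (ball (- pulse_center n k) 1) \<xi>))"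
        using k(1) by (intro member_le_sum[where f="\<lambda>k. ennreal (a k) * (indicator (ball (pulse_center n k) 1) \<xi> + indicator (ball (- pulse_center n k) 1) \<xi>)"]) auto
      finally show ?thesis .
    qed simp
  qed
  also have "\<dots> = (\<Sum>k<n. \<integral>\<^sup>+\<xi>. ennreal (a k) * (indicator (ball (pulse_center n k) 1) \<xi> + indicator (ball (- pulse_center n k) 1) \<xi>) \<partial>lborel)"
    by (intro nn_integral_sum borel_measurable_times_ennreal borel_measurable_add ball) auto
  also have "\<dots> = (\<Sum>k<n. ennreal (a k) * (ennreal unit_vol + ennreal unit_vol))"
  proof (intro sum.cong refl)
    fix k
    have "(\<integral>\<^sup>+\<xi>. ennreal (a k) * (indicator (ball (pulse_center n k) 1) \<xi> + indicator (ball (- pulse_center n k) 1) \<xi>) \<partial>lborel)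
        = ennreal (a k) * (\<integral>\<^sup>+\<xi>. indicator (ball (pulse_center n k) 1) \<xi> + indicator (ball (- pulse_center n k) 1) \<xi> \<partial>lborel)"
      by (intro nn_integral_cmult borel_measurable_add ball)
    also have "(\<integral>\<^sup>+\<xi>. indicator (ball (pulse_center n k) 1) \<xi> + indicator (ball (- pulse_center n k) 1) \<xi> \<partial>lborel)
        = ennreal unit_vol + ennreal unit_vol"
      by (subst nn_integral_add[OF ball ball]) (simp add: emeasure_ball_unit)
    finally show "(\<integral>\<^sup>+\<xi>. ennreal (a k) * (indicator (ball (pulse_center n k) 1) \<xi> + indicator (ball (- pulse_center n k) 1) \<xi>) \<partial>lborel)
        = ennreal (a k) * (ennreal unit_vol + ennreal unit_vol)" .
  qed
  also have "\<dots> = (\<Sum>k<n. ennreal (2 * unit_vol * a k))"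
  proof (intro sum.cong refl)
    fix k assume "k \<in> {..<n}"
    then have "0 \<le> a k" using a by simp
    then show "ennreal (a k) * (ennreal unit_vol + ennreal unit_vol) = ennreal (2 * unit_vol * a k)"
      using unit_vol_pos by (simp add: mult_ac flip: ennreal_plus ennreal_mult)
  qed
  also have "\<dots> = ennreal (\<Sum>k<n. 2 * unit_vol * a k)"
    using a unit_vol_pos by (intro sum_ennreal) auto
  finally show ?thesis by (simp add: sum_distrib_left)
qed

lemma weighted_pulses_le:
  assumes "0 \<le> \<delta>"
  shows "(\<integral>\<^sup>+\<xi>. ennreal (norm (pulses n \<delta> \<xi>) / norm \<xi>) \<partial>lborel) \<le> ennreal (4 * unit_vol * \<delta> * sqrt (real n))"
proof -
  let ?c = "\<delta> / sqrt (real n)"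
  have "(\<integral>\<^sup>+\<xi>. ennreal (norm (pulses n \<delta> \<xi>) / norm \<xi>) \<partial>lborel) \<le> (\<integral>\<^sup>+\<xi>. ennreal (2 * ?c * indicator (pulse_support n) \<xi>) \<partial>lborel)"
  proof (intro nn_integral_mono ennreal_leI)
    fix \<xi> :: "real^3"
    show "norm (pulses n \<delta> \<xi>) / norm \<xi> \<le> 2 * ?c * indicator (pulse_support n) \<xi>"
      using norm_pulses_le[OF assms, of n \<xi>] assms by (cases "\<xi> = 0") (auto simp: divide_le_eq mult_ac)
  qed
  also have "\<dots> \<le> ennreal (2 * unit_vol * (\<Sum>k<n. 2 * ?c))"
    using assms by (intro nn_integral_pulse_support_le) auto
  also have "2 * unit_vol * (\<Sum>k<n. 2 * ?c) = 4 * unit_vol * \<delta> * sqrt (real n)"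
    by (cases "n = 0") (auto simp: field_simps real_div_sqrt)
  finally show ?thesis .
qed

lemma integrable_pulses: "integrable lborel (\<lambda>\<xi>. pulses n \<delta> \<xi> $ i)"
proof (rule integrableI_bounded)
  let ?c = "\<bar>\<delta>\<bar> / sqrt (real n)"
  have "(\<integral>\<^sup>+\<xi>. ennreal (norm (pulses n \<delta> \<xi> $ i)) \<partial>lborel) \<le> (\<integral>\<^sup>+\<xi>. ennreal ((2 * ?c * norm \<xi>) * indicator (pulse_support n) \<xi>) \<partial>lborel)"
  proof (intro nn_integral_mono ennreal_leI)
    fix \<xi> :: "real^3"
    have "norm (pulses n \<delta> \<xi> $ i) \<le> norm (pulses n \<delta> \<xi>)" by (rule norm_component_le)
    also have "norm (pulses n \<delta> \<xi>) = norm (pulses n \<bar>\<delta>\<bar> \<xi>)" by (simp add: pulses_def abs_mult)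
    also have "\<dots> \<le> (2 * ?c * norm \<xi>) * indicator (pulse_support n) \<xi>" using norm_pulses_le[of "\<bar>\<delta>\<bar>" n \<xi>] by simp
    finally show "norm (pulses n \<delta> \<xi> $ i) \<le> (2 * ?c * norm \<xi>) * indicator (pulse_support n) \<xi>" .
  qed
  also have "\<dots> \<le> ennreal (2 * unit_vol * (\<Sum>k<n. 2 * ?c * (2 ^ (n + k) + 1)))"
  proof (rule nn_integral_pulse_support_le)
    fix k \<xi> assume "\<xi> \<in> ball (pulse_center n k) 1 \<union> ball (- pulse_center n k) 1"
    then have "norm (pulse_center n k - \<xi>) < 1 \<or> norm (- pulse_center n k - \<xi>) < 1" by (auto simp: dist_norm)
    then have "norm \<xi> \<le> 2 ^ (n + k) + 1"
      using norm_triangle_ineq3[of "pulse_center n k" \<xi>] norm_triangle_ineq3[of "- pulse_center n k" \<xi>]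
      unfolding norm_minus_cancel norm_pulse_center by linarith
    then show "2 * ?c * norm \<xi> \<le> 2 * ?c * (2 ^ (n + k) + 1)" by (intro mult_left_mono) auto
  qed auto
  finally show "(\<integral>\<^sup>+\<xi>. ennreal (norm (pulses n \<delta> \<xi> $ i)) \<partial>lborel) < \<infinity>" by (rule le_less_trans) simp
qed measurable

text \<open>Each dyadic annulus meets at most two pairs of balls.\<close>

lemma dyadic_mass_pulses_le:
  assumes lp: "littlewood_paley \<psi>" and \<delta>: "0 \<le> \<delta>" and n: "4 \<le> n"
  shows "dyadic_mass \<psi> j (\<lambda>\<xi>. pulses n \<delta> \<xi> $ i) \<le> ennreal (24 * unit_vol * (\<delta> / sqrt (real n)))"
proof -
  let ?c = "\<delta> / sqrt (real n)"
  have c: "0 \<le> ?c" using \<delta> by simp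
  let ?J = "\<lambda>k. int (n + k) = j \<or> int (n + k) = j + 1"
  let ?h = "\<lambda>\<xi>. 2 powr (- real_of_int j) * (\<psi> ((2 powi (- j)) *\<^sub>R \<xi>) * (2 * ?c * norm \<xi>))"
  let ?a = "\<lambda>k. if ?J k then 6 * ?c else 0"
  note [measurable] = lp_measurable[OF lp]
  have \<psi>1: "\<psi> \<xi> \<le> 1" for \<xi>
  proof (cases "\<xi> = 0")
    case False
    have "(\<Sum>j\<in>{0::int}. \<psi> ((2 powi (- j)) *\<^sub>R \<xi>)) \<le> 1"
      by (rule finite_sum_le_has_sum[OF lp_has_sum[OF lp False]]) (auto simp: lp_nonneg[OF lp])
    then show ?thesis by simp
  next
    case True then show ?thesis using lp_support[OF lp, of 0] by (cases "\<psi> 0 = 0") auto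
  qed
  have "dyadic_mass \<psi> j (\<lambda>\<xi>. pulses n \<delta> \<xi> $ i)
      = (\<integral>\<^sup>+\<xi>. ennreal (2 powr (- real_of_int j)) * ennreal (\<psi> ((2 powi (- j)) *\<^sub>R \<xi>) * norm (pulses n \<delta> \<xi> $ i)) \<partial>lborel)"
    unfolding dyadic_mass_def by (rule nn_integral_cmult[symmetric]) measurable
  also have "\<dots> \<le> (\<integral>\<^sup>+\<xi>. ennreal (?h \<xi> * indicator (pulse_support n) \<xi>) \<partial>lborel)"
  proof (intro nn_integral_mono)
    fix \<xi>
    have "norm (pulses n \<delta> \<xi> $ i) \<le> 2 * ?c * norm \<xi> * indicator (pulse_support n) \<xi>"
      by (rule order_trans[OF norm_component_le norm_pulses_le[OF \<delta>]])
    then have "2 powr (- real_of_int j) * (\<psi> ((2 powi (- j)) *\<^sub>R \<xi>) * norm (pulses n \<delta> \<xi> $ i))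
        \<le> 2 powr (- real_of_int j) * (\<psi> ((2 powi (- j)) *\<^sub>R \<xi>) * (2 * ?c * norm \<xi> * indicator (pulse_support n) \<xi>))"
      by (intro mult_left_mono lp_nonneg[OF lp]) auto
    then show "ennreal (2 powr (- real_of_int j)) * ennreal (\<psi> ((2 powi (- j)) *\<^sub>R \<xi>) * norm (pulses n \<delta> \<xi> $ i))
        \<le> ennreal (?h \<xi> * indicator (pulse_support n) \<xi>)"
      by (subst ennreal_mult[symmetric]) (auto simp: lp_nonneg[OF lp] mult_ac intro!: ennreal_leI)
  qed
  also have "\<dots> \<le> ennreal (2 * unit_vol * (\<Sum>k<n. ?a k))"
  proof (rule nn_integral_pulse_support_le)
    fix k \<xi> assume k: "k < n" and "\<xi> \<in> ball (pulse_center n k) 1 \<union> ball (- pulse_center n k) 1"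
    then have "norm (pulse_center n k - \<xi>) < 1 \<or> norm (- pulse_center n k - \<xi>) < 1" by (auto simp: dist_norm)
    then have R: "2 ^ (n + k) - 1 \<le> norm \<xi>" "norm \<xi> \<le> 2 ^ (n + k) + 1"
      using norm_triangle_ineq3[of "pulse_center n k" \<xi>] norm_triangle_ineq3[of "- pulse_center n k" \<xi>]
      unfolding norm_minus_cancel norm_pulse_center by linarith+
    have R16: "(16::real) \<le> 2 ^ (n + k)" using power_increasing[of 4 "n + k" "2::real"] n by simp
    show "?h \<xi> \<le> ?a k"
    proof (cases "\<psi> ((2 powi (- j)) *\<^sub>R \<xi>) = 0")
      case True then show ?thesis using c by simp
    next
      case False
      define p where "p = (2::real) powi (- j)"
      have p: "0 < p" by (simp add: p_def)
      from lp_support[OF lp False] have s: "3/4 \<le> p * norm \<xi>" "p * norm \<xi> \<le> 8/3" using p by (simp_all add: p_def)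
      have J: "?J k"
      proof (rule ccontr)
        assume "\<not> ?J k"
        then consider "int (n + k) \<ge> j + 2" | "int (n + k) \<le> j - 1" by linarith
        then show False
        proof cases
          case 1
          have "(2::real) powi 2 \<le> 2 powi (int (n + k) - j)" using 1 by (intro power_int_increasing) auto
          also have "\<dots> = p * 2 ^ (n + k)" by (simp add: p_def power_int_diff power_int_minus field_simps flip: power_int_of_nat)
          finally have "4 \<le> p * 2 ^ (n + k)" by simp
          moreover have "p * (2 ^ (n + k) * (15/16)) \<le> p * norm \<xi>" using R R16 p by (intro mult_left_mono) auto
          ultimately show False using s by linarith
        next
          case 2
          have "(2::real) powi (int (n + k) - j) \<le> 2 powi (- 1)" using 2 by (intro power_int_increasing) auto
          moreover have "(2::real) powi (int (n + k) - j) = p * 2 ^ (n + k)" by (simp add: p_def power_int_diff power_int_minus field_simps flip: power_int_of_nat)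
          ultimately have "p * 2 ^ (n + k) \<le> 1/2" by simp
          moreover have "p * norm \<xi> \<le> p * (2 ^ (n + k) * (17/16))" using R R16 p by (intro mult_left_mono) auto
          ultimately show False using s by linarith
        qed
      qed
      have "2 powr (- real_of_int j) = p" by (simp add: p_def powr_real_of_int' flip: of_int_minus)
      then have "?h \<xi> = \<psi> ((2 powi (- j)) *\<^sub>R \<xi>) * (2 * ?c * (p * norm \<xi>))" by (simp add: mult_ac)
      also have "\<dots> \<le> 1 * (2 * ?c * 3)"
      proof (rule mult_mono[OF \<psi>1 mult_left_mono])
        show "p * norm \<xi> \<le> 3" using s by simp
        have pn: "0 \<le> p * norm \<xi>" using p by simp
        show c2: "0 \<le> 2 * ?c" using c by linarith
        from mult_nonneg_nonneg[OF c2 pn] show "0 \<le> 2 * ?c * (p * norm \<xi>)" .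
      qed auto
      finally show ?thesis using J by simp
    qed
  qed (use c in auto)
  also have "\<dots> \<le> ennreal (24 * unit_vol * ?c)"
  proof (intro ennreal_leI)
    have "(\<Sum>k<n. ?a k) = (\<Sum>k\<in>{k. k < n \<and> ?J k}. 6 * ?c)"
      by (simp add: sum.If_cases Int_def lessThan_def)
    also have "\<dots> = real (card {k. k < n \<and> ?J k}) * (6 * ?c)" by simp
    also have "\<dots> \<le> 2 * (6 * ?c)"
    proof (intro mult_right_mono)
      have "{k. k < n \<and> ?J k} \<subseteq> {nat (j - int n), nat (j + 1 - int n)}" by auto
      from card_mono[OF _ this] have "card {k. k < n \<and> ?J k} \<le> 2"
        using card_insert_le_m1[of 2 "{nat (j + 1 - int n)}" "nat (j - int n)"] by (auto simp: card_insert_if split: if_splits)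
      then show "real (card {k. k < n \<and> ?J k}) \<le> 2" by simp
    qed (use c in simp)
    finally show "2 * unit_vol * (\<Sum>k<n. ?a k) \<le> 24 * unit_vol * ?c"
      using mult_left_mono[of "\<Sum>k<n. ?a k" "2 * (6 * ?c)" "2 * unit_vol"] unit_vol_pos by simp
  qed
  finally show ?thesis .
qed

text \<open>A lacunary sum whose frequencies double behaves like its largest terms: off-diagonal products
  are absorbed because the lower frequencies add up to at most the next one.\<close>

lemma lacunary_square_le:
  fixes t :: real
  assumes "0 \<le> t"
  shows "(\<Sum>k<m. 2 ^ (n + k) * exp (- t * (2 ^ (n + k))\<^sup>2 / 4))\<^sup>2 \<le> 3 * (\<Sum>k<m. (2 ^ (n + k))\<^sup>2 * exp (- t * (2 ^ (n + k))\<^sup>2 / 4))"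
proof (induction m)
  case (Suc m)
  let ?R = "\<lambda>k. (2::real) ^ (n + k)" and ?E = "\<lambda>k. exp (- t * (2 ^ (n + k))\<^sup>2 / 4)"
  let ?S = "\<Sum>k<m. ?R k * ?E k"
  have E: "0 \<le> ?E k" "?E k \<le> 1" for k using assms by auto
  have "?S \<le> (\<Sum>k<m. ?R k)" using E by (intro sum_mono) (simp add: mult_left_le)
  also have "\<dots> \<le> ?R m"
    by (induction m) (auto simp: power_add mult_ac)
  finally have S: "?S \<le> ?R m" .
  have S0: "0 \<le> ?S" using E by (intro sum_nonneg mult_nonneg_nonneg) auto
  have "(\<Sum>k<Suc m. ?R k * ?E k)\<^sup>2 = ?S\<^sup>2 + 2 * ?S * (?R m * ?E m) + (?R m * ?E m)\<^sup>2"
    by (simp add: power2_sum)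
  also have "\<dots> \<le> ?S\<^sup>2 + 2 * ?R m * (?R m * ?E m) + ?R m * (?R m * ?E m)"
  proof (intro add_mono order_refl)
    show "2 * ?S * (?R m * ?E m) \<le> 2 * ?R m * (?R m * ?E m)" using S by (intro mult_right_mono mult_left_mono) auto
    have "?R m * ?E m \<le> ?R m * 1" using E by (intro mult_left_mono) auto
    then show "(?R m * ?E m)\<^sup>2 \<le> ?R m * (?R m * ?E m)" unfolding power2_eq_square using E by (intro mult_right_mono) auto
  qed
  also have "\<dots> \<le> 3 * (\<Sum>k<m. (?R k)\<^sup>2 * ?E k) + 3 * ((?R m)\<^sup>2 * ?E m)"
    using Suc by (simp add: power2_eq_square algebra_simps)
  finally show ?case by (simp add: distrib_left)
qed simp

lemma nn_integral_exp_half_line: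
  assumes "0 < a"
  shows "(\<integral>\<^sup>+t. ennreal (exp (- t * a)) * indicator {0..} t \<partial>lborel) = ennreal (1 / a)"
proof -
  have "(\<integral>\<^sup>+t. ennreal (exp (- t * a)) * indicator {0..} t \<partial>lborel) = ennreal (0 - (- (1 / a) * exp (- 0 * a)))"
  proof (rule nn_integral_FTC_atLeast[where F="\<lambda>t. - (1 / a) * exp (- t * a)" and T=0])
    show "((\<lambda>t. - (1 / a) * exp (- t * a)) has_real_derivative exp (- t * a)) (at t)" for t
      using assms by (auto intro!: derivative_eq_intros)
    have "filterlim (\<lambda>t. t * a) at_top at_top"
      by (intro filterlim_at_top_mult_tendsto_pos[OF tendsto_const assms] filterlim_ident)
    then have "((\<lambda>t. exp (- (t * a))) \<longlongrightarrow> 0) at_top"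
      by (intro filterlim_compose[OF exp_at_bot] filterlim_compose[OF filterlim_uminus_at_bot_at_top])
    from tendsto_mult_left[OF this, of "- (1 / a)"]
    show "((\<lambda>t. - (1 / a) * exp (- t * a)) \<longlongrightarrow> 0) at_top" by simp
  qed auto
  then show ?thesis by simp
qed

text \<open>At time \<open>t\<close> the majorant has the mass \<open>(\<delta> / sqrt n) \<Sum>\<^sub>k R\<^sub>k e^(- t R\<^sub>k\<^sup>2 / 4)\<close> up to
  constants. By lacunarity its square is comparable to the sum of the squares, and each of the \<open>n\<close> squares has a time
  integral of order \<open>\<delta>\<^sup>2 / n\<close>.\<close>

lemma energy_pulses_le:
  assumes \<delta>: "0 \<le> \<delta>" and n: "4 \<le> n"
  shows "energy (heat_majorant (pulses n \<delta>)) \<le> ennreal (768 * unit_vol\<^sup>2 * \<delta>\<^sup>2)"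
proof -
  let ?c = "\<delta> / sqrt (real n)"
  let ?R = "\<lambda>k. (2::real) ^ (n + k)" and ?E = "\<lambda>t k. exp (- t * (2 ^ (n + k))\<^sup>2 / 4)"
  have c: "0 \<le> ?c" using \<delta> by simp
  have slice: "(\<integral>\<^sup>+\<xi>. heat_majorant (pulses n \<delta>) (t, \<xi>) \<partial>lborel) \<le> ennreal (8 * unit_vol * ?c * (\<Sum>k<n. ?R k * ?E t k))" if t: "0 \<le> t" for t
  proof -
    let ?h = "\<lambda>\<xi>. exp (- t * (norm \<xi>)\<^sup>2 / 2) * (2 * ?c * norm \<xi>)"
    have "(\<integral>\<^sup>+\<xi>. heat_majorant (pulses n \<delta>) (t, \<xi>) \<partial>lborel) \<le> (\<integral>\<^sup>+\<xi>. ennreal (?h \<xi> * indicator (pulse_support n) \<xi>) \<partial>lborel)"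
    proof (intro nn_integral_mono)
      fix \<xi> :: "real^3"
      have "exp (- t * (norm \<xi>)\<^sup>2 / 2) * norm (pulses n \<delta> \<xi>) \<le> exp (- t * (norm \<xi>)\<^sup>2 / 2) * (2 * ?c * norm \<xi> * indicator (pulse_support n) \<xi>)"
        by (intro mult_left_mono norm_pulses_le \<delta>) auto
      then show "heat_majorant (pulses n \<delta>) (t, \<xi>) \<le> ennreal (?h \<xi> * indicator (pulse_support n) \<xi>)"
        using t by (auto simp: heat_majorant_def mult_ac intro!: ennreal_leI)
    qed
    also have "\<dots> \<le> ennreal (2 * unit_vol * (\<Sum>k<n. ?E t k * (2 * ?c * (2 * ?R k))))"
    proof (rule nn_integral_pulse_support_le)
      fix k \<xi> assume "\<xi> \<in> ball (pulse_center n k) 1 \<union> ball (- pulse_center n k) 1"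
      then have "norm (pulse_center n k - \<xi>) < 1 \<or> norm (- pulse_center n k - \<xi>) < 1" by (auto simp: dist_norm)
      then have R: "2 ^ (n + k) - 1 \<le> norm \<xi>" "norm \<xi> \<le> 2 ^ (n + k) + 1"
        using norm_triangle_ineq3[of "pulse_center n k" \<xi>] norm_triangle_ineq3[of "- pulse_center n k" \<xi>]
        unfolding norm_minus_cancel norm_pulse_center by linarith+
      have R16: "16 \<le> ?R k" using power_increasing[of 4 "n + k" "2::real"] n by simp
      have "(?R k)\<^sup>2 / 2 \<le> (?R k * (15/16))\<^sup>2" by (simp add: power2_eq_square)
      also have "\<dots> \<le> (norm \<xi>)\<^sup>2" using R R16 by (intro power_mono) auto
      finally have "t * ((?R k)\<^sup>2 / 2) \<le> t * (norm \<xi>)\<^sup>2" using t by (intro mult_left_mono)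
      then have "exp (- t * (norm \<xi>)\<^sup>2 / 2) \<le> ?E t k" by simp
      then show "?h \<xi> \<le> ?E t k * (2 * ?c * (2 * ?R k))"
        using R R16 c by (intro mult_mono mult_nonneg_nonneg[OF mult_nonneg_nonneg]) (auto simp del: mult_le_cancel_left)
    qed (measurable, intro mult_nonneg_nonneg c, simp_all)
    also have "2 * unit_vol * (\<Sum>k<n. ?E t k * (2 * ?c * (2 * ?R k))) = 8 * unit_vol * ?c * (\<Sum>k<n. ?R k * ?E t k)"
      by (simp add: sum_distrib_left mult_ac)
    finally show ?thesis .
  qed
  have "energy (heat_majorant (pulses n \<delta>))
     \<le> (\<integral>\<^sup>+t. (\<Sum>k<n. ennreal (192 * unit_vol\<^sup>2 * ?c\<^sup>2 * (?R k)\<^sup>2) * (ennreal (exp (- t * ((?R k)\<^sup>2 / 4))) * indicator {0..} t)) \<partial>lborel)"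
    unfolding energy_def
  proof (intro nn_integral_mono)
    fix t :: real
    show "(\<integral>\<^sup>+\<xi>. heat_majorant (pulses n \<delta>) (t, \<xi>) \<partial>lborel)\<^sup>2
      \<le> (\<Sum>k<n. ennreal (192 * unit_vol\<^sup>2 * ?c\<^sup>2 * (?R k)\<^sup>2) * (ennreal (exp (- t * ((?R k)\<^sup>2 / 4))) * indicator {0..} t))"
    proof (cases "0 \<le> t")
      case True
      have "(\<integral>\<^sup>+\<xi>. heat_majorant (pulses n \<delta>) (t, \<xi>) \<partial>lborel)\<^sup>2 \<le> (ennreal (8 * unit_vol * ?c * (\<Sum>k<n. ?R k * ?E t k)))\<^sup>2"
        by (intro power_mono slice True) simp
      also have "\<dots> = ennreal (64 * unit_vol\<^sup>2 * ?c\<^sup>2 * (\<Sum>k<n. ?R k * ?E t k)\<^sup>2)"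
      proof (subst ennreal_power)
        show "0 \<le> 8 * unit_vol * ?c * (\<Sum>k<n. ?R k * ?E t k)"
          using unit_vol_pos by (intro mult_nonneg_nonneg c sum_nonneg) auto
        show "ennreal ((8 * unit_vol * ?c * (\<Sum>k<n. ?R k * ?E t k))\<^sup>2) = ennreal (64 * unit_vol\<^sup>2 * ?c\<^sup>2 * (\<Sum>k<n. ?R k * ?E t k)\<^sup>2)"
          unfolding power_mult_distrib by simp
      qed
      also have "\<dots> \<le> ennreal (64 * unit_vol\<^sup>2 * ?c\<^sup>2 * (3 * (\<Sum>k<n. (?R k)\<^sup>2 * ?E t k)))"
        by (intro ennreal_leI mult_left_mono lacunary_square_le True) auto
      also have "\<dots> = ennreal (\<Sum>k<n. (192 * unit_vol\<^sup>2 * ?c\<^sup>2 * (?R k)\<^sup>2) * exp (- t * ((?R k)\<^sup>2 / 4)))"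
        by (simp add: sum_distrib_left mult_ac)
      also have "\<dots> = (\<Sum>k<n. ennreal ((192 * unit_vol\<^sup>2 * ?c\<^sup>2 * (?R k)\<^sup>2) * exp (- t * ((?R k)\<^sup>2 / 4))))"
        by (rule sum_ennreal[symmetric]) (auto intro!: mult_nonneg_nonneg)
      also have "\<dots> = (\<Sum>k<n. ennreal (192 * unit_vol\<^sup>2 * ?c\<^sup>2 * (?R k)\<^sup>2) * (ennreal (exp (- t * ((?R k)\<^sup>2 / 4))) * indicator {0..} t))"
        using True by (intro sum.cong refl) (simp add: ennreal_mult)
      finally show ?thesis .
    qed (simp add: heat_majorant_def)
  qed
  also have "\<dots> = (\<Sum>k<n. ennreal (192 * unit_vol\<^sup>2 * ?c\<^sup>2 * (?R k)\<^sup>2) * ennreal (1 / ((?R k)\<^sup>2 / 4)))"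
  proof -
    have "(\<integral>\<^sup>+t. (ennreal (exp (- t * ((?R k)\<^sup>2 / 4))) * indicator {0..} t) \<partial>lborel) = ennreal (1 / ((?R k)\<^sup>2 / 4))" for k
      by (rule nn_integral_exp_half_line) simp
    then show ?thesis by (subst nn_integral_sum, simp, subst nn_integral_cmult) simp_all
  qed
  also have "\<dots> = (\<Sum>k<n. ennreal (768 * unit_vol\<^sup>2 * ?c\<^sup>2))"
    by (intro sum.cong refl) (simp flip: ennreal_mult)
  also have "\<dots> = ennreal (real n * (768 * unit_vol\<^sup>2 * ?c\<^sup>2))" by (simp add: ennreal_of_nat_eq_real_of_nat ennreal_mult)
  also have "real n * (768 * unit_vol\<^sup>2 * ?c\<^sup>2) = 768 * unit_vol\<^sup>2 * \<delta>\<^sup>2" using n by (simp add: power_divide)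
  finally show ?thesis .
qed

lemma weighted_norm_pulses_finite:
  assumes "0 \<le> \<delta>"
  shows "(\<integral>\<^sup>+\<xi>. ennreal (norm (pulses n \<delta> \<xi>) / norm \<xi>) \<partial>lborel) < \<infinity>"
  using weighted_pulses_le[OF assms, of n] by (rule le_less_trans) simp

lemma small_data_pulses:
  assumes "littlewood_paley \<psi>" "0 \<le> \<delta>" "4 \<le> n" "16 * 648\<^sup>2 * (768 * unit_vol\<^sup>2 * \<delta>\<^sup>2) \<le> 1"
  shows "small_data \<psi> (pulses n \<delta>) (768 * unit_vol\<^sup>2 * \<delta>\<^sup>2)"
proof
  show "energy (heat_majorant (pulses n \<delta>)) \<le> ennreal (768 * unit_vol\<^sup>2 * \<delta>\<^sup>2)"
    by (rule energy_pulses_le[OF assms(2,3)])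
qed (use assms weighted_norm_pulses_finite in \<open>simp_all add: pulses_symmetric\<close>)

lemma pulses_divergence_free: "(\<Sum>k\<in>UNIV. of_real (\<xi> $ k) * pulses n \<delta> \<xi> $ Inl k) = 0"
  unfolding pulses_def vector_scaleR_component
  by (simp add: pulse_field_def pulse_direction_def sum_3)

lemma div_free_pulses: "div_free (\<chi> k. sh_of (\<lambda>\<xi>. pulses n \<delta> \<xi> $ Inl k))"
  unfolding div_free_def
proof (intro exI conjI allI impI)
  let ?g = "\<lambda>k \<xi>. pulses n \<delta> \<xi> $ Inl k" and ?h = "\<lambda>k \<xi>. \<i> * of_real (\<xi> $ k) * pulses n \<delta> \<xi> $ Inl k"
  show "represents (dist_of (?g k)) ((\<chi> k. sh_of (?g k)) $ k)" for k
    using represents_sh_of[OF admissible_if_integrable[OF integrable_pulses]] by simp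
  fix f assume f: "schwartz f"
  have adm: "admissible (?h k)" for k
    unfolding admissible_def
  proof
    have "(\<integral>\<^sup>+\<xi>. ennreal (norm (?h k \<xi>) / (1 + norm \<xi>)) \<partial>lborel) \<le> (\<integral>\<^sup>+\<xi>. ennreal (norm (?g k \<xi>)) \<partial>lborel)"
    proof (intro nn_integral_mono ennreal_leI)
      fix \<xi> :: "real^3"
      have "\<bar>\<xi> $ k\<bar> \<le> 1 + norm \<xi>" using component_le_norm_cart[of \<xi> k] by linarith
      from mult_right_mono[OF this norm_ge_zero[of "?g k \<xi>"]]
      show "norm (?h k \<xi>) / (1 + norm \<xi>) \<le> norm (?g k \<xi>)"
        by (simp add: norm_mult divide_le_eq one_plus_norm_pos mult_ac)
    qed
    also have "\<dots> < \<infinity>" using integrable_pulses[of n \<delta> "Inl k"] by (simp add: integrable_iff_bounded)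
    finally show "(\<integral>\<^sup>+\<xi>. ennreal (norm (?h k \<xi>) / (1 + norm \<xi>)) \<partial>lborel) < \<infinity>" .
  qed measurable
  have "(\<Sum>k\<in>UNIV. - dist_of (?g k) (pd k f)) = (\<Sum>k\<in>UNIV. (LINT \<xi>|lborel. ?h k \<xi> * Finv f \<xi>))"
    unfolding dist_of_pd[OF f] by (simp add: dist_of_def)
  also have "\<dots> = (LINT \<xi>|lborel. (\<Sum>k\<in>UNIV. ?h k \<xi> * Finv f \<xi>))"
    by (rule Bochner_Integration.integral_sum[symmetric]) (rule integrable_dist_of[OF adm f])
  also have "\<dots> = 0"
  proof -
    have "(\<Sum>k\<in>UNIV. ?h k \<xi> * Finv f \<xi>) = 0" for \<xi>
    proof -
      have "(\<Sum>k\<in>UNIV. ?h k \<xi> * Finv f \<xi>) = \<i> * Finv f \<xi> * (\<Sum>k\<in>UNIV. of_real (\<xi> $ k) * ?g k \<xi>)"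
        unfolding sum_distrib_left by (intro sum.cong refl) (simp add: mult_ac)
      then show ?thesis unfolding pulses_divergence_free by simp
    qed
    then show ?thesis by simp
  qed
  finally show "(\<Sum>k\<in>UNIV. - dist_of (?g k) (pd k f)) = 0" .
qed

section \<open>Isolating the second Picard iterate\<close>

context small_data
begin

abbreviation M2 :: "real \<times> (real^3) \<Rightarrow> ennreal" where
  "M2 \<equiv> majorant_product 648 M M"

lemma M2_measurable [measurable]: "M2 \<in> borel_measurable spacetime"
  by (rule majorant_product_measurable[OF M_measurable M_measurable])

lemma linear_part_le_M: "ennreal (norm (linear_part f q)) \<le> M q"
proof -
  have "ennreal (norm (linear_part f q)) \<le> heat_majorant f q" by (rule norm_linear_part_le)
  also have "\<dots> \<le> M q" by (subst M_eq) simp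
  finally show ?thesis .
qed

text \<open>Where the majorant is infinite, so is \<open>M2\<close>, because the heat majorant is finite.\<close>

lemma norm_solution_minus_linear_le: "ennreal (norm (solution q - linear_part f q)) \<le> M2 q"
proof (cases "M q < \<infinity>")
  case True
  have "ennreal (norm (duhamel solution solution q)) \<le> M2 q" by (intro norm_duhamel_le norm_solution_le)
  then show ?thesis using True by (simp add: solution_eq)
next
  case False
  have "heat_majorant f q < \<infinity>" by (simp add: heat_majorant_def indicator_def)
  then have "M2 q = \<infinity>" using False M_eq[of q] by (auto simp: less_top[symmetric])
  then show ?thesis by simp
qed

lemma norm_duhamel_difference_le:
  assumes "M q < \<infinity>"
  shows "ennreal (norm (duhamel solution solution q - duhamel (linear_part f) (linear_part f) q))
    \<le> majorant_product 648 M2 M q + majorant_product 648 M M2 q"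
proof -
  let ?u = "linear_part f" and ?d = "\<lambda>p. solution p - linear_part f p"
  note [measurable] = linear_part_measurable[OF f_measurable]
  have [measurable]: "?d \<in> borel_measurable spacetime" by measurable
  have norm_measurable: "(\<lambda>p. ennreal (norm (X p))) \<in> borel_measurable spacetime"
    if "X \<in> borel_measurable spacetime" for X :: "real \<times> (real^3) \<Rightarrow> field" using that by measurable
  have telescope: "a - c = (a - b) + (b - c)" for a b c :: field by simp
  have "integrable spacetime (integrand solution solution q)"
    "integrable spacetime (integrand ?u ?u q)"
    by (intro integrable_integrand norm_solution_le linear_part_le_M assms; measurable)+
  then have "duhamel solution solution q - duhamel ?u ?u q
      = (LINT p|spacetime. integrand solution solution q p - integrand ?u ?u q p)"
    unfolding duhamel_def by (rule Bochner_Integration.integral_diff[symmetric])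
  also have "\<dots> = (LINT p|spacetime. integrand ?d solution q p + integrand ?u ?d q p)"
  proof (intro Bochner_Integration.integral_cong refl)
    fix p
    show "integrand solution solution q p - integrand ?u ?u q p = integrand ?d solution q p + integrand ?u ?d q p"
      unfolding integrand_def bounded_bilinear.diff_left[OF kq_bilinear] bounded_bilinear.diff_right[OF kq_bilinear] scaleR_diff_right
      by (rule telescope)
  qed
  finally have eq: "duhamel solution solution q - duhamel ?u ?u q
      = (LINT p|spacetime. integrand ?d solution q p + integrand ?u ?d q p)" .
  have "ennreal (norm (duhamel solution solution q - duhamel ?u ?u q))
      \<le> (\<integral>\<^sup>+p. ennreal (norm (integrand ?d solution q p + integrand ?u ?d q p)) \<partial>spacetime)"
    unfolding eq by (rule ennreal_norm_integral_le)
  also have "\<dots> \<le> (\<integral>\<^sup>+p. ennreal (norm (integrand ?d solution q p)) + ennreal (norm (integrand ?u ?d q p)) \<partial>spacetime)"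
    by (intro nn_integral_mono) (simp add: ennreal_leI norm_triangle_ineq flip: ennreal_plus)
  also have "\<dots> = (\<integral>\<^sup>+p. ennreal (norm (integrand ?d solution q p)) \<partial>spacetime)
      + (\<integral>\<^sup>+p. ennreal (norm (integrand ?u ?d q p)) \<partial>spacetime)"
    by (intro nn_integral_add norm_measurable integrand_measurable) measurable
  also have "\<dots> \<le> majorant_product 648 M2 M q + majorant_product 648 M M2 q"
    by (intro add_mono nn_integral_integrand_le)
      (auto intro!: AE_I2 mult_mono norm_solution_minus_linear_le norm_solution_le linear_part_le_M)
  finally show ?thesis .
qed

text \<open>The energy of \<open>M2\<close> is quadratic in \<open>e\<close> and the energy of \<open>M\<close> is linear, so that the pairing is of
  order \<open>e powr (3/2)\<close>: \<open>648\<^sup>2 (4 e)\<^sup>2 (4 e) = (5184 e sqrt e)\<^sup>2\<close>.\<close>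

lemma pairing_M2_le: "pairing M2 M \<le> ennreal (5184 * e * sqrt e)" "pairing M M2 \<le> ennreal (5184 * e * sqrt e)"
proof -
  have PM: "(pairing M M)\<^sup>2 \<le> (ennreal (4 * e))\<^sup>2"
    using pairing_square_le[OF M_measurable M_measurable] mult_mono[OF energy_M_le energy_M_le]
    by (simp add: power2_eq_square)
  have "energy M2 \<le> ennreal (648\<^sup>2) * (pairing M M)\<^sup>2"
    by (rule energy_majorant_product_le) simp_all
  also have "\<dots> \<le> ennreal (648\<^sup>2) * (ennreal (4 * e))\<^sup>2" by (intro mult_left_mono PM) simp
  finally have "energy M2 * energy M \<le> (ennreal (648\<^sup>2) * (ennreal (4 * e))\<^sup>2) * ennreal (4 * e)"
    by (intro mult_mono energy_M_le) auto
  also have "\<dots> = ennreal ((5184 * e * sqrt e)\<^sup>2)"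
    using e_nonneg by (simp add: ennreal_power power_mult_distrib del: ennreal_numeral flip: ennreal_mult)
  finally have E: "energy M2 * energy M \<le> ennreal ((5184 * e * sqrt e)\<^sup>2)" .
  have sq: "p \<le> ennreal (5184 * e * sqrt e)" if "p\<^sup>2 \<le> ennreal ((5184 * e * sqrt e)\<^sup>2)" for p :: ennreal
  proof (cases p)
    case (real x)
    then have "ennreal (x\<^sup>2) \<le> ennreal ((5184 * e * sqrt e)\<^sup>2)" using that by (simp add: ennreal_power)
    then have "x \<le> 5184 * e * sqrt e" using e_nonneg real(2) by (intro power2_le_imp_le[of x]) simp_all
    then show ?thesis using real by (simp add: ennreal_leI)
  next
    case top
    then show ?thesis using that by (simp add: power2_eq_square ennreal_top_mult top_unique)
  qed
  show "pairing M2 M \<le> ennreal (5184 * e * sqrt e)"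
    by (rule sq, rule order_trans[OF pairing_square_le E]) simp_all
  show "pairing M M2 \<le> ennreal (5184 * e * sqrt e)"
    by (rule sq, rule order_trans[OF pairing_square_le]) (use E in \<open>simp_all add: mult.commute\<close>)
qed

text \<open>Where the data vanish, the solution is minus the Duhamel term, and replacing the solution by its
  linear part in both arguments costs two products that are at least cubic in the data. The constant is
  \<open>3/2 * 648 * (5184 + 5184)\<close>, where \<open>3/2\<close> bounds \<open>\<bar>\<xi>\<bar>\<close>.\<close>

lemma solution_remainder_le:
  assumes S [measurable]: "S \<in> sets borel" and S_f: "\<And>\<xi>. \<xi> \<in> S \<Longrightarrow> f \<xi> = 0" and S_norm: "\<And>\<xi>. \<xi> \<in> S \<Longrightarrow> 0 < norm \<xi> \<and> norm \<xi> \<le> 3/2"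
  shows "(\<integral>\<^sup>+\<xi>\<in>S. ennreal (norm (solution (t, \<xi>) $ i + duhamel (linear_part f) (linear_part f) (t, \<xi>) $ i)) \<partial>lborel)
    \<le> ennreal (10077696 * e * sqrt e)"
proof -
  let ?R = "\<lambda>\<xi>. majorant_product 648 M2 M (t, \<xi>) * ennreal (1 / norm \<xi>) + majorant_product 648 M M2 (t, \<xi>) * ennreal (1 / norm \<xi>)"
  note [measurable] = majorant_product_measurable[OF M2_measurable M_measurable, of 648]
    majorant_product_measurable[OF M_measurable M2_measurable, of 648]
  have "(\<integral>\<^sup>+\<xi>\<in>S. ennreal (norm (solution (t, \<xi>) $ i + duhamel (linear_part f) (linear_part f) (t, \<xi>) $ i)) \<partial>lborel)
      \<le> (\<integral>\<^sup>+\<xi>. ennreal (3/2) * ?R \<xi> \<partial>lborel)"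
  proof (rule nn_integral_mono_AE)
    show "AE \<xi> in lborel. ennreal (norm (solution (t, \<xi>) $ i + duhamel (linear_part f) (linear_part f) (t, \<xi>) $ i)) * indicator S \<xi>
        \<le> ennreal (3/2) * ?R \<xi>"
      using AE_M_finite_slice[of t]
    proof eventually_elim
      case (elim \<xi>)
      show ?case
      proof (cases "\<xi> \<in> S")
        case True
        have "linear_part f (t, \<xi>) = 0"
          using S_f[OF True] linear_0[OF linear_propagator] by (simp add: linear_part_def)
        then have sol: "solution (t, \<xi>) = - duhamel solution solution (t, \<xi>)" using solution_eq[OF elim] by simp
        have "norm (solution (t, \<xi>) $ i + duhamel (linear_part f) (linear_part f) (t, \<xi>) $ i)
            \<le> norm (solution (t, \<xi>) + duhamel (linear_part f) (linear_part f) (t, \<xi>))"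
          unfolding vector_add_component[symmetric] by (rule norm_component_le)
        also have "\<dots> = norm (duhamel solution solution (t, \<xi>) - duhamel (linear_part f) (linear_part f) (t, \<xi>))"
          unfolding sol by (subst norm_minus_cancel[symmetric]) simp
        finally have "ennreal (norm (solution (t, \<xi>) $ i + duhamel (linear_part f) (linear_part f) (t, \<xi>) $ i))
            \<le> (majorant_product 648 M2 M (t, \<xi>) + majorant_product 648 M M2 (t, \<xi>)) * 1"
          using order_trans[OF ennreal_leI norm_duhamel_difference_le[OF elim]] by simp
        also have "\<dots> \<le> (majorant_product 648 M2 M (t, \<xi>) + majorant_product 648 M M2 (t, \<xi>)) * (ennreal (3/2) * ennreal (1 / norm \<xi>))"
          using S_norm[OF True]
          by (intro mult_left_mono) (auto simp: le_divide_eq simp flip: ennreal_mult intro!: ennreal_leI[of 1, simplified])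
        finally show ?thesis using True by (simp add: algebra_simps)
      qed simp
    qed
  qed
  also have "\<dots> = ennreal (3/2) * ((\<integral>\<^sup>+\<xi>. majorant_product 648 M2 M (t, \<xi>) * ennreal (1 / norm \<xi>) \<partial>lborel)
      + (\<integral>\<^sup>+\<xi>. majorant_product 648 M M2 (t, \<xi>) * ennreal (1 / norm \<xi>) \<partial>lborel))"
    by (subst nn_integral_cmult, measurable, subst nn_integral_add) measurable
  also have "\<dots> \<le> ennreal (3/2) * (ennreal 648 * pairing M2 M + ennreal 648 * pairing M M2)"
    by (intro mult_left_mono add_mono weighted_majorant_product_le) auto
  also have "\<dots> \<le> ennreal (3/2) * (ennreal 648 * ennreal (5184 * e * sqrt e) + ennreal 648 * ennreal (5184 * e * sqrt e))"
    by (intro mult_left_mono add_mono pairing_M2_le) auto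
  also have "\<dots> = ennreal (10077696 * e * sqrt e)"
    using e_nonneg by (simp del: ennreal_numeral flip: ennreal_mult ennreal_plus)
  finally show ?thesis .
qed

end

section \<open>The interaction of opposite pulses\<close>

lemma norm_A_symbol_le:
  assumes "norm \<xi> \<le> 3/2"
  shows "norm ((- A_symbol \<xi>) *v w) \<le> 100 * norm w"
proof -
  have neg: "(- A_symbol \<xi>) *v w = - (A_symbol \<xi> *v w)"
    by (simp add: matrix_vector_mult_def vec_eq_iff sum_negf)
  have c: "\<bar>\<xi> $ k\<bar> \<le> 3/2" for k using component_le_norm_cart[of \<xi> k] assms by linarith
  have w: "norm (w $ j) \<le> norm w" for j by (rule norm_component_le)
  have n2: "(norm \<xi>)\<^sup>2 \<le> 9/4" using power_mono[OF assms, of 2] by (simp add: power2_eq_square)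
  have B: "norm (B_symbol \<xi> $ k $ l * z) \<le> 3/2 * norm w" if "norm z \<le> norm w" for k l z
  proof -
    have "norm (B_symbol \<xi> $ k $ l) \<le> 3/2"
      using exhaust_3[of k] exhaust_3[of l] c[of 1] c[of 2] c[of 3] by (auto simp: B_symbol_def norm_mult)
    then show ?thesis unfolding norm_mult using that by (intro mult_mono) auto
  qed
  have sB: "norm (\<Sum>l\<in>UNIV. B_symbol \<xi> $ k $ l * z l) \<le> 9/2 * norm w" if "\<And>l. norm (z l) \<le> norm w" for k and z :: "3 \<Rightarrow> complex"
    using sum_norm_le[of UNIV "\<lambda>l. B_symbol \<xi> $ k $ l * z l" "\<lambda>_. 3/2 * norm w"] B[OF that] by simp
  have "norm ((A_symbol \<xi> *v w) $ i) \<le> 16 * norm w" for i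
  proof (cases i)
    case (Inl k)
    have "norm (of_real ((norm \<xi>)\<^sup>2) * w $ Inl k) \<le> 9/4 * norm w"
      unfolding norm_mult norm_of_real using n2 w by (intro mult_mono) auto
    then show ?thesis unfolding Inl A_symbol_Inl
      using sB[of "\<lambda>l. w $ Inr l" k, OF w] norm_ge_zero[of w] by (intro order_trans[OF norm_triangle_ineq]) linarith
  next
    case (Inr k)
    have 1: "norm (of_real ((norm \<xi>)\<^sup>2 + 2) * w $ Inr k) \<le> 17/4 * norm w"
      unfolding norm_mult norm_of_real using n2 w by (intro mult_mono) auto
    have "norm (\<Sum>l\<in>UNIV. of_real (\<xi> $ l) * w $ Inr l) \<le> 9/2 * norm w"
    proof -
      have "norm (of_real (\<xi> $ l) * w $ Inr l) \<le> 3/2 * norm w" for l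
        unfolding norm_mult norm_of_real using c w by (intro mult_mono) auto
      then show ?thesis using sum_norm_le[of UNIV "\<lambda>l. of_real (\<xi> $ l) * w $ Inr l" "\<lambda>_. 3/2 * norm w"] by simp
    qed
    then have "norm (of_real (\<xi> $ k) * (\<Sum>l\<in>UNIV. of_real (\<xi> $ l) * w $ Inr l)) \<le> 3/2 * (9/2 * norm w)"
      unfolding norm_mult[of "of_real (\<xi> $ k)"] norm_of_real using c by (intro mult_mono) auto
    then show ?thesis unfolding Inr A_symbol_Inr
      using 1 sB[of "\<lambda>l. w $ Inl l" k, OF w] norm_ge_zero[of w]
      by (intro order_trans[OF norm_triangle_ineq] order_trans[OF add_right_mono[OF norm_triangle_ineq]]) linarith
  qed
  then have "(\<Sum>i\<in>UNIV. norm ((A_symbol \<xi> *v w) $ i)) \<le> (\<Sum>i\<in>(UNIV::(3+3) set). 16 * norm w)" by (intro sum_mono)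
  then show ?thesis unfolding neg norm_minus_cancel
    using norm_le_sum_components[of "A_symbol \<xi> *v w"] by (simp add: order_trans[of _ "96 * norm w"])
qed

text \<open>For bounded frequencies the propagator moves by \<open>O(s)\<close>; coercivity with constant 0 suffices.\<close>

lemma propagator_near_identity:
  assumes "norm \<xi> \<le> 3/2" "0 \<le> s"
  shows "norm (propagator s \<xi> w - w) \<le> s * (100 * norm w)"
proof -
  have co: "v \<bullet> ((- A_symbol \<xi>) *v v) \<le> - 0 * (norm v)\<^sup>2" for v
  proof -
    have "0 \<le> (norm \<xi>)\<^sup>2 / 2 * (norm v)\<^sup>2" by simp
    then show ?thesis using A_symbol_coercive[of v \<xi>] by linarith
  qed
  have "norm (propagator s \<xi> w - w) \<le> s * norm ((- A_symbol \<xi>) *v w)"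
    using norm_flow_diff_le[OF linear_matrix_vector, of "- A_symbol \<xi>" 0 s 0 w] co assms
    by (simp add: propagator_def)
  also have "\<dots> \<le> s * (100 * norm w)" using assms by (intro mult_left_mono norm_A_symbol_le)
  finally show ?thesis .
qed

text \<open>On a field with divergence free angular velocity the symbol differs from \<open>\<bar>\<eta>\<bar>\<^sup>2\<close> only by the curl and
  the damping, both at most of order \<open>\<bar>\<eta>\<bar>\<close>.\<close>

lemma propagator_near_heat:
  assumes div: "(\<Sum>l\<in>UNIV. of_real (\<eta> $ l) * w $ Inr l) = 0" and \<eta>: "1 \<le> norm \<eta>" and s: "0 \<le> s"
  shows "norm (propagator s \<eta> w - exp (- s * (norm \<eta>)\<^sup>2) *\<^sub>R w) \<le> s * exp (- s * (norm \<eta>)\<^sup>2 / 2) * (30 * norm \<eta> * norm w)"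
proof -
  have neg: "(- A_symbol \<eta>) *v w = - (A_symbol \<eta> *v w)"
    by (simp add: matrix_vector_mult_def vec_eq_iff sum_negf)
  let ?v = "(- A_symbol \<eta>) *v w + (norm \<eta>)\<^sup>2 *\<^sub>R w"
  have w: "norm (w $ j) \<le> norm w" for j by (rule norm_component_le)
  have sB: "norm (\<Sum>l\<in>UNIV. B_symbol \<eta> $ k $ l * z l) \<le> 3 * (norm \<eta> * norm w)" if "\<And>l. norm (z l) \<le> norm w" for k and z :: "3 \<Rightarrow> complex"
  proof -
    have "norm (B_symbol \<eta> $ k $ l) \<le> norm \<eta>" for l
      using exhaust_3[of k] exhaust_3[of l] component_le_norm_cart[of \<eta> 1] component_le_norm_cart[of \<eta> 2] component_le_norm_cart[of \<eta> 3]
      by (auto simp: B_symbol_def norm_mult)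
    then have "norm (B_symbol \<eta> $ k $ l * z l) \<le> norm \<eta> * norm w" for l
      unfolding norm_mult using that by (intro mult_mono) auto
    then show ?thesis using sum_norm_le[of UNIV "\<lambda>l. B_symbol \<eta> $ k $ l * z l" "\<lambda>_. norm \<eta> * norm w"] by simp
  qed
  have ww: "norm w \<le> norm \<eta> * norm w" using mult_right_mono[OF \<eta> norm_ge_zero[of w]] by simp
  have "norm (?v $ i) \<le> 5 * (norm \<eta> * norm w)" for i
  proof (cases i)
    case (Inl k)
    have "?v $ i = - (\<Sum>l\<in>UNIV. B_symbol \<eta> $ k $ l * w $ Inr l)"
      unfolding neg Inl vector_add_component vector_uminus_component vector_scaleR_component A_symbol_Inl
      by (simp add: scaleR_conv_of_real)
    then have "norm (?v $ i) = norm (\<Sum>l\<in>UNIV. B_symbol \<eta> $ k $ l * w $ Inr l)" by (simp only: norm_minus_cancel)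
    then show ?thesis using sB[of "\<lambda>l. w $ Inr l" k, OF w] order_trans[OF norm_ge_zero ww] by linarith
  next
    case (Inr k)
    have "?v $ i = - ((\<Sum>l\<in>UNIV. B_symbol \<eta> $ k $ l * w $ Inl l) + 2 * w $ Inr k)"
      unfolding neg Inr vector_add_component vector_uminus_component vector_scaleR_component A_symbol_Inr div
      by (simp add: scaleR_conv_of_real algebra_simps)
    then have "norm (?v $ i) \<le> norm (\<Sum>l\<in>UNIV. B_symbol \<eta> $ k $ l * w $ Inl l) + norm (2 * w $ Inr k)"
      by (simp only: norm_minus_cancel norm_triangle_ineq)
    then show ?thesis using sB[of "\<lambda>l. w $ Inl l" k, OF w] w[of "Inr k"] ww by (simp add: norm_mult)
  qed
  then have "(\<Sum>i\<in>UNIV. norm (?v $ i)) \<le> (\<Sum>i\<in>(UNIV::(3+3) set). 5 * (norm \<eta> * norm w))" by (intro sum_mono)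
  then have v: "norm ?v \<le> 30 * norm \<eta> * norm w" using norm_le_sum_components[of ?v] by simp
  have co: "v \<bullet> ((- A_symbol \<eta>) *v v) \<le> - ((norm \<eta>)\<^sup>2 / 2) * (norm v)\<^sup>2" for v by (rule A_symbol_coercive)
  have "norm (propagator s \<eta> w - exp (- (norm \<eta>)\<^sup>2 * s) *\<^sub>R w) \<le> s * exp (- ((norm \<eta>)\<^sup>2 / 2) * s) * norm ?v"
    unfolding propagator_def by (rule norm_flow_diff_le[OF linear_matrix_vector co s]) simp
  also have "\<dots> \<le> s * exp (- ((norm \<eta>)\<^sup>2 / 2) * s) * (30 * norm \<eta> * norm w)"
    using s v by (intro mult_left_mono) auto
  finally show ?thesis by (simp add: mult_ac)
qed

lemma pulses_Inr_divergence_free: "(\<Sum>k\<in>UNIV. of_real (\<xi> $ k) * pulses n \<delta> \<xi> $ Inr k) = 0"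
  unfolding pulses_def vector_scaleR_component
  by (simp add: pulse_field_def pulse_direction_def sum_3)

text \<open>Here \<open>p, q\<close> stand for \<open>\<xi>\<^sub>1, \<xi>\<^sub>2\<close>, \<open>s\<close> for \<open>\<bar>\<xi>\<bar>\<^sup>2\<close> and \<open>x, y\<close> for
  \<open>\<eta>\<^sub>1, \<eta>\<^sub>2\<close>. The first expression is the interaction in the angular velocity and the second one,
  after the Leray projection, that in the velocity. At \<open>\<xi> = (1, 1, 0)\<close> and \<open>y = 0\<close> they are \<open>x\<^sup>2\<close> and
  \<open>x\<^sup>2 / 2\<close>, which leaves room for a perturbation.\<close>

lemma resonant_sign:
  fixes x y p q s :: real
  assumes p: "\<bar>p - 1\<bar> \<le> 1/20" and q: "\<bar>q - 1\<bar> \<le> 1/20" and s: "p\<^sup>2 + q\<^sup>2 \<le> s" and xy: "15 * \<bar>y\<bar> \<le> \<bar>x\<bar>"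
  shows "x\<^sup>2 / 5 \<le> (q * x - p * y) * x" "x\<^sup>2 / 5 \<le> (q * x - p * y) * (x - q * (q * x - p * y) / s)"
proof -
  define d where "d = q * x - p * y"
  define \<theta> where "\<theta> = d - x"
  have s1: "361/200 \<le> s"
  proof -
    have "(19/20)\<^sup>2 \<le> p\<^sup>2" "(19/20)\<^sup>2 \<le> q\<^sup>2" using p q by (intro power_mono; linarith)+
    then show ?thesis using s by (simp add: power2_eq_square)
  qed
  have "\<theta> = (q - 1) * x - p * y" by (simp add: \<theta>_def d_def algebra_simps)
  then have "\<bar>\<theta>\<bar> \<le> \<bar>q - 1\<bar> * \<bar>x\<bar> + \<bar>p\<bar> * \<bar>y\<bar>"
    using abs_triangle_ineq4[of "(q - 1) * x" "p * y"] by (simp add: abs_mult)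
  also have "\<dots> \<le> 1/20 * \<bar>x\<bar> + 21/20 * (\<bar>x\<bar> / 15)"
  proof (intro add_mono mult_mono)
    show "\<bar>p\<bar> \<le> 21/20" using p by linarith
  qed (use q xy in auto)
  also have "\<dots> = 3/25 * \<bar>x\<bar>" by simp
  finally have \<theta>: "\<bar>\<theta>\<bar> \<le> 3/25 * \<bar>x\<bar>" .
  have x\<theta>: "\<bar>x * \<theta>\<bar> \<le> 3/25 * x\<^sup>2"
    using mult_left_mono[OF \<theta>, of "\<bar>x\<bar>"] by (simp add: abs_mult power2_eq_square)
  have \<theta>\<theta>: "\<theta>\<^sup>2 \<le> 9/625 * x\<^sup>2"
    using power_mono[OF \<theta>, of 2] by (simp add: power_mult_distrib power2_eq_square)
  have d: "d = x + \<theta>" by (simp add: \<theta>_def)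
  show "x\<^sup>2 / 5 \<le> (q * x - p * y) * x"
    unfolding d_def[symmetric] unfolding d using x\<theta> zero_le_power2[of x] by (simp add: power2_eq_square algebra_simps abs_le_iff)
  define c where "c = q / s"
  have "0 \<le> q" "q \<le> 21/20" using q by linarith+
  then have c: "0 \<le> c" "c \<le> 7/12" using s1 by (auto simp: c_def divide_le_eq)
  have "(1 - c) * x\<^sup>2 \<ge> 5/12 * x\<^sup>2" using c by (intro mult_right_mono) auto
  moreover have "\<bar>(1 - 2 * c) * (x * \<theta>)\<bar> \<le> 1 * (3/25 * x\<^sup>2)"
    unfolding abs_mult[of "1 - 2 * c"] using c x\<theta> by (intro mult_mono) auto
  moreover have "c * \<theta>\<^sup>2 \<le> 7/12 * (9/625 * x\<^sup>2)" using c \<theta>\<theta> by (intro mult_mono) auto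
  ultimately have "x\<^sup>2 / 5 \<le> (1 - c) * x\<^sup>2 + (1 - 2 * c) * (x * \<theta>) - c * \<theta>\<^sup>2"
    using zero_le_power2[of x] by linarith
  also have "\<dots> = d * (x - c * d)" unfolding d by (simp add: power2_eq_square algebra_simps)
  finally show "x\<^sup>2 / 5 \<le> (q * x - p * y) * (x - q * (q * x - p * y) / s)"
    unfolding d_def[symmetric] c_def by simp
qed

text \<open>Since \<open>pulse_direction\<close> is linear and \<open>\<xi>\<close> is orthogonal to its own direction, the factor
  \<open>\<xi> \<bullet> pulse_direction (\<xi> - \<eta>)\<close> equals \<open>- \<xi> \<bullet> pulse_direction \<eta>\<close>. The
  interaction is thus a quadratic form in \<open>\<eta>\<close>, with values of the order of \<open>\<eta>\<^sub>1\<^sup>2\<close>.\<close>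

lemma proj_flux_pulse_field:
  assumes i: "i = Inl 2 \<or> i = Inr 2"
    and \<xi>: "\<bar>\<xi> $ 1 - 1\<bar> \<le> 1/20" "\<bar>\<xi> $ 2 - 1\<bar> \<le> 1/20" and \<eta>: "15 * \<bar>\<eta> $ 2\<bar> \<le> \<bar>\<eta> $ 1\<bar>"
  shows "(\<eta> $ 1)\<^sup>2 / 5 * (1 / (2 * pi) ^ 3) \<le> Im (proj \<xi> (flux \<xi> (pulse_field (\<xi> - \<eta>)) (pulse_field \<eta>)) $ i)"
proof -
  define d where "d = \<xi> $ 2 * \<eta> $ 1 - \<xi> $ 1 * \<eta> $ 2"
  define c where "c = 1 / (2 * pi) ^ 3"
  have c0: "0 \<le> c" by (simp add: c_def)
  have div: "(\<Sum>k\<in>UNIV. \<i> * of_real (\<xi> $ k) * pulse_field (\<xi> - \<eta>) $ Inl k) = of_real (- d)"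
    by (simp add: pulse_field_def pulse_direction_def sum_3 d_def algebra_simps)
  have flux: "flux \<xi> (pulse_field (\<xi> - \<eta>)) (pulse_field \<eta>) $ j = of_real (c * (- d)) * pulse_field \<eta> $ j" for j
    unfolding flux_def vec_lambda_beta div by (simp add: c_def)
  have r: "(\<eta> $ 1)\<^sup>2 / 5 \<le> d * \<eta> $ 1" "(\<eta> $ 1)\<^sup>2 / 5 \<le> d * (\<eta> $ 1 - \<xi> $ 2 * d / (norm \<xi>)\<^sup>2)"
    using resonant_sign[OF \<xi> _ \<eta>, of "(norm \<xi>)\<^sup>2"] by (simp_all add: d_def norm_vec3)
  from i show ?thesis
  proof
    assume i: "i = Inr 2"
    have "Im (proj \<xi> (flux \<xi> (pulse_field (\<xi> - \<eta>)) (pulse_field \<eta>)) $ i) = c * (d * \<eta> $ 1)"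
      unfolding i proj_Inr flux by (simp add: pulse_field_def pulse_direction_def)
    then show ?thesis using mult_left_mono[OF r(1) c0] by (simp add: c_def mult_ac)
  next
    assume i: "i = Inl 2"
    have "proj \<xi> (flux \<xi> (pulse_field (\<xi> - \<eta>)) (pulse_field \<eta>)) $ i
        = \<i> * of_real (c * (d * (\<eta> $ 1 - \<xi> $ 2 * d / (norm \<xi>)\<^sup>2)))"
      unfolding i proj_Inl flux sum_3
      by (simp add: pulse_field_def pulse_direction_def d_def diff_divide_distrib algebra_simps power2_eq_square)
    then have "Im (proj \<xi> (flux \<xi> (pulse_field (\<xi> - \<eta>)) (pulse_field \<eta>)) $ i) = c * (d * (\<eta> $ 1 - \<xi> $ 2 * d / (norm \<xi>)\<^sup>2))"
      by simp
    then show ?thesis using mult_left_mono[OF r(2) c0] by (simp add: c_def mult_ac)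
  qed
qed

lemma pulse_support_bounds:
  assumes "\<eta> \<in> pulse_support n" and n: "4 \<le> n"
  shows "15 \<le> norm \<eta>" "2 ^ n \<le> 2 * norm \<eta>" "15 * \<bar>\<eta> $ 2\<bar> \<le> \<bar>\<eta> $ 1\<bar>"
proof -
  obtain k where k: "k < n" "\<eta> \<in> ball (pulse_center n k) 1 \<union> ball (- pulse_center n k) 1" "2 ^ (n + k) - 1 < norm \<eta>"
    using assms(1) by (rule pulse_supportE) blast
  have R: "(16::real) \<le> 2 ^ (n + k)" using power_increasing[of 4 "n + k" "2::real"] n by simp
  have Rn: "(2::real) ^ n \<le> 2 ^ (n + k)" by (intro power_increasing) auto
  show "15 \<le> norm \<eta>" "2 ^ n \<le> 2 * norm \<eta>" using k R Rn by linarith+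
  have "norm (pulse_center n k - \<eta>) < 1 \<or> norm (- pulse_center n k - \<eta>) < 1" using k(2) by (auto simp: dist_norm)
  then have "\<bar>(pulse_center n k - \<eta>) $ 1\<bar> < 1 \<and> \<bar>(pulse_center n k - \<eta>) $ 2\<bar> < 1
      \<or> \<bar>(- pulse_center n k - \<eta>) $ 1\<bar> < 1 \<and> \<bar>(- pulse_center n k - \<eta>) $ 2\<bar> < 1"
    using le_less_trans[OF component_le_norm_cart] by blast
  then have "\<bar>2 ^ (n + k) - \<eta> $ 1\<bar> < 1 \<and> \<bar>\<eta> $ 2\<bar> < 1 \<or> \<bar>- (2 ^ (n + k)) - \<eta> $ 1\<bar> < 1 \<and> \<bar>\<eta> $ 2\<bar> < 1"
    by (simp add: pulse_center_def axis_def)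
  then show "15 * \<bar>\<eta> $ 2\<bar> \<le> \<bar>\<eta> $ 1\<bar>" using R by linarith
qed

lemma proj_flux_pulses:
  assumes i: "i = Inl 2 \<or> i = Inr 2" and n: "4 \<le> n"
    and \<xi>: "\<bar>\<xi> $ 1 - 1\<bar> \<le> 1/20" "\<bar>\<xi> $ 2 - 1\<bar> \<le> 1/20"
    and \<eta>: "\<eta> \<in> pulse_support n" "\<xi> - \<eta> \<in> pulse_support n"
  shows "(\<delta> / sqrt (real n))\<^sup>2 * ((\<eta> $ 1)\<^sup>2 / 5 * (1 / (2 * pi) ^ 3))
    \<le> Im (proj \<xi> (flux \<xi> (pulses n \<delta> (\<xi> - \<eta>)) (pulses n \<delta> \<eta>)) $ i)"
proof -
  let ?c = "\<delta> / sqrt (real n)"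
  have "proj \<xi> (flux \<xi> (?c *\<^sub>R a) (?c *\<^sub>R b)) = ?c\<^sup>2 *\<^sub>R proj \<xi> (flux \<xi> a b)" for a b
    using bilinear_flux[of \<xi>]
    by (simp add: bilinear_def linear_scale[OF linear_proj] linear_scale[where f="flux \<xi> _"] linear_scale[where f="\<lambda>x. flux \<xi> x _"] power2_eq_square)
  then have "proj \<xi> (flux \<xi> (pulses n \<delta> (\<xi> - \<eta>)) (pulses n \<delta> \<eta>)) = ?c\<^sup>2 *\<^sub>R proj \<xi> (flux \<xi> (pulse_field (\<xi> - \<eta>)) (pulse_field \<eta>))"
    using \<eta> by (simp add: pulses_def)
  then have "Im (proj \<xi> (flux \<xi> (pulses n \<delta> (\<xi> - \<eta>)) (pulses n \<delta> \<eta>)) $ i)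
      = ?c\<^sup>2 * Im (proj \<xi> (flux \<xi> (pulse_field (\<xi> - \<eta>)) (pulse_field \<eta>)) $ i)"
    by simp
  also have "\<dots> \<ge> ?c\<^sup>2 * ((\<eta> $ 1)\<^sup>2 / 5 * (1 / (2 * pi) ^ 3))"
    by (intro mult_left_mono proj_flux_pulse_field i \<xi> pulse_support_bounds(3)[OF \<eta>(1) n]) simp
  finally show ?thesis .
qed

text \<open>Replacing the two inner propagators by heat flows costs one derivative less than the leading
  term, and dropping the outer propagator costs a factor \<open>t\<close>. After integration in time both errors are small
  compared with the leading term, by the factors \<open>1 / \<bar>\<eta>\<bar>\<close> and \<open>t\<close>.\<close>

lemma kernel_pulses_error:
  assumes n: "4 \<le> n" and \<delta>: "0 \<le> \<delta>" and \<xi>: "norm \<xi> \<le> 3/2" and t: "0 \<le> \<tau>" "\<tau> \<le> t"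
    and \<eta>: "\<eta> \<in> pulse_support n" "\<xi> - \<eta> \<in> pulse_support n"
  shows "norm (micropolar_kernel t \<tau> \<xi> (propagator \<tau> (\<xi> - \<eta>) (pulses n \<delta> (\<xi> - \<eta>))) (propagator \<tau> \<eta> (pulses n \<delta> \<eta>))
      - (exp (- \<tau> * (norm (\<xi> - \<eta>))\<^sup>2) * exp (- \<tau> * (norm \<eta>)\<^sup>2)) *\<^sub>R proj \<xi> (flux \<xi> (pulses n \<delta> (\<xi> - \<eta>)) (pulses n \<delta> \<eta>)))
    \<le> 3000000 * (\<delta> / sqrt (real n))\<^sup>2 * ((t * (norm \<eta>)\<^sup>2 + norm \<eta>) * exp (- \<tau> * (norm \<eta>)\<^sup>2 / 4))"
proof -
  define \<zeta> where "\<zeta> = \<xi> - \<eta>"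
  define c where "c = \<delta> / sqrt (real n)"
  define a b where "a = pulses n \<delta> \<zeta>" and "b = pulses n \<delta> \<eta>"
  define ua ub where "ua = propagator \<tau> \<zeta> a" and "ub = propagator \<tau> \<eta> b"
  define Ea Eb where "Ea = exp (- \<tau> * (norm \<zeta>)\<^sup>2)" and "Eb = exp (- \<tau> * (norm \<eta>)\<^sup>2)"
  define B where "B = (\<lambda>a b. proj \<xi> (flux \<xi> a b))"
  define \<epsilon> where "\<epsilon> = exp (- \<tau> * (norm \<eta>)\<^sup>2 / 2)"
  define y where "y = norm \<eta>"
  have c0: "0 \<le> c" using \<delta> by (simp add: c_def)
  have \<eta>15: "15 \<le> y" and \<zeta>15: "15 \<le> norm \<zeta>" using pulse_support_bounds(1)[OF _ n] \<eta> by (auto simp: \<zeta>_def y_def)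
  have \<zeta>: "norm \<zeta> \<le> 2 * y"
    using norm_triangle_ineq4[of \<xi> \<eta>] \<xi> \<eta>15 unfolding \<zeta>_def y_def by linarith
  have a: "norm a \<le> 4 * c * y"
  proof -
    have "norm a \<le> 2 * c * norm \<zeta>" using norm_pulses_le[OF \<delta>, of n \<zeta>] \<eta>(2) by (simp add: a_def c_def \<zeta>_def)
    also have "\<dots> \<le> 2 * c * (2 * y)" using c0 \<zeta> by (intro mult_left_mono) auto
    finally show ?thesis by simp
  qed
  have b: "norm b \<le> 2 * c * y" using norm_pulses_le[OF \<delta>, of n \<eta>] \<eta>(1) by (simp add: b_def c_def y_def)
  have \<epsilon>: "0 \<le> \<epsilon>" by (simp add: \<epsilon>_def)
  have ua: "norm ua \<le> norm a"
    using norm_propagator_le[OF t(1), of \<zeta> a] mult_right_mono[of "exp (- \<tau> * (norm \<zeta>)\<^sup>2 / 2)" 1 "norm a"] t by (simp add: ua_def)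
  have ub: "norm ub \<le> \<epsilon> * norm b" using norm_propagator_le[OF t(1), of \<eta> b] by (simp add: ub_def \<epsilon>_def)
  \<comment> \<open>972 is \<open>648 * 3/2\<close>.\<close>
  have Bd: "norm (B v w) \<le> 972 * (norm v * norm w)" for v w
  proof -
    have "norm (B v w) \<le> 648 * norm \<xi> * (norm v * norm w)" unfolding B_def by (rule norm_proj_flux_le)
    also have "\<dots> \<le> 972 * (norm v * norm w)" using \<xi> by (intro mult_right_mono) auto
    finally show ?thesis .
  qed
  have bil: "bilinear B"
  proof -
    have "micropolar_kernel \<tau> \<tau> \<xi> = B" by (intro ext) (simp add: B_def micropolar_kernel_def propagator_0)
    then show ?thesis using bounded_bilinear_kernel[of \<tau> \<tau> \<xi>] by (simp add: bilinear_conv_bounded_bilinear)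
  qed
  have ab: "norm a * norm b \<le> 8 * (c * y)\<^sup>2"
    using mult_mono[OF a b] c0 \<eta>15 by (simp add: power2_eq_square mult_ac)
  have kernel: "micropolar_kernel t \<tau> \<xi> ua ub = propagator (t - \<tau>) \<xi> (B ua ub)"
    by (simp add: micropolar_kernel_def B_def)
  have split: "micropolar_kernel t \<tau> \<xi> ua ub - (Ea * Eb) *\<^sub>R B a b
    = (propagator (t - \<tau>) \<xi> (B ua ub) - B ua ub) + (B (ua - Ea *\<^sub>R a) ub + B (Ea *\<^sub>R a) (ub - Eb *\<^sub>R b))"
    unfolding kernel by (simp add: bilinear_lsub[OF bil] bilinear_rsub[OF bil] bilinear_lmul[OF bil] bilinear_rmul[OF bil] mult.commute)
  have 1: "norm (propagator (t - \<tau>) \<xi> (B ua ub) - B ua ub) \<le> t * (777600 * c\<^sup>2 * y\<^sup>2 * \<epsilon>)"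
  proof -
    have "norm (B ua ub) \<le> 972 * (norm a * (\<epsilon> * norm b))"
      using Bd[of ua ub] mult_mono[OF ua ub] by simp
    also have "\<dots> = 972 * \<epsilon> * (norm a * norm b)" by simp
    also have "\<dots> \<le> 972 * \<epsilon> * (8 * (c * y)\<^sup>2)" using \<epsilon> ab by (intro mult_left_mono) auto
    finally have w: "100 * norm (B ua ub) \<le> 777600 * c\<^sup>2 * y\<^sup>2 * \<epsilon>" by (simp add: power_mult_distrib mult_ac)
    have "norm (propagator (t - \<tau>) \<xi> (B ua ub) - B ua ub) \<le> (t - \<tau>) * (100 * norm (B ua ub))"
      by (rule propagator_near_identity[OF \<xi>]) (use t in simp)
    also have "\<dots> \<le> t * (777600 * c\<^sup>2 * y\<^sup>2 * \<epsilon>)" using t by (intro mult_mono[OF _ w]) auto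
    finally show ?thesis .
  qed
  have 2: "norm (B (ua - Ea *\<^sub>R a) ub) \<le> \<tau> * y ^ 3 * \<epsilon> * (466560 * c\<^sup>2)"
  proof -
    have "norm (ua - Ea *\<^sub>R a) \<le> \<tau> * exp (- \<tau> * (norm \<zeta>)\<^sup>2 / 2) * (30 * norm \<zeta> * norm a)"
      unfolding ua_def Ea_def a_def by (rule propagator_near_heat[OF pulses_Inr_divergence_free]) (use \<zeta>15 t in auto)
    also have "\<dots> \<le> \<tau> * 1 * (30 * (2 * y) * norm a)"
      using t \<zeta> \<eta>15 by (intro mult_mono mult_left_mono) auto
    finally have d: "norm (ua - Ea *\<^sub>R a) \<le> 60 * \<tau> * y * norm a" by simp
    have "norm (B (ua - Ea *\<^sub>R a) ub) \<le> 972 * ((60 * \<tau> * y * norm a) * (\<epsilon> * norm b))"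
      using Bd[of "ua - Ea *\<^sub>R a" ub] mult_mono[OF d ub] t \<eta>15 by simp
    also have "\<dots> = 58320 * \<tau> * y * \<epsilon> * (norm a * norm b)" by simp
    also have "\<dots> \<le> 58320 * \<tau> * y * \<epsilon> * (8 * (c * y)\<^sup>2)" using t \<eta>15 \<epsilon> ab by (intro mult_left_mono) auto
    finally show ?thesis by (simp add: power_mult_distrib power2_eq_square power3_eq_cube mult_ac)
  qed
  have 3: "norm (B (Ea *\<^sub>R a) (ub - Eb *\<^sub>R b)) \<le> \<tau> * y ^ 3 * \<epsilon> * (233280 * c\<^sup>2)"
  proof -
    have d: "norm (ub - Eb *\<^sub>R b) \<le> \<tau> * \<epsilon> * (30 * y * norm b)"
      unfolding ub_def Eb_def b_def \<epsilon>_def y_def by (rule propagator_near_heat[OF pulses_Inr_divergence_free]) (use \<eta>15 t in \<open>auto simp: y_def\<close>)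
    have Ea: "norm (Ea *\<^sub>R a) \<le> norm a" using t mult_right_mono[of Ea 1 "norm a"] by (simp add: Ea_def)
    have "norm (B (Ea *\<^sub>R a) (ub - Eb *\<^sub>R b)) \<le> 972 * (norm a * (\<tau> * \<epsilon> * (30 * y * norm b)))"
      using Bd[of "Ea *\<^sub>R a" "ub - Eb *\<^sub>R b"] mult_mono[OF Ea d] by simp
    also have "\<dots> = 29160 * \<tau> * y * \<epsilon> * (norm a * norm b)" by simp
    also have "\<dots> \<le> 29160 * \<tau> * y * \<epsilon> * (8 * (c * y)\<^sup>2)" using t \<eta>15 \<epsilon> ab by (intro mult_left_mono) auto
    finally show ?thesis by (simp add: power_mult_distrib power2_eq_square power3_eq_cube mult_ac)
  qed
  define x where "x = \<tau> * y\<^sup>2 / 4"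
  define F where "F = exp (- x)"
  have x0: "0 \<le> x" using t by (simp add: x_def)
  have \<epsilon>F: "\<epsilon> = F * F" unfolding \<epsilon>_def F_def x_def y_def by (simp flip: exp_add)
  have F: "0 \<le> F" "F \<le> 1" using x0 by (auto simp: F_def)
  have xF: "x * F \<le> 1"
  proof -
    have "x \<le> exp x" using exp_ge_add_one_self[of x] by linarith
    then have "x * F \<le> exp x * F" using F by (intro mult_right_mono)
    then show ?thesis by (simp add: F_def flip: exp_add)
  qed
  have "\<tau> * y ^ 3 * \<epsilon> = 4 * y * F * (x * F)" by (simp add: x_def \<epsilon>F power2_eq_square power3_eq_cube)
  also have "\<dots> \<le> 4 * y * F * 1" using F \<eta>15 xF by (intro mult_left_mono) auto
  \<comment> \<open>Half of the exponential decay pays for the factor \<open>\<tau> y\<^sup>2\<close>.\<close>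
  finally have \<tau>: "\<tau> * y ^ 3 * \<epsilon> \<le> 4 * y * F" by simp
  have "norm (micropolar_kernel t \<tau> \<xi> ua ub - (Ea * Eb) *\<^sub>R B a b)
    \<le> t * (777600 * c\<^sup>2 * y\<^sup>2 * \<epsilon>) + (\<tau> * y ^ 3 * \<epsilon> * (466560 * c\<^sup>2) + \<tau> * y ^ 3 * \<epsilon> * (233280 * c\<^sup>2))"
    unfolding split by (intro norm_triangle_mono 1 2 3)
  also have "\<dots> \<le> t * (777600 * c\<^sup>2 * y\<^sup>2 * F) + (4 * y * F * (466560 * c\<^sup>2) + 4 * y * F * (233280 * c\<^sup>2))"
  proof (intro add_mono mult_right_mono \<tau> mult_left_mono)
    show "\<epsilon> \<le> F" using mult_left_mono[OF F(2) F(1)] by (simp add: \<epsilon>F)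
  qed (use t in auto)
  also have "\<dots> = (c\<^sup>2 * F) * (777600 * (t * y\<^sup>2) + 2799360 * y)" by (simp add: algebra_simps)
  also have "\<dots> \<le> (c\<^sup>2 * F) * (3000000 * (t * y\<^sup>2) + 3000000 * y)"
    using t \<eta>15 F by (intro mult_left_mono add_mono mult_right_mono) auto
  also have "\<dots> = 3000000 * c\<^sup>2 * ((t * y\<^sup>2 + y) * F)" by (simp add: algebra_simps)
  finally show ?thesis
    unfolding ua_def ub_def a_def b_def Ea_def Eb_def B_def c_def F_def x_def y_def \<zeta>_def by simp
qed

section \<open>Norm inflation\<close>

text \<open>On this ball the function \<open>\<psi>\<close> equals 1, see \<open>lp_eq_1\<close>, and the data vanish.\<close>

definition low_ball :: "(real^3) set" where
  "low_ball = ball (vector [1, 1, 0]) (1/20)"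

lemma low_ballD:
  assumes "\<xi> \<in> low_ball"
  shows "\<bar>\<xi> $ 1 - 1\<bar> \<le> 1/20" "\<bar>\<xi> $ 2 - 1\<bar> \<le> 1/20" "4/3 < norm \<xi>" "norm \<xi> < 3/2"
proof -
  have d: "norm (\<xi> - vector [1, 1, 0]) < 1/20" using assms by (simp add: low_ball_def dist_norm norm_minus_commute)
  show "\<bar>\<xi> $ 1 - 1\<bar> \<le> 1/20" "\<bar>\<xi> $ 2 - 1\<bar> \<le> 1/20"
    using order_trans[OF component_le_norm_cart less_imp_le[OF d], of 1] order_trans[OF component_le_norm_cart less_imp_le[OF d], of 2]
    by simp_all
  have a: "norm (vector [1, 1, 0] :: real^3) = sqrt 2"
    using norm_vec3[of "vector [1, 1, 0]"] by (intro real_sqrt_unique[symmetric]) simp_all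
  have "7/5 \<le> sqrt (2::real)" "sqrt 2 \<le> (36/25 :: real)"
    by (intro real_le_rsqrt real_le_lsqrt; simp add: power2_eq_square)+
  then show "4/3 < norm \<xi>" "norm \<xi> < 3/2"
    using d a norm_triangle_ineq3[of \<xi> "vector [1, 1, 0]"] by linarith+
qed

lemma low_ball_measurable [measurable]: "low_ball \<in> sets borel"
  by (simp add: low_ball_def)

lemma dyadic_mass_low_ball:
  assumes lp: "littlewood_paley \<psi>" and [measurable]: "g \<in> borel_measurable borel"
  shows "(\<integral>\<^sup>+\<xi>\<in>low_ball. ennreal (norm (g \<xi>)) \<partial>lborel) \<le> dyadic_mass \<psi> 0 g"
proof -
  have "(\<integral>\<^sup>+\<xi>\<in>low_ball. ennreal (norm (g \<xi>)) \<partial>lborel) \<le> (\<integral>\<^sup>+\<xi>. ennreal (\<psi> \<xi> * norm (g \<xi>)) \<partial>lborel)"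
  proof (intro nn_integral_mono)
    fix \<xi> show "ennreal (norm (g \<xi>)) * indicator low_ball \<xi> \<le> ennreal (\<psi> \<xi> * norm (g \<xi>))"
      using low_ballD(3,4)[of \<xi>] lp_eq_1[OF lp, of \<xi>] by (cases "\<xi> \<in> low_ball") auto
  qed
  then show ?thesis by (simp add: dyadic_mass_def)
qed

context small_data
begin

text \<open>Up to time \<open>1 / R\<^sup>2\<close> a pulse of frequency \<open>R\<close> has lost at most a fixed factor.\<close>

lemma pulse_exponentials_ge:
  assumes n: "4 \<le> n" and \<tau>: "0 \<le> \<tau>" "\<tau> \<le> 1 / (2 ^ (n + k))\<^sup>2"
    and v: "norm v < 2 ^ (n + k) + 1" and w: "norm w < 2 ^ (n + k) + 1"
  shows "exp (- 3) \<le> exp (- \<tau> * (norm (v::real^3))\<^sup>2) * exp (- \<tau> * (norm (w::real^3))\<^sup>2)"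
proof -
  let ?R = "2 ^ (n + k) :: real"
  have R: "16 \<le> ?R" using power_increasing[of 4 "n + k" "2::real"] n by simp
  have sq: "\<tau> * (norm x)\<^sup>2 \<le> 3/2" if x: "norm x < ?R + 1" for x :: "real^3"
  proof -
    have "(norm x)\<^sup>2 \<le> (17/16 * ?R)\<^sup>2" using x R by (intro power_mono) auto
    then have "\<tau> * (norm x)\<^sup>2 \<le> 1 / ?R\<^sup>2 * (17/16 * ?R)\<^sup>2" using \<tau> by (intro mult_mono) auto
    also have "\<dots> = (17/16)\<^sup>2" by (simp add: power_mult_distrib power_divide)
    finally show ?thesis by (simp add: power2_eq_square)
  qed
  show ?thesis using sq[OF v] sq[OF w] by (simp flip: exp_add)
qed

text \<open>The lower bound is integrated over the disjoint boxes \<open>A k\<close>: times before the decay of the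
  pulse with frequency \<open>R = 2 ^ (n + k)\<close>, and a ball of frequencies \<open>\<eta>\<close> such that both \<open>\<eta>\<close> and
  \<open>\<xi> - \<eta>\<close> carry data. There the integrand is at least of order \<open>\<delta>\<^sup>2 R\<^sup>2 / n\<close>, and the
  box has the volume \<open>unit_vol / (512 R\<^sup>2)\<close>. Outside of the boxes the leading term is nonnegative, so only the error
  \<open>E\<close> is lost.\<close>

lemma duhamel_pulses_ge:
  assumes f: "f = pulses n \<delta>" and n: "4 \<le> n" and \<delta>: "0 \<le> \<delta>" and i: "i = Inl 2 \<or> i = Inr 2"
    and \<xi>: "\<xi> \<in> low_ball" and t: "t = 1 / 2 ^ n" and M: "M (t, \<xi>) < \<infinity>"
  shows "\<delta>\<^sup>2 * (unit_vol * exp (- 3) / (5120 * (2 * pi) ^ 3) - 72000000 * unit_vol / 2 ^ n)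
    \<le> Im (duhamel (linear_part f) (linear_part f) (t, \<xi>) $ i)"
proof -
  note \<xi>b = low_ballD[OF \<xi>]
  let ?u = "linear_part f" and ?\<Phi> = "pulse_support n" and ?R = "\<lambda>k. (2::real) ^ (n + k)"
  define c where "c = \<delta> / sqrt (real n)"
  define g where "g = c\<^sup>2 * exp (- 3) / (10 * (2 * pi) ^ 3)"
  \<comment> \<open>The ball is centred halfway between the pulse centre and its image under \<open>\<eta> \<mapsto> \<xi> - \<eta>\<close> of the opposite one.\<close>
  define A where "A = (\<lambda>k. {0..1 / (?R k)\<^sup>2} \<times> ball (pulse_center n k + (1/2) *\<^sub>R \<xi>) (1/8))"
  define G where "G = (\<lambda>p. \<Sum>k<n. g * (?R k)\<^sup>2 * indicator (A k) p)"
  define E where "E = (\<lambda>p::real \<times> (real^3). indicator {0..} (fst p) * (indicator ?\<Phi> (snd p) *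
    (3000000 * c\<^sup>2 * ((t * (norm (snd p))\<^sup>2 + norm (snd p)) * exp (- fst p * (norm (snd p))\<^sup>2 / 4)))))"
  define h where "h = (\<lambda>p. Im (integrand ?u ?u (t, \<xi>) p $ i))"
  have t0: "0 < t" by (simp add: t)
  have nc: "real n * c\<^sup>2 = \<delta>\<^sup>2" using n by (simp add: c_def power_divide)
  have g0: "0 \<le> g" by (simp add: g_def)
  have E0: "0 \<le> E p" for p using t0 by (auto simp: E_def)
  have R16: "16 \<le> ?R k" for k using power_increasing[of 4 "n + k" "2::real"] n by simp
  have A_sets [measurable]: "A k \<in> sets spacetime" for k
    unfolding A_def by (intro pair_measureI) auto
  have [measurable]: "E \<in> borel_measurable spacetime" unfolding E_def by measurable
  have bl: "bounded_linear (\<lambda>v::field. Im (v $ i))"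
    by (rule bounded_linear_compose[OF bounded_linear_Im bounded_linear_vec_nth])
  note [measurable] = linear_part_measurable[OF f_measurable]
  have int: "integrable spacetime (integrand ?u ?u (t, \<xi>))"
    by (intro integrable_integrand linear_part_le_M M) measurable
  have h_int: "integrable spacetime h"
    unfolding h_def by (rule integrable_bounded_linear[OF bl int])
  have h_eq: "(LINT p|spacetime. h p) = Im (duhamel ?u ?u (t, \<xi>) $ i)"
    unfolding h_def duhamel_def by (rule integral_bounded_linear[OF bl int])

  have A_sub: "\<tau> \<in> {0..t} \<and> \<eta> \<in> ball (pulse_center n k) 1 \<and> \<eta> \<in> ?\<Phi> \<and> \<xi> - \<eta> \<in> ball (- pulse_center n k) 1 \<and> \<xi> - \<eta> \<in> ?\<Phi>"
    if "(\<tau>, \<eta>) \<in> A k" "k < n" for \<tau> \<eta> k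
  proof -
    have "1 / (?R k)\<^sup>2 \<le> t"
    proof -
      have "(2::real) ^ n \<le> 2 ^ ((n + k) * 2)" by (intro power_increasing) auto
      then show ?thesis unfolding t by (simp add: frac_le flip: power_mult)
    qed
    moreover have d: "norm (pulse_center n k + (1/2) *\<^sub>R \<xi> - \<eta>) < 1/8" using that by (auto simp: A_def dist_norm)
    have "norm (pulse_center n k - \<eta>) < 1"
      using norm_triangle_ineq4[of "pulse_center n k + (1/2) *\<^sub>R \<xi> - \<eta>" "(1/2) *\<^sub>R \<xi>"] d \<xi>b(4) by simp
    moreover have "norm (- pulse_center n k - (\<xi> - \<eta>)) < 1"
    proof -
      have "(1/2) *\<^sub>R \<xi> + (1/2) *\<^sub>R \<xi> = \<xi>" by (simp flip: scaleR_left_distrib)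
      then have eq: "- pulse_center n k - (\<xi> - \<eta>) = - ((pulse_center n k + (1/2) *\<^sub>R \<xi> - \<eta>) + (1/2) *\<^sub>R \<xi>)"
        by (simp add: algebra_simps)
      show ?thesis
        using norm_triangle_ineq[of "pulse_center n k + (1/2) *\<^sub>R \<xi> - \<eta>" "(1/2) *\<^sub>R \<xi>"] d \<xi>b(4)
        unfolding eq norm_minus_cancel by simp
    qed
    ultimately show ?thesis using that by (auto simp: A_def dist_norm pulse_support_def)
  qed

  have pointwise: "G p \<le> h p + E p" for p
  proof -
    obtain \<tau> \<eta> where p: "p = (\<tau>, \<eta>)" by (cases p)
    show ?thesis
    proof (cases "\<tau> \<in> {0..t} \<and> \<eta> \<in> ?\<Phi> \<and> \<xi> - \<eta> \<in> ?\<Phi>")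
      case False
      then have "G p = 0" using A_sub unfolding G_def p by (intro sum.neutral) (auto simp: indicator_def)
      moreover have "h p = 0"
      proof (cases "\<tau> \<in> {0..t}")
        case True
        then have "f \<eta> = 0 \<or> f (\<xi> - \<eta>) = 0" using False pulses_zero f by auto
        then have "?u (\<tau>, \<eta>) = 0 \<or> ?u (\<tau>, \<xi> - \<eta>) = 0" by (auto simp: linear_part_def linear_0[OF linear_propagator])
        then show ?thesis
          by (auto simp: h_def integrand_def p bounded_bilinear.zero_left[OF kq_bilinear] bounded_bilinear.zero_right[OF kq_bilinear])
      qed (simp add: h_def integrand_def p)
      ultimately show ?thesis using E0[of p] by simp
    next
      case True
      let ?K = "micropolar_kernel t \<tau> \<xi> (propagator \<tau> (\<xi> - \<eta>) (pulses n \<delta> (\<xi> - \<eta>))) (propagator \<tau> \<eta> (pulses n \<delta> \<eta>))"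
      let ?e = "exp (- \<tau> * (norm (\<xi> - \<eta>))\<^sup>2) * exp (- \<tau> * (norm \<eta>)\<^sup>2)"
      let ?B = "proj \<xi> (flux \<xi> (pulses n \<delta> (\<xi> - \<eta>)) (pulses n \<delta> \<eta>))"
      have hp: "h p = Im (?K $ i)" using True by (simp add: h_def integrand_def linear_part_def p f)
      have err: "norm (?K - ?e *\<^sub>R ?B) \<le> E p"
        using kernel_pulses_error[OF n \<delta>, of \<xi> \<tau> t \<eta>] True \<xi>b(4) by (simp add: E_def p c_def)
      have lead: "c\<^sup>2 * ((\<eta> $ 1)\<^sup>2 / 5 * (1 / (2 * pi) ^ 3)) \<le> Im (?B $ i)"
        unfolding c_def using True by (intro proj_flux_pulses i n \<xi>b) auto
      have "\<bar>Im ((?K - ?e *\<^sub>R ?B) $ i)\<bar> \<le> norm (?K - ?e *\<^sub>R ?B)"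
        by (rule order_trans[OF abs_Im_le_cmod norm_component_le])
      then have K: "?e * Im (?B $ i) - E p \<le> h p" using err unfolding hp by simp
      have B0: "0 \<le> Im (?B $ i)" by (rule order_trans[OF _ lead]) simp
      show ?thesis
      proof (cases "\<exists>k<n. p \<in> A k")
        case False
        then have "G p = 0" unfolding G_def by (intro sum.neutral) (auto simp: indicator_def)
        moreover have "0 \<le> ?e * Im (?B $ i)" using B0 by simp
        ultimately show ?thesis using K by linarith
      next
        case True
        then obtain k where k: "k < n" "p \<in> A k" by blast
        have near: "\<bar>?R k - \<eta> $ 1\<bar> < 1" if "k < n" "p \<in> A k" for k
        proof -
          have "norm (pulse_center n k - \<eta>) < 1" using A_sub that unfolding p by (auto simp: dist_norm)
          then have "\<bar>(pulse_center n k - \<eta>) $ 1\<bar> < 1" by (rule le_less_trans[OF component_le_norm_cart])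
          then show ?thesis by (simp add: pulse_center_def axis_def)
        qed
        \<comment> \<open>The boxes are disjoint, because the centres are far apart.\<close>
        have far: "\<bar>?R k - ?R l\<bar> \<ge> 2" if "k < l" for k l
        proof -
          have "?R (Suc k) \<le> ?R l" using that by (intro power_increasing) auto
          then show ?thesis using R16[of k] by simp
        qed
        have uniq: "l = k" if "l < n" "p \<in> A l" for l
        proof (rule ccontr)
          assume "l \<noteq> k"
          then have "2 \<le> \<bar>?R k - ?R l\<bar>"
            using far[of k l] far[of l k] by (cases l k rule: linorder_cases) (auto simp: abs_minus_commute)
          then show False using near[OF that] near[OF k] by linarith
        qed
        have "G p = (\<Sum>l\<in>{k}. g * (?R l)\<^sup>2 * indicator (A l) p)"
          unfolding G_def
        proof (intro sum.mono_neutral_right ballI)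
          fix l assume "l \<in> {..<n} - {k}"
          then have "p \<notin> A l" using uniq by blast
          then show "g * (?R l)\<^sup>2 * indicator (A l) p = 0" by simp
        qed (use k in simp_all)
        then have G: "G p = g * (?R k)\<^sup>2" using k by simp
        have \<tau>: "0 \<le> \<tau>" "\<tau> \<le> 1 / (?R k)\<^sup>2" using k by (auto simp: A_def p)
        have "norm (pulse_center n k - \<eta>) < 1" "norm (- pulse_center n k - (\<xi> - \<eta>)) < 1"
          using A_sub k unfolding p by (auto simp: dist_norm)
        then have "norm \<eta> < ?R k + 1" "norm (\<xi> - \<eta>) < ?R k + 1"
          using norm_triangle_ineq3[of "pulse_center n k" \<eta>] norm_triangle_ineq3[of "- pulse_center n k" "\<xi> - \<eta>"]
          unfolding norm_minus_cancel norm_pulse_center by linarith+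
        then have e: "exp (- 3) \<le> ?e" by (intro pulse_exponentials_ge[OF n \<tau>])
        have "15/16 * ?R k \<le> \<eta> $ 1" using near[OF k] R16[of k] by linarith
        then have "(15/16 * ?R k)\<^sup>2 \<le> (\<eta> $ 1)\<^sup>2" by (intro power_mono) auto
        moreover have "(15/16 * ?R k)\<^sup>2 = 225/256 * (?R k)\<^sup>2" unfolding power_mult_distrib by (simp add: power2_eq_square)
        ultimately have \<eta>1: "(?R k)\<^sup>2 / 2 \<le> (\<eta> $ 1)\<^sup>2" using zero_le_power2[of "?R k"] by linarith
        have "G p = exp (- 3) * (c\<^sup>2 * ((?R k)\<^sup>2 / 2 / 5 * (1 / (2 * pi) ^ 3)))" by (simp add: G g_def)
        also have "\<dots> \<le> exp (- 3) * (c\<^sup>2 * ((\<eta> $ 1)\<^sup>2 / 5 * (1 / (2 * pi) ^ 3)))"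
          using \<eta>1 by (intro mult_left_mono mult_right_mono divide_right_mono) auto
        also have "\<dots> \<le> ?e * Im (?B $ i)" using e lead B0 by (intro mult_mono) auto
        finally show ?thesis using K by linarith
      qed
    qed
  qed

  have E_le: "(\<integral>\<^sup>+p. ennreal (E p) \<partial>spacetime) \<le> ennreal (72000000 * unit_vol * \<delta>\<^sup>2 / 2 ^ n)"
  proof -
    have "(\<integral>\<^sup>+p. ennreal (E p) \<partial>spacetime) = (\<integral>\<^sup>+\<tau>. \<integral>\<^sup>+\<eta>. ennreal (E (\<tau>, \<eta>)) \<partial>lborel \<partial>lborel)"
      by (rule nn_integral_space_time) measurable
    also have "\<dots> = (\<integral>\<^sup>+\<eta>. \<integral>\<^sup>+\<tau>. ennreal (E (\<tau>, \<eta>)) \<partial>lborel \<partial>lborel)"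
      by (rule lborel_pair.Fubini'[symmetric]) measurable
    also have "\<dots> \<le> (\<integral>\<^sup>+\<eta>. ennreal (36000000 * c\<^sup>2 / 2 ^ n * indicator ?\<Phi> \<eta>) \<partial>lborel)"
    proof (intro nn_integral_mono)
      fix \<eta>
      show "(\<integral>\<^sup>+\<tau>. ennreal (E (\<tau>, \<eta>)) \<partial>lborel) \<le> ennreal (36000000 * c\<^sup>2 / 2 ^ n * indicator ?\<Phi> \<eta>)"
      proof (cases "\<eta> \<in> ?\<Phi>")
        case False then show ?thesis by (simp add: E_def)
      next
        case True
        let ?y = "norm \<eta>"
        have y: "15 \<le> ?y" "2 ^ n \<le> 2 * ?y" using pulse_support_bounds[OF True n] by auto
        let ?k = "3000000 * c\<^sup>2 * (t * ?y\<^sup>2 + ?y)"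
        have k0: "0 \<le> ?k" using t0 by simp
        have "(\<integral>\<^sup>+\<tau>. ennreal (E (\<tau>, \<eta>)) \<partial>lborel) = (\<integral>\<^sup>+\<tau>. ennreal ?k * (ennreal (exp (- \<tau> * (?y\<^sup>2 / 4))) * indicator {0..} \<tau>) \<partial>lborel)"
        proof (intro nn_integral_cong)
          fix \<tau>
          have "E (\<tau>, \<eta>) = ?k * exp (- \<tau> * (?y\<^sup>2 / 4)) * indicator {0..} \<tau>"
            using True by (simp add: E_def)
          then show "ennreal (E (\<tau>, \<eta>)) = ennreal ?k * (ennreal (exp (- \<tau> * (?y\<^sup>2 / 4))) * indicator {0..} \<tau>)"
            using k0 by (cases "0 \<le> \<tau>") (simp_all add: ennreal_mult)
        qed
        also have "\<dots> = ennreal ?k * ennreal (1 / (?y\<^sup>2 / 4))"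
          using y by (subst nn_integral_cmult, measurable, subst nn_integral_exp_half_line) auto
        also have "\<dots> = ennreal (3000000 * c\<^sup>2 * (4 * t + 4 / ?y))"
        proof (subst ennreal_mult[symmetric])
          have *: "m * (s * z\<^sup>2 + z) * (1 / (z\<^sup>2 / 4)) = m * (4 * s + 4 / z)" if "z \<noteq> 0" for m s z :: real
            using that by (simp add: field_simps power2_eq_square)
          have "?k * (1 / (?y\<^sup>2 / 4)) = 3000000 * c\<^sup>2 * (4 * t + 4 / ?y)" by (rule *) (use y in auto)
          then show "ennreal (?k * (1 / (?y\<^sup>2 / 4))) = ennreal (3000000 * c\<^sup>2 * (4 * t + 4 / ?y))" by (rule arg_cong)
        qed (use k0 in simp_all)
        also have "\<dots> \<le> ennreal (3000000 * c\<^sup>2 * (4 / 2 ^ n + 8 / 2 ^ n))"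
        proof (intro ennreal_leI mult_left_mono add_mono)
          have "0 < ?y" using y by linarith
          then have "8 / (2 * ?y) \<le> 8 / 2 ^ n" using y by (intro divide_left_mono mult_pos_pos) simp_all
          then show "4 / ?y \<le> 8 / 2 ^ n" by simp
        qed (simp_all add: t)
        finally show ?thesis using True by simp
      qed
    qed
    also have "\<dots> \<le> ennreal (2 * unit_vol * (\<Sum>k<n. 36000000 * c\<^sup>2 / 2 ^ n))"
      by (rule nn_integral_pulse_support_le) auto
    also have "2 * unit_vol * (\<Sum>k<n. 36000000 * c\<^sup>2 / 2 ^ n) = 72000000 * unit_vol * \<delta>\<^sup>2 / 2 ^ n"
      by (simp add: mult_ac flip: nc)
    finally show ?thesis .
  qed
  have E_int: "integrable spacetime E"
    using E_le E0 by (intro integrableI_bounded) (auto intro: le_less_trans)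
  have "ennreal (LINT p|spacetime. E p) = (\<integral>\<^sup>+p. ennreal (E p) \<partial>spacetime)"
    using E0 by (intro nn_integral_eq_integral[symmetric] E_int) auto
  then have E_val: "(LINT p|spacetime. E p) \<le> 72000000 * unit_vol * \<delta>\<^sup>2 / 2 ^ n"
    using E_le unit_vol_pos by (subst ennreal_le_iff[symmetric]) auto

  have G_val: "(\<integral>\<^sup>+p. ennreal (G p) \<partial>spacetime) = ennreal (\<delta>\<^sup>2 * (unit_vol * exp (- 3) / (5120 * (2 * pi) ^ 3)))"
  proof -
    have "(\<integral>\<^sup>+p. ennreal (G p) \<partial>spacetime)
        = (\<integral>\<^sup>+p. (\<Sum>k<n. ennreal (g * (?R k)\<^sup>2) * indicator (A k) p) \<partial>spacetime)"
      unfolding G_def using g0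
      by (intro nn_integral_cong) (simp add: ennreal_mult' ennreal_indicator flip: sum_ennreal)
    also have "\<dots> = (\<Sum>k<n. ennreal (g * (?R k)\<^sup>2) * emeasure spacetime (A k))"
      by (subst nn_integral_sum, measurable) (intro sum.cong refl nn_integral_cmult_indicator A_sets)
    also have "\<dots> = (\<Sum>k<n. ennreal (g * unit_vol / 512))"
    proof (intro sum.cong refl)
      fix k
      have b: "emeasure lborel (ball (pulse_center n k + (1/2) *\<^sub>R \<xi>) (1/8)) = ennreal (unit_vol / 512)"
        using emeasure_eq_ennreal_measure[of lborel "ball (pulse_center n k + (1/2) *\<^sub>R \<xi>) (1/8)"]
          emeasure_lborel_ball_finite[of "pulse_center n k + (1/2) *\<^sub>R \<xi>" "1/8"]
          content_ball_conv_unit_ball[of "1/8" "pulse_center n k + (1/2) *\<^sub>R \<xi>"]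
        by (simp add: unit_vol_def less_top power3_eq_cube)
      have "emeasure spacetime (A k) = ennreal (1 / (?R k)\<^sup>2) * ennreal (unit_vol / 512)"
        unfolding A_def by (subst lborel.emeasure_pair_measure_Times) (simp_all only: b, simp_all)
      then show "ennreal (g * (?R k)\<^sup>2) * emeasure spacetime (A k) = ennreal (g * unit_vol / 512)"
        using g0 unit_vol_pos by (simp flip: ennreal_mult)
    qed
    also have "\<dots> = ennreal (real n * (g * unit_vol / 512))"
      using g0 unit_vol_pos by (simp add: ennreal_of_nat_eq_real_of_nat flip: ennreal_mult)
    also have "real n * (g * unit_vol / 512) = \<delta>\<^sup>2 * (unit_vol * exp (- 3) / (5120 * (2 * pi) ^ 3))"
      unfolding nc[symmetric] by (simp add: g_def)
    finally show ?thesis .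
  qed
  have G0: "0 \<le> G p" for p unfolding G_def using g0 by (intro sum_nonneg) auto
  have "ennreal (\<delta>\<^sup>2 * (unit_vol * exp (- 3) / (5120 * (2 * pi) ^ 3))) \<le> (\<integral>\<^sup>+p. ennreal (h p + E p) \<partial>spacetime)"
    unfolding G_val[symmetric] by (intro nn_integral_mono ennreal_leI pointwise)
  also have "\<dots> = ennreal (LINT p|spacetime. h p + E p)"
    using order_trans[OF G0 pointwise] by (intro nn_integral_eq_integral Bochner_Integration.integrable_add h_int E_int) auto
  also have "(LINT p|spacetime. h p + E p) = (LINT p|spacetime. h p) + (LINT p|spacetime. E p)"
    by (rule Bochner_Integration.integral_add[OF h_int E_int])
  finally have "\<delta>\<^sup>2 * (unit_vol * exp (- 3) / (5120 * (2 * pi) ^ 3)) \<le> (LINT p|spacetime. h p) + (LINT p|spacetime. E p)"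
  proof (subst (asm) ennreal_le_iff)
    have "0 \<le> (LINT p|spacetime. h p + E p)"
      using order_trans[OF G0 pointwise] by (intro integral_nonneg_AE) auto
    then show "0 \<le> (LINT p|spacetime. h p) + (LINT p|spacetime. E p)"
      unfolding Bochner_Integration.integral_add[OF h_int E_int] .
  qed
  moreover have "\<delta>\<^sup>2 * (72000000 * unit_vol / 2 ^ n) = 72000000 * unit_vol * \<delta>\<^sup>2 / 2 ^ n" by simp
  ultimately show ?thesis using E_val unfolding h_eq right_diff_distrib by linarith
qed

lemma nn_integral_solution_low_ball_ge:
  assumes f: "f = pulses n \<delta>" and n: "4 \<le> n" and \<delta>: "0 \<le> \<delta>" and i: "i = Inl 2 \<or> i = Inr 2"
  shows "ennreal (\<delta>\<^sup>2 * (unit_vol * exp (- 3) / (5120 * (2 * pi) ^ 3) - 72000000 * unit_vol / 2 ^ n) * measure lborel low_ball)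
    \<le> (\<integral>\<^sup>+\<xi>\<in>low_ball. ennreal (norm (solution (1 / 2 ^ n, \<xi>) $ i)) \<partial>lborel) + ennreal (10077696 * e * sqrt e)"
    (is "ennreal (?l * _) \<le> ?S + _")
proof (cases "0 \<le> ?l")
  case True
  let ?t = "1 / 2 ^ n" and ?u = "linear_part f"
  note [measurable] = duhamel_measurable[OF linear_part_measurable[OF f_measurable] linear_part_measurable[OF f_measurable]]
  have fin: "emeasure lborel low_ball = ennreal (measure lborel low_ball)"
    unfolding low_ball_def by (intro emeasure_eq_ennreal_measure less_imp_neq) (simp add: emeasure_lborel_ball_finite[unfolded infinity_ennreal_def])
  have "ennreal (?l * measure lborel low_ball) = (\<integral>\<^sup>+\<xi>. ennreal ?l * indicator low_ball \<xi> \<partial>lborel)"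
    using True by (subst nn_integral_cmult_indicator) (simp_all add: fin ennreal_mult)
  also have "\<dots> \<le> (\<integral>\<^sup>+\<xi>. ennreal (norm (solution (?t, \<xi>) $ i)) * indicator low_ball \<xi>
      + ennreal (norm (solution (?t, \<xi>) $ i + duhamel ?u ?u (?t, \<xi>) $ i)) * indicator low_ball \<xi> \<partial>lborel)"
  proof (rule nn_integral_mono_AE)
    show "AE \<xi> in lborel. ennreal ?l * indicator low_ball \<xi> \<le> ennreal (norm (solution (?t, \<xi>) $ i)) * indicator low_ball \<xi>
      + ennreal (norm (solution (?t, \<xi>) $ i + duhamel ?u ?u (?t, \<xi>) $ i)) * indicator low_ball \<xi>"
      using AE_M_finite_slice[of ?t]
    proof eventually_elim
      case (elim \<xi>)
      show ?case
      proof (cases "\<xi> \<in> low_ball")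
        case low: True
        have "?l \<le> norm (duhamel ?u ?u (?t, \<xi>) $ i)"
          using duhamel_pulses_ge[OF f n \<delta> i low refl elim] abs_Im_le_cmod[of "duhamel ?u ?u (?t, \<xi>) $ i"] by linarith
        also have "\<dots> \<le> norm (solution (?t, \<xi>) $ i) + norm (solution (?t, \<xi>) $ i + duhamel ?u ?u (?t, \<xi>) $ i)"
          using norm_triangle_ineq4[of "solution (?t, \<xi>) $ i + duhamel ?u ?u (?t, \<xi>) $ i" "solution (?t, \<xi>) $ i"] by simp
        finally show ?thesis using low by (simp add: ennreal_leI flip: ennreal_plus)
      qed simp
    qed
  qed
  also have "\<dots> = ?S + (\<integral>\<^sup>+\<xi>\<in>low_ball. ennreal (norm (solution (?t, \<xi>) $ i + duhamel ?u ?u (?t, \<xi>) $ i)) \<partial>lborel)"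
    by (rule nn_integral_add) measurable
  also have "\<dots> \<le> ?S + ennreal (10077696 * e * sqrt e)"
  proof (intro add_left_mono solution_remainder_le)
    fix \<xi> assume low: "\<xi> \<in> low_ball"
    then show "0 < norm \<xi> \<and> norm \<xi> \<le> 3/2" using low_ballD(3,4)[OF low] by linarith
    have "\<xi> \<notin> pulse_support n" using pulse_support_bounds(1)[of \<xi> n] low_ballD(4)[OF low] n by linarith
    then show "f \<xi> = 0" by (simp add: f pulses_zero)
  qed measurable
  finally show ?thesis .
next
  case False
  then have "?l * measure lborel low_ball \<le> 0" by (simp add: mult_nonpos_nonneg)
  then show ?thesis by (simp add: ennreal_neg)
qed

lemma FB_norm_evolution_ge:
  assumes "r \<noteq> 0"
  shows "(\<integral>\<^sup>+\<xi>\<in>low_ball. ennreal (norm (solution (t, \<xi>) $ i)) \<partial>lborel) \<le> FB_norm \<psi> (-1) 1 r (evolution t $ i)"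
proof -
  have "(\<integral>\<^sup>+\<xi>\<in>low_ball. ennreal (norm (solution (t, \<xi>) $ i)) \<partial>lborel) \<le> dyadic_mass \<psi> 0 (\<lambda>\<xi>. solution (t, \<xi>) $ i)"
    by (rule dyadic_mass_low_ball[OF lp]) measurable
  also have "\<dots> \<le> FB_norm \<psi> (-1) 1 r (evolution t $ i)"
    unfolding evolution_def vec_lambda_beta by (rule FB_norm_ge_dyadic_mass[OF lp admissible_solution assms])
  finally show ?thesis .
qed

end

lemma component_le_FBv_norm: "FB_norm \<psi> s p r (U $ i) \<le> FBv_norm \<psi> s p r U"
  unfolding FBv_norm_def by (rule member_le_sum) auto

text \<open>The gain is of order \<open>\<delta>\<^sup>2\<close> and the remainder of order \<open>\<delta>\<^sup>3\<close>, both uniformly in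
  \<open>n\<close>. Thus \<open>\<delta>\<close> is chosen small first, and then \<open>n\<close> large to suppress the lower order terms
  of the leading part.\<close>

lemma norm_inflation:
  assumes lp: "littlewood_paley \<psi>"
  obtains \<delta> c0 :: real and n0 :: nat where "0 < \<delta>" "16 * 648\<^sup>2 * (768 * unit_vol\<^sup>2 * \<delta>\<^sup>2) \<le> 1" "0 < c0" "4 \<le> n0"
    "\<And>n i r. n0 \<le> n \<Longrightarrow> i = Inl 2 \<or> i = Inr 2 \<Longrightarrow> r \<noteq> 0 \<Longrightarrow>
      ennreal c0 \<le> FB_norm \<psi> (-1) 1 r (small_data.evolution (pulses n \<delta>) (1 / 2 ^ n) $ i)"
proof -
  define v where "v = unit_vol"
  define \<kappa> where "\<kappa> = v * exp (- 3) / (5120 * (2 * pi) ^ 3)"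
  define V where "V = measure lborel low_ball"
  define P where "P = 10077696 * (768 * v\<^sup>2) * (sqrt 768 * v)"
  define Q where "Q = 16 * 648\<^sup>2 * (768 * v\<^sup>2)"
  have v: "0 < v" by (simp add: v_def unit_vol_pos)
  have \<kappa>: "0 < \<kappa>" using v by (simp add: \<kappa>_def)
  have V: "0 < V" unfolding V_def low_ball_def by (rule content_ball_pos) simp
  have P: "0 < P" and Q: "0 < Q" using v by (simp_all add: P_def Q_def)
  \<comment> \<open>The second entry makes the data small enough for the existence theory, the third one lets the gain absorb the remainder.\<close>
  define \<delta> where "\<delta> = min 1 (min (1 / Q) (V * \<kappa> / (4 * P)))"
  have \<delta>: "0 < \<delta>" "\<delta> \<le> 1" "\<delta> \<le> 1 / Q" "\<delta> \<le> V * \<kappa> / (4 * P)" using P Q V \<kappa> by (auto simp: \<delta>_def)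
  have P\<delta>: "P * \<delta> \<le> V * \<kappa> / 4" using \<delta>(4) P by (simp add: field_simps)
  have Q\<delta>: "Q * \<delta>\<^sup>2 \<le> 1"
  proof -
    have "Q * \<delta>\<^sup>2 \<le> Q * \<delta>" using \<delta> Q by (intro mult_left_mono) (auto simp: power2_eq_square mult_left_le)
    also have "\<dots> \<le> 1" using \<delta>(3) Q by (simp add: field_simps)
    finally show ?thesis .
  qed
  have "(\<lambda>n. 72000000 * v * inverse ((2::real) ^ n)) \<longlonglongrightarrow> 72000000 * v * 0"
    by (intro tendsto_mult tendsto_const LIMSEQ_inverse_realpow_zero) simp
  then have "eventually (\<lambda>n. 72000000 * v * inverse ((2::real) ^ n) < \<kappa> / 2) sequentially"
    using \<kappa> by (intro order_tendstoD(2)) auto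
  then obtain n1 where n1: "\<And>n. n1 \<le> n \<Longrightarrow> 72000000 * v * inverse ((2::real) ^ n) < \<kappa> / 2"
    unfolding eventually_sequentially by blast
  show ?thesis
  proof (rule that)
    show "0 < \<delta>" by fact
    show small: "16 * 648\<^sup>2 * (768 * unit_vol\<^sup>2 * \<delta>\<^sup>2) \<le> 1" using Q\<delta> by (simp add: Q_def v_def mult_ac)
    show "0 < \<delta>\<^sup>2 * (V * \<kappa> / 4)" using \<delta> V \<kappa> by simp
    show "4 \<le> max 4 n1" by simp
    fix n i r assume n: "max 4 n1 \<le> n" and i: "i = Inl (2::3) \<or> i = Inr (2::3)" and r: "r \<noteq> (0::ennreal)"
    have n4: "4 \<le> n" using n by simp
    interpret small_data \<psi> "pulses n \<delta>" "768 * unit_vol\<^sup>2 * \<delta>\<^sup>2"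
      by (rule small_data_pulses[OF lp less_imp_le[OF \<delta>(1)] n4 small])
    let ?S = "\<integral>\<^sup>+\<xi>\<in>low_ball. ennreal (norm (solution (1 / 2 ^ n, \<xi>) $ i)) \<partial>lborel" and ?a = "ennreal (\<delta>\<^sup>2 * (V * \<kappa> / 4))"
    have rem: "10077696 * (768 * unit_vol\<^sup>2 * \<delta>\<^sup>2) * sqrt (768 * unit_vol\<^sup>2 * \<delta>\<^sup>2) = \<delta>\<^sup>2 * (P * \<delta>)"
      using v \<delta> by (simp add: P_def real_sqrt_mult v_def[symmetric])
    have "ennreal (\<delta>\<^sup>2 * (V * \<kappa> / 4)) + ennreal (\<delta>\<^sup>2 * (V * \<kappa> / 4)) = ennreal (\<delta>\<^sup>2 * (\<kappa> / 2) * V)"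
      using V \<kappa> by (subst ennreal_plus[symmetric]) (auto simp: field_simps)
    also have "\<dots> \<le> ennreal (\<delta>\<^sup>2 * (\<kappa> - 72000000 * v / 2 ^ n) * V)"
    proof (intro ennreal_leI mult_right_mono mult_left_mono)
      have "72000000 * v / 2 ^ n < \<kappa> / 2" using n1[of n] n by (simp only: divide_inverse max.bounded_iff)
      then show "\<kappa> / 2 \<le> \<kappa> - 72000000 * v / 2 ^ n" by linarith
    qed (use V in simp_all)
    also have "\<dots> \<le> ?S + ennreal (\<delta>\<^sup>2 * (P * \<delta>))"
      using nn_integral_solution_low_ball_ge[OF refl n4 less_imp_le[OF \<delta>(1)] i]
      unfolding rem \<kappa>_def v_def V_def .
    also have "\<dots> \<le> ?S + ennreal (\<delta>\<^sup>2 * (V * \<kappa> / 4))"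
      by (intro add_left_mono ennreal_leI mult_left_mono P\<delta>) simp
    finally have "?a + ?a \<le> ?a + ?S" unfolding add.commute[of ?a ?S] .
    then have "?a \<le> ?S" unfolding ennreal_add_left_cancel_le by simp
    also have "\<dots> \<le> FB_norm \<psi> (-1) 1 r (evolution (1 / 2 ^ n) $ i)" by (rule FB_norm_evolution_ge[OF r])
    finally show "ennreal (\<delta>\<^sup>2 * (V * \<kappa> / 4)) \<le> FB_norm \<psi> (-1) 1 r (evolution (1 / 2 ^ n) $ i)" .
  qed
qed

text \<open>The largest dyadic mass is of order \<open>\<delta> / sqrt n\<close> and the sum of all masses of order
  \<open>\<delta> sqrt n\<close>; interpolation gives \<open>\<delta> n powr (1/r - 1/2)\<close>.\<close>

lemma FB_norm_pulses_tendsto_0: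
  assumes lp: "littlewood_paley \<psi>" and \<delta>: "0 < \<delta>" and r: "2 < r"
  shows "(\<lambda>n. FB_norm \<psi> (-1) 1 r (sh_of (\<lambda>\<xi>. pulses n \<delta> \<xi> $ i))) \<longlonglongrightarrow> 0"
proof -
  let ?e = "\<lambda>n. 24 * unit_vol * (\<delta> / sqrt (real n))" and ?B = "\<lambda>n. 8/3 * (4 * unit_vol * \<delta> * sqrt (real n))"
  let ?\<rho> = "enn2real r"
  let ?b = "\<lambda>n. if r = \<infinity> then ?e n else (?e n powr (?\<rho> - 1) * ?B n) powr (1 / ?\<rho>)"
  have le: "FB_norm \<psi> (-1) 1 r (sh_of (\<lambda>\<xi>. pulses n \<delta> \<xi> $ i)) \<le> ennreal (?b n)" if n: "4 \<le> n" for n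
  proof -
    have w: "weighted_norm (\<lambda>\<xi>. pulses n \<delta> \<xi> $ i) \<le> ennreal (4 * unit_vol * \<delta> * sqrt (real n))"
      unfolding weighted_norm_def
      by (rule order_trans[OF nn_integral_mono weighted_pulses_le[OF less_imp_le[OF \<delta>], of n]])
        (intro ennreal_leI divide_right_mono norm_component_le, simp)
    have "FB_norm \<psi> (-1) 1 r (sh_of (\<lambda>\<xi>. pulses n \<delta> \<xi> $ i))
      \<le> (if r = \<infinity> then ennreal (?e n) else ennreal ((?e n powr (?\<rho> - 1) * ?B n) powr (1 / ?\<rho>)))"
    proof (rule FB_norm_le_interpolation[OF lp admissible_if_integrable[OF integrable_pulses]])
      show "1 < r" using r by (rule less_trans[rotated]) simp
      show "0 \<le> ?e n" "0 \<le> ?B n" using unit_vol_pos \<delta> by auto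
      show "dyadic_mass \<psi> j (\<lambda>\<xi>. pulses n \<delta> \<xi> $ i) \<le> ennreal (?e n)" for j
        by (rule dyadic_mass_pulses_le[OF lp less_imp_le[OF \<delta>] n])
      fix F :: "int set" assume "finite F"
      then have "(\<Sum>j\<in>F. dyadic_mass \<psi> j (\<lambda>\<xi>. pulses n \<delta> \<xi> $ i)) \<le> ennreal (8/3) * weighted_norm (\<lambda>\<xi>. pulses n \<delta> \<xi> $ i)"
        by (intro sum_dyadic_mass_le[OF lp]) auto
      also have "\<dots> \<le> ennreal (8/3) * ennreal (4 * unit_vol * \<delta> * sqrt (real n))" by (intro mult_left_mono w) simp
      also have "\<dots> = ennreal (?B n)" using unit_vol_pos \<delta> by (intro ennreal_mult[symmetric]) auto
      finally show "(\<Sum>j\<in>F. dyadic_mass \<psi> j (\<lambda>\<xi>. pulses n \<delta> \<xi> $ i)) \<le> ennreal (?B n)" .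
    qed
    then show ?thesis by (cases "r = \<infinity>") simp_all
  qed
  have sq: "filterlim (\<lambda>n. sqrt (real n)) at_top sequentially"
    by (rule filterlim_compose[OF sqrt_at_top filterlim_real_sequentially])
  have "?b \<longlonglongrightarrow> 0"
  proof (cases "r = \<infinity>")
    case True
    have "(\<lambda>n. 24 * unit_vol * (\<delta> / sqrt (real n))) \<longlonglongrightarrow> 24 * unit_vol * 0"
      by (intro tendsto_mult tendsto_const tendsto_divide_0[OF tendsto_const] filterlim_at_top_imp_at_infinity sq)
    then show ?thesis using True by simp
  next
    case False
    then have \<rho>: "2 < ?\<rho>" using r by (cases r) (auto simp: ennreal_less_iff simp flip: ennreal_numeral)
    let ?C = "(24 * unit_vol * \<delta>) powr (?\<rho> - 1) * (8/3 * (4 * unit_vol * \<delta>))"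
    have "(\<lambda>n. ?C * sqrt (real n) powr (- (?\<rho> - 2))) \<longlonglongrightarrow> ?C * 0"
      using \<rho> by (intro tendsto_mult tendsto_const tendsto_neg_powr sq) auto
    then have lim: "(\<lambda>n. (?C * sqrt (real n) powr (- (?\<rho> - 2))) powr (1 / ?\<rho>)) \<longlonglongrightarrow> 0"
      using \<rho> unit_vol_pos \<delta> by (intro tendsto_zero_powrI[where b="1 / ?\<rho>"]) (auto intro!: always_eventually mult_nonneg_nonneg)
    have "eventually (\<lambda>n. (?C * sqrt (real n) powr (- (?\<rho> - 2))) powr (1 / ?\<rho>) = ?b n) sequentially"
      using eventually_gt_at_top[of 0]
    proof eventually_elim
      case (elim n)
      have s: "0 < sqrt (real n)" using elim by simp
      have e1: "?e n powr (?\<rho> - 1) = (24 * unit_vol * \<delta>) powr (?\<rho> - 1) * sqrt (real n) powr (- (?\<rho> - 1))"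
      proof -
        have "?e n = (24 * unit_vol * \<delta>) * sqrt (real n) powr (- 1)"
          using s by (simp add: powr_minus divide_inverse)
        then have "?e n powr (?\<rho> - 1) = ((24 * unit_vol * \<delta>) * sqrt (real n) powr (- 1)) powr (?\<rho> - 1)" by (simp only:)
        also have "\<dots> = (24 * unit_vol * \<delta>) powr (?\<rho> - 1) * (sqrt (real n) powr (- 1)) powr (?\<rho> - 1)"
          by (rule powr_mult)
        finally show ?thesis by (simp only: powr_powr mult_minus1)
      qed
      have e2: "sqrt (real n) powr (- (?\<rho> - 1)) * sqrt (real n) = sqrt (real n) powr (- (?\<rho> - 2))"
        using s powr_add[of "sqrt (real n)" "- (?\<rho> - 1)" 1] by (simp add: algebra_simps)
      have "?e n powr (?\<rho> - 1) * ?B n = ?C * sqrt (real n) powr (- (?\<rho> - 2))"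
        unfolding e1 e2[symmetric] by (simp only: mult_ac)
      then show ?case using False by (simp only: if_False)
    qed
    with lim show ?thesis by (rule Lim_transform_eventually)
  qed
  then have "(\<lambda>n. ennreal (?b n)) \<longlonglongrightarrow> ennreal 0" by (rule tendsto_ennrealI)
  then have lim: "(\<lambda>n. ennreal (?b n)) \<longlonglongrightarrow> 0" by simp
  show ?thesis
  proof (rule tendsto_sandwich[OF _ _ tendsto_const lim])
    show "eventually (\<lambda>n. FB_norm \<psi> (-1) 1 r (sh_of (\<lambda>\<xi>. pulses n \<delta> \<xi> $ i)) \<le> ennreal (?b n)) sequentially"
      using eventually_ge_at_top[of 4] by (rule eventually_mono) (rule le)
  qed simp
qed

theorem theorem1p5:
  fixes \<psi> :: "real^3 \<Rightarrow> real" and r :: ennreal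
  assumes "littlewood_paley \<psi>" and "2 < r"
  shows "\<exists>(f :: nat \<Rightarrow> sh^(3 + 3)) (t :: nat \<Rightarrow> real) (U :: nat \<Rightarrow> real \<Rightarrow> sh^(3 + 3)) (c\<^sub>0 :: real).
     c\<^sub>0 > 0 \<and>
     (\<forall>N\<ge>1. f N \<in> FBv \<psi> (-1) 1 2 \<and> div_free (u_part (f N)) \<and> (\<forall>i. real_valued (f N $ i))) \<and>
     (\<forall>N\<ge>1. t N > 0) \<and>
     (\<lambda>N. FBv_norm \<psi> (-1) 1 r (f N)) \<longlonglongrightarrow> 0 \<and>
     t \<longlonglongrightarrow> 0 \<and>
     (\<forall>N\<ge>1. FBv_continuous \<psi> (-1) 1 2 (U N) \<and>
            (\<forall>s\<ge>0. \<forall>i. real_valued (U N s $ i)) \<and>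
            mild_solution (f N) (U N) \<and> U N 0 = f N \<and>
            FBv_norm \<psi> (-1) 1 r (u_part (U N (t N))) \<ge> ennreal c\<^sub>0 \<and>
            FBv_norm \<psi> (-1) 1 r (w_part (U N (t N))) \<ge> ennreal c\<^sub>0)"
proof -
  obtain \<delta> c0 n0 where \<delta>: "0 < \<delta>" "16 * 648\<^sup>2 * (768 * unit_vol\<^sup>2 * \<delta>\<^sup>2) \<le> 1" and c0: "0 < c0" and n0: "4 \<le> n0"
    and large: "\<And>n i r. n0 \<le> n \<Longrightarrow> i = Inl 2 \<or> i = Inr 2 \<Longrightarrow> r \<noteq> 0 \<Longrightarrow>
      ennreal c0 \<le> FB_norm \<psi> (-1) 1 r (small_data.evolution (pulses n \<delta>) (1 / 2 ^ n) $ i)"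
    using norm_inflation[OF assms(1)] by blast
  define D where "D = (\<lambda>n. small_data.data (pulses n \<delta>))"
  define U where "U = (\<lambda>n. small_data.evolution (pulses n \<delta>))"
  have r0: "r \<noteq> 0" using assms(2) by auto
  have D_nth: "D n $ i = sh_of (\<lambda>\<xi>. pulses n \<delta> \<xi> $ i)" if "n0 \<le> n" for n i
  proof -
    interpret small_data \<psi> "pulses n \<delta>" "768 * unit_vol\<^sup>2 * \<delta>\<^sup>2"
      by (rule small_data_pulses[OF assms(1) less_imp_le[OF \<delta>(1)] _ \<delta>(2)]) (use that n0 in simp)
    show ?thesis by (simp add: D_def data_def)
  qed
  have facts: "D n \<in> FBv \<psi> (-1) 1 2 \<and> div_free (u_part (D n)) \<and> (\<forall>i. real_valued (D n $ i)) \<and>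
      FBv_continuous \<psi> (-1) 1 2 (U n) \<and> (\<forall>s\<ge>0. \<forall>i. real_valued (U n s $ i)) \<and>
      mild_solution (D n) (U n) \<and> U n 0 = D n \<and>
      FBv_norm \<psi> (-1) 1 r (u_part (U n (1 / 2 ^ n))) \<ge> ennreal c0 \<and>
      FBv_norm \<psi> (-1) 1 r (w_part (U n (1 / 2 ^ n))) \<ge> ennreal c0" if n: "n0 \<le> n" for n
  proof -
    interpret small_data \<psi> "pulses n \<delta>" "768 * unit_vol\<^sup>2 * \<delta>\<^sup>2"
      by (rule small_data_pulses[OF assms(1) less_imp_le[OF \<delta>(1)] _ \<delta>(2)]) (use n n0 in simp)
    have D: "D n = data" and U: "U n = evolution" by (simp_all add: D_def U_def)
    have "u_part (D n) = (\<chi> k. sh_of (\<lambda>\<xi>. pulses n \<delta> \<xi> $ Inl k))" by (simp add: u_part_def D_nth[OF n])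
    then have "div_free (u_part (D n))" using div_free_pulses by simp
    moreover have "ennreal c0 \<le> FBv_norm \<psi> (-1) 1 r (u_part (U n (1 / 2 ^ n)))"
    proof -
      have "ennreal c0 \<le> FB_norm \<psi> (-1) 1 r (u_part (U n (1 / 2 ^ n)) $ 2)"
        using large[OF n _ r0, of "Inl 2"] by (simp add: u_part_def U_def)
      then show ?thesis by (rule order_trans[OF _ component_le_FBv_norm])
    qed
    moreover have "ennreal c0 \<le> FBv_norm \<psi> (-1) 1 r (w_part (U n (1 / 2 ^ n)))"
    proof -
      have "ennreal c0 \<le> FB_norm \<psi> (-1) 1 r (w_part (U n (1 / 2 ^ n)) $ 2)"
        using large[OF n _ r0, of "Inr 2"] by (simp add: w_part_def U_def)
      then show ?thesis by (rule order_trans[OF _ component_le_FBv_norm])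
    qed
    ultimately show ?thesis
      using evolution_in_FBv[of 0] evolution_0 mild_evolution evolution_continuous real_valued_evolution[of 0] real_valued_evolution
      unfolding D U by auto
  qed
  have norm0: "(\<lambda>n. FBv_norm \<psi> (-1) 1 r (D (n + n0))) \<longlonglongrightarrow> 0"
  proof -
    have "(\<lambda>n. \<Sum>i\<in>(UNIV::(3 + 3) set). FB_norm \<psi> (-1) 1 r (sh_of (\<lambda>\<xi>. pulses (n + n0) \<delta> \<xi> $ i)))
        \<longlonglongrightarrow> (\<Sum>i\<in>(UNIV::(3 + 3) set). 0)"
      by (intro tendsto_sum LIMSEQ_ignore_initial_segment FB_norm_pulses_tendsto_0 assms \<delta>)
    then show ?thesis by (simp add: FBv_norm_def D_nth)
  qed
  have t0: "(\<lambda>n. 1 / 2 ^ (n + n0)) \<longlonglongrightarrow> (0::real)"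
    by (intro LIMSEQ_ignore_initial_segment) (simp add: LIMSEQ_inverse_realpow_zero divide_inverse)
  show ?thesis
    by (rule exI[of _ "\<lambda>N. D (N + n0)"], rule exI[of _ "\<lambda>N. 1 / 2 ^ (N + n0)"], rule exI[of _ "\<lambda>N. U (N + n0)"],
      rule exI[of _ c0]) (use c0 norm0 t0 facts in auto)
qed

end
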